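(* Let $m,n\in\mathbb Z_{>0}$ with $m>2n$, let $\Gamma$ be a congruence subgroup of $\mathrm{Sp}_{2n}(\mathbb Z)$, and let $\varphi\in\mathcal A_{cusp}(\Gamma\backslash\mathrm{Sp}_{2n}(\mathbb R))_{[\chi_m]}^{\mathfrak p_{\mathbb C}^-}$. Then $$\langle\varphi,P_\Gamma F_{1,m}\rangle_{L^2(\Gamma\backslash\mathrm{Sp}_{2n}(\mathbb R))}=C_{m,n}\,\varphi(I_{2n}),$$ where (with $\Gamma(\cdot)$ denoting the gamma function) $$C_{m,n}=2^{\frac{n(n+3)}2}\pi^{\frac{n(n+1)}2}\prod_{r=1}^n\frac{\Gamma\left(m-\frac{n+r}2\right)}{\Gamma\left(m-\frac{r-1}2\right)}.$$
   Context: $\mathcal H_n=\{z=x+iy\in M_n(\mathbb C): z^\top=z,\ y>0\}$. $\mathrm{Sp}_{2n}(\mathbb R)=\{g\in\mathrm{GL}_{2n}(\mathbb R):g^\top J_ng=J_n\}$, $J_n=\begin{pmatrix}0&I_n\\-I_n&0\end{pmatrix}$, acts on $\mathcal H_n$ by $g.z=(Az+B)(Cz+D)^{-1}$, $g=\begin{pmatrix}A&B\\C&D\end{pmatrix}$, and $(f|_mg)(z)=\det(Cz+D)^{-m}f(g.z)$ for $f:\mathcal H_n\to\mathbb C$. A congruence subgroup of $\mathrm{Sp}_{2n}(\mathbb Z)$ is a subgroup containing $\Gamma_n(N)=\{g\in\mathrm{Sp}_{2n}(\mathbb Z): g\equiv I_{2n}\pmod N\}$ for some $N\in\mathbb Z_{>0}$.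 $K=\mathrm{Sp}_{2n}(\mathbb R)\cap\mathrm U(2n)=\{k_u:u\in\mathrm U(n)\}$, where $k_{A+iB}=\begin{pmatrix}A&B\\-B&A\end{pmatrix}$ for $A+iB\in\mathrm U(n)$, $A,B$ real; $\chi_m:K\to\mathbb C^\times$, $\chi_m(k_u)=(\det u)^m$. Measures: $n_x=\begin{pmatrix}I_n&x\\0&I_n\end{pmatrix}$, $a_y=\begin{pmatrix}y^{1/2}&0\\0&y^{-1/2}\end{pmatrix}$. The Haar measure on $\mathrm{Sp}_{2n}(\mathbb R)$ is $\int f(g)\,dg=\int_{\mathcal H_n}\int_Kf(n_xa_yk)\,dk\,d\mathsf v(z)$, where $z=x+iy$, $d\mathsf v(z)=(\det y)^{-n-1}\prod_{1\le r\le s\le n}dx_{r,s}dy_{r,s}$ and $\mathrm{vol}(K)=1$. On $\Gamma\backslash\mathrm{Sp}_{2n}(\mathbb R)$ we use the measure with $\int_{\Gamma\backslash\mathrm{Sp}_{2n}(\mathbb R)}\sum_{\gamma\in\Gamma}f(\gamma g)\,dg=\int_{\mathrm{Sp}_{2n}(\mathbb R)}f(g)\,dg$ for $f\in C_c(\mathrm{Sp}_{2n}(\mathbb R))$; $\langle\varphi_1,\varphi_2\rangle_{L^2(\Gamma\backslash\mathrm{Sp}_{2n}(\mathbb R))}=\int\varphi_1\overline{\varphi_2}$. Lie algebra: $\mathfrak g=\mathfrak{sp}_{2n}(\mathbb R)$, with complexification $\mathfrak g_{\mathbb C}$; $\mathcal Z(\mathfrak g)$ is the center of the universal enveloping algebra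 of $\mathfrak g_{\mathbb C}$. Let $T_r=-i\begin{pmatrix}0&E_{r,r}\\-E_{r,r}&0\end{pmatrix}$, $1\le r\le n$ ($E_{r,r}\in M_n(\mathbb C)$ the matrix unit), $\mathfrak h=i\bigoplus_r\mathbb RT_r$ a Cartan subalgebra of $\mathfrak g$, and $e_r\in\mathfrak h_{\mathbb C}^*$ with $e_r(T_s)=\delta_{r,s}$. Then $\mathfrak p_{\mathbb C}^-=\bigoplus_{1\le r\le s\le n}\mathfrak g_{-(e_r+e_s)}$ (sum of root subspaces of $\mathfrak g_{\mathbb C}$). $\mathfrak g$ and $K$ act on functions on $\mathrm{Sp}_{2n}(\mathbb R)$ by right translation. $\mathcal A_{cusp}(\Gamma\backslash\mathrm{Sp}_{2n}(\mathbb R))$ is the space of smooth $\varphi:\mathrm{Sp}_{2n}(\mathbb R)\to\mathbb C$ that are left $\Gamma$-invariant, $\mathcal Z(\mathfrak g)$-finite, right $K$-finite, cuspidal (for every proper $\mathbb Q$-parabolic subgroup $P$ of $\mathrm{Sp}_{2n}$ with unipotent radical $U$, $\int_{(\Gamma\cap U(\mathbb R))\backslash U(\mathbb R)}\varphi(ug)\,du=0$ for all $g$), and bounded (given the other conditions, boundedness is equivalent to $\varphi\in L^2(\Gamma\backslash\mathrm{Sp}_{2n}(\mathbb R))$). $\mathcal A_{cusp}(\Gamma\backslash\mathrm{Sp}_{2n}(\mathbb R))_{[\chi_m]}^{\mathfrak p_{\mathbb C}^-}$ is its subspace of functions $\varphi$ with $\varphi(gk)=\chi_m(k)\varphi(g)$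 for all $g\in\mathrm{Sp}_{2n}(\mathbb R),k\in K$, and $X\varphi=0$ for all $X\in\mathfrak p_{\mathbb C}^-$. $f_{1,m}(z)=(2i)^{mn}\det(z+iI_n)^{-m}$ on $\mathcal H_n$, $F_{1,m}(g)=(f_{1,m}|_mg)(iI_n)$ on $\mathrm{Sp}_{2n}(\mathbb R)$, and $(P_\Gamma F_{1,m})(g)=\sum_{\gamma\in\Gamma}F_{1,m}(\gamma g)$, which converges absolutely and uniformly on compact sets for $m>2n$. *)

theory Defs
  imports
    "HOL-Analysis.Analysis"
    "HOL-Algebra.Solvable_Groups"
    "HOL-Library.Poly_Mapping"
begin

section \<open>Block matrices and the symplectic group\<close>

text \<open>The size \<open>n\<close> is the cardinality of the index type \<open>'n\<close>; a matrix of size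
  \<open>2n\<close> is indexed by \<open>'n + 'n\<close>, with \<open>Inl\<close> for the first and \<open>Inr\<close> for the second block.
  Functions on a group of matrices are total functions on the matrix type, of which only the
  values on the group are relevant.\<close>

type_synonym ('a, 'n) smat = "(('a, 'n) vec, 'n) vec"
type_synonym ('a, 'n) dmat = "(('a, 'n + 'n) vec, 'n + 'n) vec"

definition block ::
  "('a, 'n::finite) smat \<Rightarrow> ('a, 'n) smat \<Rightarrow> ('a, 'n) smat \<Rightarrow> ('a, 'n) smat \<Rightarrow> ('a, 'n) dmat" where
  "block A B C D = (\<chi> i j. case i of
      Inl r \<Rightarrow> (case j of Inl s \<Rightarrow> A $ r $ s | Inr s \<Rightarrow> B $ r $ s)
    | Inr r \<Rightarrow> (case j of Inl s \<Rightarrow> C $ r $ s | Inr s \<Rightarrow> D $ r $ s))"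

definition blockA :: "('a, 'n::finite) dmat \<Rightarrow> ('a, 'n) smat" where
  "blockA g = (\<chi> r s. g $ Inl r $ Inl s)"
definition blockB :: "('a, 'n::finite) dmat \<Rightarrow> ('a, 'n) smat" where
  "blockB g = (\<chi> r s. g $ Inl r $ Inr s)"
definition blockC :: "('a, 'n::finite) dmat \<Rightarrow> ('a, 'n) smat" where
  "blockC g = (\<chi> r s. g $ Inr r $ Inl s)"
definition blockD :: "('a, 'n::finite) dmat \<Rightarrow> ('a, 'n) smat" where
  "blockD g = (\<chi> r s. g $ Inr r $ Inr s)"

abbreviation of_real_mat :: "(real, 'm::finite) smat \<Rightarrow> (complex, 'm) smat" where
  "of_real_mat \<equiv> map_matrix complex_of_real"

definition complex_mat :: "(real, 'm::finite) smat \<Rightarrow> (real, 'm) smat \<Rightarrow> (complex, 'm) smat" where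
  "complex_mat x y = (\<chi> r s. Complex (x $ r $ s) (y $ r $ s))"

definition J_mat :: "('a::comm_ring_1, 'n::finite) dmat" where
  "J_mat = block 0 (mat 1) (- mat 1) 0"

definition Sp :: "('a::comm_ring_1, 'n::finite) dmat set" where
  "Sp = {g. invertible g \<and> transpose g ** J_mat ** g = J_mat}"

definition Sp_int :: "(real, 'n::finite) dmat set" where
  "Sp_int = {g \<in> Sp. \<forall>i j. g $ i $ j \<in> \<int>}"

definition mat_group :: "('a::comm_ring_1, 'm::finite) smat set \<Rightarrow> ('a, 'm) smat monoid" where
  "mat_group S = \<lparr>carrier = S, monoid.mult = (**), one = mat 1\<rparr>"

definition principal_congruence :: "nat \<Rightarrow> (real, 'n::finite) dmat set" where
  "principal_congruence N =
    {g \<in> Sp_int. \<forall>i j. \<exists>k::int. g $ i $ j = mat 1 $ i $ j + real N * of_int k}"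

definition congruence_subgroup :: "(real, 'n::finite) dmat set \<Rightarrow> bool" where
  "congruence_subgroup \<Gamma> \<longleftrightarrow>
    subgroup \<Gamma> (mat_group Sp_int) \<and> (\<exists>N>0. principal_congruence N \<subseteq> \<Gamma>)"

section \<open>The Siegel upper half space and the maximal compact subgroup\<close>

definition pos_def :: "(real, 'm::finite) smat \<Rightarrow> bool" where
  "pos_def y \<longleftrightarrow> transpose y = y \<and> (\<forall>v. v \<noteq> 0 \<longrightarrow> v \<bullet> (y *v v) > 0)"

definition siegel :: "(complex, 'n::finite) smat set" where
  "siegel = {z. transpose z = z \<and> pos_def (map_matrix Im z)}"

definition aut_factor :: "(real, 'n::finite) dmat \<Rightarrow> (complex, 'n) smat \<Rightarrow> (complex, 'n) smat" where
  "aut_factor g z = of_real_mat (blockC g) ** z + of_real_mat (blockD g)"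

definition siegel_act :: "(real, 'n::finite) dmat \<Rightarrow> (complex, 'n) smat \<Rightarrow> (complex, 'n) smat" where
  "siegel_act g z =
    (of_real_mat (blockA g) ** z + of_real_mat (blockB g)) ** matrix_inv (aut_factor g z)"

definition slash ::
  "nat \<Rightarrow> ((complex, 'n::finite) smat \<Rightarrow> complex) \<Rightarrow> (real, 'n) dmat \<Rightarrow> (complex, 'n) smat \<Rightarrow> complex" where
  "slash m f g z = inverse (det (aut_factor g z) ^ m) * f (siegel_act g z)"

definition unitary_mat :: "(complex, 'm::finite) smat \<Rightarrow> bool" where
  "unitary_mat u \<longleftrightarrow> u ** transpose (map_matrix cnj u) = mat 1"

definition K_sp :: "(real, 'n::finite) dmat set" where
  "K_sp = {k \<in> Sp. unitary_mat (of_real_mat k)}"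

text \<open>An element of \<open>K_sp\<close> has the form \<open>block A B (- B) A\<close>, and the corresponding
  unitary matrix of size \<open>n\<close> is \<open>A + iB\<close>.\<close>

definition chi :: "nat \<Rightarrow> (real, 'n::finite) dmat \<Rightarrow> complex" where
  "chi m k = det (complex_mat (blockA k) (blockB k)) ^ m"

section \<open>Measures\<close>

text \<open>\<open>\<Prod>\<^bsub>r\<le>s\<^esub> dx\<^bsub>r,s\<^esub>\<close> as a measure on matrices, concentrated on the symmetric ones.\<close>

definition sym_lborel :: "(real, 'n::{finite, linorder}) smat measure" where
  "sym_lborel = distr (\<Pi>\<^sub>M p\<in>{(r, s). r \<le> s}. lborel) borel
     (\<lambda>c. \<chi> r s. c (if r \<le> s then (r, s) else (s, r)))"

definition siegel_measure :: "(complex, 'n::{finite, linorder}) smat measure" where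
  "siegel_measure =
     density (restrict_space (distr (sym_lborel \<Otimes>\<^sub>M sym_lborel) borel (\<lambda>(x, y). complex_mat x y)) siegel)
       (\<lambda>z. ennreal (inverse (det (map_matrix Im z) ^ (CARD('n) + 1))))"

definition pos_sqrt :: "(real, 'm::finite) smat \<Rightarrow> (real, 'm) smat" where
  "pos_sqrt y = (THE s. pos_def s \<and> s ** s = y)"

definition n_mat :: "(real, 'n::finite) smat \<Rightarrow> (real, 'n) dmat" where
  "n_mat x = block (mat 1) x 0 (mat 1)"

definition a_mat :: "(real, 'n::finite) smat \<Rightarrow> (real, 'n) dmat" where
  "a_mat y = block (pos_sqrt y) 0 0 (matrix_inv (pos_sqrt y))"

text \<open>Left Haar measures on a closed group of real matrices; no regularity condition is needed,
  because such a group is second countable and locally compact.\<close>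

definition haar_measure :: "(real, 'm::finite) smat set \<Rightarrow> (real, 'm) smat measure \<Rightarrow> bool" where
  "haar_measure H \<nu> \<longleftrightarrow>
     sets \<nu> = sets (restrict_space borel H) \<and>
     (\<forall>h\<in>H. \<forall>A\<in>sets \<nu>. emeasure \<nu> ((\<lambda>x. h ** x) ` A) = emeasure \<nu> A) \<and>
     (\<forall>C. compact C \<and> C \<subseteq> H \<longrightarrow> emeasure \<nu> C < \<infinity>) \<and>
     emeasure \<nu> H \<noteq> 0"

text \<open>The Haar measure on \<open>Sp\<close>, in terms of a Haar measure \<open>\<kappa>\<close> on \<open>K_sp\<close>.\<close>

definition sp_measure ::
  "(real, 'n::{finite, linorder}) dmat measure \<Rightarrow> (real, 'n) dmat measure" where
  "sp_measure \<kappa> = distr (siegel_measure \<Otimes>\<^sub>M \<kappa>) (restrict_space borel Sp)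
     (\<lambda>(z, k). n_mat (map_matrix Re z) ** a_mat (map_matrix Im z) ** k)"

text \<open>The quotient \<open>\<Delta>\<setminus>H\<close> consists of the cosets \<open>\<Delta>h\<close>, with the Borel sets of the
  quotient topology. A left \<open>\<Delta>\<close>-invariant function on \<open>H\<close> becomes a function on cosets
  through an arbitrary choice of representatives.\<close>

definition coset_space :: "(real, 'm::finite) smat set \<Rightarrow> (real, 'm) smat set \<Rightarrow> (real, 'm) smat set set" where
  "coset_space \<Delta> H = (\<lambda>h. (\<lambda>\<gamma>. \<gamma> ** h) ` \<Delta>) ` H"

definition coset_borel ::
  "(real, 'm::finite) smat set \<Rightarrow> (real, 'm) smat set \<Rightarrow> (real, 'm) smat set measure" where
  "coset_borel \<Delta> H =
     sigma (coset_space \<Delta> H) {A. A \<subseteq> coset_space \<Delta> H \<and> openin (top_of_set H) (\<Union>A)}"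

definition on_cosets :: "('a \<Rightarrow> complex) \<Rightarrow> 'a set \<Rightarrow> complex" where
  "on_cosets \<phi> C = \<phi> (SOME h. h \<in> C)"

definition compactly_supported :: "'a::topological_space set \<Rightarrow> ('a \<Rightarrow> complex) \<Rightarrow> bool" where
  "compactly_supported H f \<longleftrightarrow> (\<exists>C. compact C \<and> C \<subseteq> H \<and> (\<forall>h\<in>H - C. f h = 0))"

text \<open>For discrete \<open>\<Delta>\<close>, the sum over \<open>\<Delta>\<close> below has only finitely many nonzero terms.\<close>

definition quotient_measure ::
  "(real, 'm::finite) smat set \<Rightarrow> (real, 'm) smat set \<Rightarrow> (real, 'm) smat measure \<Rightarrow>
   (real, 'm) smat set measure \<Rightarrow> bool" where
  "quotient_measure \<Delta> H \<nu> \<mu> \<longleftrightarrow>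
     sets \<mu> = sets (coset_borel \<Delta> H) \<and>
     (\<forall>f. continuous_on H f \<and> compactly_supported H f \<longrightarrow>
        (LINT C|\<mu>. on_cosets (\<lambda>h. \<Sum>\<^sub>\<infinity>\<gamma>\<in>\<Delta>. f (\<gamma> ** h)) C) = (LINT h|\<nu>. f h))"

definition L2_inner ::
  "(real, 'm::finite) smat set measure \<Rightarrow> ((real, 'm) smat \<Rightarrow> complex) \<Rightarrow>
   ((real, 'm) smat \<Rightarrow> complex) \<Rightarrow> complex" where
  "L2_inner \<mu> \<phi>1 \<phi>2 = (LINT C|\<mu>. on_cosets (\<lambda>g. \<phi>1 g * cnj (\<phi>2 g)) C)"

section \<open>The Lie algebra and its action\<close>

definition sp_lie :: "(real, 'n::finite) dmat set" where
  "sp_lie = {X. transpose X ** J_mat + J_mat ** X = 0}"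

definition sp_lie_complex :: "(complex, 'n::finite) dmat set" where
  "sp_lie_complex = {complex_mat X Y | X Y. X \<in> sp_lie \<and> Y \<in> sp_lie}"

definition bracket :: "('a::comm_ring_1, 'm::finite) smat \<Rightarrow> ('a, 'm) smat \<Rightarrow> ('a, 'm) smat" where
  "bracket X Y = X ** Y - Y ** X"

definition mat_scale :: "'a::comm_ring_1 \<Rightarrow> ('a, 'm::finite) smat \<Rightarrow> ('a, 'm) smat" where
  "mat_scale c X = map_matrix ((*) c) X"

definition mat_exp :: "(real, 'm::finite) smat \<Rightarrow> (real, 'm) smat" where
  "mat_exp X = suminf (\<lambda>k. (1 / fact k) *\<^sub>R (((**) X ^^ k) (mat 1)))"

definition lie_act_real ::
  "(real, 'm::finite) smat \<Rightarrow> ((real, 'm) smat \<Rightarrow> complex) \<Rightarrow> (real, 'm) smat \<Rightarrow> complex" where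
  "lie_act_real X \<phi> g = vector_derivative (\<lambda>t. \<phi> (g ** mat_exp (t *\<^sub>R X))) (at 0)"

definition lie_act ::
  "(complex, 'm::finite) smat \<Rightarrow> ((real, 'm) smat \<Rightarrow> complex) \<Rightarrow> (real, 'm) smat \<Rightarrow> complex" where
  "lie_act X \<phi> g = lie_act_real (map_matrix Re X) \<phi> g + \<i> * lie_act_real (map_matrix Im X) \<phi> g"

definition unit_mat :: "'n::finite \<Rightarrow> 'n \<Rightarrow> (complex, 'n) smat" where
  "unit_mat r s = (\<chi> a b. if a = r \<and> b = s then 1 else 0)"

definition T_mat :: "'n::finite \<Rightarrow> (complex, 'n) dmat" where
  "T_mat r = mat_scale (- \<i>) (block 0 (unit_mat r r) (- unit_mat r r) 0)"

definition cartan_complex :: "(complex, 'n::finite) dmat set" where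
  "cartan_complex = {\<Sum>r\<in>UNIV. mat_scale (c r) (T_mat r) | c. True}"

text \<open>The functional \<open>e\<^sub>r\<close> on \<open>cartan_complex\<close> that is dual to the basis \<open>T_mat\<close>.\<close>

definition e_weight :: "'n::finite \<Rightarrow> (complex, 'n) dmat \<Rightarrow> complex" where
  "e_weight r H = \<i> * H $ Inl r $ Inr r"

lemma e_weight_cartan: "e_weight r (\<Sum>s\<in>UNIV. mat_scale (c s) (T_mat s)) = c r"
proof -
  have "(mat_scale (c s) (T_mat s)) $ Inl r $ Inr r = (if s = r then - \<i> * c s else 0)" for s
    by (simp add: mat_scale_def T_mat_def block_def unit_mat_def)
  then show ?thesis
    by (simp add: e_weight_def flip: mult.assoc)
qed

definition root_subspace :: "((complex, 'n::finite) dmat \<Rightarrow> complex) \<Rightarrow> (complex, 'n) dmat set" where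
  "root_subspace \<alpha> = {X \<in> sp_lie_complex. \<forall>H\<in>cartan_complex. bracket H X = mat_scale (\<alpha> H) X}"

definition p_minus :: "(complex, 'n::{finite, linorder}) dmat set" where
  "p_minus = {\<Sum>(r, s)\<in>{(r, s). r \<le> s}. X r s | X.
     \<forall>r s. r \<le> s \<longrightarrow> X r s \<in> root_subspace (\<lambda>H. - (e_weight r H + e_weight s H))}"

section \<open>The universal enveloping algebra\<close>

text \<open>The free associative algebra over \<open>\<complex>\<close> on a set \<open>S\<close> consists of the finitely
  supported complex-valued functions on words over \<open>S\<close>, i.e. it is the monoid algebra of the
  free monoid. The universal enveloping algebra is its quotient by the two-sided ideal
  \<open>env_ideal\<close>; its elements are represented by elements of \<open>free_algebra sp_lie_complex\<close>.\<close>

datatype 'a fword = FWord (letters: "'a list")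

instantiation fword :: (type) monoid_add
begin
definition zero_fword :: "'a fword" where "zero_fword = FWord []"
definition plus_fword :: "'a fword \<Rightarrow> 'a fword \<Rightarrow> 'a fword" where
  "plus_fword u v = FWord (letters u @ letters v)"
instance
  by standard (auto simp: zero_fword_def plus_fword_def)
end

definition free_algebra :: "'a set \<Rightarrow> ('a fword \<Rightarrow>\<^sub>0 complex) set" where
  "free_algebra S = {a. \<forall>w\<in>Poly_Mapping.keys a. set (letters w) \<subseteq> S}"

definition gen :: "'a \<Rightarrow> ('a fword \<Rightarrow>\<^sub>0 complex)" where
  "gen X = Poly_Mapping.single (FWord [X]) 1"

definition scalar :: "complex \<Rightarrow> ('a fword \<Rightarrow>\<^sub>0 complex)" where
  "scalar c = Poly_Mapping.single 0 c"

inductive_set env_ideal :: "((complex, 'n::finite) dmat fword \<Rightarrow>\<^sub>0 complex) set" where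
  gen_add: "X \<in> sp_lie_complex \<Longrightarrow> Y \<in> sp_lie_complex \<Longrightarrow> gen (X + Y) - gen X - gen Y \<in> env_ideal"
| gen_scale: "X \<in> sp_lie_complex \<Longrightarrow> gen (mat_scale c X) - scalar c * gen X \<in> env_ideal"
| gen_bracket: "X \<in> sp_lie_complex \<Longrightarrow> Y \<in> sp_lie_complex \<Longrightarrow>
    gen X * gen Y - gen Y * gen X - gen (bracket X Y) \<in> env_ideal"
| zero: "0 \<in> env_ideal"
| add: "a \<in> env_ideal \<Longrightarrow> b \<in> env_ideal \<Longrightarrow> a + b \<in> env_ideal"
| mult_left: "a \<in> env_ideal \<Longrightarrow> b \<in> free_algebra sp_lie_complex \<Longrightarrow> b * a \<in> env_ideal"
| mult_right: "a \<in> env_ideal \<Longrightarrow> b \<in> free_algebra sp_lie_complex \<Longrightarrow> a * b \<in> env_ideal"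

definition env_center :: "((complex, 'n::finite) dmat fword \<Rightarrow>\<^sub>0 complex) set" where
  "env_center = {a \<in> free_algebra sp_lie_complex.
     \<forall>b\<in>free_algebra sp_lie_complex. a * b - b * a \<in> env_ideal}"

definition env_act ::
  "((complex, 'm::finite) smat fword \<Rightarrow>\<^sub>0 complex) \<Rightarrow> ((real, 'm) smat \<Rightarrow> complex) \<Rightarrow>
   (real, 'm) smat \<Rightarrow> complex" where
  "env_act a \<phi> g =
     (\<Sum>w\<in>Poly_Mapping.keys a. Poly_Mapping.lookup a w * foldr lie_act (letters w) \<phi> g)"

text \<open>The set \<open>\<F>\<close>, restricted to \<open>H\<close>, lies in (equivalently, spans) a finite-dimensional
  space of functions on \<open>H\<close>.\<close>

definition finite_dim_span :: "'a set \<Rightarrow> ('a \<Rightarrow> complex) set \<Rightarrow> bool" where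
  "finite_dim_span H \<F> \<longleftrightarrow>
     (\<exists>B. finite B \<and> (\<forall>\<psi>\<in>\<F>. \<exists>c. \<forall>g\<in>H. \<psi> g = (\<Sum>b\<in>B. c b * b g)))"

definition Z_finite :: "((real, 'n::finite) dmat \<Rightarrow> complex) \<Rightarrow> bool" where
  "Z_finite \<phi> \<longleftrightarrow> finite_dim_span Sp ((\<lambda>a. env_act a \<phi>) ` env_center)"

definition K_finite :: "((real, 'n::finite) dmat \<Rightarrow> complex) \<Rightarrow> bool" where
  "K_finite \<phi> \<longleftrightarrow> finite_dim_span Sp ((\<lambda>k g. \<phi> (g ** k)) ` K_sp)"

section \<open>Smooth functions\<close>

primrec Ck_on :: "nat \<Rightarrow> 'a::euclidean_space set \<Rightarrow> ('a \<Rightarrow> complex) \<Rightarrow> bool" where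
  "Ck_on 0 S f \<longleftrightarrow> continuous_on S f"
| "Ck_on (Suc k) S f \<longleftrightarrow> (\<forall>x\<in>S. f differentiable (at x)) \<and>
     (\<forall>v. Ck_on k S (\<lambda>x. frechet_derivative f (at x) v))"

text \<open>Smoothness on a submanifold: local extendability to smooth functions on open sets.\<close>

definition smooth_function_on :: "'a::euclidean_space set \<Rightarrow> ('a \<Rightarrow> complex) \<Rightarrow> bool" where
  "smooth_function_on M \<phi> \<longleftrightarrow>
     (\<forall>g\<in>M. \<exists>U \<psi>. open U \<and> g \<in> U \<and> (\<forall>k. Ck_on k U \<psi>) \<and> (\<forall>x\<in>U \<inter> M. \<psi> x = \<phi> x))"

section \<open>Parabolic subgroups and cuspidality\<close>

text \<open>Algebraic groups are identified with their groups of complex points.\<close>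

inductive_set poly_functions :: "complex set \<Rightarrow> ((complex, 'm::finite) smat \<Rightarrow> complex) set"
  for F :: "complex set" where
  const: "c \<in> F \<Longrightarrow> (\<lambda>g. c) \<in> poly_functions F"
| entry: "(\<lambda>g. g $ i $ j) \<in> poly_functions F"
| add: "p \<in> poly_functions F \<Longrightarrow> q \<in> poly_functions F \<Longrightarrow> (\<lambda>g. p g + q g) \<in> poly_functions F"
| mult: "p \<in> poly_functions F \<Longrightarrow> q \<in> poly_functions F \<Longrightarrow> (\<lambda>g. p g * q g) \<in> poly_functions F"

definition zariski_closed_over :: "complex set \<Rightarrow> (complex, 'm::finite) smat set \<Rightarrow> bool" where
  "zariski_closed_over F S \<longleftrightarrow> (\<exists>\<P>\<subseteq>poly_functions F. S = {g. \<forall>p\<in>\<P>. p g = 0})"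

definition zariski_connected :: "(complex, 'm::finite) smat set \<Rightarrow> bool" where
  "zariski_connected S \<longleftrightarrow>
     \<not> (\<exists>A B. zariski_closed_over UNIV A \<and> zariski_closed_over UNIV B \<and> S \<subseteq> A \<union> B \<and>
          S \<inter> A \<inter> B = {} \<and> S \<inter> A \<noteq> {} \<and> S \<inter> B \<noteq> {})"

definition algebraic_subgroup :: "(complex, 'n::finite) dmat set \<Rightarrow> bool" where
  "algebraic_subgroup S \<longleftrightarrow> subgroup S (mat_group Sp) \<and> zariski_closed_over UNIV S"

definition connected_solvable :: "(complex, 'n::finite) dmat set \<Rightarrow> bool" where
  "connected_solvable S \<longleftrightarrow>
     algebraic_subgroup S \<and> zariski_connected S \<and> solvable (mat_group S)"

definition borel_subgroup :: "(complex, 'n::finite) dmat set \<Rightarrow> bool" where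
  "borel_subgroup B \<longleftrightarrow>
     connected_solvable B \<and> (\<forall>S. connected_solvable S \<and> B \<subseteq> S \<longrightarrow> S = B)"

text \<open>As \<open>\<rat>\<close> is perfect, a closed subgroup is defined over \<open>\<rat>\<close> iff it is the zero set of
  polynomials with rational coefficients.\<close>

definition rational_parabolic :: "(complex, 'n::finite) dmat set \<Rightarrow> bool" where
  "rational_parabolic P \<longleftrightarrow>
     algebraic_subgroup P \<and> zariski_closed_over \<rat> P \<and> (\<exists>B. borel_subgroup B \<and> B \<subseteq> P)"

definition unipotent_mat :: "(complex, 'm::finite) smat \<Rightarrow> bool" where
  "unipotent_mat g \<longleftrightarrow> (\<exists>k. ((**) (g - mat 1) ^^ k) (mat 1) = 0)"

definition connected_normal_unipotent ::
  "(complex, 'n::finite) dmat set \<Rightarrow> (complex, 'n) dmat set \<Rightarrow> bool" where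
  "connected_normal_unipotent P U \<longleftrightarrow>
     algebraic_subgroup U \<and> zariski_connected U \<and> U \<lhd> mat_group P \<and> (\<forall>u\<in>U. unipotent_mat u)"

definition unipotent_radical ::
  "(complex, 'n::finite) dmat set \<Rightarrow> (complex, 'n) dmat set \<Rightarrow> bool" where
  "unipotent_radical P U \<longleftrightarrow>
     connected_normal_unipotent P U \<and> (\<forall>V. connected_normal_unipotent P V \<longrightarrow> V \<subseteq> U)"

definition real_points :: "(complex, 'n::finite) dmat set \<Rightarrow> (real, 'n) dmat set" where
  "real_points S = {g. of_real_mat g \<in> S}"

text \<open>The invariant measure on the quotient is unique up to a positive factor, which is
  irrelevant for the vanishing of the integrals.\<close>

definition cuspidal :: "(real, 'n::finite) dmat set \<Rightarrow> ((real, 'n) dmat \<Rightarrow> complex) \<Rightarrow> bool" where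
  "cuspidal \<Gamma> \<phi> \<longleftrightarrow>
     (\<forall>P U \<nu> \<mu>. rational_parabolic P \<and> P \<noteq> Sp \<and> unipotent_radical P U \<and>
        haar_measure (real_points U) \<nu> \<and>
        quotient_measure (\<Gamma> \<inter> real_points U) (real_points U) \<nu> \<mu> \<longrightarrow>
        (\<forall>g\<in>Sp. (LINT C|\<mu>. on_cosets (\<lambda>u. \<phi> (u ** g)) C) = 0))"

section \<open>Spaces of cusp forms\<close>

definition A_cusp :: "(real, 'n::finite) dmat set \<Rightarrow> ((real, 'n) dmat \<Rightarrow> complex) set" where
  "A_cusp \<Gamma> = {\<phi>. smooth_function_on Sp \<phi> \<and>
     (\<forall>\<gamma>\<in>\<Gamma>. \<forall>g\<in>Sp. \<phi> (\<gamma> ** g) = \<phi> g) \<and>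
     Z_finite \<phi> \<and> K_finite \<phi> \<and> cuspidal \<Gamma> \<phi> \<and> (\<exists>b. \<forall>g\<in>Sp. norm (\<phi> g) \<le> b)}"

definition A_cusp_chi_p_minus ::
  "(real, 'n::{finite, linorder}) dmat set \<Rightarrow> nat \<Rightarrow> ((real, 'n) dmat \<Rightarrow> complex) set" where
  "A_cusp_chi_p_minus \<Gamma> m = {\<phi> \<in> A_cusp \<Gamma>.
     (\<forall>g\<in>Sp. \<forall>k\<in>K_sp. \<phi> (g ** k) = chi m k * \<phi> g) \<and>
     (\<forall>X\<in>p_minus. \<forall>g\<in>Sp. lie_act X \<phi> g = 0)}"

section \<open>The Poincare series and the constant\<close>

definition f1 :: "nat \<Rightarrow> (complex, 'n::finite) smat \<Rightarrow> complex" where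
  "f1 m z = (2 * \<i>) ^ (m * CARD('n)) * inverse (det (z + mat \<i>) ^ m)"

definition F1 :: "nat \<Rightarrow> (real, 'n::finite) dmat \<Rightarrow> complex" where
  "F1 m g = slash m (f1 m) g (mat \<i>)"

definition poincare ::
  "(real, 'm::finite) smat set \<Rightarrow> ((real, 'm) smat \<Rightarrow> complex) \<Rightarrow> (real, 'm) smat \<Rightarrow> complex" where
  "poincare \<Gamma> F g = (\<Sum>\<^sub>\<infinity>\<gamma>\<in>\<Gamma>. F (\<gamma> ** g))"

definition C_const :: "nat \<Rightarrow> nat \<Rightarrow> real" where
  "C_const m n = 2 powr (real (n * (n + 3)) / 2) * pi powr (real (n * (n + 1)) / 2) *
     (\<Prod>r=1..n. Gamma (real m - (real n + real r) / 2) / Gamma (real m - (real r - 1) / 2))"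

end

theory Submission
  imports Defs "HOL-Complex_Analysis.Complex_Analysis" "HOL-Probability.Probability"
begin

text \<open>Attach to \<open>\<phi>\<close> the holomorphic function \<open>f\<close> on the Siegel upper half space with
  \<open>f (g.\<i>) = det (C\<i> + D)\<^sup>m \<phi> g\<close>; holomorphy is the annihilation of \<open>\<phi>\<close> by \<open>\<pp>\<^sup>-\<close>.
  Unfolding the Poincare series turns the inner product into an integral over the whole group, and
  \<open>K\<close>-equivariance turns this into the integral of \<open>(f / f\<^sub>1) |f\<^sub>1|\<^sup>2 (det y)\<^sup>m\<close> over the half space.
  The finite measure \<open>|f\<^sub>1|\<^sup>2 (det y)\<^sup>m dv\<close> is invariant under the circle of rotations
  \<open>z \<mapsto> (cz + s) (c - sz)\<^sup>-\<^sup>1\<close>, which multiply the Cayley transform of \<open>z\<close> by scalars of modulus one.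
  By the mean value property on the disc through \<open>z\<close> and \<open>\<i>\<close>, the average of \<open>f / f\<^sub>1\<close> over such a circle
  is its value \<open>\<phi> 1\<close> at \<open>\<i>\<close>, so the inner product is \<open>\<phi> 1\<close> times the total mass. The mass is computed by
  bordering symmetric matrices one row at a time, which reduces it to one-dimensional Gaussian and
  beta integrals; the same bordering, applied to the rotations of a single coordinate, shows that the
  measure \<open>dv\<close> is invariant under them.

  The quotient measure is only characterized on continuous functions with compact support, so
  unfolding needs an exhaustion by cutoff functions. Where the Poincare series does not converge
  absolutely, its value is \<open>0\<close> by the convention for infinite sums.\<close>

text \<open>The condition \<open>m > 2 * CARD('n)\<close> enters through absolute convergence. As
  \<open>\<phi>\<close> is bounded, the integrand is dominated by a multiple of
  \<open>norm (F1 m g)\<close>, and on the half space this is, up to a constant, the density |det (z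
  + i)|^(-2a) (det y)^a with a = m/2, whereas the mass is the same integral with a = m. The integral
  is therefore evaluated for a real exponent a > n and used twice: at m/2 for finiteness and at m
  for the constant.

  For fixed y the real parts are integrated first. This leaves a power of det (y + 1), because z + i
  has imaginary part y + 1, and the integral over y is then a matrix beta integral. Both inductions
  rest on one fact: bordering turns a rank one perturbation of a matrix into a rank one perturbation
  of its Schur complement, up to a translation.

  The derivative of the function attached to \<open>\<phi>\<close> is computed at the base point i,
  where the square root in the section z to n_x a_y has an explicit derivative; other points are
  moved to i by the group.\<close>

no_notation fps_nth (infixl "$" 75)

section \<open>Block matrices and the symplectic action\<close>

lemma matrix_mul_ring_simps:
  fixes A B C :: "('a::comm_ring_1, 'm::finite) smat"
  shows "A ** (B + C) = A ** B + A ** C" "(A + B) ** C = A ** C + B ** C"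
    "A ** (B - C) = A ** B - A ** C" "(A - B) ** C = A ** C - B ** C"
    "A ** (- B) = - (A ** B)" "(- A) ** B = - (A ** B)" "A ** 0 = 0" "0 ** A = 0"
    "(A ** B) ** C = A ** (B ** C)" "mat 1 ** A = A" "A ** mat 1 = A"
proof -
  show "(A ** B) ** C = A ** (B ** C)" "mat 1 ** A = A" "A ** mat 1 = A"
    by (simp_all add: matrix_mul_assoc)
qed (simp_all add: vec_eq_iff matrix_matrix_mult_def algebra_simps sum.distrib sum_subtractf sum_negf)

lemma transpose_ring_simps:
  fixes A B :: "('a::comm_ring_1, 'm::finite) smat"
  shows "transpose (A + B) = transpose A + transpose B" "transpose (A - B) = transpose A - transpose B"
    "transpose (- A) = - transpose A" "transpose (0 :: ('a, 'm) smat) = 0"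
    "transpose (A ** B) = transpose B ** transpose A"
  by (simp_all add: transpose_def vec_eq_iff matrix_transpose_mul[unfolded transpose_def vec_eq_iff])
     (simp add: matrix_matrix_mult_def mult.commute)

lemma map_matrix_of_real_simps:
  fixes A B :: "(real, 'm::finite) smat"
  shows "of_real_mat (A + B) = of_real_mat A + of_real_mat B"
    "of_real_mat (A - B) = of_real_mat A - of_real_mat B"
    "of_real_mat (- A) = - of_real_mat A" "of_real_mat (0 :: (real, 'm) smat) = 0"
    "of_real_mat (A ** B) = of_real_mat A ** of_real_mat B"
    "of_real_mat (transpose A) = transpose (of_real_mat A)"
    "of_real_mat (mat 1 :: (real, 'm) smat) = mat 1"
  by (simp_all add: vec_eq_iff matrix_matrix_mult_def transpose_def mat_def)

lemma map_matrix_cnj_simps: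
  fixes A B :: "(complex, 'm::finite) smat"
  shows "map_matrix cnj (A + B) = map_matrix cnj A + map_matrix cnj B"
    "map_matrix cnj (A - B) = map_matrix cnj A - map_matrix cnj B"
    "map_matrix cnj (A ** B) = map_matrix cnj A ** map_matrix cnj B"
    "map_matrix cnj (transpose A) = transpose (map_matrix cnj A)"
    "map_matrix cnj (of_real_mat X) = of_real_mat X"
    "map_matrix cnj (mat 1 :: (complex, 'm) smat) = mat 1"
    "map_matrix cnj (map_matrix cnj A) = A"
  by (simp_all add: vec_eq_iff matrix_matrix_mult_def transpose_def mat_def)

lemma det_cnj: "det (map_matrix cnj A) = cnj (det A)" for A :: "(complex, 'm::finite) smat"
  by (simp add: det_def)

lemma det_of_real: "det (of_real_mat A) = of_real (det A)" for A :: "(real, 'm::finite) smat"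
  by (simp add: det_def)

lemma matrix_inv_unique:
  fixes A B :: "('a::field, 'm::finite) smat"
  assumes "A ** B = mat 1"
  shows "matrix_inv A = B"
proof -
  have BA: "B ** A = mat 1" using assms matrix_left_right_inverse by blast
  have "A ** matrix_inv A = mat 1 \<and> matrix_inv A ** A = mat 1"
    unfolding matrix_inv_def by (rule someI[of _ B]) (use assms BA in auto)
  then show ?thesis by (metis BA matrix_mul_assoc matrix_mul_lid matrix_mul_rid)
qed

lemma matrix_inv_mult:
  fixes A :: "('a::field, 'm::finite) smat"
  assumes "invertible A"
  shows "A ** matrix_inv A = mat 1" "matrix_inv A ** A = mat 1"
  using assms matrix_inv_unique unfolding invertible_def by metis+

lemma invertibleI:
  fixes A B :: "('a::field, 'm::finite) smat"
  assumes "A ** B = mat 1"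
  shows "invertible A" "invertible B"
  using assms matrix_left_right_inverse unfolding invertible_def by blast+

lemma block_nth [simp]:
  "block A B C D $ Inl r $ Inl s = A $ r $ s" "block A B C D $ Inl r $ Inr s = B $ r $ s"
  "block A B C D $ Inr r $ Inl s = C $ r $ s" "block A B C D $ Inr r $ Inr s = D $ r $ s"
  by (simp_all add: block_def)

lemma dmat_eq_iff:
  "(g::('a, 'n::finite) dmat) = h \<longleftrightarrow> blockA g = blockA h \<and> blockB g = blockB h \<and> blockC g = blockC h \<and> blockD g = blockD h"
proof
  assume *: "blockA g = blockA h \<and> blockB g = blockB h \<and> blockC g = blockC h \<and> blockD g = blockD h"
  have "g $ i $ j = h $ i $ j" for i j
    using * by (cases i; cases j) (auto simp: blockA_def blockB_def blockC_def blockD_def vec_eq_iff)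
  then show "g = h" by (simp add: vec_eq_iff)
qed auto

lemma block_proj [simp]:
  "blockA (block A B C D) = A" "blockB (block A B C D) = B"
  "blockC (block A B C D) = C" "blockD (block A B C D) = D"
  by (simp_all add: blockA_def blockB_def blockC_def blockD_def vec_eq_iff)

lemma block_eta: "block (blockA g) (blockB g) (blockC g) (blockD g) = g"
  by (simp add: dmat_eq_iff)

lemma block_eq_iff [simp]: "block A B C D = block A' B' C' D' \<longleftrightarrow> A = A' \<and> B = B' \<and> C = C' \<and> D = D'"
  by (metis block_proj)

lemma block_ops:
  fixes A B C D A' B' C' D' :: "('a::comm_ring_1, 'n::finite) smat"
  shows "block A B C D ** block A' B' C' D' =
      block (A ** A' + B ** C') (A ** B' + B ** D') (C ** A' + D ** C') (C ** B' + D ** D')"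
    "transpose (block A B C D) = block (transpose A) (transpose C) (transpose B) (transpose D)"
    "block A B C D + block A' B' C' D' = block (A + A') (B + B') (C + C') (D + D')"
    "block A B C D - block A' B' C' D' = block (A - A') (B - B') (C - C') (D - D')"
    "- block A B C D = block (- A) (- B) (- C) (- D)"
    "(mat 1 :: ('a, 'n) dmat) = block (mat 1) 0 0 (mat 1)"
    "(0 :: ('a, 'n) dmat) = block 0 0 0 0"
  by (simp_all add: dmat_eq_iff, simp_all add: vec_eq_iff blockA_def blockB_def blockC_def blockD_def
      matrix_matrix_mult_def transpose_def mat_def UNIV_Plus_UNIV[symmetric] sum.Plus del: UNIV_Plus_UNIV)

lemma diff_eq_minus_iff: "X - Y = - Z \<longleftrightarrow> Y = Z + X" for X Y Z :: "'a::ab_group_add"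
proof
  assume "X - Y = - Z"
  then have "X - Y + (Y + Z) = - Z + (Y + Z)" by simp
  then show "Y = Z + X" by (simp add: algebra_simps)
qed simp

text \<open>Invertibility follows from the relation itself because \<open>- J_mat\<close> inverts
  \<open>J_mat\<close>. Of the four block equations, the one for
  \<open>transpose B ** C - transpose D ** A\<close> is the transpose of the one for
  \<open>transpose A ** D - transpose C ** B\<close>, which leaves three conditions.\<close>

lemma Sp_block_iff:
  fixes A B C D :: "('a::field, 'n::finite) smat"
  shows "block A B C D \<in> Sp \<longleftrightarrow> transpose A ** C = transpose C ** A \<and> transpose B ** D = transpose D ** B
    \<and> transpose A ** D = mat 1 + transpose C ** B"
proof -
  let ?g = "block A B C D"
  have J: "transpose ?g ** J_mat ** ?g = block (transpose A ** C - transpose C ** A) (transpose A ** D - transpose C ** B)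
     (transpose B ** C - transpose D ** A) (transpose B ** D - transpose D ** B)"
    by (simp add: J_mat_def block_ops matrix_mul_ring_simps algebra_simps)
  have JJ: "(- J_mat) ** J_mat = (mat 1 :: ('a, 'n) dmat)"
    by (simp add: J_mat_def block_ops matrix_mul_ring_simps)
  have "invertible ?g" if "transpose ?g ** J_mat ** ?g = J_mat"
  proof -
    have "((- J_mat) ** transpose ?g ** J_mat) ** ?g = mat 1"
      using that JJ by (metis matrix_mul_assoc)
    then show ?thesis by (rule invertibleI)
  qed
  then have 1: "?g \<in> Sp \<longleftrightarrow> transpose ?g ** J_mat ** ?g = J_mat"
    unfolding Sp_def by blast
  have 2: "transpose ?g ** J_mat ** ?g = J_mat \<longleftrightarrow> transpose A ** C = transpose C ** A \<and> transpose B ** D = transpose D ** B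
    \<and> transpose A ** D = mat 1 + transpose C ** B \<and> transpose B ** C - transpose D ** A = - mat 1"
    unfolding J by (auto simp: J_mat_def algebra_simps)
  have 3: "transpose B ** C - transpose D ** A = - mat 1 \<longleftrightarrow> transpose A ** D = mat 1 + transpose C ** B"
  proof -
    have *: "transpose (transpose B ** C - transpose D ** A) = transpose C ** B - transpose A ** D"
      by (simp add: transpose_ring_simps)
    have "transpose B ** C - transpose D ** A = - mat 1
        \<longleftrightarrow> transpose (transpose B ** C - transpose D ** A) = transpose (- mat 1)"
      by (rule transpose_iff[symmetric])
    also have "\<dots> \<longleftrightarrow> transpose C ** B - transpose A ** D = - mat 1"
      unfolding * by (simp add: transpose_ring_simps)
    also have "\<dots> \<longleftrightarrow> transpose A ** D = mat 1 + transpose C ** B"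
      by (rule diff_eq_minus_iff)
    finally show ?thesis .
  qed
  from 1 2 3 show ?thesis by argo
qed

lemma Sp_relations:
  fixes g :: "('a::field, 'n::finite) dmat"
  assumes "g \<in> Sp"
  shows "transpose (blockA g) ** blockC g = transpose (blockC g) ** blockA g"
    "transpose (blockB g) ** blockD g = transpose (blockD g) ** blockB g"
    "transpose (blockA g) ** blockD g = mat 1 + transpose (blockC g) ** blockB g"
    "transpose (blockD g) ** blockA g = mat 1 + transpose (blockB g) ** blockC g"
proof -
  have "block (blockA g) (blockB g) (blockC g) (blockD g) \<in> Sp" using assms by (simp add: block_eta)
  from this[unfolded Sp_block_iff] show "transpose (blockA g) ** blockC g = transpose (blockC g) ** blockA g"
    "transpose (blockB g) ** blockD g = transpose (blockD g) ** blockB g"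
    and *: "transpose (blockA g) ** blockD g = mat 1 + transpose (blockC g) ** blockB g" by simp_all
  show "transpose (blockD g) ** blockA g = mat 1 + transpose (blockB g) ** blockC g"
    using arg_cong[OF *, of transpose] by (simp add: transpose_ring_simps)
qed

lemma Sp_mult:
  fixes g h :: "('a::comm_ring_1, 'n::finite) dmat"
  assumes "g \<in> Sp" "h \<in> Sp"
  shows "g ** h \<in> Sp"
proof -
  have "transpose (g ** h) ** J_mat ** (g ** h) = transpose h ** (transpose g ** J_mat ** g) ** h"
    by (simp add: transpose_ring_simps matrix_mul_ring_simps)
  also have "\<dots> = J_mat" using assms by (simp add: Sp_def)
  finally show ?thesis using assms by (simp add: Sp_def invertible_mult)
qed

lemma mat_1_in_Sp: "(mat 1 :: ('a::field, 'n::finite) dmat) \<in> Sp"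
  by (simp add: block_ops Sp_block_iff matrix_mul_ring_simps transpose_ring_simps)

text \<open>The relation g^T J g = J says that -J g^T J is a left inverse of g; the right side is
  its block form. Transforming the same relation by the inverse shows that the inverse is
  symplectic.\<close>

lemma Sp_inverse:
  fixes g :: "('a::field, 'n::finite) dmat"
  assumes "g \<in> Sp"
  shows "matrix_inv g = block (transpose (blockD g)) (- transpose (blockB g)) (- transpose (blockC g)) (transpose (blockA g))"
    and "g ** matrix_inv g = mat 1" and "matrix_inv g ** g = mat 1" and "matrix_inv g \<in> Sp"
proof -
  let ?h = "block (transpose (blockD g)) (- transpose (blockB g)) (- transpose (blockC g)) (transpose (blockA g))"
  have "?h ** block (blockA g) (blockB g) (blockC g) (blockD g) = mat 1"
    using Sp_relations[OF assms] by (simp add: block_ops matrix_mul_ring_simps)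
  then have hg: "?h ** g = mat 1" by (simp add: block_eta)
  then have gh: "g ** ?h = mat 1" using matrix_left_right_inverse by blast
  then show h: "matrix_inv g = ?h" by (rule matrix_inv_unique)
  show "g ** matrix_inv g = mat 1" "matrix_inv g ** g = mat 1" using h hg gh by simp_all
  have "transpose ?h ** (transpose g ** J_mat ** g) ** ?h = J_mat"
  proof -
    have "transpose ?h ** (transpose g ** J_mat ** g) ** ?h = transpose (g ** ?h) ** J_mat ** (g ** ?h)"
      unfolding transpose_ring_simps by (simp only: matrix_mul_assoc)
    then show ?thesis unfolding gh by simp
  qed
  then have "transpose ?h ** J_mat ** ?h = J_mat" using assms by (simp add: Sp_def)
  then show "matrix_inv g \<in> Sp" using h invertibleI(1)[OF hg] by (simp add: Sp_def)
qed

section \<open>Hermitian forms and the action on the half space\<close>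

text \<open>The value of the sesquilinear form with matrix \<open>M\<close>. Positivity of a real
  matrix is tested on complex vectors because the automorphy factor is complex, so that a congruence
  by it mixes real and imaginary parts.\<close>

definition hform :: "(complex, 'm::finite) smat \<Rightarrow> (complex, 'm) vec \<Rightarrow> complex" where
  "hform M v = (\<Sum>i\<in>UNIV. cnj (v $ i) * (M *v v) $ i)"

abbreviation conj_transpose :: "(complex, 'm::finite) smat \<Rightarrow> (complex, 'm) smat" where
  "conj_transpose Q \<equiv> transpose (map_matrix cnj Q)"

lemma hform_congruence: "hform (conj_transpose Q ** M ** Q) v = hform M (Q *v v)"
proof -
  have "(\<Sum>i\<in>UNIV. cnj (v $ i) * (conj_transpose Q *v x) $ i) = (\<Sum>i\<in>UNIV. cnj ((Q *v v) $ i) * x $ i)" for x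
    unfolding matrix_vector_mult_def transpose_def
    by (simp add: sum_distrib_left sum_distrib_right mult_ac) (rule sum.swap)
  then show ?thesis
    unfolding hform_def by (simp flip: matrix_vector_mul_assoc del: transpose_matrix_vector)
qed

lemma hform_real:
  assumes "transpose y = y"
  shows "hform (of_real_mat y) v = of_real ((\<chi> i. Re (v $ i)) \<bullet> (y *v (\<chi> i. Re (v $ i))) + (\<chi> i. Im (v $ i)) \<bullet> (y *v (\<chi> i. Im (v $ i))))"
    (is "_ = of_real (?a \<bullet> (y *v ?a) + ?b \<bullet> (y *v ?b))")
proof -
  have sym: "?a \<bullet> (y *v ?b) = ?b \<bullet> (y *v ?a)"
    by (metis assms dot_lmul_matrix inner_commute transpose_matrix_vector)
  have 1: "(of_real_mat y *v v) $ i = Complex ((y *v ?a) $ i) ((y *v ?b) $ i)" for i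
    by (simp add: complex_eq_iff matrix_vector_mult_def)
  have "hform (of_real_mat y) v = Complex (?a \<bullet> (y *v ?a) + ?b \<bullet> (y *v ?b)) (?a \<bullet> (y *v ?b) - ?b \<bullet> (y *v ?a))"
    unfolding hform_def 1 by (simp add: complex_eq_iff inner_vec_def sum.distrib sum_subtractf algebra_simps)
  then show ?thesis using sym by (simp add: complex_eq_iff)
qed

lemma hform_pos:
  assumes "pos_def y" "v \<noteq> 0"
  shows "Re (hform (of_real_mat y) v) > 0" "Im (hform (of_real_mat y) v) = 0"
proof -
  have s: "transpose y = y" using assms by (simp add: pos_def_def)
  let ?a = "\<chi> i. Re (v $ i)" and ?b = "\<chi> i. Im (v $ i)"
  have nn: "u \<bullet> (y *v u) \<ge> 0" for u using assms by (cases "u = 0") (auto simp: pos_def_def less_imp_le)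
  have "?a \<noteq> 0 \<or> ?b \<noteq> 0" using assms(2) by (auto simp: vec_eq_iff complex_eq_iff)
  then have "?a \<bullet> (y *v ?a) + ?b \<bullet> (y *v ?b) > 0"
    using nn[of ?a] nn[of ?b] assms(1) unfolding pos_def_def by (metis add_nonneg_pos add_pos_nonneg)
  then show "Re (hform (of_real_mat y) v) > 0" "Im (hform (of_real_mat y) v) = 0"
    unfolding hform_real[OF s] by simp_all
qed

lemma pos_def_iff_hform:
  assumes "transpose y = y"
  shows "pos_def y \<longleftrightarrow> (\<forall>v\<noteq>0. Re (hform (of_real_mat y) v) > 0)"
proof
  assume *: "\<forall>v\<noteq>0. Re (hform (of_real_mat y) v) > 0"
  have "u \<bullet> (y *v u) > 0" if "u \<noteq> 0" for u
  proof -
    let ?v = "\<chi> i. complex_of_real (u $ i)"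
    have "?v \<noteq> 0" using that by (auto simp: vec_eq_iff)
    then have "Re (hform (of_real_mat y) ?v) > 0" using * by blast
    then show ?thesis unfolding hform_real[OF assms]
      by (simp add: zero_vec_def[symmetric])
  qed
  then show "pos_def y" using assms by (simp add: pos_def_def)
qed (use hform_pos in blast)

lemma det_pos_def_nonzero:
  assumes "pos_def y" shows "det y \<noteq> 0" "invertible y"
proof -
  have "y *v x = 0 \<Longrightarrow> x = 0" for x using assms by (metis inner_zero_right order_less_irrefl pos_def_def)
  then have "\<exists>B. B ** y = mat 1" using matrix_left_invertible_ker by blast
  then show "invertible y" by (meson invertibleI)
  then show "det y \<noteq> 0" by (simp add: invertible_det_nz)
qed

lemma siegelD:
  assumes "z \<in> siegel" shows "transpose z = z" "pos_def (map_matrix Im z)"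
  using assms by (auto simp: siegel_def)

lemma mat_mult_nth:
  fixes A :: "('a::comm_ring_1, 'm::finite) smat"
  shows "(mat c ** A) $ i $ j = c * A $ i $ j" "(A ** mat c) $ i $ j = c * A $ i $ j"
proof -
  show "(mat c ** A) $ i $ j = c * A $ i $ j"
    unfolding matrix_matrix_mult_def mat_def
    by (simp add: if_distrib[of "\<lambda>x. x * _"] cong: if_cong)
  show "(A ** mat c) $ i $ j = c * A $ i $ j"
    unfolding matrix_matrix_mult_def mat_def
    by (simp add: if_distrib[of "\<lambda>x. _ * x"] mult.commute cong: if_cong)
qed

lemma siegel_diff_cnj: "z - map_matrix cnj z = mat (2 * \<i>) ** of_real_mat (map_matrix Im z)"
  by (simp add: vec_eq_iff mat_mult_nth complex_eq_iff)

text \<open>Stacking z over the identity and multiplying by g gives P stacked over Q. As g is real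
  it preserves both the sesquilinear and the bilinear form of J on such columns; evaluated on the
  column of z these forms give the conjugate of z minus z, and 0 by symmetry of z.\<close>

lemma aut_factor_hermitian:
  fixes g :: "(real, 'a::finite) dmat"
  assumes g: "g \<in> Sp" and z: "transpose z = z"
  defines "P \<equiv> of_real_mat (blockA g) ** z + of_real_mat (blockB g)"
  defines "Q \<equiv> aut_factor g z"
  shows "conj_transpose Q ** P - conj_transpose P ** Q = z - map_matrix cnj z"
    and "transpose Q ** P = transpose P ** Q"
proof -
  let ?A = "of_real_mat (blockA g)" and ?B = "of_real_mat (blockB g)"
  let ?C = "of_real_mat (blockC g)" and ?D = "of_real_mat (blockD g)"
  note R = Sp_relations[OF g, THEN arg_cong[where f = of_real_mat], unfolded map_matrix_of_real_simps]
  have R': "transpose ?A ** (?C ** X) = transpose ?C ** (?A ** X)" for X :: "(complex, 'a) smat"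
    using arg_cong[OF R(1), of "\<lambda>M. M ** X"] by (simp only: matrix_mul_assoc)
  have R2': "transpose ?A ** (?D ** X) = X + transpose ?C ** (?B ** X)" for X :: "(complex, 'a) smat"
    using arg_cong[OF R(3), of "\<lambda>M. M ** X"] by (simp add: matrix_mul_ring_simps)
  have R3': "transpose ?D ** (?A ** X) = X + transpose ?B ** (?C ** X)" for X :: "(complex, 'a) smat"
    using arg_cong[OF R(4), of "\<lambda>M. M ** X"] by (simp add: matrix_mul_ring_simps)
  have zc: "transpose (map_matrix cnj z) = map_matrix cnj z"
    using z by (metis map_matrix_cnj_simps(4))
  show "conj_transpose Q ** P - conj_transpose P ** Q = z - map_matrix cnj z"
    unfolding P_def Q_def aut_factor_def
    by (simp add: map_matrix_cnj_simps transpose_ring_simps matrix_mul_ring_simps R R' R2' R3' zc)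
  show "transpose Q ** P = transpose P ** Q"
    unfolding P_def Q_def aut_factor_def
    by (simp add: transpose_ring_simps matrix_mul_ring_simps R R' R2' R3' z)
qed

lemma mat_commute: "mat c ** A = A ** mat c" for A :: "('a::comm_ring_1, 'm::finite) smat"
  by (simp add: vec_eq_iff mat_mult_nth)

text \<open>Everything comes from the two relations of \<open>aut_factor_hermitian\<close>. With w Q
  = P, the second becomes Q^T w Q = Q^T w^T Q, hence w is symmetric, and the first becomes the
  congruence between Im w and Im z, which transports positivity.\<close>

lemma siegel_act_props:
  assumes g: "g \<in> Sp" and z: "z \<in> siegel"
  shows "invertible (aut_factor g z)" and "siegel_act g z \<in> siegel"
    and "conj_transpose (aut_factor g z) ** of_real_mat (map_matrix Im (siegel_act g z)) ** aut_factor g z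
      = of_real_mat (map_matrix Im z)"
    and "siegel_act g z ** aut_factor g z = of_real_mat (blockA g) ** z + of_real_mat (blockB g)"
proof -
  let ?P = "of_real_mat (blockA g) ** z + of_real_mat (blockB g)"
  let ?Q = "aut_factor g z"
  let ?w = "siegel_act g z"
  let ?i = "mat (2 * \<i>) :: (complex, _) smat"
  note zD = siegelD[OF z]
  note H = aut_factor_hermitian[OF g zD(1)]
  have i2: "mat (1 / (2 * \<i>)) ** ?i = (mat 1 :: (complex, _) smat)"
    by (simp add: vec_eq_iff mat_mult_nth) (simp add: mat_def)
  \<comment> \<open>A kernel vector v of Q annihilates the left side of the first relation, while
    the right side takes the value 2i times the form of Im z at v, which is nonzero unless v =
    0.\<close>
  have "v = 0" if v: "?Q *v v = 0" for v
  proof (rule ccontr)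
    assume "v \<noteq> 0"
    have 0: "hform (conj_transpose ?Q ** M ** ?Q) v = 0" for M
      unfolding hform_congruence by (simp add: v hform_def)
    have e: "hform (A + B) v = hform A v + hform B v" "hform (A - B) v = hform A v - hform B v" for A B
      unfolding hform_def by (simp_all add: algebra_simps sum.distrib sum_subtractf)
    have a: "hform (conj_transpose X ** ?Q) v = 0" for X
      unfolding hform_def by (simp add: v flip: matrix_vector_mul_assoc del: transpose_matrix_vector)
    have b: "hform (conj_transpose ?Q ** X) v = 0" for X
    proof -
      have "hform (conj_transpose ?Q ** X) v = (\<Sum>i\<in>UNIV. cnj ((?Q *v v) $ i) * (X *v v) $ i)"
        unfolding hform_def matrix_vector_mul_assoc[symmetric]
        unfolding matrix_vector_mult_def transpose_def
        by (simp add: sum_distrib_left sum_distrib_right mult_ac) (rule sum.swap)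
      then show ?thesis by (simp add: v)
    qed
    have "hform (z - map_matrix cnj z) v = 0" using H(1) a b e(2) by (metis diff_zero)
    moreover have "hform (z - map_matrix cnj z) v = 2 * \<i> * hform (of_real_mat (map_matrix Im z)) v"
      unfolding siegel_diff_cnj hform_def
      by (simp add: matrix_vector_mult_def matrix_vector_mul_assoc mat_mult_nth sum_distrib_left mult_ac)
    ultimately show False using hform_pos(1)[OF zD(2) \<open>v \<noteq> 0\<close>] by auto
  qed
  then show inv: "invertible ?Q"
    using matrix_left_invertible_ker invertibleI by blast
  then show wQ: "?w ** ?Q = ?P"
    unfolding siegel_act_def by (metis matrix_inv_mult(2) matrix_mul_assoc matrix_mul_rid)
  have sym: "transpose ?w = ?w"
  proof -
    have "transpose ?Q ** ?w ** ?Q = transpose ?Q ** transpose ?w ** ?Q"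
      using H(2) unfolding wQ[symmetric] by (simp add: transpose_ring_simps matrix_mul_ring_simps)
    then have "transpose ?Q ** ?w = transpose ?Q ** transpose ?w"
      by (metis inv matrix_inv_mult(1) matrix_mul_assoc matrix_mul_rid)
    moreover have "transpose (matrix_inv ?Q) ** transpose ?Q = mat 1"
      by (metis inv matrix_inv_mult(1) matrix_transpose_mul transpose_mat)
    ultimately show ?thesis by (metis matrix_mul_assoc matrix_mul_lid)
  qed
  have wc: "transpose (map_matrix cnj ?w) = map_matrix cnj ?w" using sym by (metis map_matrix_cnj_simps(4))
  have "conj_transpose ?Q ** (?w - map_matrix cnj ?w) ** ?Q = z - map_matrix cnj z"
    using H(1) unfolding wQ[symmetric]
    by (simp add: transpose_ring_simps matrix_mul_ring_simps map_matrix_cnj_simps wc)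
  then have "?i ** (conj_transpose ?Q ** of_real_mat (map_matrix Im ?w) ** ?Q) = ?i ** of_real_mat (map_matrix Im z)"
    unfolding siegel_diff_cnj matrix_mul_assoc mat_commute[of "2 * \<i>" "conj_transpose ?Q"] .
  then show *: "conj_transpose ?Q ** of_real_mat (map_matrix Im ?w) ** ?Q = of_real_mat (map_matrix Im z)"
    by (metis i2 matrix_mul_assoc matrix_mul_lid)
  have "Re (hform (of_real_mat (map_matrix Im ?w)) u) > 0" if "u \<noteq> 0" for u
  proof -
    let ?v = "matrix_inv ?Q *v u"
    have u: "?Q *v ?v = u" by (simp add: matrix_vector_mul_assoc matrix_inv_mult[OF inv])
    then have "?v \<noteq> 0" using that by auto
    then show ?thesis using hform_pos(1)[OF zD(2)] hform_congruence u unfolding *[symmetric] by metis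
  qed
  moreover have "transpose (map_matrix Im ?w) = map_matrix Im ?w"
    using sym by (simp add: transpose_def vec_eq_iff)
  ultimately show "?w \<in> siegel" using sym by (simp add: siegel_def pos_def_iff_hform)
qed

lemma det_Im_siegel_act:
  assumes "g \<in> Sp" "z \<in> siegel"
  shows "det (map_matrix Im (siegel_act g z)) * (norm (det (aut_factor g z)))\<^sup>2 = det (map_matrix Im z)"
    "det (aut_factor g z) \<noteq> 0"
proof -
  have "complex_of_real (det (map_matrix Im z)) =
     cnj (det (aut_factor g z)) * of_real (det (map_matrix Im (siegel_act g z))) * det (aut_factor g z)"
    using arg_cong[OF siegel_act_props(3)[OF assms], of det]
    by (simp add: det_mul det_cnj det_of_real)
  also have "\<dots> = of_real (det (map_matrix Im (siegel_act g z)) * (norm (det (aut_factor g z)))\<^sup>2)"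
    by (simp add: complex_norm_square mult_ac del: of_real_power)
  finally show "det (map_matrix Im (siegel_act g z)) * (norm (det (aut_factor g z)))\<^sup>2 = det (map_matrix Im z)"
    unfolding of_real_eq_iff by simp
  show "det (aut_factor g z) \<noteq> 0" using siegel_act_props(1)[OF assms] by (simp add: invertible_det_nz)
qed

text \<open>The criterion by which actions are computed below: checking a candidate after
  multiplication by the automorphy factor avoids calculations with
  \<open>matrix_inv\<close>.\<close>

lemma siegel_act_unique:
  assumes "g \<in> Sp" "z \<in> siegel" "w ** aut_factor g z = of_real_mat (blockA g) ** z + of_real_mat (blockB g)"
  shows "siegel_act g z = w"
  using siegel_act_props(1,4)[OF assms(1,2)] assms(3)
  by (metis matrix_inv_mult(1) matrix_mul_assoc matrix_mul_rid)

lemma block_mult_proj: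
  fixes g h :: "('a::comm_ring_1, 'n::finite) dmat"
  shows "blockA (g ** h) = blockA g ** blockA h + blockB g ** blockC h"
    "blockB (g ** h) = blockA g ** blockB h + blockB g ** blockD h"
    "blockC (g ** h) = blockC g ** blockA h + blockD g ** blockC h"
    "blockD (g ** h) = blockC g ** blockB h + blockD g ** blockD h"
proof -
  have "g ** h = block (blockA g) (blockB g) (blockC g) (blockD g) ** block (blockA h) (blockB h) (blockC h) (blockD h)"
    by (simp add: block_eta)
  then show "blockA (g ** h) = blockA g ** blockA h + blockB g ** blockC h"
    "blockB (g ** h) = blockA g ** blockB h + blockB g ** blockD h"
    "blockC (g ** h) = blockC g ** blockA h + blockD g ** blockC h"
    "blockD (g ** h) = blockC g ** blockB h + blockD g ** blockD h"
    by (simp_all add: block_ops)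
qed

lemma block_transpose_proj:
  "transpose g = block (transpose (blockA g)) (transpose (blockC g)) (transpose (blockB g)) (transpose (blockD g))"
  for g :: "('a::comm_ring_1, 'n::finite) dmat"
  using block_ops(2)[of "blockA g" "blockB g" "blockC g" "blockD g"] by (simp add: block_eta)

lemma siegel_act_mult:
  assumes g: "g \<in> Sp" and h: "h \<in> Sp" and z: "z \<in> siegel"
  shows "aut_factor (g ** h) z = aut_factor g (siegel_act h z) ** aut_factor h z"
    and "siegel_act (g ** h) z = siegel_act g (siegel_act h z)"
proof -
  note w = siegel_act_props[OF h z]
  show a: "aut_factor (g ** h) z = aut_factor g (siegel_act h z) ** aut_factor h z"
    unfolding aut_factor_def[of "g ** h"] aut_factor_def[of g]
    using w(4)[unfolded siegel_act_def]
    by (simp add: block_mult_proj map_matrix_of_real_simps matrix_mul_ring_simps w(4))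
       (simp add: aut_factor_def matrix_mul_ring_simps)
  show "siegel_act (g ** h) z = siegel_act g (siegel_act h z)"
  proof (rule siegel_act_unique[OF Sp_mult[OF g h] z])
    have "siegel_act g (siegel_act h z) ** aut_factor (g ** h) z =
      (of_real_mat (blockA g) ** siegel_act h z + of_real_mat (blockB g)) ** aut_factor h z"
      unfolding a using siegel_act_props(4)[OF g w(2)] by (metis matrix_mul_assoc)
    also have "\<dots> = of_real_mat (blockA (g ** h)) ** z + of_real_mat (blockB (g ** h))"
      by (simp add: block_mult_proj map_matrix_of_real_simps matrix_mul_ring_simps w(4))
         (simp add: aut_factor_def matrix_mul_ring_simps)
    finally show "siegel_act g (siegel_act h z) ** aut_factor (g ** h) z =
      of_real_mat (blockA (g ** h)) ** z + of_real_mat (blockB (g ** h))" .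
  qed
qed

section \<open>The base point and its stabilizer\<close>

lemma mat_i_in_siegel: "(mat \<i> :: (complex, 'n::finite) smat) \<in> siegel"
proof -
  have "map_matrix Im (mat \<i>) = (mat 1 :: (real, 'n) smat)" by (simp add: vec_eq_iff mat_def)
  moreover have "pos_def (mat 1 :: (real, 'n) smat)" by (simp add: pos_def_def)
  ultimately show ?thesis by (simp add: siegel_def)
qed

text \<open>A real unitary matrix is orthogonal, so its transpose is its inverse, and comparison
  with the block form of the symplectic inverse gives the shape (A, B; -B, A). The automorphy factor
  at i is then the complex conjugate of u = A + iB. Since det u has modulus one, the m-th power of
  its determinant is the inverse of \<open>chi m k\<close>.\<close>

lemma K_sp_block:
  assumes k: "k \<in> K_sp"
  shows "blockD k = blockA k" "blockC k = - blockB k"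
    "complex_mat (blockA k) (blockB k) ** conj_transpose (complex_mat (blockA k) (blockB k)) = mat 1"
    "chi m k * det (aut_factor k (mat \<i>)) ^ m = 1" "norm (chi m k) = 1" "siegel_act k (mat \<i>) = mat \<i>"
proof -
  have kS: "k \<in> Sp" using k by (simp add: K_sp_def)
  have "of_real_mat (k ** transpose k) = of_real_mat (mat 1)"
    using k unfolding K_sp_def unitary_mat_def by (simp add: map_matrix_of_real_simps map_matrix_cnj_simps)
  then have kk: "k ** transpose k = mat 1" by (simp add: vec_eq_iff)
  then have "transpose k = matrix_inv k" using matrix_inv_unique by metis
  then have "block (transpose (blockA k)) (transpose (blockC k)) (transpose (blockB k)) (transpose (blockD k)) =
      block (transpose (blockD k)) (- transpose (blockB k)) (- transpose (blockC k)) (transpose (blockA k))"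
    unfolding block_transpose_proj[symmetric] Sp_inverse(1)[OF kS, symmetric] .
  then have "transpose (blockA k) = transpose (blockD k)" and 2: "transpose (blockC k) = - transpose (blockB k)"
    unfolding block_eq_iff by blast+
  then show D: "blockD k = blockA k" by simp
  show C: "blockC k = - blockB k" using 2 by (metis transpose_iff transpose_ring_simps(3))
  let ?u = "complex_mat (blockA k) (blockB k)"
  have u: "?u = of_real_mat (blockA k) + mat \<i> ** of_real_mat (blockB k)"
    by (simp add: complex_mat_def vec_eq_iff complex_eq_iff mat_mult_nth)
  have uc: "map_matrix cnj ?u = of_real_mat (blockA k) - mat \<i> ** of_real_mat (blockB k)"
    by (simp add: complex_mat_def vec_eq_iff complex_eq_iff mat_mult_nth)
  have ii: "mat \<i> ** mat \<i> = - (mat 1 :: (complex, 'a) smat)"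
    by (simp add: vec_eq_iff mat_mult_nth) (simp add: mat_def)
  have ii': "mat \<i> ** (mat \<i> ** X) = - X" for X :: "(complex, 'a) smat"
    by (metis ii matrix_mul_assoc matrix_mul_ring_simps(6,10))
  have tmi: "transpose (mat \<i> ** X) = mat \<i> ** transpose X" for X :: "(complex, 'a) smat"
    by (simp add: transpose_ring_simps mat_commute)
  have rel: "blockA k ** transpose (blockA k) + blockB k ** transpose (blockB k) = mat 1"
     "blockB k ** transpose (blockA k) = blockA k ** transpose (blockB k)"
  proof -
    have "block (blockA k) (blockB k) (- blockB k) (blockA k) ** transpose (block (blockA k) (blockB k) (- blockB k) (blockA k)) = mat 1"
      using kk block_eta[of k, unfolded C D] by simp
    then have h: "blockA k ** transpose (blockA k) + blockB k ** transpose (blockB k) = mat 1"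
      "- (blockA k ** transpose (blockB k)) + blockB k ** transpose (blockA k) = 0"
      unfolding block_ops block_eq_iff matrix_mul_ring_simps transpose_ring_simps by blast+
    then show "blockA k ** transpose (blockA k) + blockB k ** transpose (blockB k) = mat 1" by blast
    show "blockB k ** transpose (blockA k) = blockA k ** transpose (blockB k)"
      using neg_eq_iff_add_eq_0[THEN iffD2, OF h(2)] by (simp only: minus_minus)
  qed
  note relc = rel[THEN arg_cong[where f = of_real_mat], unfolded map_matrix_of_real_simps]
  have mm: "X ** (mat \<i> ** Y) = mat \<i> ** (X ** Y)" for X Y :: "(complex, 'a) smat"
    by (metis mat_commute matrix_mul_assoc)
  have mm2: "mat \<i> ** (X ** (mat \<i> ** Y)) = - (X ** Y)" for X Y :: "(complex, 'a) smat"
    unfolding mm[of X Y] ii' ..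
  show uu: "?u ** conj_transpose ?u = mat 1"
  proof -
    let ?A = "of_real_mat (blockA k)" and ?B = "of_real_mat (blockB k)"
    have "?u ** conj_transpose ?u = (?A + mat \<i> ** ?B) ** (transpose ?A - mat \<i> ** transpose ?B)"
      unfolding uc unfolding u by (simp only: transpose_ring_simps(2) tmi)
    also have "\<dots> = (?A ** transpose ?A + ?B ** transpose ?B)
        + (mat \<i> ** (?B ** transpose ?A) - mat \<i> ** (?A ** transpose ?B))"
      unfolding matrix_mul_ring_simps(2,3,9) mm2 mm[of ?A] by simp
    also have "\<dots> = mat 1" unfolding relc by simp
    finally show ?thesis .
  qed
  have aut: "aut_factor k (mat \<i>) = map_matrix cnj ?u"
    unfolding uc aut_factor_def C D by (simp add: map_matrix_of_real_simps matrix_mul_ring_simps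
        mat_commute[of \<i> "of_real_mat (blockB k)"])
  have d: "det ?u * cnj (det ?u) = 1"
    using arg_cong[OF uu, of det] by (simp add: det_mul det_cnj)
  then show "chi m k * det (aut_factor k (mat \<i>)) ^ m = 1"
    unfolding aut chi_def by (simp add: det_cnj flip: power_mult_distrib)
  have "norm (det ?u) ^ 2 = 1" using d by (metis complex_norm_square of_real_eq_1_iff)
  then have "norm (det ?u) = 1" by (simp add: power2_eq_1_iff) (use norm_ge_zero[of "det ?u"] in linarith)
  then show "norm (chi m k) = 1" by (simp add: chi_def norm_power)
  show "siegel_act k (mat \<i>) = mat \<i>"
    by (rule siegel_act_unique[OF kS mat_i_in_siegel])
      (simp add: aut_factor_def C D map_matrix_of_real_simps matrix_mul_ring_simps ii'
        mat_commute[of \<i> "of_real_mat (blockA k)", symmetric] mat_commute[of \<i> "of_real_mat (blockB k)", symmetric])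
qed

text \<open>Comparing entries in i (C i + D) = A i + B forces C = -B and D = A, and for such blocks
  the symplectic inverse is the transpose.\<close>

lemma stabilizer_in_K_sp:
  assumes k: "k \<in> Sp" and fixed: "siegel_act k (mat \<i>) = mat \<i>"
  shows "k \<in> K_sp"
proof -
  have "mat \<i> ** (of_real_mat (blockC k) ** mat \<i> + of_real_mat (blockD k)) = of_real_mat (blockA k) ** mat \<i> + of_real_mat (blockB k)"
    using siegel_act_props(4)[OF k mat_i_in_siegel] fixed by (simp add: aut_factor_def)
  then have "Complex (- blockC k $ r $ s) (blockD k $ r $ s) = Complex (blockB k $ r $ s) (blockA k $ r $ s)" for r s
    by (simp add: vec_eq_iff complex_eq_iff mat_mult_nth)
  then have CD: "blockC k = - blockB k" "blockD k = blockA k"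
    by (simp_all add: vec_eq_iff) (metis add.inverse_inverse)
  have "matrix_inv k = transpose k"
    unfolding Sp_inverse(1)[OF k] block_transpose_proj using CD by (simp add: transpose_ring_simps)
  then have "k ** transpose k = mat 1" using Sp_inverse(2)[OF k] by simp
  then have "of_real_mat k ** conj_transpose (of_real_mat k) = mat 1"
    by (metis map_matrix_cnj_simps(5) map_matrix_of_real_simps(5,6,7))
  then show ?thesis using k by (simp add: K_sp_def unitary_mat_def)
qed

section \<open>Determinants of principal submatrices\<close>

text \<open>The principal minor on \<open>I\<close>, filled up with an identity block to full size:
  an induction over \<open>I\<close> shrinks the index set, but the index type stays the
  same.\<close>

definition subdet :: "'n::finite set \<Rightarrow> ('n \<Rightarrow> 'n \<Rightarrow> 'a::comm_ring_1) \<Rightarrow> 'a" where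
  "subdet I M = det (\<chi> r s. if r \<in> I \<and> s \<in> I then M r s else if r = s then 1 else 0)"

definition sub_sym :: "'n set \<Rightarrow> ('n \<Rightarrow> 'n \<Rightarrow> 'a) \<Rightarrow> bool" where
  "sub_sym I M \<longleftrightarrow> (\<forall>r\<in>I. \<forall>s\<in>I. M r s = M s r)"

definition sub_pos :: "'n set \<Rightarrow> ('n \<Rightarrow> 'n \<Rightarrow> real) \<Rightarrow> bool" where
  "sub_pos I M \<longleftrightarrow> (\<forall>v. (\<exists>r\<in>I. v r \<noteq> 0) \<longrightarrow> (\<Sum>r\<in>I. \<Sum>s\<in>I. v r * M r s * v s) > 0)"

definition schur :: "'n \<Rightarrow> ('n \<Rightarrow> 'n \<Rightarrow> 'a::field) \<Rightarrow> 'n \<Rightarrow> 'n \<Rightarrow> 'a" where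
  "schur k M r s = M r s - M r k * M k s / M k k"

lemma subdet_cong: "(\<And>r s. r \<in> I \<Longrightarrow> s \<in> I \<Longrightarrow> M r s = N r s) \<Longrightarrow> subdet I M = subdet I N"
  unfolding subdet_def by (rule arg_cong[where f = det]) (auto simp: vec_eq_iff)

lemma sub_pos_cong: "(\<And>r s. r \<in> I \<Longrightarrow> s \<in> I \<Longrightarrow> M r s = N r s) \<Longrightarrow> sub_pos I M = sub_pos I N"
  unfolding sub_pos_def by simp

lemma subdet_UNIV: "subdet UNIV M = det (\<chi> r s. M r s)"
  by (simp add: subdet_def)

lemma subdet_empty [simp]: "subdet {} M = (1 :: 'a::comm_ring_1)"
proof -
  have "(\<chi> r s. if r = s then 1 else 0) = (mat 1 :: ('a, 'b::finite) smat)" by (simp add: mat_def)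
  then show ?thesis by (simp add: subdet_def)
qed

text \<open>In the Leibniz sum a permutation other than \<open>id\<close> meets a zero entry: if a
  moved index is sent to k, then k itself is moved, and row k vanishes off the diagonal; otherwise
  the entry of the moved index is already zero.\<close>

lemma det_column_unipotent:
  fixes c :: "'n::finite \<Rightarrow> 'a::comm_ring_1"
  shows "det (\<chi> r s. if s = k \<and> r \<noteq> k then c r else if r = s then 1 else 0) = 1" (is "det ?E = 1")
proof -
  have z: "of_int (sign p) * (\<Prod>i\<in>UNIV. ?E $ i $ p i) = 0" if p: "p permutes UNIV" "p \<noteq> id" for p
  proof -
    obtain i where i: "p i \<noteq> i" using p(2) by (auto simp: fun_eq_iff)
    have "\<exists>j. ?E $ j $ p j = 0"
    proof (cases "p i = k")
      case True
      then have "i \<noteq> k" using i by auto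
      then have "p k \<noteq> k" using True p(1) by (metis permutes_inj injD)
      then show ?thesis by (intro exI[of _ k]) auto
    qed (use i in \<open>auto intro!: exI[of _ i]\<close>)
    then show ?thesis by (metis (no_types, lifting) UNIV_I finite mult_zero_right prod_zero)
  qed
  have "det ?E = (\<Sum>p\<in>{id}. of_int (sign p) * (\<Prod>i\<in>UNIV. ?E $ i $ p i))"
    unfolding det_def by (rule sum.mono_neutral_right) (use z permutes_id in auto)
  also have "\<dots> = 1" by (simp add: sign_id)
  finally show ?thesis .
qed

text \<open>A unipotent factor on the left clears column k and one on the right clears row k. What
  remains is the block sum of \<open>M k k\<close> and the Schur complement.\<close>

lemma subdet_insert:
  fixes M :: "'n::finite \<Rightarrow> 'n \<Rightarrow> 'a::field"
  assumes k: "k \<notin> I" and nz: "M k k \<noteq> 0"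
  shows "subdet (insert k I) M = M k k * subdet I (schur k M)"
proof -
  define e where "e = (\<lambda>r. if r \<in> I then - M r k / M k k else 0)"
  define f where "f = (\<lambda>s. if s \<in> I then - M k s / M k k else 0)"
  define N where "N = (\<lambda>r s. if r \<in> insert k I \<and> s \<in> insert k I then M r s else if r = s then 1 else 0)"
  define N' where "N' = (\<lambda>r s. N r s + (if r \<noteq> k then e r * N k s else 0))"
  let ?E = "\<chi> r s. if s = k \<and> r \<noteq> k then e r else if r = s then 1 else 0"
  let ?F = "\<chi> r s. if s = k \<and> r \<noteq> k then f r else if r = s then 1 else 0"
  have E: "?E ** (\<chi> r s. N r s) = (\<chi> r s. N' r s)"
  proof -
    have "(\<Sum>j\<in>UNIV. ?E $ r $ j * N j s) = N' r s" for r s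
    proof -
      have "(\<Sum>j\<in>UNIV. ?E $ r $ j * N j s)
        = (\<Sum>j\<in>UNIV. (if r = j then N j s else 0) + (if j = k then if r \<noteq> k then e r * N k s else 0 else 0))"
        by (rule sum.cong) auto
      then show ?thesis by (simp add: sum.distrib N'_def)
    qed
    then show ?thesis by (simp add: vec_eq_iff matrix_matrix_mult_def)
  qed
  have F: "(\<chi> r s. N' r s) ** transpose ?F = (\<chi> r s. N' r s + (if s \<noteq> k then N' r k * f s else 0))"
  proof -
    have "(\<Sum>j\<in>UNIV. N' r j * ?F $ s $ j) = N' r s + (if s \<noteq> k then N' r k * f s else 0)" for r s
    proof -
      have "(\<Sum>j\<in>UNIV. N' r j * ?F $ s $ j)
        = (\<Sum>j\<in>UNIV. (if s = j then N' r j else 0) + (if j = k then if s \<noteq> k then N' r k * f s else 0 else 0))"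
        by (rule sum.cong) auto
      then show ?thesis by (simp add: sum.distrib)
    qed
    then show ?thesis by (simp add: vec_eq_iff matrix_matrix_mult_def transpose_def)
  qed
  let ?S = "\<lambda>r. \<chi> s. if r \<in> I \<and> s \<in> I then schur k M r s else if r = s then 1 else 0"
  have "N' r s + (if s \<noteq> k then N' r k * f s else 0) = (if r = k then (M k k *s ?S r) $ s else ?S r $ s)" for r s
    using k nz by (auto simp: N'_def N_def e_def f_def schur_def field_simps)
  then have S: "(\<chi> r s. N' r s + (if s \<noteq> k then N' r k * f s else 0)) = (\<chi> r. if r = k then M k k *s ?S r else ?S r)"
    by (simp add: vec_eq_iff)
  have "det (\<chi> r s. N r s) = det (?E ** (\<chi> r s. N r s) ** transpose ?F)"
    by (simp only: det_mul det_transpose det_column_unipotent mult_1_left mult_1_right)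
  also have "\<dots> = M k k * det (\<chi> r. if r = k then ?S r else ?S r)"
    unfolding E F S by (rule det_row_mul)
  finally show ?thesis unfolding subdet_def N_def by simp
qed

lemma sub_sym_schur: "sub_sym (insert k I) M \<Longrightarrow> sub_sym I (schur k M)"
  unfolding sub_sym_def schur_def by (metis insertCI mult.commute)

text \<open>Completing the square in the coordinate k: with L v the pairing of row k with the
  remaining coordinates, the quadratic form is M_kk (v_k + L v / M_kk)^2 plus the form of the Schur
  complement (\<open>QS\<close>).\<close>

lemma sub_pos_insert:
  assumes fin: "finite I" and k: "k \<notin> I" and sym: "sub_sym (insert k I) M"
  shows "sub_pos (insert k I) M \<longleftrightarrow> M k k > 0 \<and> sub_pos I (schur k M)"
proof -
  define L where "L = (\<lambda>v. \<Sum>r\<in>I. M r k * v r)"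
  define Q where "Q = (\<lambda>v. \<Sum>r\<in>insert k I. \<Sum>s\<in>insert k I. v r * M r s * v s)"
  have MkL: "(\<Sum>r\<in>I. v r * M r k) = L v" "(\<Sum>s\<in>I. M k s * v s) = L v" for v
  proof -
    have "M k r = M r k" if "r \<in> I" for r using sym that unfolding sub_sym_def by blast
    then show "(\<Sum>r\<in>I. v r * M r k) = L v" "(\<Sum>s\<in>I. M k s * v s) = L v"
      unfolding L_def by (simp_all add: mult.commute)
  qed
  have Q: "Q v = M k k * (v k)\<^sup>2 + 2 * v k * L v + (\<Sum>r\<in>I. \<Sum>s\<in>I. v r * M r s * v s)" for v
  proof -
    have "Q v = v k * M k k * v k + v k * (\<Sum>s\<in>I. M k s * v s) + (\<Sum>r\<in>I. v r * M r k) * v k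
       + (\<Sum>r\<in>I. \<Sum>s\<in>I. v r * M r s * v s)"
      unfolding Q_def using fin k by (simp add: sum.distrib sum_distrib_left sum_distrib_right mult_ac)
    then show ?thesis unfolding MkL by (simp add: power2_eq_square)
  qed
  have S: "(\<Sum>r\<in>I. \<Sum>s\<in>I. v r * schur k M r s * v s) = (\<Sum>r\<in>I. \<Sum>s\<in>I. v r * M r s * v s) - (L v)\<^sup>2 / M k k" for v
  proof -
    have "(L v)\<^sup>2 / M k k = (\<Sum>r\<in>I. v r * M r k) * (\<Sum>s\<in>I. M k s * v s) / M k k"
      unfolding MkL by (simp add: power2_eq_square)
    also have "\<dots> = (\<Sum>r\<in>I. \<Sum>s\<in>I. v r * (M r k * M k s / M k k) * v s)"
      by (simp add: sum_product sum_divide_distrib mult_ac)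
    finally show ?thesis by (simp add: schur_def algebra_simps sum_subtractf)
  qed
  have QS: "Q v = M k k * (v k + L v / M k k)\<^sup>2 + (\<Sum>r\<in>I. \<Sum>s\<in>I. v r * schur k M r s * v s)" if "M k k \<noteq> 0" for v
    unfolding Q S using that by (simp add: field_simps power2_eq_square)
  have Lc: "L (v(k := x)) = L v" "(\<Sum>r\<in>I. \<Sum>s\<in>I. (v(k := x)) r * N r s * (v(k := x)) s) = (\<Sum>r\<in>I. \<Sum>s\<in>I. v r * N r s * v s)" for v x N
    using k by (auto simp: L_def intro!: sum.cong)
  show ?thesis
  proof
    assume P: "sub_pos (insert k I) M"
    have "Q ((\<lambda>_. 0)(k := 1)) > 0" using P unfolding sub_pos_def Q_def by (auto dest!: spec[of _ "(\<lambda>_. 0)(k := 1)"] split: if_splits)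
    then have pos: "M k k > 0" unfolding Q Lc by (simp add: L_def)
    have "(\<Sum>r\<in>I. \<Sum>s\<in>I. v r * schur k M r s * v s) > 0" if "\<exists>r\<in>I. v r \<noteq> 0" for v
    proof -
      \<comment> \<open>This value of the coordinate k annihilates the square, so that positivity of
        the whole form becomes positivity of the Schur complement.\<close>
      let ?v = "v(k := - L v / M k k)"
      have "\<exists>r\<in>insert k I. ?v r \<noteq> 0" using that k by (metis fun_upd_other insertCI)
      then have "Q ?v > 0" using P unfolding sub_pos_def Q_def by blast
      then show ?thesis using pos by (subst (asm) QS) (simp_all only: Lc, auto)
    qed
    then show "M k k > 0 \<and> sub_pos I (schur k M)" using pos unfolding sub_pos_def by blast
  next
    assume A: "M k k > 0 \<and> sub_pos I (schur k M)"
    have "Q v > 0" if v: "\<exists>r\<in>insert k I. v r \<noteq> 0" for v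
    proof (cases "\<exists>r\<in>I. v r \<noteq> 0")
      case True
      then have "(\<Sum>r\<in>I. \<Sum>s\<in>I. v r * schur k M r s * v s) > 0" using A by (auto simp: sub_pos_def)
      moreover have "M k k * (v k + L v / M k k)\<^sup>2 \<ge> 0" using A by simp
      ultimately show ?thesis using QS[of v] A by linarith
    next
      case False
      then have "v k \<noteq> 0" using v by blast
      moreover have "Q v = M k k * (v k)\<^sup>2" using False unfolding Q by (simp add: L_def)
      ultimately show ?thesis using A by simp
    qed
    then show "sub_pos (insert k I) M" unfolding sub_pos_def Q_def by blast
  qed
qed

lemma subdet_pos:
  fixes I :: "'n::finite set"
  assumes "sub_sym I M" "sub_pos I M"
  shows "subdet I M > 0"
  using finite[of I] assms
proof (induction I arbitrary: M rule: finite_induct)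
  case (insert k I)
  then have p: "M k k > 0" "sub_pos I (schur k M)" using sub_pos_insert[OF insert.hyps insert.prems(1)] insert.prems(2) by blast+
  have "subdet I (schur k M) > 0" by (rule insert.IH[OF sub_sym_schur[OF insert.prems(1)] p(2)])
  then show ?case using p insert.hyps by (subst subdet_insert) auto
qed simp

lemma sub_pos_add_rank1:
  assumes P: "sub_pos I P" and c: "c \<ge> 0"
  shows "sub_pos I (\<lambda>r s. P r s + c * u r * u s)"
  unfolding sub_pos_def
proof (intro allI impI)
  fix v :: "'a \<Rightarrow> real" assume v: "\<exists>r\<in>I. v r \<noteq> 0"
  have "(\<Sum>r\<in>I. \<Sum>s\<in>I. v r * (P r s + c * u r * u s) * v s)
      = (\<Sum>r\<in>I. \<Sum>s\<in>I. v r * P r s * v s) + c * (\<Sum>r\<in>I. u r * v r)\<^sup>2"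
    by (simp add: power2_eq_square sum_product sum_distrib_left sum.distrib algebra_simps)
  moreover have "c * (\<Sum>r\<in>I. u r * v r)\<^sup>2 \<ge> 0" using c by simp
  ultimately show "(\<Sum>r\<in>I. \<Sum>s\<in>I. v r * (P r s + c * u r * u s) * v s) > 0"
    using P[unfolded sub_pos_def, rule_format, OF v] by linarith
qed

lemma sub_pos_add_one:
  assumes P: "sub_pos I P" and fin: "finite I"
  shows "sub_pos I (\<lambda>r s. P r s + (if r = s then 1 else 0))"
  unfolding sub_pos_def
proof (intro allI impI)
  fix v :: "'a \<Rightarrow> real" assume v: "\<exists>r\<in>I. v r \<noteq> 0"
  have "(\<Sum>s\<in>I. v r * (P r s + (if r = s then 1 else 0)) * v s) = (\<Sum>s\<in>I. v r * P r s * v s) + v r * v r" if "r \<in> I" for r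
  proof -
    have "v r * (P r s + (if r = s then 1 else 0)) * v s = v r * P r s * v s + (if r = s then v r * v s else 0)" for s
      by (simp add: algebra_simps)
    then show ?thesis using that fin by (simp add: sum.distrib)
  qed
  then have "(\<Sum>r\<in>I. \<Sum>s\<in>I. v r * (P r s + (if r = s then 1 else 0)) * v s)
      = (\<Sum>r\<in>I. \<Sum>s\<in>I. v r * P r s * v s) + (\<Sum>r\<in>I. v r * v r)"
    by (simp add: sum.distrib)
  moreover have "(\<Sum>r\<in>I. v r * v r) \<ge> 0" by (simp add: sum_nonneg)
  ultimately show "(\<Sum>r\<in>I. \<Sum>s\<in>I. v r * (P r s + (if r = s then 1 else 0)) * v s) > 0"
    using P[unfolded sub_pos_def, rule_format, OF v] by linarith
qed

lemma sub_pos_empty [simp]: "sub_pos {} M" by (simp add: sub_pos_def)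

lemma measurable_subdet:
  fixes M :: "'x \<Rightarrow> 'n::finite \<Rightarrow> 'n \<Rightarrow> 'a::{second_countable_topology, real_normed_field}"
  assumes "\<And>r s. r \<in> I \<Longrightarrow> s \<in> I \<Longrightarrow> (\<lambda>x. M x r s) \<in> borel_measurable N"
  shows "(\<lambda>x. subdet I (M x)) \<in> borel_measurable N"
proof -
  have "(\<lambda>x. if r \<in> I \<and> s \<in> I then M x r s else if r = s then 1 else 0) \<in> borel_measurable N" for r s
    using assms by (cases "r \<in> I \<and> s \<in> I") auto
  then show ?thesis
    unfolding subdet_def det_def
    by (auto intro!: borel_measurable_sum borel_measurable_times borel_measurable_prod)
qed

text \<open>Positivity quantifies over uncountably many vectors. The Schur criterion replaces it by
  finitely many inequalities between measurable functions, at the price of assuming symmetry at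
  every point x.\<close>

lemma measurable_sub_pos:
  fixes M :: "'x \<Rightarrow> 'n::finite \<Rightarrow> 'n \<Rightarrow> real"
  assumes "\<And>r s. r \<in> I \<Longrightarrow> s \<in> I \<Longrightarrow> (\<lambda>x. M x r s) \<in> borel_measurable N" "\<And>x. sub_sym I (M x)"
  shows "Measurable.pred N (\<lambda>x. sub_pos I (M x))"
  using finite[of I] assms
proof (induction I arbitrary: M rule: finite_induct)
  case (insert k I)
  have M: "(\<lambda>x. M x r s) \<in> borel_measurable N" if "r \<in> insert k I" "s \<in> insert k I" for r s
    using insert.prems(1) that by blast
  have "(\<lambda>x. M x k k) \<in> borel_measurable N" by (rule M) auto
  then have 1: "Measurable.pred N (\<lambda>x. M x k k > 0)" by simp
  have 2: "Measurable.pred N (\<lambda>x. sub_pos I (schur k (M x)))"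
  proof (rule insert.IH)
    show "(\<lambda>x. schur k (M x) r s) \<in> borel_measurable N" if "r \<in> I" "s \<in> I" for r s
      unfolding schur_def using that
      by (intro borel_measurable_diff borel_measurable_divide borel_measurable_times M) auto
    show "sub_sym I (schur k (M x))" for x
      using insert.prems(2) by (rule sub_sym_schur)
  qed
  show ?case
    unfolding sub_pos_insert[OF insert.hyps insert.prems(2)] using 1 2 by simp
qed simp

section \<open>One-dimensional integrals\<close>

lemma nn_integral_Gamma_scaled:
  assumes "s > 0" "c > 0"
  shows "(\<integral>\<^sup>+t. ennreal (indicator {0..} t * t powr (s - 1) * exp (- c * t)) \<partial>lborel) = ennreal (Gamma s * c powr (- s))"
proof -
  have "ennreal (Gamma s) = (\<integral>\<^sup>+t. ennreal (indicator {0..} t * t powr (s - 1) / exp t) \<partial>lborel)"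
    by (rule Gamma_conv_nn_integral_real[OF assms(1)])
  also have "\<dots> = ennreal \<bar>c\<bar> * (\<integral>\<^sup>+t. ennreal (indicator {0..} (0 + c * t) * (0 + c * t) powr (s - 1) / exp (0 + c * t)) \<partial>lborel)"
    by (rule nn_integral_real_affine) (use assms in auto)
  also have "\<dots> = (\<integral>\<^sup>+t. ennreal (c powr s) * ennreal (indicator {0..} t * t powr (s - 1) * exp (- c * t)) \<partial>lborel)"
  proof (subst nn_integral_cmult[symmetric], measurable, rule nn_integral_cong)
    fix t :: real
    show "ennreal \<bar>c\<bar> * ennreal (indicator {0..} (0 + c * t) * (0 + c * t) powr (s - 1) / exp (0 + c * t))
      = ennreal (c powr s) * ennreal (indicator {0..} t * t powr (s - 1) * exp (- c * t))"
    proof (cases "t \<ge> 0")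
      case True
      then have "\<bar>c\<bar> * (indicator {0..} (0 + c * t) * (0 + c * t) powr (s - 1) / exp (0 + c * t))
         = c powr s * (indicator {0..} t * t powr (s - 1) * exp (- c * t))"
        using assms by (simp add: powr_mult powr_diff exp_minus field_simps)
      then show ?thesis using True by (simp flip: ennreal_mult')
    next
      case False
      then have "\<not> 0 \<le> c * t" using assms by (simp add: zero_le_mult_iff)
      then show ?thesis using False by simp
    qed
  qed
  also have "\<dots> = ennreal (c powr s) * (\<integral>\<^sup>+t. ennreal (indicator {0..} t * t powr (s - 1) * exp (- c * t)) \<partial>lborel)"
    by (rule nn_integral_cmult) measurable
  finally have *: "ennreal (Gamma s) = ennreal (c powr s) * (\<integral>\<^sup>+t. ennreal (indicator {0..} t * t powr (s - 1) * exp (- c * t)) \<partial>lborel)" .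
  have "ennreal (c powr - s) * ennreal (Gamma s) = (ennreal (c powr - s) * ennreal (c powr s)) * (\<integral>\<^sup>+t. ennreal (indicator {0..} t * t powr (s - 1) * exp (- c * t)) \<partial>lborel)"
    unfolding * by (simp add: mult.assoc)
  also have "ennreal (c powr - s) * ennreal (c powr s) = 1"
    using assms by (simp add: powr_minus flip: ennreal_mult')
  finally show ?thesis using Gamma_real_pos[OF assms(1)] by (simp add: ennreal_mult'' mult.commute)
qed

text \<open>This is the normalization of the normal density with variance 1 / (2c).\<close>

lemma nn_integral_gauss:
  assumes "c > 0"
  shows "(\<integral>\<^sup>+u. ennreal (exp (- c * u\<^sup>2)) \<partial>lborel) = ennreal (sqrt pi * c powr (- 1 / 2))"
proof -
  define \<sigma> where "\<sigma> = sqrt (1 / (2 * c))"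
  have s: "\<sigma> > 0" "\<sigma>\<^sup>2 = 1 / (2 * c)" using assms by (simp_all add: \<sigma>_def)
  have "(\<integral>\<^sup>+u. ennreal (normal_density 0 \<sigma> u) \<partial>lborel) = 1"
    using prob_space.emeasure_space_1[OF prob_space_normal_density[OF s(1), of 0]]
    by (simp add: emeasure_density)
  moreover have "normal_density 0 \<sigma> u = sqrt (c / pi) * exp (- c * u\<^sup>2)" for u
    unfolding normal_density_def s(2) using assms by (simp add: real_sqrt_divide field_simps)
  ultimately have 1: "ennreal (sqrt (c / pi)) * (\<integral>\<^sup>+u. ennreal (exp (- c * u\<^sup>2)) \<partial>lborel) = 1"
    by (subst nn_integral_cmult[symmetric]) (use assms in \<open>auto simp flip: ennreal_mult'\<close>)
  have "sqrt pi * c powr (- 1 / 2) = sqrt (pi / c)"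
    using assms by (simp add: powr_minus powr_half_sqrt real_sqrt_divide field_simps)
  moreover have "ennreal (sqrt (pi / c)) * ennreal (sqrt (c / pi)) = 1"
    using assms by (simp add: real_sqrt_divide flip: ennreal_mult')
  ultimately show ?thesis using 1
    by (metis mult.assoc mult.commute mult_1)
qed

text \<open>The power is written as a Gamma integral over t; after exchanging the integrals, the one
  over u is Gaussian and contributes t^(-1/2). The remaining Gamma integral has parameter s - 1/2,
  whence the condition on s.\<close>

lemma nn_integral_powr_quadratic:
  assumes s: "s > 1/2" and c: "c > 0" and P: "P > 0"
  shows "(\<integral>\<^sup>+u. ennreal ((P + c * u\<^sup>2) powr (- s)) \<partial>lborel)
    = ennreal (sqrt pi * Gamma (s - 1/2) / Gamma s * c powr (- 1/2) * P powr (1/2 - s))"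
proof -
  have pos: "P + c * u\<^sup>2 > 0" for u using c P by (simp add: add_pos_nonneg)
  have G: "Gamma s > 0" using s by (simp add: Gamma_real_pos)
  have "ennreal (Gamma s) * (\<integral>\<^sup>+u. ennreal ((P + c * u\<^sup>2) powr (- s)) \<partial>lborel)
    = (\<integral>\<^sup>+u. (\<integral>\<^sup>+t. ennreal (indicator {0..} t * t powr (s - 1) * exp (- (P + c * u\<^sup>2) * t)) \<partial>lborel) \<partial>lborel)"
  proof -
    have "(\<integral>\<^sup>+t. ennreal (indicator {0..} t * t powr (s - 1) * exp (- (P + c * u\<^sup>2) * t)) \<partial>lborel)
      = ennreal (Gamma s) * ennreal ((P + c * u\<^sup>2) powr (- s))" for u
      using nn_integral_Gamma_scaled[OF _ pos, of s u] s G by (simp add: ennreal_mult'')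
    then show ?thesis by (subst nn_integral_cmult[symmetric]) simp_all
  qed
  also have "\<dots> = (\<integral>\<^sup>+t. (\<integral>\<^sup>+u. ennreal (indicator {0..} t * t powr (s - 1) * exp (- (P + c * u\<^sup>2) * t)) \<partial>lborel) \<partial>lborel)"
    by (rule lborel_pair.Fubini') measurable
  also have "\<dots> = (\<integral>\<^sup>+t. ennreal (sqrt pi * c powr (- 1/2)) * ennreal (indicator {0..} t * t powr (s - 1/2 - 1) * exp (- P * t)) \<partial>lborel)"
  \<comment> \<open>At t = 0 the Gaussian integral over u would have coefficient c t = 0; this point
    is removed as a null set.\<close>
  proof (rule nn_integral_cong_AE, rule AE_mp[OF AE_lborel_singleton[of 0]], rule AE_I2, rule impI)
    fix t :: real assume t0: "t \<noteq> 0"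
    show "(\<integral>\<^sup>+u. ennreal (indicator {0..} t * t powr (s - 1) * exp (- (P + c * u\<^sup>2) * t)) \<partial>lborel)
      = ennreal (sqrt pi * c powr (- 1/2)) * ennreal (indicator {0..} t * t powr (s - 1/2 - 1) * exp (- P * t))"
    proof (cases "t > 0")
      case True
      have "(\<integral>\<^sup>+u. ennreal (indicator {0..} t * t powr (s - 1) * exp (- (P + c * u\<^sup>2) * t)) \<partial>lborel)
        = (\<integral>\<^sup>+u. ennreal (t powr (s - 1) * exp (- P * t)) * ennreal (exp (- (c * t) * u\<^sup>2)) \<partial>lborel)"
        using True by (intro nn_integral_cong) (auto simp: algebra_simps exp_diff exp_minus exp_add field_simps simp flip: ennreal_mult')
      also have "\<dots> = ennreal (t powr (s - 1) * exp (- P * t)) * ennreal (sqrt pi * (c * t) powr (- 1/2))"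
        unfolding nn_integral_gauss[OF mult_pos_pos[OF c True], symmetric] by (rule nn_integral_cmult; measurable)
      also have "\<dots> = ennreal (sqrt pi * c powr (- 1/2)) * ennreal (t powr (s - 1/2 - 1) * exp (- P * t))"
      proof -
        have "t powr (s - 1) * t powr (- 1/2) = t powr (s - 1/2 - 1)" by (simp flip: powr_add)
        then have "t powr (s - 1) * exp (- P * t) * (sqrt pi * (c * t) powr (- 1/2))
          = sqrt pi * c powr (- 1/2) * (t powr (s - 1/2 - 1) * exp (- P * t))"
          using True c by (simp add: powr_mult mult_ac)
        then show ?thesis by (simp flip: ennreal_mult')
      qed
      finally show ?thesis using True by simp
    qed (use t0 in simp)
  qed
  also have "\<dots> = ennreal (sqrt pi * c powr (- 1/2)) * ennreal (Gamma (s - 1/2) * P powr (- (s - 1/2)))"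
    using nn_integral_Gamma_scaled[of "s - 1/2" P] s P by (subst nn_integral_cmult) auto
  finally have *: "ennreal (Gamma s) * (\<integral>\<^sup>+u. ennreal ((P + c * u\<^sup>2) powr (- s)) \<partial>lborel)
    = ennreal (sqrt pi * c powr (- 1/2) * (Gamma (s - 1/2) * P powr (1/2 - s)))"
    by (simp flip: ennreal_mult')
  have "(\<integral>\<^sup>+u. ennreal ((P + c * u\<^sup>2) powr (- s)) \<partial>lborel)
     = ennreal (1 / Gamma s) * (ennreal (Gamma s) * (\<integral>\<^sup>+u. ennreal ((P + c * u\<^sup>2) powr (- s)) \<partial>lborel))"
  proof -
    have "ennreal (1 / Gamma s) * ennreal (Gamma s) = 1" using G by (simp flip: ennreal_mult')
    then show ?thesis by (simp flip: mult.assoc)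
  qed
  also have "\<dots> = ennreal (sqrt pi * Gamma (s - 1/2) / Gamma s * c powr (- 1/2) * P powr (1/2 - s))"
    unfolding * using G by (simp flip: ennreal_mult')  (simp add: mult_ac)
  finally show ?thesis .
qed

text \<open>The beta integral on the half line. As in \<open>nn_integral_powr_quadratic\<close>, the
  power of t + 1 is expanded into a Gamma integral and the order of integration is
  exchanged.\<close>

lemma nn_integral_beta_prime:
  assumes a: "a > 0" and b: "b > 0"
  shows "(\<integral>\<^sup>+t. ennreal (indicator {0..} t * t powr (a - 1) * (t + 1) powr (- (a + b))) \<partial>lborel)
    = ennreal (Gamma a * Gamma b / Gamma (a + b))"
proof -
  have G: "Gamma (a + b) > 0" using a b by (simp add: Gamma_real_pos)
  let ?w = "\<lambda>t. indicator {0..} t * t powr (a - 1) :: real"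
  have "ennreal (Gamma (a + b)) * (\<integral>\<^sup>+t. ennreal (?w t * (t + 1) powr (- (a + b))) \<partial>lborel)
    = (\<integral>\<^sup>+t. (\<integral>\<^sup>+x. ennreal (?w t) * ennreal (indicator {0..} x * x powr (a + b - 1) * exp (- (t + 1) * x)) \<partial>lborel) \<partial>lborel)"
  proof (subst nn_integral_cmult[symmetric], measurable, rule nn_integral_cong)
    fix t :: real
    show "ennreal (Gamma (a + b)) * ennreal (?w t * (t + 1) powr (- (a + b)))
      = (\<integral>\<^sup>+x. ennreal (?w t) * ennreal (indicator {0..} x * x powr (a + b - 1) * exp (- (t + 1) * x)) \<partial>lborel)"
    proof (cases "t \<ge> 0")
      case True
      have "(\<integral>\<^sup>+x. ennreal (indicator {0..} x * x powr (a + b - 1) * exp (- (t + 1) * x)) \<partial>lborel)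
        = ennreal (Gamma (a + b)) * ennreal ((t + 1) powr (- (a + b)))"
        using nn_integral_Gamma_scaled[of "a + b" "t + 1"] a b G True by (simp add: ennreal_mult'')
      then have "(\<integral>\<^sup>+x. ennreal (?w t) * ennreal (indicator {0..} x * x powr (a + b - 1) * exp (- (t + 1) * x)) \<partial>lborel)
        = ennreal (?w t) * (ennreal (Gamma (a + b)) * ennreal ((t + 1) powr (- (a + b))))"
        by (subst nn_integral_cmult) simp_all
      then show ?thesis by (simp add: ennreal_mult' mult_ac)
    qed simp
  qed
  also have "\<dots> = (\<integral>\<^sup>+x. (\<integral>\<^sup>+t. ennreal (?w t) * ennreal (indicator {0..} x * x powr (a + b - 1) * exp (- (t + 1) * x)) \<partial>lborel) \<partial>lborel)"
    by (rule lborel_pair.Fubini') measurable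
  also have "\<dots> = (\<integral>\<^sup>+x. ennreal (Gamma a) * ennreal (indicator {0..} x * x powr (b - 1) * exp (- 1 * x)) \<partial>lborel)"
  proof (rule nn_integral_cong_AE, rule AE_mp[OF AE_lborel_singleton[of 0]], rule AE_I2, rule impI)
    fix x :: real assume x0: "x \<noteq> 0"
    show "(\<integral>\<^sup>+t. ennreal (?w t) * ennreal (indicator {0..} x * x powr (a + b - 1) * exp (- (t + 1) * x)) \<partial>lborel)
      = ennreal (Gamma a) * ennreal (indicator {0..} x * x powr (b - 1) * exp (- 1 * x))"
    proof (cases "x > 0")
      case True
      have "(\<integral>\<^sup>+t. ennreal (?w t) * ennreal (indicator {0..} x * x powr (a + b - 1) * exp (- (t + 1) * x)) \<partial>lborel)
        = (\<integral>\<^sup>+t. ennreal (x powr (a + b - 1) * exp (- x)) * ennreal (?w t * exp (- x * t)) \<partial>lborel)"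
        using True by (intro nn_integral_cong) (auto simp: algebra_simps exp_diff exp_minus exp_add field_simps simp flip: ennreal_mult')
      also have "\<dots> = ennreal (x powr (a + b - 1) * exp (- x)) * ennreal (Gamma a * x powr (- a))"
        unfolding nn_integral_Gamma_scaled[OF a True, symmetric] by (rule nn_integral_cmult; measurable)
      also have "\<dots> = ennreal (Gamma a) * ennreal (x powr (b - 1) * exp (- x))"
      proof -
        have "x powr (a + b - 1) * x powr (- a) = x powr (b - 1)" by (simp flip: powr_add)
        then have "x powr (a + b - 1) * exp (- x) * (Gamma a * x powr (- a)) = Gamma a * (x powr (b - 1) * exp (- x))"
          by simp
        then have "ennreal (x powr (a + b - 1) * exp (- x) * (Gamma a * x powr (- a))) = ennreal (Gamma a * (x powr (b - 1) * exp (- x)))"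
          by (rule arg_cong)
        then show ?thesis by (simp only: ennreal_mult'' powr_ge_zero mult_nonneg_nonneg exp_ge_zero ennreal_mult'
             Gamma_real_pos[OF a, THEN less_imp_le])
      qed
      finally show ?thesis using True by simp
    qed (use x0 in simp)
  qed
  also have "\<dots> = ennreal (Gamma a) * ennreal (Gamma b)"
    using nn_integral_Gamma_scaled[of b 1] b by (subst nn_integral_cmult) auto
  finally have *: "ennreal (Gamma (a + b)) * (\<integral>\<^sup>+t. ennreal (?w t * (t + 1) powr (- (a + b))) \<partial>lborel)
    = ennreal (Gamma a * Gamma b)" using a b Gamma_real_pos[of a] by (simp flip: ennreal_mult')
  have "ennreal (1 / Gamma (a + b)) * ennreal (Gamma (a + b)) = 1" using G by (simp flip: ennreal_mult')
  then have "(\<integral>\<^sup>+t. ennreal (?w t * (t + 1) powr (- (a + b))) \<partial>lborel)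
     = ennreal (1 / Gamma (a + b)) * (ennreal (Gamma (a + b)) * (\<integral>\<^sup>+t. ennreal (?w t * (t + 1) powr (- (a + b))) \<partial>lborel))"
    by (simp flip: mult.assoc)
  also have "\<dots> = ennreal (Gamma a * Gamma b / Gamma (a + b))"
    unfolding * using G by (simp flip: ennreal_mult')
  finally show ?thesis .
qed

section \<open>Integration over products of lines\<close>

abbreviation lborel_prod_on :: "'i set \<Rightarrow> ('i \<Rightarrow> 'b::euclidean_space) measure" where
  "lborel_prod_on J \<equiv> PiM J (\<lambda>_. lborel)"

lemma product_sigma_finite_lborel: "product_sigma_finite (\<lambda>_. lborel :: 'b::euclidean_space measure)"
  by (rule product_sigma_finite.intro) (rule sigma_finite_lborel)

text \<open>Used for translations, where all weights are 1, and for multiplication of complex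
  coordinates by a scalar a, where each weight is \<open>1 / (norm a)\<^sup>2\<close>.\<close>

lemma nn_integral_PiM_coordinatewise:
  fixes T :: "'i \<Rightarrow> 'b::euclidean_space \<Rightarrow> 'b" and w :: "'i \<Rightarrow> ennreal"
  assumes "finite J" and T: "\<And>j. j \<in> J \<Longrightarrow> T j \<in> borel_measurable borel"
    and w: "\<And>j g. j \<in> J \<Longrightarrow> g \<in> borel_measurable borel \<Longrightarrow> (\<integral>\<^sup>+x. g (T j x) \<partial>lborel) = w j * (\<integral>\<^sup>+x. g x \<partial>lborel)"
    and "f \<in> borel_measurable (lborel_prod_on J)"
  shows "(\<integral>\<^sup>+x. f (\<lambda>j\<in>J. T j (x j)) \<partial>lborel_prod_on J) = (\<Prod>j\<in>J. w j) * (\<integral>\<^sup>+x. f x \<partial>lborel_prod_on J)"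
  using assms
proof (induction J arbitrary: f rule: finite_induct)
  case empty
  then show ?case by (simp add: PiM_empty nn_integral_count_space_finite)
next
  case (insert i J)
  interpret product_sigma_finite "\<lambda>_. lborel :: 'b measure" by (rule product_sigma_finite_lborel)
  have f[measurable]: "f \<in> borel_measurable (lborel_prod_on (insert i J))" by (rule insert.prems)
  have Tm[measurable]: "T j \<in> borel_measurable borel" if "j \<in> insert i J" for j using insert.prems that by blast
  have Ti[measurable]: "T i \<in> borel_measurable borel" by (rule Tm) simp
  have TJ[measurable]: "(\<lambda>x. \<lambda>j\<in>J. T j (x j)) \<in> lborel_prod_on J \<rightarrow>\<^sub>M lborel_prod_on J"
    by (rule measurable_restrict) (use Tm in \<open>auto intro: measurable_compose[OF measurable_component_singleton]\<close>)
  have "(\<lambda>x. \<lambda>j\<in>insert i J. T j (x j)) \<in> lborel_prod_on (insert i J) \<rightarrow>\<^sub>M lborel_prod_on (insert i J)"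
    by (rule measurable_restrict) (use Tm in \<open>auto intro: measurable_compose[OF measurable_component_singleton]\<close>)
  then have fT: "(\<lambda>x. f (\<lambda>j\<in>insert i J. T j (x j))) \<in> borel_measurable (lborel_prod_on (insert i J))"
    using f by (rule measurable_compose)
  define h where "h = (\<lambda>x. \<integral>\<^sup>+y. f (x(i := y)) \<partial>lborel)"
  have hm: "h \<in> borel_measurable (lborel_prod_on J)" unfolding h_def by measurable
  have upd: "(\<lambda>j\<in>insert i J. T j ((x(i := y)) j)) = (\<lambda>j\<in>J. T j (x j))(i := T i y)" for x y
    using insert.hyps by (auto simp: fun_eq_iff restrict_def)
  have "(\<integral>\<^sup>+x. f (\<lambda>j\<in>insert i J. T j (x j)) \<partial>lborel_prod_on (insert i J))
    = (\<integral>\<^sup>+x. \<integral>\<^sup>+y. f ((\<lambda>j\<in>J. T j (x j))(i := T i y)) \<partial>lborel \<partial>lborel_prod_on J)"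
    by (subst product_nn_integral_insert[OF insert.hyps fT]) (simp only: upd)
  also have "\<dots> = (\<integral>\<^sup>+x. w i * h (\<lambda>j\<in>J. T j (x j)) \<partial>lborel_prod_on J)"
  proof (rule nn_integral_cong)
    fix x :: "'i \<Rightarrow> 'b" assume "x \<in> space (lborel_prod_on J)"
    then have "(\<lambda>j\<in>J. T j (x j)) \<in> space (lborel_prod_on J)" by (simp add: space_PiM)
    then have "(\<lambda>y. f ((\<lambda>j\<in>J. T j (x j))(i := y))) \<in> borel_measurable borel" by measurable
    from insert.prems(2)[OF insertI1 this]
    show "(\<integral>\<^sup>+y. f ((\<lambda>j\<in>J. T j (x j))(i := T i y)) \<partial>lborel) = w i * h (\<lambda>j\<in>J. T j (x j))"
      by (simp add: h_def)
  qed
  also have "\<dots> = w i * (\<integral>\<^sup>+x. h (\<lambda>j\<in>J. T j (x j)) \<partial>lborel_prod_on J)"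
    by (rule nn_integral_cmult) (rule measurable_compose[OF TJ hm])
  also have "(\<integral>\<^sup>+x. h (\<lambda>j\<in>J. T j (x j)) \<partial>lborel_prod_on J) = (\<Prod>j\<in>J. w j) * (\<integral>\<^sup>+x. h x \<partial>lborel_prod_on J)"
    by (rule insert.IH) (use insert.prems hm in auto)
  also have "(\<integral>\<^sup>+x. h x \<partial>lborel_prod_on J) = (\<integral>\<^sup>+x. f x \<partial>lborel_prod_on (insert i J))"
    unfolding h_def by (rule product_nn_integral_insert[OF insert.hyps f, symmetric])
  finally show ?case using insert.hyps by (simp add: mult.assoc)
qed

lemma nn_integral_PiM_shift:
  fixes a :: "'i \<Rightarrow> 'b::euclidean_space"
  assumes "finite J" "f \<in> borel_measurable (lborel_prod_on J)"
  shows "(\<integral>\<^sup>+x. f (\<lambda>j\<in>J. x j + a j) \<partial>lborel_prod_on J) = (\<integral>\<^sup>+x. f x \<partial>lborel_prod_on J)"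
proof -
  have "(\<integral>\<^sup>+x. g (x + a j) \<partial>lborel) = (\<integral>\<^sup>+x. g x \<partial>lborel)" if "g \<in> borel_measurable borel" for g :: "'b \<Rightarrow> ennreal" and j
  proof -
    have "(\<integral>\<^sup>+x. g x \<partial>lborel) = (\<integral>\<^sup>+x. g x \<partial>distr lborel borel ((+) (a j)))" by (simp add: lborel_distr_plus)
    also have "\<dots> = (\<integral>\<^sup>+x. g (a j + x) \<partial>lborel)" by (rule nn_integral_distr) (use that in auto)
    finally show ?thesis by (simp add: add.commute)
  qed
  then show ?thesis
    using nn_integral_PiM_coordinatewise[OF assms(1) _ _ assms(2), of "\<lambda>j x. x + a j" "\<lambda>_. 1"] by simp
qed

text \<open>In the applications u is a row of a symmetric matrix: the product runs over index pairs
  such as \<open>upair k r\<close>, whereas the integrand is a function of a vector indexed by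
  \<open>I\<close>. The translation is carried to the pairs by \<open>inv_into\<close>.\<close>

lemma nn_integral_PiM_shift_reindexed:
  fixes a :: "'k \<Rightarrow> 'b::euclidean_space"
  assumes I: "finite I" and p: "inj_on p I" and f: "(\<lambda>u. f (\<lambda>r\<in>I. u (p r))) \<in> borel_measurable (lborel_prod_on (p ` I))"
  shows "(\<integral>\<^sup>+u. f (\<lambda>r\<in>I. u (p r) + a r) \<partial>lborel_prod_on (p ` I)) = (\<integral>\<^sup>+u. f (\<lambda>r\<in>I. u (p r)) \<partial>lborel_prod_on (p ` I))"
proof -
  have "(\<lambda>r\<in>I. (\<lambda>j\<in>p ` I. u j + a (inv_into I p j)) (p r)) = (\<lambda>r\<in>I. u (p r) + a r)" for u
    using p by (auto simp: fun_eq_iff)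
  then show ?thesis
    using nn_integral_PiM_shift[OF finite_imageI[OF I] f, of "\<lambda>j. a (inv_into I p j)"] by simp
qed

section \<open>Gaussian-type integrals of determinants\<close>

text \<open>By the matrix determinant lemma the integrand is a power of det P (1 + c u^T P^-1 u), so
  the right side is what the substitution by a square root of P predicts. The induction over
  \<open>I\<close> reaches it with translations only: after splitting off the coordinate y of u at
  k, the Schur complement is again a rank one perturbation, of \<open>schur k P\<close>.\<close>

lemma nn_integral_subdet_rank1:
  fixes P :: "'n::finite \<Rightarrow> 'n \<Rightarrow> real" and p :: "'n \<Rightarrow> 'i"
  assumes "sub_sym I P" "sub_pos I P" "c > 0" "s > real (card I) / 2" "inj_on p I"
  shows "(\<integral>\<^sup>+u. ennreal (subdet I (\<lambda>r t. P r t + c * u (p r) * u (p t)) powr (- s)) \<partial>lborel_prod_on (p ` I))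
    = ennreal (pi powr (real (card I) / 2) * Gamma (s - real (card I) / 2) / Gamma s
        * c powr (- real (card I) / 2) * subdet I P powr (1 / 2 - s))"
  using finite[of I] assms
proof (induction I arbitrary: P c rule: finite_induct)
  case empty
  then have "s > 0" by simp
  then have "Gamma s \<noteq> 0" by (metis Gamma_real_pos less_irrefl)
  with empty show ?case by (simp add: PiM_empty nn_integral_count_space_finite)
next
  case (insert k I)
  interpret product_sigma_finite "\<lambda>_. lborel :: real measure" by (rule product_sigma_finite_lborel)
  let ?d = "real (card I)"
  have pk: "p k \<notin> p ` I" and inj: "inj_on p I" using insert.prems(5) insert.hyps by auto
  have Pk: "P k k > 0" "sub_pos I (schur k P)" using sub_pos_insert[OF insert.hyps insert.prems(1)] insert.prems(2) by blast+
  have Ssym: "sub_sym I (schur k P)" by (rule sub_sym_schur[OF insert.prems(1)])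
  have s: "s > ?d / 2 + 1 / 2" using insert.prems(4) insert.hyps by (simp add: add_divide_distrib)
  define m where "m = (\<lambda>y. P k k + c * y\<^sup>2)"
  have m: "m y > 0" for y using Pk(1) insert.prems(3) by (simp add: m_def add_pos_nonneg)
  \<comment> \<open>The Schur complement of P + c u u^T at k, where u has the coordinate y, equals
    \<open>schur k P\<close> plus c' y times the square of the vector u_r - y P_rk / P_kk. This
    fixes the coefficient \<open>c'\<close> and the translation \<open>a\<close>.\<close>
  define c' where "c' = (\<lambda>y. c * P k k / m y)"
  have c': "c' y > 0" for y using m[of y] Pk insert.prems(3) by (simp add: c'_def)
  define a where "a = (\<lambda>y r. - (P r k * y / P k k))"
  let ?G = "\<lambda>y v. subdet I (\<lambda>r t. schur k P r t + c' y * v r * v t)"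
  have Gm: "(\<lambda>u. ennreal (?G y (\<lambda>r\<in>I. u (p r)) powr (- s))) \<in> borel_measurable (lborel_prod_on (p ` I))" for y
    by (intro measurable_compose[OF _ measurable_ennreal] powr_real_measurable measurable_subdet borel_measurable_add borel_measurable_times) auto
  have main: "subdet (insert k I) (\<lambda>r t. P r t + c * (x(p k := y)) (p r) * (x(p k := y)) (p t)) = m y * ?G y (\<lambda>r\<in>I. x (p r) + a y r)" for x y
  proof -
    let ?M = "\<lambda>r t. P r t + c * (x(p k := y)) (p r) * (x(p k := y)) (p t)"
    have Mk: "?M k k = m y" by (simp add: m_def power2_eq_square)
    have "subdet (insert k I) ?M = m y * subdet I (schur k ?M)"
      using subdet_insert[OF insert.hyps(2), of ?M] m[of y] unfolding Mk by simp
    also have "subdet I (schur k ?M) = ?G y (\<lambda>r\<in>I. x (p r) + a y r)"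
    proof (rule subdet_cong)
      fix r t assume rt: "r \<in> I" "t \<in> I"
      have ne: "p r \<noteq> p k" "p t \<noteq> p k" using imageI[OF rt(1), of p] imageI[OF rt(2), of p] pk by auto
      have sy: "P k t = P t k" using insert.prems(1) rt(2) unfolding sub_sym_def by blast
      have "schur k ?M r t = P r t + c * x (p r) * x (p t) - (P r k + c * x (p r) * y) * (P t k + c * y * x (p t)) / m y"
        unfolding schur_def Mk using ne by (simp add: sy)
      also have "\<dots> = P r t - P r k * P t k / P k k + c' y * (x (p r) - P r k * y / P k k) * (x (p t) - P t k * y / P k k)"
        using m[of y] Pk(1) unfolding c'_def
        by (simp add: divide_simps) (simp add: m_def power2_eq_square algebra_simps)
      finally show "schur k ?M r t = schur k P r t + c' y * (\<lambda>r\<in>I. x (p r) + a y r) r * (\<lambda>r\<in>I. x (p r) + a y r) t"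
        using rt by (simp add: schur_def sy a_def)
    qed
    finally show ?thesis .
  qed
  have Gpos: "?G y v > 0" for y v
  proof (rule subdet_pos)
    show "sub_sym I (\<lambda>r t. schur k P r t + c' y * v r * v t)" using Ssym by (simp add: sub_sym_def)
    show "sub_pos I (\<lambda>r t. schur k P r t + c' y * v r * v t)"
      by (rule sub_pos_add_rank1[OF Pk(2)]) (use c'[of y] in simp)
  qed
  let ?C = "pi powr (?d / 2) * Gamma (s - ?d / 2) / Gamma s"
  have C: "?C > 0" using s by (simp add: Gamma_real_pos)
  have fm: "(\<lambda>u. ennreal (subdet (insert k I) (\<lambda>r t. P r t + c * u (p r) * u (p t)) powr (- s)))
    \<in> borel_measurable (lborel_prod_on (insert (p k) (p ` I)))"
    by (intro measurable_compose[OF _ measurable_ennreal] powr_real_measurable measurable_subdet borel_measurable_add borel_measurable_times) auto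
  have "(\<integral>\<^sup>+u. ennreal (subdet (insert k I) (\<lambda>r t. P r t + c * u (p r) * u (p t)) powr (- s)) \<partial>lborel_prod_on (p ` insert k I))
    = (\<integral>\<^sup>+y. \<integral>\<^sup>+x. ennreal ((m y * ?G y (\<lambda>r\<in>I. x (p r) + a y r)) powr (- s)) \<partial>lborel_prod_on (p ` I) \<partial>lborel)"
    unfolding image_insert using insert.hyps pk
    by (subst product_nn_integral_insert_rev[OF _ pk fm]) (simp_all only: main finite_imageI)
  also have "\<dots> = (\<integral>\<^sup>+y. ennreal (?C * (c * P k k) powr (- ?d / 2) * subdet I (schur k P) powr (1/2 - s)) * ennreal (m y powr (- (s - ?d / 2))) \<partial>lborel)"
  proof (rule nn_integral_cong)
    fix y :: real
    have "(\<integral>\<^sup>+x. ennreal ((m y * ?G y (\<lambda>r\<in>I. x (p r) + a y r)) powr (- s)) \<partial>lborel_prod_on (p ` I))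
       = (\<integral>\<^sup>+x. ennreal (m y powr (- s)) * ennreal (?G y (\<lambda>r\<in>I. x (p r) + a y r) powr (- s)) \<partial>lborel_prod_on (p ` I))"
      using m[of y] Gpos by (intro nn_integral_cong) (simp add: powr_mult less_imp_le flip: ennreal_mult')
    also have "\<dots> = ennreal (m y powr (- s)) * (\<integral>\<^sup>+x. ennreal (?G y (\<lambda>r\<in>I. x (p r) + a y r) powr (- s)) \<partial>lborel_prod_on (p ` I))"
      by (rule nn_integral_cmult)
        (intro measurable_compose[OF _ measurable_ennreal] powr_real_measurable measurable_subdet borel_measurable_add borel_measurable_times; auto)
    also have "(\<integral>\<^sup>+x. ennreal (?G y (\<lambda>r\<in>I. x (p r) + a y r) powr (- s)) \<partial>lborel_prod_on (p ` I))
      = (\<integral>\<^sup>+x. ennreal (?G y (\<lambda>r\<in>I. x (p r)) powr (- s)) \<partial>lborel_prod_on (p ` I))"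
      by (rule nn_integral_PiM_shift_reindexed[OF insert.hyps(1) inj Gm, of y "a y"])
    also have "\<dots> = (\<integral>\<^sup>+x. ennreal (subdet I (\<lambda>r t. schur k P r t + c' y * x (p r) * x (p t)) powr (- s)) \<partial>lborel_prod_on (p ` I))"
      by (intro nn_integral_cong arg_cong[where f = "\<lambda>x. ennreal (x powr (- s))"] subdet_cong) auto
    also have "\<dots> = ennreal (?C * c' y powr (- ?d / 2) * subdet I (schur k P) powr (1/2 - s))"
      by (rule insert.IH[OF Ssym Pk(2) c' _ inj]) (use s in linarith)
    also have "ennreal (m y powr (- s)) * \<dots> = ennreal (?C * (c * P k k) powr (- ?d / 2) * subdet I (schur k P) powr (1/2 - s) * m y powr (- (s - ?d / 2)))"
    proof -
      \<comment> \<open>The power -d/2 of \<open>c' y\<close> returns m y to the power d/2, which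
        lowers the exponent of the last, one-dimensional integral from s to s - d/2.\<close>
      have A: "c' y powr (- ?d / 2) = (c * P k k) powr (- ?d / 2) * m y powr (?d / 2)"
        using m[of y] Pk(1) insert.prems(3) by (simp add: c'_def powr_divide powr_minus divide_simps)
      have B: "m y powr (- s) * m y powr (?d / 2) = m y powr (- (s - ?d / 2))"
        by (simp flip: powr_add)
      have "m y powr (- s) * (?C * c' y powr (- ?d / 2) * subdet I (schur k P) powr (1/2 - s))
          = ?C * (c * P k k) powr (- ?d / 2) * subdet I (schur k P) powr (1/2 - s) * (m y powr (- s) * m y powr (?d / 2))"
        unfolding A by (simp only: mult_ac)
      also note B
      finally have "m y powr (- s) * (?C * c' y powr (- ?d / 2) * subdet I (schur k P) powr (1/2 - s))
          = ?C * (c * P k k) powr (- ?d / 2) * subdet I (schur k P) powr (1/2 - s) * m y powr (- (s - ?d / 2))" .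
      then show ?thesis by (simp only: ennreal_mult'[OF powr_ge_zero, symmetric])
    qed
    also have "\<dots> = ennreal (?C * (c * P k k) powr (- ?d / 2) * subdet I (schur k P) powr (1/2 - s)) * ennreal (m y powr (- (s - ?d / 2)))"
      by (rule ennreal_mult'') simp
    finally show "(\<integral>\<^sup>+x. ennreal ((m y * ?G y (\<lambda>r\<in>I. x (p r) + a y r)) powr (- s)) \<partial>lborel_prod_on (p ` I)) = \<dots>" .
  qed
  also have "\<dots> = ennreal (?C * (c * P k k) powr (- ?d / 2) * subdet I (schur k P) powr (1/2 - s))
      * ennreal (sqrt pi * Gamma (s - ?d / 2 - 1/2) / Gamma (s - ?d / 2) * c powr (- 1/2) * P k k powr (1/2 - (s - ?d / 2)))"
  proof -
    have "s - ?d / 2 > 1 / 2" using s by simp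
    from nn_integral_powr_quadratic[OF this insert.prems(3) Pk(1), symmetric] show ?thesis
      unfolding m_def by (simp only:) (rule nn_integral_cmult; measurable)
  qed
  also have "\<dots> = ennreal (pi powr (real (card (insert k I)) / 2) * Gamma (s - real (card (insert k I)) / 2) / Gamma s
        * c powr (- real (card (insert k I)) / 2) * subdet (insert k I) P powr (1 / 2 - s))"
  proof -
    have G: "Gamma (s - ?d / 2) > 0" "Gamma s > 0" using s by (auto intro!: Gamma_real_pos)
    have cd: "real (card (insert k I)) = ?d + 1" using insert.hyps by simp
    have e1: "pi powr ((?d + 1) / 2) = pi powr (?d / 2) * sqrt pi"
      by (simp add: add_divide_distrib powr_add powr_half_sqrt)
    have e2: "c powr (- (?d + 1) / 2) = c powr (- ?d / 2) * c powr (- 1/2)"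
      by (simp flip: powr_add) (simp add: diff_divide_distrib)
    have e3: "P k k powr (- ?d / 2) * P k k powr (1/2 - (s - ?d / 2)) = P k k powr (1/2 - s)"
      by (simp flip: powr_add)
    have e4: "subdet (insert k I) P powr (1/2 - s) = P k k powr (1/2 - s) * subdet I (schur k P) powr (1/2 - s)"
      using Pk(1) subdet_pos[OF Ssym Pk(2)] insert.hyps by (subst subdet_insert) (auto simp: powr_mult)
    have e5: "Gamma (s - (?d + 1) / 2) = Gamma (s - ?d / 2 - 1/2)" by (rule arg_cong[where f = Gamma]) (simp add: field_simps)
    have e6: "(c * P k k) powr (- ?d / 2) = c powr (- ?d / 2) * P k k powr (- ?d / 2)"
      using Pk(1) insert.prems(3) by (simp add: powr_mult)
    show ?thesis
      using C unfolding cd e1 e2 e4 e5 e6 e3[symmetric]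
      by (subst ennreal_mult'[symmetric]) (use G in \<open>auto simp: field_simps\<close>)
  qed
  finally show ?case .
qed

section \<open>Integration over symmetric matrices\<close>

text \<open>Each unordered pair of indices is represented by its ordered form. A symmetric matrix is
  then a function of \<open>upair r s\<close>, and its free entries are the coordinates of a product
  space.\<close>

definition upair :: "'n::linorder \<Rightarrow> 'n \<Rightarrow> 'n \<times> 'n" where
  "upair r s = (if r \<le> s then (r, s) else (s, r))"

definition upairs :: "'n::linorder set \<Rightarrow> ('n \<times> 'n) set" where
  "upairs I = {(r, s). r \<in> I \<and> s \<in> I \<and> r \<le> s}"

lemma upair_commute: "upair r s = upair s r" by (auto simp: upair_def)

lemma upair_in_upairs [simp]: "upair r s \<in> upairs I \<longleftrightarrow> r \<in> I \<and> s \<in> I"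
  by (auto simp: upair_def upairs_def)

lemma upair_eq_iff: "upair r s = upair r' s' \<longleftrightarrow> r = r' \<and> s = s' \<or> r = s' \<and> s = r'"
  by (auto simp: upair_def)

lemma upair_same [simp]: "upair r r = (r, r)" by (simp add: upair_def)

lemma upairs_insert: "upairs (insert k I) = insert (k, k) (upair k ` I) \<union> upairs I"
  by (auto simp: upairs_def upair_def)

lemma finite_upairs: "finite I \<Longrightarrow> finite (upairs I)"
  by (rule finite_subset[of _ "I \<times> I"]) (auto simp: upairs_def)

lemma inj_on_upair: "k \<notin> I \<Longrightarrow> inj_on (upair k) I"
  by (auto simp: inj_on_def upair_eq_iff)

lemma kk_notin_upair_image: "k \<notin> I \<Longrightarrow> (k, k) \<notin> upair k ` I"
  by (auto simp: upair_def)

lemma upairs_disjoint: "k \<notin> I \<Longrightarrow> insert (k, k) (upair k ` I) \<inter> upairs I = {}"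
  by (auto simp: upairs_def upair_def)

lemma upairs_empty [simp]: "upairs {} = {}" by (simp add: upairs_def)

text \<open>The symmetric matrix with diagonal entry \<open>\<xi>\<close> at \<open>k\<close>, further entries \<open>u\<close> in row
  \<open>k\<close> and remaining entries \<open>x\<close>.\<close>

definition bordered ::
  "'n::linorder \<Rightarrow> 'n set \<Rightarrow> 'b \<Rightarrow> ('n \<times> 'n \<Rightarrow> 'b) \<Rightarrow> ('n \<times> 'n \<Rightarrow> 'b) \<Rightarrow> 'n \<times> 'n \<Rightarrow> 'b" where
  "bordered k I \<xi> u x = merge (insert (k, k) (upair k ` I)) (upairs I) (u((k, k) := \<xi>), x)"

lemma bordered_simps:
  assumes "k \<notin> I"
  shows "bordered k I \<xi> u x (k, k) = \<xi>"
    "r \<in> I \<Longrightarrow> bordered k I \<xi> u x (upair k r) = u (upair k r)"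
    "r \<in> I \<Longrightarrow> bordered k I \<xi> u x (upair r k) = u (upair k r)"
    "r \<in> I \<Longrightarrow> s \<in> I \<Longrightarrow> bordered k I \<xi> u x (upair r s) = x (upair r s)"
proof -
  have n: "upair k r \<noteq> (k, k)" if "r \<in> I" for r using that assms by (auto simp: upair_def)
  show "bordered k I \<xi> u x (k, k) = \<xi>" by (simp add: bordered_def merge_def)
  show b: "bordered k I \<xi> u x (upair k r) = u (upair k r)" if "r \<in> I" for r
    using that n by (auto simp: bordered_def merge_def)
  show "bordered k I \<xi> u x (upair r k) = u (upair k r)" if "r \<in> I" for r
    using b[OF that] by (simp add: upair_commute)
  show "bordered k I \<xi> u x (upair r s) = x (upair r s)" if "r \<in> I" "s \<in> I" for r s
  proof -
    have "upair r s \<notin> insert (k, k) (upair k ` I)"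
      using upairs_disjoint[OF assms] that by (metis disjoint_iff upair_in_upairs)
    then show ?thesis using that by (simp add: bordered_def merge_def)
  qed
qed

lemma measurable_bordered [measurable]:
  "(\<lambda>(\<xi>, u, x). bordered k I \<xi> u x) \<in>
     lborel \<Otimes>\<^sub>M lborel_prod_on (upair k ` I) \<Otimes>\<^sub>M lborel_prod_on (upairs I) \<rightarrow>\<^sub>M lborel_prod_on (upairs (insert k I))"
  unfolding bordered_def upairs_insert case_prod_beta
  by (rule measurable_compose[OF _ measurable_merge], rule measurable_Pair,
      rule measurable_fun_upd[where J = "upair k ` I"]) auto

lemma nn_integral_bordered:
  fixes f :: "('n::linorder \<times> 'n \<Rightarrow> 'b::euclidean_space) \<Rightarrow> ennreal"
  assumes I: "finite I" and k: "k \<notin> I" and f: "f \<in> borel_measurable (lborel_prod_on (upairs (insert k I)))"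
  shows "(\<integral>\<^sup>+x. f x \<partial>lborel_prod_on (upairs (insert k I)))
    = (\<integral>\<^sup>+\<xi>. \<integral>\<^sup>+u. \<integral>\<^sup>+x. f (bordered k I \<xi> u x) \<partial>lborel_prod_on (upairs I) \<partial>lborel_prod_on (upair k ` I) \<partial>lborel)"
proof -
  interpret product_sigma_finite "\<lambda>_. lborel :: 'b measure" by (rule product_sigma_finite_lborel)
  interpret X: finite_product_sigma_finite "\<lambda>_. lborel :: 'b measure" "upairs I"
    by unfold_locales (rule finite_upairs[OF I])
  let ?K = "insert (k, k) (upair k ` I)"
  have f': "f \<in> borel_measurable (lborel_prod_on (?K \<union> upairs I))" using f by (simp add: upairs_insert)
  have [measurable]: "(\<lambda>p. f (merge ?K (upairs I) p)) \<in> borel_measurable (lborel_prod_on ?K \<Otimes>\<^sub>M lborel_prod_on (upairs I))"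
    by (rule measurable_compose[OF measurable_merge f'])
  have g: "(\<lambda>v. \<integral>\<^sup>+x. f (merge ?K (upairs I) (v, x)) \<partial>lborel_prod_on (upairs I)) \<in> borel_measurable (lborel_prod_on ?K)"
    by measurable
  have "(\<integral>\<^sup>+x. f x \<partial>lborel_prod_on (upairs (insert k I)))
    = (\<integral>\<^sup>+v. \<integral>\<^sup>+x. f (merge ?K (upairs I) (v, x)) \<partial>lborel_prod_on (upairs I) \<partial>lborel_prod_on ?K)"
    unfolding upairs_insert
    by (rule product_nn_integral_fold[OF upairs_disjoint[OF k] _ _ f']) (use I finite_upairs in auto)
  also have "\<dots> = (\<integral>\<^sup>+\<xi>. \<integral>\<^sup>+u. \<integral>\<^sup>+x. f (merge ?K (upairs I) (u((k, k) := \<xi>), x)) \<partial>lborel_prod_on (upairs I) \<partial>lborel_prod_on (upair k ` I) \<partial>lborel)"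
    by (rule product_nn_integral_insert_rev[OF _ kk_notin_upair_image[OF k] g]) (use I in auto)
  finally show ?thesis by (simp add: bordered_def)
qed

lemma measurable_upair_component:
  "r \<in> I \<Longrightarrow> s \<in> I \<Longrightarrow> (\<lambda>x. x (upair r s)) \<in> borel_measurable (lborel_prod_on (upairs I))"
  by (rule measurable_component_singleton[where M = "\<lambda>_. lborel", simplified]) simp

section \<open>The integral over the real parts\<close>

text \<open>The factor with index i is the contribution of a row that borders a matrix of size i.
  Its first quotient comes from the entries off the diagonal, by
  \<open>nn_integral_subdet_rank1\<close> with s = 2a - (i + 1)/2, and its second one from the
  diagonal entry, by \<open>nn_integral_powr_quadratic\<close> with exponent a - i/2.\<close>

definition siegel_x_const :: "nat \<Rightarrow> real \<Rightarrow> real" where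
  "siegel_x_const d a = (\<Prod>i<d. pi powr (real i / 2) * Gamma (2 * a - real i - 1 / 2) / Gamma (2 * a - (real i + 1) / 2)
     * (sqrt pi * Gamma (a - (real i + 1) / 2) / Gamma (a - real i / 2)))"

text \<open>Effect of bordering on x + it: in the Schur complement the real part is merely
  translated, whereas the imaginary part is the Schur complement of t plus a positive rank one term
  in the real entries of the row, translated by multiples of t.\<close>

lemma Complex_rank1_split:
  fixes \<xi> \<tau> u1 u2 t1 t2 :: real
  assumes "\<tau> > 0"
  shows "Complex x t - Complex u1 t1 * Complex u2 t2 / Complex \<xi> \<tau>
   = Complex (x - Re (Complex u1 t1 * Complex u2 t2 / Complex \<xi> \<tau>))
      (t - t1 * t2 / \<tau> + \<tau> / (\<xi>\<^sup>2 + \<tau>\<^sup>2) * (u1 - \<xi> * t1 / \<tau>) * (u2 - \<xi> * t2 / \<tau>))"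
proof (rule complex_eqI)
  have p: "\<xi>\<^sup>2 + \<tau>\<^sup>2 > 0" using assms by (simp add: add_nonneg_pos)
  have "Im (Complex u1 t1 * Complex u2 t2 / Complex \<xi> \<tau>) = ((u1 * t2 + t1 * u2) * \<xi> - (u1 * u2 - t1 * t2) * \<tau>) / (\<xi>\<^sup>2 + \<tau>\<^sup>2)"
    by (simp add: Im_divide)
  also have "\<dots> = t1 * t2 / \<tau> - \<tau> / (\<xi>\<^sup>2 + \<tau>\<^sup>2) * (u1 - \<xi> * t1 / \<tau>) * (u2 - \<xi> * t2 / \<tau>)"
    using p assms by (simp add: divide_simps) (simp add: power2_eq_square algebra_simps)
  finally show "Im (Complex x t - Complex u1 t1 * Complex u2 t2 / Complex \<xi> \<tau>) = Im (Complex (x - Re (Complex u1 t1 * Complex u2 t2 / Complex \<xi> \<tau>))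
      (t - t1 * t2 / \<tau> + \<tau> / (\<xi>\<^sup>2 + \<tau>\<^sup>2) * (u1 - \<xi> * t1 / \<tau>) * (u2 - \<xi> * t2 / \<tau>)))"
    by simp
qed simp

lemma measurable_Complex [measurable (raw)]:
  assumes "f \<in> borel_measurable M" "g \<in> borel_measurable M"
  shows "(\<lambda>x. Complex (f x) (g x)) \<in> borel_measurable M"
  unfolding Complex_eq using assms by measurable

text \<open>With row k split off by \<open>Complex_rank1_split\<close>, a translation and the
  induction hypothesis integrate out the real parts of the smaller matrix. They leave a power of a
  determinant that is a rank one perturbation in the row, to which
  \<open>nn_integral_subdet_rank1\<close> applies, and a one-dimensional integral over the diagonal
  entry.\<close>

lemma nn_integral_subdet_shift_Re:
  fixes t :: "'n::{finite, linorder} \<Rightarrow> 'n \<Rightarrow> real"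
  assumes "sub_sym I t" "sub_pos I t" "a > real (card I) / 2"
  shows "(\<integral>\<^sup>+x. ennreal (norm (subdet I (\<lambda>r s. Complex (x (upair r s)) (t r s))) powr (- (2 * a))) \<partial>lborel_prod_on (upairs I))
    = ennreal (siegel_x_const (card I) a * subdet I t powr ((real (card I) + 1) / 2 - 2 * a))"
  using finite[of I] assms
proof (induction I arbitrary: t rule: finite_induct)
  case empty
  then show ?case by (simp add: PiM_empty nn_integral_count_space_finite siegel_x_const_def)
next
  case (insert k I)
  let ?d = "real (card I)"
  let ?s = "2 * a - (?d + 1) / 2"
  define \<tau> where "\<tau> = t k k"
  have \<tau>: "\<tau> > 0" and Tpos: "sub_pos I (schur k t)" using sub_pos_insert[OF insert.hyps insert.prems(1)] insert.prems(2) by (auto simp: \<tau>_def)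
  have Tsym: "sub_sym I (schur k t)" by (rule sub_sym_schur[OF insert.prems(1)])
  have a: "a > ?d / 2 + 1 / 2" using insert.prems(3) insert.hyps by (simp add: add_divide_distrib)
  let ?M = "\<lambda>x r s. Complex (x (upair r s)) (t r s)"
  \<comment> \<open>Coefficient of the rank one term in \<open>Complex_rank1_split\<close>;
    \<open>\<alpha>\<close> is the translation of the row and \<open>b\<close> that of the smaller
    real part.\<close>
  define c where "c = (\<lambda>\<xi>. \<tau> / (\<xi>\<^sup>2 + \<tau>\<^sup>2))"
  have N: "\<xi>\<^sup>2 + \<tau>\<^sup>2 > 0" for \<xi> using \<tau> by (simp add: add_nonneg_pos)
  have c: "c \<xi> > 0" for \<xi> using N[of \<xi>] \<tau> by (simp add: c_def)
  define \<alpha> where "\<alpha> = (\<lambda>\<xi> r. - (\<xi> * t r k / \<tau>))"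
  let ?T = "\<lambda>\<xi> v r s. schur k t r s + c \<xi> * v r * v s"
  define b where "b = (\<lambda>\<xi> (u :: 'n \<times> 'n \<Rightarrow> real) (r, s). - Re (Complex (u (upair k r)) (t r k) * Complex (u (upair k s)) (t s k) / Complex \<xi> \<tau>))"
  have bsym: "b \<xi> u (upair r s) = - Re (Complex (u (upair k r)) (t r k) * Complex (u (upair k s)) (t s k) / Complex \<xi> \<tau>)" for \<xi> u r s
    by (simp add: b_def upair_def mult.commute)
  have nz: "Complex \<xi> \<tau> \<noteq> 0" for \<xi> using \<tau> by (simp add: complex_eq_iff)
  have nC: "norm (Complex \<xi> \<tau>) = sqrt (\<xi>\<^sup>2 + \<tau>\<^sup>2)" for \<xi> by (simp add: cmod_def)
  have main: "subdet (insert k I) (?M (bordered k I \<xi> u x)) = Complex \<xi> \<tau> *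
      subdet I (\<lambda>r s. Complex (x (upair r s) + b \<xi> u (upair r s)) (?T \<xi> (\<lambda>r\<in>I. u (upair k r) + \<alpha> \<xi> r) r s))" for \<xi> u x
  proof -
    let ?N = "?M (bordered k I \<xi> u x)"
    have kk: "?N k k = Complex \<xi> \<tau>" using insert.hyps by (simp add: bordered_simps \<tau>_def)
    have "subdet (insert k I) ?N = Complex \<xi> \<tau> * subdet I (schur k ?N)"
      using subdet_insert[OF insert.hyps(2), of ?N] nz unfolding kk by blast
    also have "subdet I (schur k ?N) = subdet I (\<lambda>r s. Complex (x (upair r s) + b \<xi> u (upair r s)) (?T \<xi> (\<lambda>r\<in>I. u (upair k r) + \<alpha> \<xi> r) r s))"
    proof (rule subdet_cong)
      fix r s assume rs: "r \<in> I" "s \<in> I"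
      then have sy: "t k s = t s k" using insert.prems(1) unfolding sub_sym_def by blast
      have "schur k ?N r s = Complex (x (upair r s)) (t r s) - Complex (u (upair k r)) (t r k) * Complex (u (upair k s)) (t s k) / Complex \<xi> \<tau>"
        unfolding schur_def kk using rs insert.hyps by (simp add: bordered_simps sy)
      then show "schur k ?N r s = Complex (x (upair r s) + b \<xi> u (upair r s)) (?T \<xi> (\<lambda>r\<in>I. u (upair k r) + \<alpha> \<xi> r) r s)"
        unfolding Complex_rank1_split[OF \<tau>] using rs by (simp add: bsym schur_def sy \<tau>_def[symmetric] c_def \<alpha>_def)
    qed
    finally show ?thesis .
  qed
  have Tv: "sub_sym I (?T \<xi> v)" "sub_pos I (?T \<xi> v)" for \<xi> v
    using Tsym sub_pos_add_rank1[OF Tpos, of "c \<xi>" v] c[of \<xi>] by (auto simp: sub_sym_def less_imp_le)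
  have inj: "inj_on (upair k) I" by (rule inj_on_upair[OF insert.hyps(2)])
  let ?A = "siegel_x_const (card I) a"
  let ?D = "pi powr (?d / 2) * Gamma (?s - ?d / 2) / Gamma ?s"
  let ?S = "subdet I (schur k t)"
  have G: "Gamma ?s > 0" "Gamma (?s - ?d / 2) > 0" using a by (auto intro!: Gamma_real_pos simp: field_simps)
  have A: "?A \<ge> 0" unfolding siegel_x_const_def
  proof (rule prod_nonneg)
    fix i assume "i \<in> {..<card I}"
    then have "real i < ?d" by simp
    then show "0 \<le> pi powr (real i / 2) * Gamma (2 * a - real i - 1 / 2) / Gamma (2 * a - (real i + 1) / 2)
       * (sqrt pi * Gamma (a - (real i + 1) / 2) / Gamma (a - real i / 2))"
      using a by (intro mult_nonneg_nonneg divide_nonneg_nonneg less_imp_le[OF Gamma_real_pos]) (auto simp: field_simps)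
  qed
  have fm: "(\<lambda>x. ennreal (norm (subdet (insert k I) (?M x)) powr (- (2 * a)))) \<in> borel_measurable (lborel_prod_on (upairs (insert k I)))"
  proof -
    have "(\<lambda>x. subdet (insert k I) (?M x)) \<in> borel_measurable (lborel_prod_on (upairs (insert k I)))"
      by (rule measurable_subdet, rule measurable_Complex, rule measurable_upair_component) auto
    then show ?thesis by simp
  qed
  have "(\<integral>\<^sup>+x. ennreal (norm (subdet (insert k I) (?M x)) powr (- (2 * a))) \<partial>lborel_prod_on (upairs (insert k I)))
    = (\<integral>\<^sup>+\<xi>. \<integral>\<^sup>+u. \<integral>\<^sup>+x. ennreal (norm (subdet (insert k I) (?M (bordered k I \<xi> u x))) powr (- (2 * a)))
        \<partial>lborel_prod_on (upairs I) \<partial>lborel_prod_on (upair k ` I) \<partial>lborel)"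
    by (rule nn_integral_bordered[OF insert.hyps fm])
  also have "\<dots> = (\<integral>\<^sup>+\<xi>. \<integral>\<^sup>+u. ennreal ((\<xi>\<^sup>2 + \<tau>\<^sup>2) powr (- a) * ?A) * ennreal (subdet I (?T \<xi> (\<lambda>r\<in>I. u (upair k r) + \<alpha> \<xi> r)) powr (- ?s)) \<partial>lborel_prod_on (upair k ` I) \<partial>lborel)"
  proof (intro nn_integral_cong)
    fix \<xi> :: real and u :: "'n \<times> 'n \<Rightarrow> real"
    let ?t = "?T \<xi> (\<lambda>r\<in>I. u (upair k r) + \<alpha> \<xi> r)"
    let ?F = "\<lambda>x. ennreal (norm (subdet I (\<lambda>r s. Complex (x (upair r s)) (?t r s))) powr (- (2 * a)))"
    have F: "?F \<in> borel_measurable (lborel_prod_on (upairs I))"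
    proof -
      have "(\<lambda>x. subdet I (\<lambda>r s. Complex (x (upair r s)) (?t r s))) \<in> borel_measurable (lborel_prod_on (upairs I))"
        by (rule measurable_subdet, rule measurable_Complex, rule measurable_upair_component) auto
      then show ?thesis by simp
    qed
    have "(\<integral>\<^sup>+x. ennreal (norm (subdet (insert k I) (?M (bordered k I \<xi> u x))) powr (- (2 * a))) \<partial>lborel_prod_on (upairs I))
      = (\<integral>\<^sup>+x. ennreal ((\<xi>\<^sup>2 + \<tau>\<^sup>2) powr (- a)) * ?F (\<lambda>j\<in>upairs I. x j + b \<xi> u j) \<partial>lborel_prod_on (upairs I))"
    proof (rule nn_integral_cong)
      fix x :: "'n \<times> 'n \<Rightarrow> real"
      have "norm (Complex \<xi> \<tau>) powr (- (2 * a)) = (\<xi>\<^sup>2 + \<tau>\<^sup>2) powr (- a)"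
        unfolding nC using N[of \<xi>] by (simp add: powr_powr flip: powr_half_sqrt)
      moreover have "subdet I (\<lambda>r s. Complex (x (upair r s) + b \<xi> u (upair r s)) (?t r s)) = subdet I (\<lambda>r s. Complex ((\<lambda>j\<in>upairs I. x j + b \<xi> u j) (upair r s)) (?t r s))"
        by (rule subdet_cong) simp
      ultimately show "ennreal (norm (subdet (insert k I) (?M (bordered k I \<xi> u x))) powr (- (2 * a)))
         = ennreal ((\<xi>\<^sup>2 + \<tau>\<^sup>2) powr (- a)) * ?F (\<lambda>j\<in>upairs I. x j + b \<xi> u j)"
        unfolding main norm_mult by (simp add: powr_mult flip: ennreal_mult')
    qed
    also have "\<dots> = ennreal ((\<xi>\<^sup>2 + \<tau>\<^sup>2) powr (- a)) * (\<integral>\<^sup>+x. ?F (\<lambda>j\<in>upairs I. x j + b \<xi> u j) \<partial>lborel_prod_on (upairs I))"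
    proof (rule nn_integral_cmult, rule measurable_compose[OF _ F], rule measurable_restrict)
      fix j :: "'n \<times> 'n" assume "j \<in> upairs I"
      then have "(\<lambda>x. x j) \<in> borel_measurable (lborel_prod_on (upairs I))"
        by (rule measurable_component_singleton[where M = "\<lambda>_. lborel", simplified])
      then have "(\<lambda>x. x j + b \<xi> u j) \<in> borel_measurable (lborel_prod_on (upairs I))"
        by (rule borel_measurable_add) simp
      then show "(\<lambda>x. x j + b \<xi> u j) \<in> lborel_prod_on (upairs I) \<rightarrow>\<^sub>M lborel" by simp
    qed
    also have "(\<integral>\<^sup>+x. ?F (\<lambda>j\<in>upairs I. x j + b \<xi> u j) \<partial>lborel_prod_on (upairs I)) = (\<integral>\<^sup>+x. ?F x \<partial>lborel_prod_on (upairs I))"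
      by (rule nn_integral_PiM_shift[OF finite_upairs[OF insert.hyps(1)] F])
    also have "\<dots> = ennreal (?A * subdet I ?t powr ((?d + 1) / 2 - 2 * a))"
      by (rule insert.IH[OF Tv]) (use a in linarith)
    also have "ennreal ((\<xi>\<^sup>2 + \<tau>\<^sup>2) powr (- a)) * \<dots> = ennreal ((\<xi>\<^sup>2 + \<tau>\<^sup>2) powr (- a) * ?A) * ennreal (subdet I ?t powr (- ?s))"
      by (simp add: ennreal_mult'' mult.assoc A)
    finally show "(\<integral>\<^sup>+x. ennreal (norm (subdet (insert k I) (?M (bordered k I \<xi> u x))) powr (- (2 * a))) \<partial>lborel_prod_on (upairs I)) = \<dots>" .
  qed
  also have "\<dots> = (\<integral>\<^sup>+\<xi>. ennreal (?A * ?D * ?S powr (1 / 2 - ?s) * \<tau> powr (- ?d / 2)) * ennreal ((\<tau>\<^sup>2 + 1 * \<xi>\<^sup>2) powr (- (a - ?d / 2))) \<partial>lborel)"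
  proof (rule nn_integral_cong)
    fix \<xi> :: real
    let ?H = "\<lambda>v. ennreal (subdet I (?T \<xi> v) powr (- ?s))"
    have Hm: "(\<lambda>u. ?H (\<lambda>r\<in>I. u (upair k r))) \<in> borel_measurable (lborel_prod_on (upair k ` I))"
      by (intro measurable_compose[OF _ measurable_ennreal] powr_real_measurable measurable_subdet borel_measurable_add borel_measurable_times) auto
    have "(\<integral>\<^sup>+u. ennreal ((\<xi>\<^sup>2 + \<tau>\<^sup>2) powr (- a) * ?A) * ?H (\<lambda>r\<in>I. u (upair k r) + \<alpha> \<xi> r) \<partial>lborel_prod_on (upair k ` I))
      = ennreal ((\<xi>\<^sup>2 + \<tau>\<^sup>2) powr (- a) * ?A) * (\<integral>\<^sup>+u. ?H (\<lambda>r\<in>I. u (upair k r) + \<alpha> \<xi> r) \<partial>lborel_prod_on (upair k ` I))"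
      by (rule nn_integral_cmult)
       (intro measurable_compose[OF _ measurable_ennreal] powr_real_measurable measurable_subdet borel_measurable_add borel_measurable_times; auto)
    also have "(\<integral>\<^sup>+u. ?H (\<lambda>r\<in>I. u (upair k r) + \<alpha> \<xi> r) \<partial>lborel_prod_on (upair k ` I)) = (\<integral>\<^sup>+u. ?H (\<lambda>r\<in>I. u (upair k r)) \<partial>lborel_prod_on (upair k ` I))"
      by (rule nn_integral_PiM_shift_reindexed[OF insert.hyps(1) inj Hm])
    also have "\<dots> = (\<integral>\<^sup>+u. ennreal (subdet I (\<lambda>r s. schur k t r s + c \<xi> * u (upair k r) * u (upair k s)) powr (- ?s)) \<partial>lborel_prod_on (upair k ` I))"
      by (intro nn_integral_cong arg_cong[where f = "\<lambda>x. ennreal (x powr (- ?s))"] subdet_cong) auto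
    also have "\<dots> = ennreal (?D * c \<xi> powr (- ?d / 2) * ?S powr (1 / 2 - ?s))"
      by (rule nn_integral_subdet_rank1[OF Tsym Tpos c _ inj]) (use a in \<open>simp add: field_simps\<close>)
    also have "ennreal ((\<xi>\<^sup>2 + \<tau>\<^sup>2) powr (- a) * ?A) * \<dots> = ennreal ((\<xi>\<^sup>2 + \<tau>\<^sup>2) powr (- a) * ?A * (?D * c \<xi> powr (- ?d / 2) * ?S powr (1 / 2 - ?s)))"
      by (rule ennreal_mult'[symmetric]) (use A in simp)
    also have "(\<xi>\<^sup>2 + \<tau>\<^sup>2) powr (- a) * ?A * (?D * c \<xi> powr (- ?d / 2) * ?S powr (1 / 2 - ?s))
       = ?A * ?D * ?S powr (1 / 2 - ?s) * \<tau> powr (- ?d / 2) * (\<tau>\<^sup>2 + 1 * \<xi>\<^sup>2) powr (- (a - ?d / 2))"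
    proof -
      \<comment> \<open>The factor c to the power -d/2 lowers the exponent of the quadratic in the
        diagonal entry from a to a - d/2.\<close>
      have A': "c \<xi> powr (- ?d / 2) = \<tau> powr (- ?d / 2) * (\<xi>\<^sup>2 + \<tau>\<^sup>2) powr (?d / 2)"
        using N[of \<xi>] \<tau> by (simp add: c_def powr_divide powr_minus divide_simps)
      have B': "(\<xi>\<^sup>2 + \<tau>\<^sup>2) powr (- a) * (\<xi>\<^sup>2 + \<tau>\<^sup>2) powr (?d / 2) = (\<tau>\<^sup>2 + 1 * \<xi>\<^sup>2) powr (- (a - ?d / 2))"
        by (simp add: add.commute flip: powr_add)
      show ?thesis unfolding A' B'[symmetric] by (simp only: mult_ac)
    qed
    also have "ennreal (?A * ?D * ?S powr (1 / 2 - ?s) * \<tau> powr (- ?d / 2) * (\<tau>\<^sup>2 + 1 * \<xi>\<^sup>2) powr (- (a - ?d / 2)))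
      = ennreal (?A * ?D * ?S powr (1 / 2 - ?s) * \<tau> powr (- ?d / 2)) * ennreal ((\<tau>\<^sup>2 + 1 * \<xi>\<^sup>2) powr (- (a - ?d / 2)))"
      by (rule ennreal_mult'') simp
    finally show "(\<integral>\<^sup>+u. ennreal ((\<xi>\<^sup>2 + \<tau>\<^sup>2) powr (- a) * ?A) * ?H (\<lambda>r\<in>I. u (upair k r) + \<alpha> \<xi> r) \<partial>lborel_prod_on (upair k ` I)) = \<dots>" .
  qed
  also have "\<dots> = ennreal (?A * ?D * ?S powr (1 / 2 - ?s) * \<tau> powr (- ?d / 2))
      * (\<integral>\<^sup>+\<xi>. ennreal ((\<tau>\<^sup>2 + 1 * \<xi>\<^sup>2) powr (- (a - ?d / 2))) \<partial>lborel)"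
    by (rule nn_integral_cmult; measurable)
  also have "(\<integral>\<^sup>+\<xi>. ennreal ((\<tau>\<^sup>2 + 1 * \<xi>\<^sup>2) powr (- (a - ?d / 2))) \<partial>lborel)
      = ennreal (sqrt pi * Gamma (a - ?d / 2 - 1/2) / Gamma (a - ?d / 2) * 1 powr (- 1/2) * \<tau>\<^sup>2 powr (1/2 - (a - ?d / 2)))"
    by (rule nn_integral_powr_quadratic) (use a \<tau> in auto)
  also have "ennreal (?A * ?D * ?S powr (1 / 2 - ?s) * \<tau> powr (- ?d / 2)) * \<dots>
    = ennreal (?A * ?D * ?S powr (1 / 2 - ?s) * \<tau> powr (- ?d / 2) * (sqrt pi * Gamma (a - ?d / 2 - 1/2) / Gamma (a - ?d / 2) * 1 powr (- 1/2) * \<tau>\<^sup>2 powr (1/2 - (a - ?d / 2))))"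
    by (rule ennreal_mult'[symmetric]) (use A G in auto)
  also have "?A * ?D * ?S powr (1 / 2 - ?s) * \<tau> powr (- ?d / 2) * (sqrt pi * Gamma (a - ?d / 2 - 1/2) / Gamma (a - ?d / 2) * 1 powr (- 1/2) * \<tau>\<^sup>2 powr (1/2 - (a - ?d / 2)))
     = siegel_x_const (card (insert k I)) a * subdet (insert k I) t powr ((real (card (insert k I)) + 1) / 2 - 2 * a)"
  proof -
    have cd: "card (insert k I) = Suc (card I)" using insert.hyps by simp
    have e1: "siegel_x_const (Suc (card I)) a = ?A * ?D * (sqrt pi * Gamma (a - ?d / 2 - 1/2) / Gamma (a - ?d / 2))"
    proof -
      have 1: "2 * a - ?d - 1 / 2 = ?s - ?d / 2" and 2: "a - (?d + 1) / 2 = a - ?d / 2 - 1 / 2" by (simp_all add: field_simps)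
      show ?thesis unfolding siegel_x_const_def prod.lessThan_Suc 1 2 by (simp only: mult_ac)
    qed
    have e2: "(real (Suc (card I)) + 1) / 2 - 2 * a = 1 / 2 - ?s" by (simp add: field_simps)
    have e3: "subdet (insert k I) t = \<tau> * ?S" using \<tau> insert.hyps by (subst subdet_insert) (auto simp: \<tau>_def)
    have e4: "\<tau> powr (- ?d / 2) * \<tau>\<^sup>2 powr (1/2 - (a - ?d / 2)) = \<tau> powr (1 / 2 - ?s)"
    proof -
      have "\<tau>\<^sup>2 powr (1/2 - (a - ?d / 2)) = \<tau> powr (2 * (1/2 - (a - ?d / 2)))"
        using powr_powr[of \<tau> 2] \<tau> by simp
      then have "\<tau> powr (- ?d / 2) * \<tau>\<^sup>2 powr (1/2 - (a - ?d / 2)) = \<tau> powr (- ?d / 2 + 2 * (1/2 - (a - ?d / 2)))"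
        by (simp only: powr_add)
      also have "- ?d / 2 + 2 * (1/2 - (a - ?d / 2)) = 1 / 2 - ?s" by (simp add: field_simps)
      finally show ?thesis .
    qed
    have "?S > 0" by (rule subdet_pos[OF Tsym Tpos])
    then have e5: "(\<tau> * ?S) powr (1 / 2 - ?s) = \<tau> powr (1 / 2 - ?s) * ?S powr (1 / 2 - ?s)" using \<tau> by (simp add: powr_mult)
    show ?thesis unfolding cd e1 e2 e3 e5 e4[symmetric] by (simp add: mult_ac)
  qed
  finally show ?case .
qed

section \<open>The matrix beta integral over the positive cone\<close>

text \<open>One bordering step contributes the integral over the row and a beta integral over the
  diagonal entry, between which \<open>Gamma (s - d/2)\<close> cancels. The row integral turns the
  exponent -s of the determinant into 1/2 - s, hence the recursion with s - 1/2.\<close>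

primrec siegel_y_const :: "nat \<Rightarrow> real \<Rightarrow> real \<Rightarrow> real" where
  "siegel_y_const 0 s b = 1"
| "siegel_y_const (Suc d) s b =
     pi powr (real d / 2) * Gamma (b + real d / 2 + 1) * Gamma (s - real d - b - 1) / Gamma s * siegel_y_const d (s - 1 / 2) b"

lemma sigma_finite_lborel_prod_on:
  "finite J \<Longrightarrow> sigma_finite_measure (lborel_prod_on J :: ('i \<Rightarrow> 'b::euclidean_space) measure)"
  by (rule product_sigma_finite.sigma_finite[OF product_sigma_finite_lborel])

lemma sub_sym_upair: "sub_sym I (\<lambda>r s. x (upair r s))"
  by (simp add: sub_sym_def upair_commute)

lemma sub_pos_upair_measurable:
  "Measurable.pred (lborel_prod_on (upairs I)) (\<lambda>x. sub_pos I (\<lambda>r s. x (upair r s)))"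
  for I :: "'n::{finite, linorder} set"
  by (rule measurable_sub_pos) (auto intro: measurable_upair_component sub_sym_upair)

abbreviation plus_one :: "('n \<Rightarrow> 'n \<Rightarrow> real) \<Rightarrow> 'n \<Rightarrow> 'n \<Rightarrow> real" where
  "plus_one M \<equiv> \<lambda>r s. M r s + (if r = s then 1 else 0)"

text \<open>If the border consists of the diagonal entry \<open>\<xi>\<close> and the row u, the
  Schur complement of x differs from the smaller matrix by the translation \<open>\<beta>\<close>.
  Once this is undone, positivity and the determinant of x depend on the row no longer, the matrix x
  + 1 is left with a rank one term in u, and \<open>nn_integral_subdet_rank1\<close> integrates the
  row before the induction hypothesis is used.\<close>

lemma nn_integral_subdet_positive_cone:
  fixes I :: "'n::{finite, linorder} set"
  assumes "b > -1" "s > b + real (card I)"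
  shows "(\<integral>\<^sup>+x. (if sub_pos I (\<lambda>r s. x (upair r s))
       then ennreal (subdet I (plus_one (\<lambda>r s. x (upair r s))) powr (- s) * subdet I (\<lambda>r s. x (upair r s)) powr b) else 0)
       \<partial>lborel_prod_on (upairs I))
    = ennreal (siegel_y_const (card I) s b)"
  using finite[of I] assms(2)
proof (induction I arbitrary: s rule: finite_induct)
  case empty
  then show ?case by (simp add: PiM_empty nn_integral_count_space_finite)
next
  case (insert k I)
  interpret product_sigma_finite "\<lambda>_. lborel :: real measure" by (rule product_sigma_finite_lborel)
  interpret UX: pair_sigma_finite "lborel_prod_on (upair k ` I) :: ('n \<times> 'n \<Rightarrow> real) measure" "lborel_prod_on (upairs I)"
    by (intro pair_sigma_finite.intro sigma_finite_lborel_prod_on finite_upairs finite_imageI insert.hyps(1))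
  let ?d = "real (card I)"
  let ?X = "\<lambda>x r s. x (upair r s) :: real"
  have s: "s > b + ?d + 1" using insert.prems insert.hyps by simp
  have sd: "s > ?d / 2" using s assms(1) by (simp add: field_simps)
  let ?D = "pi powr (?d / 2) * Gamma (s - ?d / 2) / Gamma s"
  have spos: "s > 0" using sd by (smt (verit) divide_nonneg_nonneg of_nat_0_le_iff)
  have G: "Gamma s > 0" "Gamma (s - ?d / 2) > 0" using sd spos by (auto intro!: Gamma_real_pos)
  have D: "?D > 0" using G by simp
  \<comment> \<open>This is 1 / \<open>\<xi>\<close> - 1 / (\<open>\<xi>\<close> + 1): the Schur
    complement of x subtracts u u^T / \<open>\<xi>\<close>, that of x + 1 subtracts u u^T /
    (\<open>\<xi>\<close> + 1).\<close>
  define c where "c = (\<lambda>\<xi>::real. 1 / (\<xi> * (\<xi> + 1)))"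
  define \<beta> where "\<beta> = (\<lambda>\<xi> (u :: 'n \<times> 'n \<Rightarrow> real) (r, s). - (u (upair k r) * u (upair k s) / \<xi>))"
  have \<beta>: "\<beta> \<xi> u (upair r s) = - (u (upair k r) * u (upair k s) / \<xi>)" for \<xi> u r s
    by (simp add: \<beta>_def upair_def mult.commute)
  let ?f = "\<lambda>x. if sub_pos (insert k I) (?X x)
       then ennreal (subdet (insert k I) (plus_one (?X x)) powr (- s) * subdet (insert k I) (?X x) powr b) else 0"
  have "(\<lambda>x. subdet (insert k I) (plus_one (?X x))) \<in> borel_measurable (lborel_prod_on (upairs (insert k I)))"
    "(\<lambda>x. subdet (insert k I) (?X x)) \<in> borel_measurable (lborel_prod_on (upairs (insert k I)))"
    by (rule measurable_subdet; intro borel_measurable_add borel_measurable_const measurable_upair_component; assumption)+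
  then have fm: "?f \<in> borel_measurable (lborel_prod_on (upairs (insert k I)))"
    by (intro measurable_If predE[OF sub_pos_upair_measurable] measurable_compose[OF _ measurable_ennreal]
        borel_measurable_times powr_real_measurable borel_measurable_const)
  let ?F = "\<lambda>\<xi> u x. if sub_pos I (?X x) then ennreal ((\<xi> + 1) powr (- s) * \<xi> powr b *
      (subdet I (\<lambda>r t. plus_one (?X x) r t + c \<xi> * u (upair k r) * u (upair k t)) powr (- s) * subdet I (?X x) powr b)) else 0"
  have rw: "?f (bordered k I \<xi> u x) = (if \<xi> > 0 then ?F \<xi> u (\<lambda>j\<in>upairs I. x j + \<beta> \<xi> u j) else 0)" for \<xi> u x
  proof (cases "\<xi> > 0")
    case False
    then show ?thesis
      using sub_pos_insert[OF insert.hyps sub_sym_upair, of "bordered k I \<xi> u x"] insert.hyps by (simp add: bordered_simps)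
  next
    case True
    let ?B = "?X (bordered k I \<xi> u x)"
    let ?x' = "\<lambda>j\<in>upairs I. x j + \<beta> \<xi> u j"
    have kk: "?B k k = \<xi>" using insert.hyps by (simp add: bordered_simps)
    have sc: "schur k ?B r t = ?X ?x' r t" if "r \<in> I" "t \<in> I" for r t
      unfolding schur_def kk using that insert.hyps by (simp add: bordered_simps \<beta>)
    have sc1: "schur k (plus_one ?B) r t = plus_one (?X ?x') r t + c \<xi> * u (upair k r) * u (upair k t)" if "r \<in> I" "t \<in> I" for r t
    proof -
      have ne: "r \<noteq> k" "k \<noteq> t" using that insert.hyps by auto
      have "schur k (plus_one ?B) r t = x (upair r t) + (if r = t then 1 else 0) - u (upair k r) * u (upair k t) / (\<xi> + 1)"
        unfolding schur_def using kk that insert.hyps ne by (simp add: bordered_simps)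
      also have "u (upair k r) * u (upair k t) / (\<xi> + 1) = u (upair k r) * u (upair k t) / \<xi> - c \<xi> * u (upair k r) * u (upair k t)"
      proof -
        have "1 / (\<xi> + 1) = 1 / \<xi> - c \<xi>" using True by (simp add: c_def divide_simps)
        then have "u (upair k r) * u (upair k t) * (1 / (\<xi> + 1)) = u (upair k r) * u (upair k t) * (1 / \<xi> - c \<xi>)"
          by (rule arg_cong)
        then show ?thesis by (simp add: algebra_simps)
      qed
      finally show ?thesis using that by (simp add: \<beta>)
    qed
    have P: "sub_pos (insert k I) ?B \<longleftrightarrow> sub_pos I (?X ?x')"
      unfolding sub_pos_insert[OF insert.hyps sub_sym_upair] kk using True sub_pos_cong[of I "schur k ?B" "?X ?x'"] sc by blast
    have d1: "subdet (insert k I) ?B = \<xi> * subdet I (?X ?x')"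
      using subdet_insert[OF insert.hyps(2), of ?B] True subdet_cong[of I "schur k ?B" "?X ?x'"] sc unfolding kk by simp
    have d2: "subdet (insert k I) (plus_one ?B) = (\<xi> + 1) * subdet I (\<lambda>r t. plus_one (?X ?x') r t + c \<xi> * u (upair k r) * u (upair k t))"
    proof -
      have kk1: "plus_one ?B k k = \<xi> + 1" using kk by simp
      have "subdet (insert k I) (plus_one ?B) = (\<xi> + 1) * subdet I (schur k (plus_one ?B))"
        using subdet_insert[OF insert.hyps(2), of "plus_one ?B"] True unfolding kk1 by simp
      also have "subdet I (schur k (plus_one ?B)) = subdet I (\<lambda>r t. plus_one (?X ?x') r t + c \<xi> * u (upair k r) * u (upair k t))"
        by (rule subdet_cong) (rule sc1)
      finally show ?thesis .
    qed
    show ?thesis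
    proof (cases "sub_pos I (?X ?x')")
      case pos: True
      have sy: "sub_sym I (\<lambda>r t. plus_one (?X ?x') r t + c \<xi> * u (upair k r) * u (upair k t))"
        unfolding sub_sym_def by (simp add: upair_commute mult_ac)
      have "c \<xi> \<ge> 0" using True by (simp add: c_def)
      then have p: "subdet I (\<lambda>r t. plus_one (?X ?x') r t + c \<xi> * u (upair k r) * u (upair k t)) > 0"
        by (intro subdet_pos sy sub_pos_add_rank1 sub_pos_add_one pos insert.hyps(1))
      have p': "subdet I (?X ?x') > 0" by (intro subdet_pos sub_sym_upair pos)
      have "subdet (insert k I) (plus_one ?B) powr (- s) * subdet (insert k I) ?B powr b =
         (\<xi> + 1) powr (- s) * \<xi> powr b *
      (subdet I (\<lambda>r t. plus_one (?X ?x') r t + c \<xi> * u (upair k r) * u (upair k t)) powr (- s) * subdet I (?X ?x') powr b)"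
        unfolding d1 d2 using True p p' by (simp only: powr_mult mult_ac)
      then show ?thesis using True P pos by simp
    qed (use P True in simp)
  qed
  have Fxm: "?F \<xi> u \<in> borel_measurable (lborel_prod_on (upairs I))" for \<xi> u
  proof -
    have "(\<lambda>x. subdet I (\<lambda>r t. plus_one (?X x) r t + c \<xi> * u (upair k r) * u (upair k t))) \<in> borel_measurable (lborel_prod_on (upairs I))"
      "(\<lambda>x. subdet I (?X x)) \<in> borel_measurable (lborel_prod_on (upairs I))"
      by (rule measurable_subdet; intro borel_measurable_add borel_measurable_const measurable_upair_component; assumption)+
    then show ?thesis
      by (intro measurable_If predE[OF sub_pos_upair_measurable] measurable_compose[OF _ measurable_ennreal]
        borel_measurable_times powr_real_measurable borel_measurable_const)
  qed
  have uc: "(\<lambda>p. fst p (upair k r)) \<in> borel_measurable (lborel_prod_on (upair k ` I) \<Otimes>\<^sub>M (lborel_prod_on (upairs I) :: ('n \<times> 'n \<Rightarrow> real) measure))" if "r \<in> I" for r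
    using measurable_compose[OF measurable_fst measurable_component_singleton[where M = "\<lambda>_. lborel :: real measure", of "upair k r" "upair k ` I"]] that by simp
  have xc: "(\<lambda>p. snd p (upair r t)) \<in> borel_measurable ((lborel_prod_on (upair k ` I) :: ('n \<times> 'n \<Rightarrow> real) measure) \<Otimes>\<^sub>M lborel_prod_on (upairs I))" if "r \<in> I" "t \<in> I" for r t
    using measurable_compose[OF measurable_snd measurable_upair_component[OF that]] .
  have Fm: "(\<lambda>(u, x). ?F \<xi> u x) \<in> borel_measurable (lborel_prod_on (upair k ` I) \<Otimes>\<^sub>M lborel_prod_on (upairs I))" for \<xi>
  proof -
    have "(\<lambda>p. subdet I (\<lambda>r t. plus_one (?X (snd p)) r t + c \<xi> * fst p (upair k r) * fst p (upair k t))) \<in> borel_measurable (lborel_prod_on (upair k ` I) \<Otimes>\<^sub>M lborel_prod_on (upairs I))"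
      "(\<lambda>p :: ('n \<times> 'n \<Rightarrow> real) \<times> ('n \<times> 'n \<Rightarrow> real). subdet I (?X (snd p))) \<in> borel_measurable (lborel_prod_on (upair k ` I) \<Otimes>\<^sub>M lborel_prod_on (upairs I))"
      by (rule measurable_subdet; intro borel_measurable_add borel_measurable_times borel_measurable_const uc xc; assumption)+
    moreover have "Measurable.pred (lborel_prod_on (upair k ` I) \<Otimes>\<^sub>M lborel_prod_on (upairs I)) (\<lambda>p :: ('n \<times> 'n \<Rightarrow> real) \<times> ('n \<times> 'n \<Rightarrow> real). sub_pos I (?X (snd p)))"
      by (rule measurable_compose[OF measurable_snd sub_pos_upair_measurable])
    note pm = predE[OF this]
    ultimately show ?thesis unfolding case_prod_beta
      by (intro measurable_If pm measurable_compose[OF _ measurable_ennreal] borel_measurable_times powr_real_measurable borel_measurable_const)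
  qed
  let ?E = "\<lambda>x. if sub_pos I (?X x) then ennreal (subdet I (plus_one (?X x)) powr (- (s - 1 / 2)) * subdet I (?X x) powr b) else 0"
  have Em: "?E \<in> borel_measurable (lborel_prod_on (upairs I))"
  proof -
    have "(\<lambda>x. subdet I (plus_one (?X x))) \<in> borel_measurable (lborel_prod_on (upairs I))"
      "(\<lambda>x. subdet I (?X x)) \<in> borel_measurable (lborel_prod_on (upairs I))"
      by (rule measurable_subdet; intro borel_measurable_add borel_measurable_const measurable_upair_component; assumption)+
    then show ?thesis
      by (intro measurable_If predE[OF sub_pos_upair_measurable] measurable_compose[OF _ measurable_ennreal]
        borel_measurable_times powr_real_measurable borel_measurable_const)
  qed
  have inj: "inj_on (upair k) I" by (rule inj_on_upair[OF insert.hyps(2)])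
  have IH: "(\<integral>\<^sup>+x. ?E x \<partial>lborel_prod_on (upairs I)) = ennreal (siegel_y_const (card I) (s - 1 / 2) b)"
    by (rule insert.IH) (use s in linarith)
  let ?C = "siegel_y_const (card I) (s - 1 / 2) b"
  have inner: "(\<integral>\<^sup>+u. \<integral>\<^sup>+x. ?f (bordered k I \<xi> u x) \<partial>lborel_prod_on (upairs I) \<partial>lborel_prod_on (upair k ` I))
    = ennreal (?D * (indicator {0..} \<xi> * \<xi> powr (b + ?d / 2 + 1 - 1) * (\<xi> + 1) powr (- (s - ?d / 2)))) * ennreal ?C" if x0: "\<xi> \<noteq> 0" for \<xi>
  proof (cases "\<xi> > 0")
    case False
    then show ?thesis unfolding rw using x0 by simp
  next
    case True
    have c: "c \<xi> > 0" using True by (simp add: c_def)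
    have "(\<integral>\<^sup>+u. \<integral>\<^sup>+x. ?f (bordered k I \<xi> u x) \<partial>lborel_prod_on (upairs I) \<partial>lborel_prod_on (upair k ` I))
      = (\<integral>\<^sup>+u. \<integral>\<^sup>+x. ?F \<xi> u x \<partial>lborel_prod_on (upairs I) \<partial>lborel_prod_on (upair k ` I))"
      unfolding rw if_P[OF True]
      by (rule nn_integral_cong) (rule nn_integral_PiM_shift[OF finite_upairs[OF insert.hyps(1)] Fxm])
    also have "\<dots> = (\<integral>\<^sup>+x. \<integral>\<^sup>+u. ?F \<xi> u x \<partial>lborel_prod_on (upair k ` I) \<partial>lborel_prod_on (upairs I))"
      by (rule UX.Fubini'[symmetric, OF Fm])
    also have "\<dots> = (\<integral>\<^sup>+x. ennreal ((\<xi> + 1) powr (- s) * \<xi> powr b * (?D * c \<xi> powr (- ?d / 2))) * ?E x \<partial>lborel_prod_on (upairs I))"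
    proof (rule nn_integral_cong)
      fix x :: "'n \<times> 'n \<Rightarrow> real"
      show "(\<integral>\<^sup>+u. ?F \<xi> u x \<partial>lborel_prod_on (upair k ` I)) = ennreal ((\<xi> + 1) powr (- s) * \<xi> powr b * (?D * c \<xi> powr (- ?d / 2))) * ?E x"
      proof (cases "sub_pos I (?X x)")
        case pos: True
        let ?K = "(\<xi> + 1) powr (- s) * \<xi> powr b * subdet I (?X x) powr b"
        have sy: "sub_sym I (plus_one (?X x))" unfolding sub_sym_def by (simp add: upair_commute)
        have sp: "sub_pos I (plus_one (?X x))" by (rule sub_pos_add_one[OF pos insert.hyps(1)])
        have gm: "(\<lambda>u. ennreal (subdet I (\<lambda>r t. plus_one (?X x) r t + c \<xi> * u (upair k r) * u (upair k t)) powr (- s))) \<in> borel_measurable (lborel_prod_on (upair k ` I))"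
          by (intro measurable_compose[OF _ measurable_ennreal] powr_real_measurable measurable_subdet borel_measurable_add borel_measurable_times) auto
        have "(\<integral>\<^sup>+u. ?F \<xi> u x \<partial>lborel_prod_on (upair k ` I))
          = (\<integral>\<^sup>+u. ennreal ?K * ennreal (subdet I (\<lambda>r t. plus_one (?X x) r t + c \<xi> * u (upair k r) * u (upair k t)) powr (- s)) \<partial>lborel_prod_on (upair k ` I))"
          using pos by (intro nn_integral_cong) (simp add: mult_ac flip: ennreal_mult')
        also have "\<dots> = ennreal ?K * (\<integral>\<^sup>+u. ennreal (subdet I (\<lambda>r t. plus_one (?X x) r t + c \<xi> * u (upair k r) * u (upair k t)) powr (- s)) \<partial>lborel_prod_on (upair k ` I))"
          by (rule nn_integral_cmult[OF gm])
        also have "\<dots> = ennreal ?K * ennreal (?D * c \<xi> powr (- ?d / 2) * subdet I (plus_one (?X x)) powr (1 / 2 - s))"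
          by (subst nn_integral_subdet_rank1[OF sy sp c sd inj]) simp
        also have "\<dots> = ennreal (?K * (?D * c \<xi> powr (- ?d / 2) * subdet I (plus_one (?X x)) powr (1 / 2 - s)))"
          by (rule ennreal_mult'[symmetric]) simp
        also have "?K * (?D * c \<xi> powr (- ?d / 2) * subdet I (plus_one (?X x)) powr (1 / 2 - s))
          = (\<xi> + 1) powr (- s) * \<xi> powr b * (?D * c \<xi> powr (- ?d / 2)) * (subdet I (plus_one (?X x)) powr (- (s - 1 / 2)) * subdet I (?X x) powr b)"
          by (simp only: mult_ac minus_diff_eq)
        also have "ennreal \<dots> = ennreal ((\<xi> + 1) powr (- s) * \<xi> powr b * (?D * c \<xi> powr (- ?d / 2))) * ?E x"
          unfolding if_P[OF pos] by (rule ennreal_mult'') simp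
        finally show ?thesis .
      qed simp
    qed
    also have "\<dots> = ennreal ((\<xi> + 1) powr (- s) * \<xi> powr b * (?D * c \<xi> powr (- ?d / 2))) * ennreal ?C"
      unfolding IH[symmetric] by (rule nn_integral_cmult[OF Em])
    also have "(\<xi> + 1) powr (- s) * \<xi> powr b * (?D * c \<xi> powr (- ?d / 2)) = ?D * (indicator {0..} \<xi> * \<xi> powr (b + ?d / 2 + 1 - 1) * (\<xi> + 1) powr (- (s - ?d / 2)))"
    proof -
      have 1: "c \<xi> powr (- ?d / 2) = \<xi> powr (?d / 2) * (\<xi> + 1) powr (?d / 2)"
        using True by (simp add: c_def powr_divide powr_minus powr_mult divide_simps)
      have 2: "\<xi> powr (b + ?d / 2 + 1 - 1) = \<xi> powr b * \<xi> powr (?d / 2)" by (simp add: powr_add)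
      have 3: "(\<xi> + 1) powr (- (s - ?d / 2)) = (\<xi> + 1) powr (- s) * (\<xi> + 1) powr (?d / 2)" by (simp flip: powr_add)
      show ?thesis unfolding 1 2 3 using True by (simp only: indicator_simps atLeast_iff less_imp_le mult_1_left mult_ac)
    qed
    finally show ?thesis .
  qed
  have "(\<integral>\<^sup>+x. ?f x \<partial>lborel_prod_on (upairs (insert k I)))
    = (\<integral>\<^sup>+\<xi>. \<integral>\<^sup>+u. \<integral>\<^sup>+x. ?f (bordered k I \<xi> u x) \<partial>lborel_prod_on (upairs I) \<partial>lborel_prod_on (upair k ` I) \<partial>lborel)"
    by (rule nn_integral_bordered[OF insert.hyps fm])
  also have "\<dots> = (\<integral>\<^sup>+\<xi>. ennreal (?D * (indicator {0..} \<xi> * \<xi> powr (b + ?d / 2 + 1 - 1) * (\<xi> + 1) powr (- (s - ?d / 2)))) * ennreal ?C \<partial>lborel)"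
    by (rule nn_integral_cong_AE, rule AE_mp[OF AE_lborel_singleton[of 0]], rule AE_I2, rule impI) (rule inner)
  also have "\<dots> = (\<integral>\<^sup>+\<xi>. (ennreal ?D * ennreal ?C) * ennreal (indicator {0..} \<xi> * \<xi> powr (b + ?d / 2 + 1 - 1) * (\<xi> + 1) powr (- (s - ?d / 2))) \<partial>lborel)"
    unfolding ennreal_mult'[OF less_imp_le[OF D]] by (simp only: mult_ac)
  also have "\<dots> = (ennreal ?D * ennreal ?C) * (\<integral>\<^sup>+\<xi>. ennreal (indicator {0..} \<xi> * \<xi> powr (b + ?d / 2 + 1 - 1) * (\<xi> + 1) powr (- (s - ?d / 2))) \<partial>lborel)"
    by (rule nn_integral_cmult; measurable)
  also have "(\<integral>\<^sup>+\<xi>. ennreal (indicator {0..} \<xi> * \<xi> powr (b + ?d / 2 + 1 - 1) * (\<xi> + 1) powr (- (s - ?d / 2))) \<partial>lborel)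
     = ennreal (Gamma (b + ?d / 2 + 1) * Gamma (s - ?d - b - 1) / Gamma (s - ?d / 2))"
  proof -
    have e: "b + ?d / 2 + 1 + (s - ?d - b - 1) = s - ?d / 2" by (simp add: field_simps)
    have p: "b + ?d / 2 + 1 > 0" "s - ?d - b - 1 > 0" using assms(1) s by (simp_all add: add_pos_nonneg)
    show ?thesis using nn_integral_beta_prime[OF p] unfolding e .
  qed
  also have "(ennreal ?D * ennreal ?C) * \<dots> = ennreal (?D * (Gamma (b + ?d / 2 + 1) * Gamma (s - ?d - b - 1) / Gamma (s - ?d / 2)) * ?C)"
  proof -
    have "Gamma (b + ?d / 2 + 1) > 0" "Gamma (s - ?d - b - 1) > 0"
      using assms(1) s by (auto intro!: Gamma_real_pos add_pos_nonneg)
    then have q: "Gamma (b + ?d / 2 + 1) * Gamma (s - ?d - b - 1) / Gamma (s - ?d / 2) \<ge> 0" using G by simp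
    show ?thesis
      unfolding ennreal_mult'[OF mult_nonneg_nonneg[OF less_imp_le[OF D] q]] ennreal_mult'[OF less_imp_le[OF D]]
      by (simp only: mult_ac)
  qed
  also have "?D * (Gamma (b + ?d / 2 + 1) * Gamma (s - ?d - b - 1) / Gamma (s - ?d / 2)) * ?C = siegel_y_const (card (insert k I)) s b"
    using insert.hyps G by (simp add: field_simps)
  finally show ?case .
qed

section \<open>Closed form of the constant\<close>

text \<open>The first argument drops by 1/2 with each step in d, exactly as in the recursion. At d =
  n it is 2a - (n + 1)/2, the exponent left over by the real parts; the second one, a - n - 1,
  combines (det y)^a with the density of dv.\<close>

lemma siegel_y_const_closed:
  "siegel_y_const d (2 * a - real n + (real d - 1) / 2) (a - real n - 1) =
    (\<Prod>i<d. pi powr (real i / 2) * Gamma (a - real n + real i / 2) * Gamma (a - real i / 2) / Gamma (2 * a - real n + real i / 2))"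
proof (induction d)
  case (Suc d)
  have e: "2 * a - real n + (real (Suc d) - 1) / 2 - 1 / 2 = 2 * a - real n + (real d - 1) / 2"
    "a - real n - 1 + real d / 2 + 1 = a - real n + real d / 2"
    "2 * a - real n + (real (Suc d) - 1) / 2 - real d - (a - real n - 1) - 1 = a - real d / 2"
    "2 * a - real n + (real (Suc d) - 1) / 2 = 2 * a - real n + real d / 2"
    by (simp_all add: field_simps)
  show ?case
    unfolding siegel_y_const.simps(2) e(1-3) Suc.IH unfolding e(4) by simp
qed simp

text \<open>This and the next three are rearrangements stated for variables, so that field
  arithmetic need not act on the long Gamma products which they stand for.\<close>

lemma const_rearrange1: "q \<noteq> 0 \<Longrightarrow> (c * o' / g * p / q) * (d * r * q / h) = c * d * (o' * p * r / (g * h))" for c :: real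
  by (simp add: field_simps)

lemma const_rearrange2: "o' \<noteq> 0 \<Longrightarrow> p \<noteq> 0 \<Longrightarrow> q \<noteq> 0 \<Longrightarrow> z \<noteq> 0 \<Longrightarrow> o' * p * r / (o' * (z * (p * q))) = r / q / z" for r :: real
  by (simp add: field_simps)

lemma const_rearrange3: "u * (c * d * (r / q / z)) = u * (c * d / z) * (r / q)" for r :: real
  by (simp add: mult.commute)

lemma const_rearrange4: "a * s * b / (z / s) = a * b * (s * s) * (1 / z)" for a :: real
  by simp

lemma prod_split_even_odd:
  "(\<Prod>j=1..2 * n. f j) = (\<Prod>i<n. f (2 * i + 1)) * (\<Prod>i<n. f (2 * i + 2))" for f :: "nat \<Rightarrow> 'a::comm_monoid_mult"
  by (induction n) (simp_all add: mult_ac)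

text \<open>The denominators together run over \<open>\<Gamma>(2a - j/2)\<close> for \<open>1 \<le> j \<le> 2n\<close>; those with odd \<open>j\<close> cancel and
  the duplication formula applies to the others.\<close>

lemma siegel_const_product:
  assumes a: "a > real n"
  shows "2 powr (2 * a * real n) * (siegel_x_const n a * siegel_y_const n (2 * a - (real n + 1) / 2) (a - real n - 1))
    = 2 powr (real (n * (n + 3)) / 2) * pi powr (real (n * (n + 1)) / 2) *
     (\<Prod>r=1..n. Gamma (a - (real n + real r) / 2) / Gamma (a - (real r - 1) / 2))"
proof -
  have gp: "Gamma x > 0" if "x > 0" for x :: real using that by (rule Gamma_real_pos)
  let ?g = "\<lambda>j. Gamma (2 * a - real j / 2)"
  have X: "siegel_x_const n a = (\<Prod>i<n. pi powr (real i / 2) * sqrt pi) * (\<Prod>i<n. ?g (2 * i + 1)) / (\<Prod>i<n. ?g (i + 1))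
      * (\<Prod>i<n. Gamma (a - (real i + 1) / 2)) / (\<Prod>i<n. Gamma (a - real i / 2))"
  proof -
    have 1: "(\<Prod>i<n. Gamma (2 * a - real i - 1 / 2)) = (\<Prod>i<n. ?g (2 * i + 1))"
      by (intro prod.cong refl arg_cong[where f = Gamma]) (simp add: field_simps)
    have 2: "(\<Prod>i<n. Gamma (2 * a - (real i + 1) / 2)) = (\<Prod>i<n. ?g (i + 1))"
      by (intro prod.cong refl arg_cong[where f = Gamma]) simp
    show ?thesis unfolding siegel_x_const_def prod.distrib prod_dividef 1 2 by simp
  qed
  have Y: "siegel_y_const n (2 * a - (real n + 1) / 2) (a - real n - 1) = (\<Prod>i<n. pi powr (real i / 2)) *
     (\<Prod>i<n. Gamma (a - real n + real i / 2)) * (\<Prod>i<n. Gamma (a - real i / 2)) / (\<Prod>i<n. ?g (2 * n - i))"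
  proof -
    have e: "2 * a - (real n + 1) / 2 = 2 * a - real n + (real n - 1) / 2" by (simp add: field_simps)
    have "(\<Prod>i<n. Gamma (2 * a - real n + real i / 2)) = (\<Prod>i<n. ?g (2 * n - i))"
      by (intro prod.cong arg_cong[where f = Gamma]) (auto simp: of_nat_diff field_simps)
    then show ?thesis unfolding e siegel_y_const_closed by (simp add: prod.distrib prod_dividef)
  qed
  have all: "(\<Prod>i<n. ?g (i + 1)) * (\<Prod>i<n. ?g (2 * n - i)) = (\<Prod>j=1..2 * n. ?g j)"
  proof -
    have 1: "(\<Prod>i<n. ?g (i + 1)) = (\<Prod>j=1..n. ?g j)"
      by (rule prod.reindex_bij_witness[of _ "\<lambda>j. j - 1" "\<lambda>i. i + 1"]) auto
    have 2: "(\<Prod>i<n. ?g (2 * n - i)) = (\<Prod>j=n+1..2 * n. ?g j)"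
      by (rule prod.reindex_bij_witness[of _ "\<lambda>j. 2 * n - j" "\<lambda>i. 2 * n - i"]) auto
    show ?thesis unfolding 1 2 unfolding mult_2 by (rule prod.ub_add_nat[symmetric]) simp
  qed
  have dup: "?g (2 * i + 2) = 2 powr (2 * a - real i - 2) / sqrt pi * (Gamma (a - (real i + 1) / 2) * Gamma (a - real i / 2))" if "i < n" for i
  proof -
    \<comment> \<open>At this x, 2x = 2a - (2i + 2)/2 is the argument with even index, and x and x +
      1/2 are the arguments a - (i + 1)/2 and a - i/2 of the other Gamma factors.\<close>
    define x where "x = a - (real i + 1) / 2"
    have i: "real i + 1 \<le> real n" using that by linarith
    then have x: "x > 0" using a by (simp add: x_def)
    have "Gamma x * Gamma (x + 1/2) = exp ((1 - 2 * x) * ln 2) * sqrt pi * Gamma (2 * x)"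
    proof -
      have "of_real y \<notin> (\<int>\<^sub>\<le>\<^sub>0 :: complex set)" if "y > 0" for y :: real
      proof
        assume "of_real y \<in> (\<int>\<^sub>\<le>\<^sub>0 :: complex set)"
        then obtain n :: nat where "complex_of_real y = - of_nat n" by (elim nonpos_Ints_cases')
        then have "y = - real n" by (metis of_real_eq_iff of_real_minus of_real_of_nat_eq)
        then show False using that by simp
      qed
      from Gamma_legendre_duplication[of "of_real x"] this[of x] this[of "x + 1/2"] x
      have "Gamma (complex_of_real x) * Gamma (complex_of_real (x + 1/2)) = exp (complex_of_real ((1 - 2 * x) * ln 2)) * of_real (sqrt pi) * Gamma (complex_of_real (2 * x))"
        by simp
      then show ?thesis unfolding Gamma_complex_of_real exp_of_real of_real_mult[symmetric] of_real_eq_iff .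
    qed
    also have "exp ((1 - 2 * x) * ln 2) = 2 powr (1 - 2 * x)" by (simp add: powr_def)
    finally have h: "Gamma (2 * x) = 2 powr (2 * x - 1) / sqrt pi * (Gamma x * Gamma (x + 1/2))"
      by (simp add: powr_diff field_simps)
    have e: "2 * x = 2 * a - real (2 * i + 2) / 2" "x + 1/2 = a - real i / 2"
      "2 * a - real (2 * i + 2) / 2 - 1 = 2 * a - real i - 2"
      by (simp_all add: x_def field_simps)
    show ?thesis using h unfolding e unfolding e x_def .
  qed
  let ?P = "\<Prod>i<n. Gamma (a - (real i + 1) / 2)" and ?Q = "\<Prod>i<n. Gamma (a - real i / 2)"
  let ?O = "\<Prod>i<n. ?g (2 * i + 1)" and ?E = "\<Prod>i<n. ?g (2 * i + 2)"
  let ?R = "\<Prod>i<n. Gamma (a - real n + real i / 2)"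
  have P: "?P > 0" "?Q > 0" "?O > 0"
    using a by (auto intro!: prod_pos gp)
  have E: "?E = (\<Prod>i<n. 2 powr (2 * a - real i - 2) / sqrt pi) * (?P * ?Q)"
    unfolding prod.distrib[symmetric] by (rule prod.cong) (auto simp only: dup lessThan_iff)
  have Z: "(\<Prod>i<n. 2 powr (2 * a - real i - 2) / sqrt pi) > 0" by (intro prod_pos) simp
  have "siegel_x_const n a * siegel_y_const n (2 * a - (real n + 1) / 2) (a - real n - 1)
     = (\<Prod>i<n. pi powr (real i / 2) * sqrt pi) * (\<Prod>i<n. pi powr (real i / 2)) * (?O * ?P * ?R / ((\<Prod>i<n. ?g (i + 1)) * (\<Prod>i<n. ?g (2 * n - i))))"
    unfolding X Y by (rule const_rearrange1) (use P in linarith)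
  also have "?O * ?P * ?R / ((\<Prod>i<n. ?g (i + 1)) * (\<Prod>i<n. ?g (2 * n - i))) = ?R / ?Q / (\<Prod>i<n. 2 powr (2 * a - real i - 2) / sqrt pi)"
    unfolding all prod_split_even_odd E by (rule const_rearrange2) (use P Z in linarith)+
  finally have *: "siegel_x_const n a * siegel_y_const n (2 * a - (real n + 1) / 2) (a - real n - 1)
     = (\<Prod>i<n. pi powr (real i / 2) * sqrt pi) * (\<Prod>i<n. pi powr (real i / 2)) * (?R / ?Q / (\<Prod>i<n. 2 powr (2 * a - real i - 2) / sqrt pi))" .
  have "2 powr (2 * a * real n) * (siegel_x_const n a * siegel_y_const n (2 * a - (real n + 1) / 2) (a - real n - 1))
    = 2 powr (2 * a * real n) * ((\<Prod>i<n. pi powr (real i / 2) * sqrt pi) * (\<Prod>i<n. pi powr (real i / 2)) / (\<Prod>i<n. 2 powr (2 * a - real i - 2) / sqrt pi)) * (?R / ?Q)"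
    unfolding * by (rule const_rearrange3)
  also have "2 powr (2 * a * real n) * ((\<Prod>i<n. pi powr (real i / 2) * sqrt pi) * (\<Prod>i<n. pi powr (real i / 2)) / (\<Prod>i<n. 2 powr (2 * a - real i - 2) / sqrt pi))
     = 2 powr (real (n * (n + 3)) / 2) * pi powr (real (n * (n + 1)) / 2)"
  proof (induction n)
    case (Suc n)
    let ?u = "\<lambda>n. (\<Prod>i<n. pi powr (real i / 2) * sqrt pi) * (\<Prod>i<n. pi powr (real i / 2)) / (\<Prod>i<n. 2 powr (2 * a - real i - 2) / sqrt pi)"
    have "?u (Suc n) = ?u n * (pi powr (real n / 2) * sqrt pi * pi powr (real n / 2) / (2 powr (2 * a - real n - 2) / sqrt pi))"
      by simp
    also have "pi powr (real n / 2) * sqrt pi * pi powr (real n / 2) / (2 powr (2 * a - real n - 2) / sqrt pi) = pi powr (real n + 1) * 2 powr (- (2 * a - real n - 2))"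
    proof -
      have "pi powr (real n / 2) * pi powr (real n / 2) * (sqrt pi * sqrt pi) = pi powr (real n + 1)"
        by (simp flip: powr_add) (simp add: powr_add)
      then show ?thesis unfolding const_rearrange4 powr_minus_divide by (rule arg_cong)
    qed
    finally have "2 powr (2 * a * real (Suc n)) * ?u (Suc n) = 2 powr (2 * a * real n) * ?u n * (2 powr (2 * a) * 2 powr (- (2 * a - real n - 2)) * pi powr (real n + 1))"
      by (simp add: distrib_left powr_add mult_ac)
    also have "\<dots> = 2 powr (real (n * (n + 3)) / 2) * pi powr (real (n * (n + 1)) / 2) * (2 powr (real n + 2) * pi powr (real n + 1))"
      unfolding Suc.IH by (simp add: add.commute flip: powr_add)
    also have "\<dots> = 2 powr (real (n * (n + 3)) / 2 + (real n + 2)) * pi powr (real (n * (n + 1)) / 2 + (real n + 1))"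
      by (simp only: powr_add mult_ac)
    also have "real (n * (n + 3)) / 2 + (real n + 2) = real (Suc n * (Suc n + 3)) / 2" by (simp add: field_simps)
    also have "real (n * (n + 1)) / 2 + (real n + 1) = real (Suc n * (Suc n + 1)) / 2" by (simp add: field_simps)
    finally show ?case .
  qed simp
  also have "?R / ?Q = (\<Prod>r=1..n. Gamma (a - (real n + real r) / 2) / Gamma (a - (real r - 1) / 2))"
  proof -
    have 1: "?R = (\<Prod>r=1..n. Gamma (a - (real n + real r) / 2))"
      by (rule prod.reindex_bij_witness[of _ "\<lambda>r. n - r" "\<lambda>i. n - i"]) (auto simp: of_nat_diff field_simps)
    have 2: "?Q = (\<Prod>r=1..n. Gamma (a - (real r - 1) / 2))"
      by (rule prod.reindex_bij_witness[of _ "\<lambda>r. r - 1" "\<lambda>i. i + 1"]) (auto simp: of_nat_diff)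
    show ?thesis unfolding 1 2 by (simp add: prod_dividef)
  qed
  finally show ?thesis .
qed

section \<open>Differential calculus of matrices\<close>

lemma bounded_bilinear_matrix_mult:
  "bounded_bilinear ((**) :: ('a::{real_normed_field, euclidean_space}, 'm::finite) smat \<Rightarrow> ('a, 'm) smat \<Rightarrow> ('a, 'm) smat)"
  unfolding bilinear_conv_bounded_bilinear[symmetric] bilinear_def
  by (auto intro!: linearI simp: matrix_mul_ring_simps matrix_scalar_ac scalar_matrix_assoc)

interpretation matmul: bounded_bilinear "(**) :: ('a::{real_normed_field, euclidean_space}, 'm::finite) smat \<Rightarrow> ('a, 'm) smat \<Rightarrow> ('a, 'm) smat"
  by (rule bounded_bilinear_matrix_mult)

lemma bounded_bilinear_matrix_vector:
  "bounded_bilinear ((*v) :: (real, 'm::finite) smat \<Rightarrow> (real, 'm) vec \<Rightarrow> (real, 'm) vec)"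
  unfolding bilinear_conv_bounded_bilinear[symmetric] bilinear_def
  by (auto intro!: linearI simp: algebra_simps scaleR_matrix_vector_assoc[symmetric])

lemma continuous_on_det:
  fixes f :: "'x::topological_space \<Rightarrow> ('a::real_normed_field, 'm::finite) smat"
  assumes "continuous_on S f"
  shows "continuous_on S (\<lambda>x. det (f x))"
  unfolding det_def by (intro continuous_intros assms)

lemma continuous_on_matrix_mult:
  fixes f g :: "'x::topological_space \<Rightarrow> ('a::{real_normed_field, euclidean_space}, 'm::finite) smat"
  assumes "continuous_on S f" "continuous_on S g"
  shows "continuous_on S (\<lambda>x. f x ** g x)"
  by (rule matmul.continuous_on[OF assms])

lemma continuous_on_matrix:
  fixes f :: "'x::topological_space \<Rightarrow> 'm::finite \<Rightarrow> 'k::finite \<Rightarrow> 'a::topological_space"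
  assumes "\<And>i j. continuous_on S (\<lambda>x. f x i j)"
  shows "continuous_on S (\<lambda>x. \<chi> i j. f x i j)"
  by (intro continuous_on_vec_lambda assms)

text \<open>The entries of the inverse are quotients of determinants, from which continuity of
  inversion can be read off.\<close>

lemma matrix_inv_cramer:
  fixes A :: "('a::field, 'm::finite) smat"
  assumes "det A \<noteq> 0"
  shows "matrix_inv A = (\<chi> k j. det (\<chi> i l. if l = k then if i = j then 1 else 0 else A $ i $ l) / det A)"
proof -
  have inv: "invertible A" using assms by (simp add: invertible_det_nz)
  have "matrix_inv A $ k $ j = det (\<chi> i l. if l = k then if i = j then 1 else 0 else A $ i $ l) / det A" for k j
  proof -
    have "A *v (matrix_inv A *v axis j 1) = axis j 1"
      by (simp add: matrix_vector_mul_assoc matrix_inv_mult[OF inv])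
    then have "matrix_inv A *v axis j 1 = (\<chi> k. det (\<chi> i l. if l = k then axis j 1 $ i else A $ i $ l) / det A)"
      using cramer[OF assms] by blast
    then have 1: "(matrix_inv A *v axis j 1) $ k = det (\<chi> i l. if l = k then axis j 1 $ i else A $ i $ l) / det A"
      by simp
    have 2: "(matrix_inv A *v axis j 1) $ k = matrix_inv A $ k $ j"
      unfolding matrix_vector_mult_def axis_def by (simp add: if_distrib[of "\<lambda>x. _ * x"] cong: if_cong)
    have 3: "axis j 1 $ i = (if i = j then 1 else 0 :: 'a)" for i by (simp add: axis_def)
    show ?thesis using 1 unfolding 2 3 .
  qed
  then show ?thesis by (simp add: vec_eq_iff)
qed

lemma continuous_on_matrix_inv:
  fixes f :: "'x::topological_space \<Rightarrow> ('a::{real_normed_field}, 'm::finite) smat"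
  assumes "continuous_on S f" "\<And>x. x \<in> S \<Longrightarrow> invertible (f x)"
  shows "continuous_on S (\<lambda>x. matrix_inv (f x))"
proof -
  have d: "det (f x) \<noteq> 0" if "x \<in> S" for x using assms(2)[OF that] by (simp add: invertible_det_nz)
  have e: "continuous_on S (\<lambda>x. if l = k then if i = j then 1 else 0 else f x $ i $ l)" for i j k l
    using assms(1) by (cases "l = k") (auto intro!: continuous_intros)
  have "continuous_on S (\<lambda>x. \<chi> k j. det (\<chi> i l. if l = k then if i = j then 1 else 0 else f x $ i $ l) / det (f x))"
    by (intro continuous_on_matrix continuous_on_divide continuous_on_det e assms(1)) (use d in auto)
  then show ?thesis
    by (rule continuous_on_eq) (use d in \<open>simp add: matrix_inv_cramer\<close>)
qed

lemma open_invertible: "open {A :: ('a::real_normed_field, 'm::finite) smat. invertible A}"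
proof -
  have "continuous_on UNIV (\<lambda>A :: ('a, 'm) smat. det A)" by (intro continuous_on_det continuous_on_id)
  then have "open ((\<lambda>A :: ('a, 'm) smat. det A) -` (- {0}))" by (rule open_vimage[rotated]) auto
  moreover have "(\<lambda>A :: ('a, 'm) smat. det A) -` (- {0}) = {A. invertible A}" by (auto simp: invertible_det_nz)
  ultimately show ?thesis by simp
qed

text \<open>From X^-1 - A^-1 = -X^-1 (X - A) A^-1 the error of the linear approximation is -(X^-1 -
  A^-1) (X - A) A^-1, which is small compared with X - A because inversion is continuous.\<close>

lemma has_derivative_matrix_inv:
  fixes A :: "('a::{real_normed_field, euclidean_space}, 'm::finite) smat"
  assumes A: "invertible A"
  shows "(matrix_inv has_derivative (\<lambda>H. - (matrix_inv A ** H ** matrix_inv A))) (at A within S)"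
proof -
  have bl: "bounded_linear (\<lambda>H. - (matrix_inv A ** H ** matrix_inv A))"
    by (intro bounded_linear_minus matmul.bounded_linear_left[THEN bounded_linear_compose] matmul.bounded_linear_right)
  obtain K where K: "K > 0" "norm (X ** Y) \<le> norm X * norm Y * K" for X Y :: "('a, 'm) smat"
    using matmul.pos_bounded by blast
  have cont: "(matrix_inv \<longlongrightarrow> matrix_inv A) (at A)"
  proof -
    have "continuous_on {A :: ('a, 'm) smat. invertible A} matrix_inv"
      by (rule continuous_on_matrix_inv[OF continuous_on_id]) auto
    then have "isCont matrix_inv A"
      unfolding continuous_on_eq_continuous_at[OF open_invertible] using A by blast
    then show ?thesis by (rule isContD)
  qed
  have "((\<lambda>X. (1 / norm (X - A)) *\<^sub>R (matrix_inv X - (matrix_inv A + - (matrix_inv A ** (X - A) ** matrix_inv A)))) \<longlongrightarrow> 0) (at A)"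
  proof (rule Lim_null_comparison)
    have ev: "eventually (\<lambda>X. invertible X) (at A)"
      using A open_invertible eventually_at_topological by blast
    show "eventually (\<lambda>X. norm ((1 / norm (X - A)) *\<^sub>R (matrix_inv X - (matrix_inv A + - (matrix_inv A ** (X - A) ** matrix_inv A))))
        \<le> norm (matrix_inv X - matrix_inv A) * (K * norm (matrix_inv A) * K)) (at A)"
      using ev
    proof eventually_elim
      case (elim X)
      let ?I = "matrix_inv X - matrix_inv A"
      have 1: "?I = - (matrix_inv X ** (X - A) ** matrix_inv A)"
        using matrix_inv_mult[OF elim] matrix_inv_mult[OF A]
        by (simp add: matrix_mul_ring_simps)
      have eq: "matrix_inv X - (matrix_inv A + - (matrix_inv A ** (X - A) ** matrix_inv A)) = - (?I ** (X - A) ** matrix_inv A)"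
        using 1 by (simp add: matrix_mul_ring_simps algebra_simps)
      have "norm (?I ** (X - A) ** matrix_inv A) \<le> norm (?I ** (X - A)) * norm (matrix_inv A) * K" by (rule K(2))
      also have "\<dots> \<le> (norm ?I * norm (X - A) * K) * norm (matrix_inv A) * K"
        by (intro mult_right_mono K(2)) (use K(1) in auto)
      finally have *: "norm (?I ** (X - A) ** matrix_inv A) \<le> norm (X - A) * (norm ?I * (K * norm (matrix_inv A) * K))"
        by (simp add: mult_ac)
      show ?case unfolding eq using * by (cases "X = A") (auto simp: divide_simps mult_ac)
    qed
    have "((\<lambda>X. norm (matrix_inv X - matrix_inv A)) \<longlongrightarrow> 0) (at A)"
      by (rule tendsto_norm_zero[OF LIM_zero[OF cont]])
    then show "((\<lambda>X. norm (matrix_inv X - matrix_inv A) * (K * norm (matrix_inv A) * K)) \<longlongrightarrow> 0) (at A)"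
      by (rule tendsto_mult_left_zero)
  qed
  then have "(matrix_inv has_derivative (\<lambda>H. - (matrix_inv A ** H ** matrix_inv A))) (at A)"
    using bl unfolding has_derivative_at2 by blast
  then show ?thesis by (rule has_derivative_at_withinI)
qed

text \<open>A permutation other than the identity moves at least two indices, so even after one
  factor has been differentiated its term still contains an off-diagonal entry of the identity
  matrix. The identity permutation gives the trace.\<close>

lemma has_derivative_det_at_1:
  "(det has_derivative trace) (at (mat 1 :: ('a::real_normed_field, 'm::finite) smat) within S)"
proof -
  let ?D = "\<lambda>H :: ('a, 'm) smat. \<Sum>p | p permutes UNIV. of_int (sign p) *
      (\<Sum>i\<in>UNIV. H $ i $ p i * (\<Prod>j\<in>UNIV - {i}. (mat 1 :: ('a, 'm) smat) $ j $ p j))"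
  have "((\<lambda>A. \<Sum>p | p permutes UNIV. of_int (sign p) * (\<Prod>i\<in>UNIV. A $ i $ p i)) has_derivative ?D)
     (at (mat 1 :: ('a, 'm) smat) within S)"
    by (intro has_derivative_sum has_derivative_mult_right has_derivative_prod)
      (auto intro!: bounded_linear_imp_has_derivative bounded_linear_compose[OF bounded_linear_vec_nth bounded_linear_vec_nth])
  moreover have "?D H = trace H" for H
  proof -
    have "(\<Sum>i\<in>UNIV. H $ i $ p i * (\<Prod>j\<in>UNIV - {i}. (mat 1 :: ('a, 'm) smat) $ j $ p j)) = 0"
      if p: "p permutes UNIV" "p \<noteq> id" for p
    proof (rule sum.neutral, rule ballI)
      fix i :: 'm
      have "\<exists>j. j \<noteq> i \<and> p j \<noteq> j"
      proof (rule ccontr)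
        assume "\<nexists>j. j \<noteq> i \<and> p j \<noteq> j"
        then have *: "p j = j" if "j \<noteq> i" for j using that by blast
        then have "p i = i" using p(1) by (metis permutes_def)
        then show False using * p(2) by (metis eq_id_iff)
      qed
      then obtain j where "j \<noteq> i" "p j \<noteq> j" by blast
      then have "(\<Prod>j\<in>UNIV - {i}. (mat 1 :: ('a, 'm) smat) $ j $ p j) = 0"
        by (intro prod_zero) (auto simp: mat_def intro!: bexI[of _ j])
      then show "H $ i $ p i * (\<Prod>j\<in>UNIV - {i}. (mat 1 :: ('a, 'm) smat) $ j $ p j) = 0" by simp
    qed
    then have "?D H = (\<Sum>p\<in>{id}. of_int (sign p) *
      (\<Sum>i\<in>UNIV. H $ i $ p i * (\<Prod>j\<in>UNIV - {i}. (mat 1 :: ('a, 'm) smat) $ j $ p j)))"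
      by (intro sum.mono_neutral_right) (auto simp: permutes_id)
    then show ?thesis by (simp add: sign_id mat_def trace_def)
  qed
  ultimately show ?thesis unfolding det_def[abs_def] by simp
qed

section \<open>Symmetric matrices and positive square roots\<close>

text \<open>The vector v maximizes the quadratic form on the unit sphere of V. If the component w of
  A v orthogonal to v were nonzero, a small step from v in the direction of w, which stays in V,
  would raise the Rayleigh quotient to first order.\<close>

lemma symmetric_eigenvector_in_subspace:
  fixes A :: "(real, 'm::finite) smat"
  assumes sym: "transpose A = A" and V: "subspace V" and inv: "\<And>v. v \<in> V \<Longrightarrow> A *v v \<in> V" and ne: "V \<noteq> {0}"
  obtains v where "v \<in> V" "norm v = 1" "A *v v = (v \<bullet> (A *v v)) *\<^sub>R v"
proof -
  have symA: "x \<bullet> (A *v y) = y \<bullet> (A *v x)" for x y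
    by (metis sym dot_lmul_matrix inner_commute transpose_matrix_vector)
  have "compact (V \<inter> sphere 0 1)" using closed_subspace[OF V] by (intro closed_Int_compact) auto
  moreover obtain u where "u \<in> V" "u \<noteq> 0" using ne subspace_0[OF V] by auto
  then have "(1 / norm u) *\<^sub>R u \<in> V \<inter> sphere 0 1" using V by (auto simp: subspace_scale)
  then have "V \<inter> sphere 0 1 \<noteq> {}" by blast
  moreover have "continuous_on (V \<inter> sphere 0 1) (\<lambda>v. v \<bullet> (A *v v))"
    by (intro continuous_intros linear_continuous_on_compose[OF continuous_on_id] matrix_vector_mul_linear)
  ultimately obtain v where v0: "v \<in> V \<inter> sphere 0 1" and max0: "\<forall>w\<in>V \<inter> sphere 0 1. w \<bullet> (A *v w) \<le> v \<bullet> (A *v v)"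
    using continuous_attains_sup[of "V \<inter> sphere 0 1" "\<lambda>v. v \<bullet> (A *v v)"] by blast
  have v: "v \<in> V" "norm v = 1" using v0 by auto
  have max: "w \<bullet> (A *v w) \<le> v \<bullet> (A *v v)" if "w \<in> V" "norm w = 1" for w
    using max0 that by simp
  define l where "l = v \<bullet> (A *v v)"
  have max': "w \<bullet> (A *v w) \<le> l * (w \<bullet> w)" if "w \<in> V" for w
  proof (cases "w = 0")
    case False
    have "((1 / norm w) *\<^sub>R w) \<bullet> (A *v ((1 / norm w) *\<^sub>R w)) \<le> l"
      unfolding l_def using False V that by (intro max) (auto simp: subspace_scale)
    then have "(w \<bullet> (A *v w)) / (norm w)\<^sup>2 \<le> l"
      by (simp add: matrix_vector_mult_scaleR power2_eq_square divide_inverse mult_ac)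
    then show ?thesis using False by (simp add: divide_le_eq power2_norm_eq_inner)
  qed simp
  define w where "w = A *v v - l *\<^sub>R v"
  have w: "w \<in> V" using v inv V by (simp add: w_def subspace_diff subspace_scale)
  have vw: "v \<bullet> w = 0" using v(2) by (simp add: w_def inner_diff_right l_def flip: power2_norm_eq_inner)
  have wA: "w \<bullet> (A *v v) = w \<bullet> w"
    using vw by (simp add: w_def inner_diff_right inner_diff_left inner_commute)
  have "w \<bullet> w = 0"
  proof (rule ccontr)
    assume "w \<bullet> w \<noteq> 0"
    then have p: "w \<bullet> w > 0" by simp
    define c where "c = l * (w \<bullet> w) - w \<bullet> (A *v w)"
    have c: "c \<ge> 0" using max'[OF w] by (simp add: c_def)
    \<comment> \<open>The step t yields a gain 2 t (w . w) against a loss t^2 c, and this t makes t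
      c at most w . w. Adding 1 in the denominator covers c = 0.\<close>
    define t where "t = (w \<bullet> w) / (c + 1)"
    have t: "t > 0" using p c by (simp add: t_def)
    have le: "(v + t *\<^sub>R w) \<bullet> (A *v (v + t *\<^sub>R w)) \<le> l * ((v + t *\<^sub>R w) \<bullet> (v + t *\<^sub>R w))"
      using v w V by (intro max') (auto simp: subspace_add subspace_scale)
    have e1: "(v + t *\<^sub>R w) \<bullet> (A *v (v + t *\<^sub>R w)) = l + 2 * t * (w \<bullet> w) + t * t * (w \<bullet> (A *v w))"
      using symA[of v w] wA by (simp add: matrix_vector_right_distrib matrix_vector_mult_scaleR inner_add_left inner_add_right l_def algebra_simps)
    have e2: "(v + t *\<^sub>R w) \<bullet> (v + t *\<^sub>R w) = 1 + t * t * (w \<bullet> w)"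
      using vw v(2) by (simp add: inner_add_left inner_add_right inner_commute norm_eq_1 algebra_simps)
    have "2 * t * (w \<bullet> w) \<le> t * t * c" using le unfolding e1 e2 by (simp add: c_def algebra_simps)
    then have "2 * (w \<bullet> w) \<le> t * c" using t by (simp add: mult.assoc)
    also have "t * c \<le> w \<bullet> w" using c p by (simp add: t_def divide_le_eq algebra_simps)
    finally show False using p by simp
  qed
  then have "A *v v = l *\<^sub>R v" by (simp add: w_def)
  then show thesis using that v unfolding l_def by blast
qed

lemma symmetric_orthonormal_eigenbasis_subspace:
  fixes A :: "(real, 'm::finite) smat"
  assumes sym: "transpose A = A"
  shows "subspace V \<Longrightarrow> (\<And>v. v \<in> V \<Longrightarrow> A *v v \<in> V) \<Longrightarrow>
    \<exists>B. finite B \<and> B \<subseteq> V \<and> V \<subseteq> span B \<and> pairwise orthogonal B \<and> (\<forall>b\<in>B. norm b = 1 \<and> A *v b = (b \<bullet> (A *v b)) *\<^sub>R b)"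
proof (induction "dim V" arbitrary: V rule: less_induct)
  case less
  show ?case
  proof (cases "V = {0}")
    case True
    then show ?thesis by (intro exI[of _ "{}"]) auto
  next
    case False
    obtain v where v: "v \<in> V" "norm v = 1" and ev: "A *v v = (v \<bullet> (A *v v)) *\<^sub>R v"
      using symmetric_eigenvector_in_subspace[OF sym less.prems False] by blast
    let ?W = "{w \<in> V. v \<bullet> w = 0}"
    have W: "subspace ?W" using less.prems(1) by (auto simp: subspace_def inner_add_right)
    have Winv: "A *v w \<in> ?W" if "w \<in> ?W" for w
    proof -
      have "v \<bullet> (A *v w) = (A *v v) \<bullet> w"
        by (metis sym dot_lmul_matrix transpose_matrix_vector)
      also have "\<dots> = 0" using that by (subst ev) simp
      finally show ?thesis using that less.prems(2) by simp
    qed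
    have "v \<notin> ?W" using v(2) by (auto simp: norm_eq_1)
    then have "?W \<subset> V" using v(1) by blast
    then have "span ?W \<subset> span V"
      unfolding span_eq_iff[THEN iffD2, OF W] span_eq_iff[THEN iffD2, OF less.prems(1)] .
    then have "dim ?W < dim V" by (rule dim_psubset)
    from less.hyps[OF this W Winv] obtain B where B: "finite B" "B \<subseteq> ?W" "?W \<subseteq> span B" "pairwise orthogonal B"
      "\<forall>b\<in>B. norm b = 1 \<and> A *v b = (b \<bullet> (A *v b)) *\<^sub>R b" by blast
    have "x \<in> span (insert v B)" if "x \<in> V" for x
    proof -
      have "x - (v \<bullet> x) *\<^sub>R v \<in> ?W"
        using that v less.prems(1) by (auto simp: subspace_diff subspace_scale inner_diff_right norm_eq_1)
      then have "x - (v \<bullet> x) *\<^sub>R v \<in> span B" using B(3) by blast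
      then show ?thesis by (auto simp: span_insert)
    qed
    moreover have "pairwise orthogonal (insert v B)"
      using B(2,4) by (auto simp: pairwise_insert orthogonal_def inner_commute)
    ultimately show ?thesis using B v ev by (intro exI[of _ "insert v B"]) auto
  qed
qed

lemma symmetric_orthonormal_eigenbasis:
  fixes A :: "(real, 'm::finite) smat"
  assumes "transpose A = A"
  obtains B where "finite B" "span B = UNIV" "pairwise orthogonal B" "\<And>b. b \<in> B \<Longrightarrow> norm b = 1"
    "\<And>b. b \<in> B \<Longrightarrow> A *v b = (b \<bullet> (A *v b)) *\<^sub>R b"
  using symmetric_orthonormal_eigenbasis_subspace[OF assms subspace_UNIV] by auto

lemma matrix_eq_on_spanning:
  fixes A C :: "(real, 'm::finite) smat"
  assumes "span B = UNIV" "\<And>b. b \<in> B \<Longrightarrow> A *v b = C *v b"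
  shows "A = C"
proof -
  have "A *v x = C *v x" for x
    by (rule linear_eq_on_span[of "(*v) A" "(*v) C" B]) (use assms in auto)
  then show ?thesis by (simp add: matrix_eq)
qed

section \<open>Positive square roots and their derivative\<close>

definition spectral_mat :: "(real, 'm::finite) vec set \<Rightarrow> ((real, 'm) vec \<Rightarrow> real) \<Rightarrow> (real, 'm) smat" where
  "spectral_mat B l = (\<chi> i j. \<Sum>b\<in>B. l b * b $ i * b $ j)"

lemma spectral_mat_mult: "spectral_mat B l *v x = (\<Sum>b\<in>B. (l b * (b \<bullet> x)) *\<^sub>R b)"
proof -
  have "(\<Sum>j\<in>UNIV. (\<Sum>b\<in>B. l b * b $ i * b $ j) * x $ j) = (\<Sum>b\<in>B. l b * (\<Sum>j\<in>UNIV. b $ j * x $ j) * b $ i)" for i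
    unfolding sum_distrib_right sum_distrib_left by (subst sum.swap) (simp add: mult_ac)
  then show ?thesis
    by (simp add: vec_eq_iff matrix_vector_mult_def spectral_mat_def inner_vec_def)
qed

lemma spectral_mat_eigen:
  assumes "finite B" "pairwise orthogonal B" "\<And>b. b \<in> B \<Longrightarrow> norm b = 1" "c \<in> B"
  shows "spectral_mat B l *v c = l c *\<^sub>R c"
proof -
  have "(l b * (b \<bullet> c)) *\<^sub>R b = (if b = c then l c *\<^sub>R c else 0)" if "b \<in> B" for b
    using that assms by (auto simp: pairwise_def orthogonal_def norm_eq_1)
  then show ?thesis unfolding spectral_mat_mult using assms(1,4) by simp
qed

lemma spectral_mat_pos_def:
  assumes "finite B" "span B = UNIV" "\<And>b. b \<in> B \<Longrightarrow> l b > 0"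
  shows "pos_def (spectral_mat B l)"
  unfolding pos_def_def
proof (intro conjI allI impI)
  show "transpose (spectral_mat B l) = spectral_mat B l"
    by (simp add: spectral_mat_def transpose_def vec_eq_iff mult_ac)
  fix v :: "(real, 'a) vec" assume v: "v \<noteq> 0"
  have "\<exists>b\<in>B. b \<bullet> v \<noteq> 0"
  proof (rule ccontr)
    assume "\<not> (\<exists>b\<in>B. b \<bullet> v \<noteq> 0)"
    then have "B \<subseteq> {x. x \<bullet> v = 0}" by blast
    moreover have "subspace {x. x \<bullet> v = 0}" by (simp add: subspace_def inner_add_left)
    ultimately have "span B \<subseteq> {x. x \<bullet> v = 0}" by (rule span_minimal)
    then have "v \<in> {x. x \<bullet> v = 0}" using assms(2) by blast
    then show False using v by simp
  qed
  then obtain b where "b \<in> B" "b \<bullet> v \<noteq> 0" by blast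
  then have "0 < (\<Sum>b\<in>B. l b * (b \<bullet> v)\<^sup>2)"
    using assms by (intro sum_pos2[of B b]) (auto simp: less_imp_le)
  then show "v \<bullet> (spectral_mat B l *v v) > 0"
    unfolding spectral_mat_mult by (simp add: inner_sum_right inner_commute power2_eq_square mult_ac)
qed

lemma pos_def_sqrt_exists:
  assumes y: "pos_def y"
  shows "\<exists>s. pos_def s \<and> s ** s = y"
proof -
  have sym: "transpose y = y" using y by (simp add: pos_def_def)
  obtain B where B: "finite B" "span B = UNIV" "pairwise orthogonal B" "\<And>b. b \<in> B \<Longrightarrow> norm b = 1"
    "\<And>b. b \<in> B \<Longrightarrow> y *v b = (b \<bullet> (y *v b)) *\<^sub>R b"
    using symmetric_orthonormal_eigenbasis[OF sym] by blast
  have pos: "b \<bullet> (y *v b) > 0" if "b \<in> B" for b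
    using y B(4)[OF that] unfolding pos_def_def by (metis norm_zero zero_neq_one)
  let ?s = "spectral_mat B (\<lambda>b. sqrt (b \<bullet> (y *v b)))"
  have "?s ** ?s = y"
  proof (rule matrix_eq_on_spanning[OF B(2)])
    fix b assume b: "b \<in> B"
    have "(?s ** ?s) *v b = ?s *v (?s *v b)" by (simp add: matrix_vector_mul_assoc)
    also have "\<dots> = (sqrt (b \<bullet> (y *v b)) * sqrt (b \<bullet> (y *v b))) *\<^sub>R b"
      by (simp add: spectral_mat_eigen[OF B(1,3,4) b] matrix_vector_mult_scaleR)
    also have "\<dots> = y *v b" using pos[OF b] B(5)[OF b] by simp
    finally show "(?s ** ?s) *v b = y *v b" .
  qed
  moreover have "pos_def ?s" by (rule spectral_mat_pos_def[OF B(1,2)]) (simp add: pos)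
  ultimately show ?thesis by blast
qed

lemma pos_def_coercive:
  assumes "pos_def s"
  obtains m where "m > 0" "\<And>v. norm v = 1 \<Longrightarrow> v \<bullet> (s *v v) \<ge> m"
proof -
  have "continuous_on (sphere 0 1) (\<lambda>v. v \<bullet> (s *v v))"
    by (intro continuous_intros linear_continuous_on_compose[OF continuous_on_id] matrix_vector_mul_linear)
  moreover have "sphere 0 1 \<noteq> ({} :: (real, 'a) vec set)" by simp
  ultimately obtain v where v: "v \<in> sphere 0 1" "\<forall>w\<in>sphere 0 1. v \<bullet> (s *v v) \<le> w \<bullet> (s *v w)"
    using continuous_attains_inf[OF compact_sphere, of 0 1 "\<lambda>v. v \<bullet> (s *v v)"] by blast
  have "v \<noteq> 0" using v(1) by force
  then have "v \<bullet> (s *v v) > 0" using assms by (simp add: pos_def_def)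
  then show thesis using that[of "v \<bullet> (s *v v)"] v(2) by auto
qed

text \<open>An eigenvector \<open>b\<close> of \<open>t - s\<close> with eigenvalue \<open>\<lambda>\<close> satisfies
  \<open>\<lambda> (b\<^sup>T t b + b\<^sup>T s b) = b\<^sup>T (t\<^sup>2 - s\<^sup>2) b\<close>.\<close>

lemma pos_def_sqrt_lipschitz:
  assumes s: "pos_def s"
  obtains K where "K \<ge> 0" "\<And>t. pos_def t \<Longrightarrow> norm (t - s) \<le> K * norm (t ** t - s ** s)"
proof -
  obtain m where m: "m > 0" "\<And>v. norm v = 1 \<Longrightarrow> v \<bullet> (s *v v) \<ge> m" using pos_def_coercive[OF s] by blast
  obtain C where C: "C > 0" "\<And>A :: (real, 'a) smat. \<And>x. norm (A *v x) \<le> norm A * norm x * C"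
    using bounded_bilinear.pos_bounded[OF bounded_bilinear_matrix_vector] by blast
  define N where "N = real CARD('a)"
  have "norm (t - s) \<le> (N * N * N * C / m) * norm (t ** t - s ** s)" if t: "pos_def t" for t
  proof -
    let ?d = "t - s" and ?D = "t ** t - s ** s"
    have sym: "transpose ?d = ?d" "transpose t = t" "transpose s = s" using s t by (auto simp: pos_def_def transpose_ring_simps)
    obtain B where B: "finite B" "span B = UNIV" "pairwise orthogonal B" "\<And>b. b \<in> B \<Longrightarrow> norm b = 1"
      "\<And>b. b \<in> B \<Longrightarrow> ?d *v b = (b \<bullet> (?d *v b)) *\<^sub>R b"
      using symmetric_orthonormal_eigenbasis[OF sym(1)] by blast
    define l where "l = (\<lambda>b. b \<bullet> (?d *v b))"
    have card: "card B \<le> CARD('a)"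
    proof -
      have "0 \<notin> B" using B(4) by force
      then have "independent B" using B(3) by (rule pairwise_orthogonal_independent[rotated])
      then have "card B \<le> DIM((real, 'a) vec)" using independent_bound by blast
      then show ?thesis by simp
    qed
    have lb: "\<bar>l b\<bar> \<le> C / m * norm ?D" if b: "b \<in> B" for b
    proof -
      have n1: "norm b = 1" by (rule B(4)[OF b])
      then have bn: "b \<noteq> 0" by auto
      have db: "?d *v b = l b *\<^sub>R b" using B(5)[OF b] by (simp add: l_def)
      have "?D = t ** ?d + ?d ** s" by (simp add: matrix_mul_ring_simps)
      then have "b \<bullet> (?D *v b) = b \<bullet> (t *v (?d *v b)) + b \<bullet> (?d *v (s *v b))"
        by (simp add: matrix_vector_mult_add_rdistrib inner_add_right matrix_vector_mul_assoc)
      also have "b \<bullet> (?d *v (s *v b)) = (?d *v b) \<bullet> (s *v b)"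
        by (metis sym(1) dot_lmul_matrix transpose_matrix_vector)
      finally have e: "b \<bullet> (?D *v b) = l b * (b \<bullet> (t *v b) + b \<bullet> (s *v b))"
        unfolding db by (simp add: matrix_vector_mult_scaleR algebra_simps)
      \<comment> \<open>The lower bound m is taken from s alone, t adding a positive term; this is
        why the Lipschitz constant does not depend on t.\<close>
      have ge: "b \<bullet> (t *v b) + b \<bullet> (s *v b) \<ge> m" using m(2)[OF n1] t bn unfolding pos_def_def by (smt (verit))
      have "\<bar>l b\<bar> * m \<le> \<bar>l b\<bar> * (b \<bullet> (t *v b) + b \<bullet> (s *v b))" by (rule mult_left_mono[OF ge]) simp
      also have "\<dots> = \<bar>b \<bullet> (?D *v b)\<bar>" unfolding e abs_mult using ge m(1) by simp
      also have "\<dots> \<le> norm ?D * C" using Cauchy_Schwarz_ineq2[of b "?D *v b"] C(2)[of ?D b] n1 by simp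
      finally show ?thesis using m(1) by (simp add: field_simps)
    qed
    have "?d = spectral_mat B l"
      by (rule matrix_eq_on_spanning[OF B(2)]) (use B(5) in \<open>simp add: spectral_mat_eigen[OF B(1,3,4)] l_def\<close>)
    then have dij: "\<bar>?d $ i $ j\<bar> \<le> N * (C / m * norm ?D)" for i j
    proof -
      have "\<bar>?d $ i $ j\<bar> = \<bar>\<Sum>b\<in>B. l b * b $ i * b $ j\<bar>" using \<open>?d = spectral_mat B l\<close> by (simp add: spectral_mat_def)
      also have "\<dots> \<le> (\<Sum>b\<in>B. \<bar>l b * b $ i * b $ j\<bar>)" by (rule sum_abs)
      also have "\<dots> \<le> (\<Sum>b\<in>B. C / m * norm ?D)"
      proof (rule sum_mono)
        fix b assume b: "b \<in> B"
        have "\<bar>b $ i\<bar> \<le> 1" "\<bar>b $ j\<bar> \<le> 1" using component_le_norm_cart[of b] B(4)[OF b] by metis+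
        then have "\<bar>b $ i\<bar> * \<bar>b $ j\<bar> \<le> 1" by (intro mult_le_one) auto
        then have "\<bar>l b\<bar> * (\<bar>b $ i\<bar> * \<bar>b $ j\<bar>) \<le> \<bar>l b\<bar> * 1" by (rule mult_left_mono) simp
        then show "\<bar>l b * b $ i * b $ j\<bar> \<le> C / m * norm ?D" using lb[OF b] by (simp add: abs_mult mult.assoc)
      qed
      also have "\<dots> = real (card B) * (C / m * norm ?D)" by simp
      also have "\<dots> \<le> N * (C / m * norm ?D)"
        using card C(1) m(1) by (intro mult_right_mono) (auto simp: N_def)
      finally show ?thesis .
    qed
    have "norm ?d \<le> (\<Sum>i\<in>UNIV. norm (?d $ i))" unfolding norm_vec_def[of ?d] by (rule L2_set_le_sum) simp
    also have "\<dots> \<le> (\<Sum>i\<in>UNIV. \<Sum>j\<in>UNIV. \<bar>?d $ i $ j\<bar>)" by (intro sum_mono norm_le_l1_cart)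
    also have "\<dots> \<le> (\<Sum>i\<in>(UNIV :: 'a set). \<Sum>j\<in>(UNIV :: 'a set). N * (C / m * norm ?D))" by (intro sum_mono dij)
    also have "\<dots> = (N * N * N * C / m) * norm ?D" by (simp add: N_def)
    finally show ?thesis .
  qed
  moreover have "N * N * N * C / m \<ge> 0" using C(1) m(1) by (simp add: N_def)
  ultimately show thesis using that by blast
qed

text \<open>The definite description in \<open>pos_sqrt\<close> requires uniqueness, which is the
  Lipschitz estimate for two roots with equal squares.\<close>

lemma pos_sqrt:
  assumes "pos_def y"
  shows "pos_def (pos_sqrt y)" "pos_sqrt y ** pos_sqrt y = y"
proof -
  have "\<exists>!s. pos_def s \<and> s ** s = y"
  proof (rule ex_ex1I)
    fix s t assume st: "pos_def s \<and> s ** s = y" "pos_def t \<and> t ** t = y"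
    then obtain K where "\<And>t. pos_def t \<Longrightarrow> norm (t - s) \<le> K * norm (t ** t - s ** s)"
      using pos_def_sqrt_lipschitz by metis
    from this[of t] st have "norm (t - s) \<le> 0" by simp
    then show "s = t" by simp
  qed (rule pos_def_sqrt_exists[OF assms])
  from theI'[OF this] show "pos_def (pos_sqrt y)" "pos_sqrt y ** pos_sqrt y = y"
    unfolding pos_sqrt_def by blast+
qed

lemma pos_def_1: "pos_def (mat 1)" by (simp add: pos_def_def)

lemma pos_sqrt_1: "pos_sqrt (mat 1) = mat 1"
proof -
  obtain K where "\<And>t :: (real, 'a) smat. pos_def t \<Longrightarrow> norm (t - mat 1) \<le> K * norm (t ** t - mat 1 ** mat 1)"
    using pos_def_sqrt_lipschitz[OF pos_def_1] by metis
  from this[OF pos_sqrt(1)[OF pos_def_1]] show ?thesis by (simp add: pos_sqrt(2)[OF pos_def_1])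
qed

lemma pos_sqrt_lipschitz:
  assumes "pos_def x"
  obtains K where "K \<ge> 0" "\<And>y. pos_def y \<Longrightarrow> norm (pos_sqrt y - pos_sqrt x) \<le> K * norm (y - x)"
  using pos_def_sqrt_lipschitz[OF pos_sqrt(1)[OF assms]] pos_sqrt assms by metis

lemma continuous_on_pos_sqrt: "continuous_on {y. pos_def y} pos_sqrt"
proof (rule continuous_on_sequentiallyI)
  fix u :: "nat \<Rightarrow> (real, 'a) smat" and x assume u: "\<forall>n. u n \<in> {y. pos_def y}" "x \<in> {y. pos_def y}" "u \<longlonglongrightarrow> x"
  obtain K where K: "\<And>y. pos_def y \<Longrightarrow> norm (pos_sqrt y - pos_sqrt x) \<le> K * norm (y - x)"
    using pos_sqrt_lipschitz u(2) by blast
  have "(\<lambda>n. norm (u n - x)) \<longlonglongrightarrow> 0" by (rule tendsto_norm_zero[OF LIM_zero[OF u(3)]])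
  then have "(\<lambda>n. K * norm (u n - x)) \<longlonglongrightarrow> 0" by (rule tendsto_mult_right_zero)
  moreover have "eventually (\<lambda>n. norm (pos_sqrt (u n) - pos_sqrt x) \<le> K * norm (u n - x)) sequentially"
    using u(1) K by (intro always_eventually) blast
  ultimately have "(\<lambda>n. pos_sqrt (u n) - pos_sqrt x) \<longlonglongrightarrow> 0"
    by (rule Lim_null_comparison[rotated])
  then show "(\<lambda>n. pos_sqrt (u n)) \<longlonglongrightarrow> pos_sqrt x" by (simp add: LIM_zero_cancel)
qed

text \<open>With p the square root of y minus 1 one has y - 1 = 2p + p^2, so the error of the linear
  approximation is -p^2 / 2, and the Lipschitz estimate makes it quadratic in y - 1.\<close>

lemma has_derivative_pos_sqrt_at_1:
  "(pos_sqrt has_derivative (\<lambda>H. (1 / 2) *\<^sub>R H)) (at (mat 1) within {y. pos_def y})"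
proof -
  obtain K where K: "K \<ge> 0" "\<And>y :: (real, 'a) smat. pos_def y \<Longrightarrow> norm (pos_sqrt y - mat 1) \<le> K * norm (y - mat 1)"
    using pos_sqrt_lipschitz[OF pos_def_1] unfolding pos_sqrt_1 by blast
  obtain C where C: "C > 0" "norm (X ** Y) \<le> norm X * norm Y * C" for X Y :: "(real, 'a) smat"
    using matmul.pos_bounded by blast
  have *: "pos_sqrt y - mat 1 - (1 / 2) *\<^sub>R (y - mat 1) = - (1 / 2) *\<^sub>R ((pos_sqrt y - mat 1) ** (pos_sqrt y - mat 1))"
    if "pos_def y" for y :: "(real, 'a) smat"
    using pos_sqrt(2)[OF that] by (simp add: matrix_mul_ring_simps vec_eq_iff algebra_simps)
  show ?thesis
  proof (rule has_derivativeI_sandwich[of 1])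
    show "bounded_linear (\<lambda>H :: (real, 'a) smat. (1 / 2) *\<^sub>R H)" by (rule bounded_linear_scaleR_right)
    fix y :: "(real, 'a) smat" assume y: "y \<in> {y. pos_def y}" "y \<noteq> mat 1"
    let ?p = "pos_sqrt y - mat 1"
    have "norm (pos_sqrt y - pos_sqrt (mat 1) - (1 / 2) *\<^sub>R (y - mat 1)) \<le> norm (?p ** ?p)"
      unfolding pos_sqrt_1 using *[of y] y by simp
    also have "\<dots> \<le> norm ?p * norm ?p * C" by (rule C(2))
    also have "\<dots> \<le> (K * norm (y - mat 1)) * (K * norm (y - mat 1)) * C"
      using K y C(1) by (intro mult_mono mult_right_mono) auto
    finally have "norm (pos_sqrt y - pos_sqrt (mat 1) - (1 / 2) *\<^sub>R (y - mat 1)) \<le> (K * K * C * norm (y - mat 1)) * norm (y - mat 1)"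
      by (simp add: mult_ac)
    then show "norm (pos_sqrt y - pos_sqrt (mat 1) - (1 / 2) *\<^sub>R (y - mat 1)) / norm (y - mat 1) \<le> K * K * C * norm (y - mat 1)"
      using y by (simp add: divide_le_eq)
  next
    have "((\<lambda>y :: (real, 'a) smat. K * K * C * norm (y - mat 1)) \<longlongrightarrow> K * K * C * norm (mat 1 - mat 1 :: (real, 'a) smat)) (at (mat 1) within {y. pos_def y})"
      by (intro tendsto_intros)
    then show "((\<lambda>y :: (real, 'a) smat. K * K * C * norm (y - mat 1)) \<longlongrightarrow> 0) (at (mat 1) within {y. pos_def y})" by simp
  qed simp
qed

section \<open>The section of \<open>Sp\<close> over the Siegel upper half space\<close>

text \<open>The upper triangular representative of z: a section of the map that sends g to its value
  at i, with values in the solvable factor of the Iwasawa decomposition.\<close>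

definition bz :: "(complex, 'n::finite) smat \<Rightarrow> (real, 'n) dmat" where
  "bz z = n_mat (map_matrix Re z) ** a_mat (map_matrix Im z)"

lemma pos_def_inv_sym:
  assumes "pos_def s"
  shows "transpose (matrix_inv s) = matrix_inv s" "s ** matrix_inv s = mat 1" "matrix_inv s ** s = mat 1"
proof -
  note inv = matrix_inv_mult[OF det_pos_def_nonzero(2)[OF assms]]
  show "s ** matrix_inv s = mat 1" "matrix_inv s ** s = mat 1" by (rule inv)+
  have "transpose s = s" using assms by (simp add: pos_def_def)
  then have "s ** transpose (matrix_inv s) = mat 1" using arg_cong[OF inv(2), of transpose] by (simp add: transpose_ring_simps)
  then show "transpose (matrix_inv s) = matrix_inv s" by (metis matrix_inv_unique)
qed

lemma n_mat_Sp: "transpose x = x \<Longrightarrow> n_mat x \<in> Sp"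
  by (simp add: n_mat_def Sp_block_iff matrix_mul_ring_simps transpose_ring_simps)

lemma a_mat_Sp:
  assumes "pos_def y" shows "a_mat y \<in> Sp"
proof -
  note s = pos_sqrt[OF assms]
  have "transpose (pos_sqrt y) = pos_sqrt y" using s by (simp add: pos_def_def)
  then show ?thesis using pos_def_inv_sym[OF s(1)]
    by (simp add: a_mat_def Sp_block_iff matrix_mul_ring_simps transpose_ring_simps)
qed

lemma siegel_Re_sym: "z \<in> siegel \<Longrightarrow> transpose (map_matrix Re z) = map_matrix Re z"
  by (auto simp: siegel_def vec_eq_iff transpose_def)

lemma bz_Sp: "z \<in> siegel \<Longrightarrow> bz z \<in> Sp"
  unfolding bz_def by (intro Sp_mult n_mat_Sp a_mat_Sp siegel_Re_sym siegelD(2))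

lemma bz_block:
  "bz z = block (pos_sqrt (map_matrix Im z)) (map_matrix Re z ** matrix_inv (pos_sqrt (map_matrix Im z))) 0 (matrix_inv (pos_sqrt (map_matrix Im z)))"
  by (simp add: bz_def n_mat_def a_mat_def block_ops matrix_mul_ring_simps)

lemma aut_factor_bz: "aut_factor (bz z) w = of_real_mat (matrix_inv (pos_sqrt (map_matrix Im z)))"
  by (simp add: aut_factor_def bz_block map_matrix_of_real_simps matrix_mul_ring_simps)

lemma siegel_act_bz:
  assumes "z \<in> siegel" shows "siegel_act (bz z) (mat \<i>) = z"
proof (rule siegel_act_unique[OF bz_Sp[OF assms] mat_i_in_siegel])
  let ?y = "map_matrix Im z" and ?x = "map_matrix Re z"
  let ?s = "pos_sqrt ?y"
  note y = siegelD(2)[OF assms]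
  note s = pos_sqrt[OF y]
  have "?y ** matrix_inv ?s = ?s" using s(2) pos_def_inv_sym(2)[OF s(1)] by (metis matrix_mul_assoc matrix_mul_rid)
  then have ys: "of_real_mat ?y ** of_real_mat (matrix_inv ?s) = of_real_mat ?s"
    by (simp flip: map_matrix_of_real_simps)
  have "z = of_real_mat ?x + mat \<i> ** of_real_mat ?y" by (simp add: vec_eq_iff mat_mult_nth complex_eq_iff)
  then have "z ** of_real_mat (matrix_inv ?s) = of_real_mat ?x ** of_real_mat (matrix_inv ?s) + mat \<i> ** of_real_mat ?s"
    by (metis matrix_mul_ring_simps(2,9) ys)
  then show "z ** aut_factor (bz z) (mat \<i>) = of_real_mat (blockA (bz z)) ** mat \<i> + of_real_mat (blockB (bz z))"
    unfolding aut_factor_bz by (simp add: bz_block map_matrix_of_real_simps mat_commute)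
qed

text \<open>Defined through the representative \<open>bz z\<close>; \<open>hol_fun_eq\<close> shows
  that every g with g.i = z gives the same value when \<open>\<phi>\<close> transforms by
  \<open>chi m\<close>.\<close>

definition hol_fun :: "nat \<Rightarrow> ((real, 'n::finite) dmat \<Rightarrow> complex) \<Rightarrow> (complex, 'n) smat \<Rightarrow> complex" where
  "hol_fun m \<phi> z = \<phi> (bz z) * det (aut_factor (bz z) (mat \<i>)) ^ m"

text \<open>Both g and \<open>bz z\<close> carry i to z, so their quotient stabilizes i and lies in
  \<open>K_sp\<close>.\<close>

lemma bz_K_decomposition:
  assumes g: "g \<in> Sp"
  defines "z \<equiv> siegel_act g (mat \<i>)"
  shows "z \<in> siegel" "matrix_inv (bz z) ** g \<in> K_sp" "bz z ** (matrix_inv (bz z) ** g) = g"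
proof -
  show z: "z \<in> siegel" unfolding z_def by (rule siegel_act_props(2)[OF g mat_i_in_siegel])
  note b = bz_Sp[OF z]
  show gk: "bz z ** (matrix_inv (bz z) ** g) = g" using Sp_inverse(2)[OF b] by (metis matrix_mul_assoc matrix_mul_lid)
  have k: "matrix_inv (bz z) ** g \<in> Sp" by (intro Sp_mult Sp_inverse b g)
  have "siegel_act (matrix_inv (bz z) ** g) (mat \<i>) = siegel_act (matrix_inv (bz z)) (siegel_act (bz z) (mat \<i>))"
    using siegel_act_mult(2)[OF Sp_inverse(4)[OF b] g mat_i_in_siegel] siegel_act_bz[OF z] by (simp add: z_def)
  also have "\<dots> = siegel_act (matrix_inv (bz z) ** bz z) (mat \<i>)"
    by (rule siegel_act_mult(2)[OF Sp_inverse(4)[OF b] b mat_i_in_siegel, symmetric])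
  also have "\<dots> = mat \<i>"
    unfolding Sp_inverse(3)[OF b]
    by (rule siegel_act_unique[OF mat_1_in_Sp mat_i_in_siegel])
      (simp add: aut_factor_def block_ops(6) map_matrix_of_real_simps matrix_mul_ring_simps)
  finally show "matrix_inv (bz z) ** g \<in> K_sp" by (rule stabilizer_in_K_sp[OF k])
qed

text \<open>Passing from \<open>bz z\<close> to g multiplies \<open>\<phi>\<close> by
  \<open>chi m k\<close> and the automorphy factor by that of k at i; by
  \<open>K_sp_block(4)\<close> the two contributions cancel.\<close>

lemma hol_fun_eq:
  assumes g: "g \<in> Sp" and eq: "\<And>h k. h \<in> Sp \<Longrightarrow> k \<in> K_sp \<Longrightarrow> \<phi> (h ** k) = chi m k * \<phi> h"
  shows "hol_fun m \<phi> (siegel_act g (mat \<i>)) = \<phi> g * det (aut_factor g (mat \<i>)) ^ m"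
proof -
  let ?z = "siegel_act g (mat \<i>)"
  let ?k = "matrix_inv (bz ?z) ** g"
  note d = bz_K_decomposition[OF g]
  note b = bz_Sp[OF d(1)]
  have kS: "?k \<in> Sp" using d(2) by (simp add: K_sp_def)
  have "\<phi> g = chi m ?k * \<phi> (bz ?z)" using eq[OF b d(2)] d(3) by simp
  moreover have "aut_factor g (mat \<i>) = aut_factor (bz ?z) (mat \<i>) ** aut_factor ?k (mat \<i>)"
    using siegel_act_mult(1)[OF b kS mat_i_in_siegel] K_sp_block(6)[OF d(2)] d(3) by simp
  ultimately have "\<phi> g * det (aut_factor g (mat \<i>)) ^ m
      = \<phi> (bz ?z) * det (aut_factor (bz ?z) (mat \<i>)) ^ m * (chi m ?k * det (aut_factor ?k (mat \<i>)) ^ m)"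
    by (simp add: det_mul power_mult_distrib)
  then show ?thesis unfolding K_sp_block(4)[OF d(2)] by (simp add: hol_fun_def)
qed

section \<open>The exponential function and the Lie algebra action\<close>

lemma SpI:
  fixes g :: "('a::field, 'n::finite) dmat"
  assumes "transpose g ** J_mat ** g = J_mat"
  shows "g \<in> Sp"
proof -
  have "(- J_mat) ** J_mat = (mat 1 :: ('a, 'n) dmat)" by (simp add: J_mat_def block_ops matrix_mul_ring_simps)
  then have "((- J_mat) ** transpose g ** J_mat) ** g = mat 1" using assms by (metis matrix_mul_assoc)
  then show ?thesis using assms invertibleI(2) unfolding Sp_def by blast
qed

lemma has_derivative_matrix_componentwise:
  fixes f :: "'x::real_normed_vector \<Rightarrow> (real, 'm::finite) smat"
  assumes "\<And>i j. ((\<lambda>x. f x $ i $ j) has_derivative (\<lambda>h. D h $ i $ j)) (at a within S)"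
  shows "(f has_derivative D) (at a within S)"
proof (subst has_derivative_componentwise_within, rule ballI)
  fix b :: "(real, 'm) smat" assume "b \<in> Basis"
  then obtain i j where b: "b = axis i (axis j 1)" unfolding Basis_vec_def by auto
  show "((\<lambda>x. f x \<bullet> b) has_derivative (\<lambda>x. D x \<bullet> b)) (at a within S)"
    unfolding b inner_axis using assms[of i j] by simp
qed

lemma has_derivative_vec_nth:
  assumes "(f has_derivative D) (at a within S)"
  shows "((\<lambda>x. f x $ i) has_derivative (\<lambda>h. D h $ i)) (at a within S)"
  by (rule bounded_linear.has_derivative[OF bounded_linear_vec_nth assms])

lemma has_derivative_block:
  fixes A B C D :: "'x::real_normed_vector \<Rightarrow> (real, 'n::finite) smat"
  assumes "(A has_derivative A') (at a within S)" "(B has_derivative B') (at a within S)"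
    "(C has_derivative C') (at a within S)" "(D has_derivative D') (at a within S)"
  shows "((\<lambda>x. block (A x) (B x) (C x) (D x)) has_derivative (\<lambda>h. block (A' h) (B' h) (C' h) (D' h))) (at a within S)"
proof (rule has_derivative_matrix_componentwise)
  fix i j :: "'n + 'n"
  show "((\<lambda>x. block (A x) (B x) (C x) (D x) $ i $ j) has_derivative (\<lambda>h. block (A' h) (B' h) (C' h) (D' h) $ i $ j)) (at a within S)"
    by (cases i; cases j) (auto intro!: has_derivative_vec_nth assms)
qed

definition mat_pow :: "(real, 'm::finite) smat \<Rightarrow> nat \<Rightarrow> (real, 'm) smat" where
  "mat_pow X k = ((**) X ^^ k) (mat 1)"

lemma mat_pow_simps [simp]: "mat_pow X 0 = mat 1" "mat_pow X (Suc k) = X ** mat_pow X k"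
  by (simp_all add: mat_pow_def)

lemma mat_pow_scaleR: "mat_pow (t *\<^sub>R X) k = t ^ k *\<^sub>R mat_pow X k"
  by (induction k) (simp_all add: matmul.scaleR_left matmul.scaleR_right)

lemma summable_mat_pow: "summable (\<lambda>k. (1 / fact k) *\<^sub>R mat_pow X k)"
proof -
  obtain K where K: "K > 0" "norm (A ** B) \<le> norm A * norm B * K" for A B :: "(real, 'a) smat"
    using matmul.pos_bounded by blast
  have b: "norm (mat_pow X k) \<le> (norm X * K) ^ k * norm (mat 1 :: (real, 'a) smat)" for k
  proof (induction k)
    case (Suc k)
    have "norm (mat_pow X (Suc k)) \<le> norm X * norm (mat_pow X k) * K" using K(2) by simp
    also have "\<dots> \<le> norm X * ((norm X * K) ^ k * norm (mat 1 :: (real, 'a) smat)) * K"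
      using K(1) Suc by (intro mult_right_mono mult_left_mono) auto
    finally show ?case by (simp add: mult_ac)
  qed simp
  have "summable (\<lambda>k. inverse (fact k) * (norm X * K) ^ k * norm (mat 1 :: (real, 'a) smat))"
    by (intro summable_mult2 summable_exp)
  then show ?thesis
  proof (rule summable_comparison_test'[where N = 0])
    fix k :: nat
    have "norm ((1 / fact k) *\<^sub>R mat_pow X k) = inverse (fact k) * norm (mat_pow X k)" by (simp add: divide_inverse)
    also have "\<dots> \<le> inverse (fact k) * ((norm X * K) ^ k * norm (mat 1 :: (real, 'a) smat))"
      by (intro mult_left_mono b) simp
    finally show "norm ((1 / fact k) *\<^sub>R mat_pow X k) \<le> inverse (fact k) * (norm X * K) ^ k * norm (mat 1 :: (real, 'a) smat)"
      by (simp add: mult.assoc)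
  qed
qed

text \<open>Entrywise the exponential of t X is a power series in t, which opens the way to termwise
  differentiation.\<close>

lemma mat_exp_entry:
  "summable (\<lambda>k. mat_pow X k $ i $ j / fact k * t ^ k)"
  "mat_exp (t *\<^sub>R X) $ i $ j = suminf (\<lambda>k. mat_pow X k $ i $ j / fact k * t ^ k)"
proof -
  have bl: "bounded_linear (\<lambda>A :: (real, 'a) smat. A $ i $ j)"
    by (rule bounded_linear_compose[OF bounded_linear_vec_nth bounded_linear_vec_nth])
  have e: "((1 / fact k) *\<^sub>R mat_pow (t *\<^sub>R X) k) $ i $ j = mat_pow X k $ i $ j / fact k * t ^ k" for k
    by (simp add: mat_pow_scaleR)
  show "summable (\<lambda>k. mat_pow X k $ i $ j / fact k * t ^ k)"
    using bounded_linear.summable[OF bl summable_mat_pow[of "t *\<^sub>R X"]] unfolding e .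
  show "mat_exp (t *\<^sub>R X) $ i $ j = suminf (\<lambda>k. mat_pow X k $ i $ j / fact k * t ^ k)"
    using bounded_linear.suminf[OF bl summable_mat_pow[of "t *\<^sub>R X"]] unfolding e
    by (simp add: mat_exp_def mat_pow_def)
qed

lemma mat_exp_0: "mat_exp 0 = mat 1"
proof -
  have "mat_exp (0 *\<^sub>R (0 :: (real, 'a) smat)) $ i $ j = (mat 1 :: (real, 'a) smat) $ i $ j" for i j
    unfolding mat_exp_entry(2) powser_zero by simp
  then show ?thesis by (simp add: vec_eq_iff)
qed

lemma has_derivative_mat_exp:
  "((\<lambda>t. mat_exp (t *\<^sub>R X)) has_derivative (\<lambda>h. h *\<^sub>R (X ** mat_exp (t *\<^sub>R X)))) (at t)"
proof (rule has_derivative_matrix_componentwise)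
  fix i j
  let ?c = "\<lambda>l k. mat_pow X k $ l $ j / fact k"
  have "DERIV (\<lambda>x. suminf (\<lambda>k. ?c i k * x ^ k)) t :> suminf (\<lambda>k. diffs (?c i) k * t ^ k)"
    by (rule termdiffs_strong_converges_everywhere) (rule mat_exp_entry(1))
  moreover have "(\<lambda>k. diffs (?c i) k * t ^ k) sums (\<Sum>l\<in>UNIV. X $ i $ l * mat_exp (t *\<^sub>R X) $ l $ j)"
  proof -
    have "(\<lambda>k. \<Sum>l\<in>UNIV. X $ i $ l * (?c l k * t ^ k)) sums (\<Sum>l\<in>UNIV. X $ i $ l * mat_exp (t *\<^sub>R X) $ l $ j)"
      unfolding mat_exp_entry(2) by (intro sums_sum sums_mult summable_sums mat_exp_entry(1))
    moreover have "diffs (?c i) k * t ^ k = (\<Sum>l\<in>UNIV. X $ i $ l * (?c l k * t ^ k))" for k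
    proof -
      have "diffs (?c i) k = (X ** mat_pow X k) $ i $ j / fact k"
        by (simp add: diffs_def fact_Suc del: of_nat_Suc)
      also have "\<dots> * t ^ k = (\<Sum>l\<in>UNIV. X $ i $ l * (?c l k * t ^ k))"
        by (simp add: matrix_matrix_mult_def sum_distrib_right sum_divide_distrib mult.assoc)
      finally show ?thesis .
    qed
    ultimately show ?thesis by simp
  qed
  ultimately have "DERIV (\<lambda>x. mat_exp (x *\<^sub>R X) $ i $ j) t :> (X ** mat_exp (t *\<^sub>R X)) $ i $ j"
    unfolding mat_exp_entry(2) by (simp add: sums_unique[symmetric] matrix_matrix_mult_def mat_exp_entry(2))
  then show "((\<lambda>x. mat_exp (x *\<^sub>R X) $ i $ j) has_derivative (\<lambda>h. (h *\<^sub>R (X ** mat_exp (t *\<^sub>R X))) $ i $ j)) (at t)"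
    by (simp add: has_field_derivative_def mult_commute_abs)
qed

lemma bounded_linear_transpose: "bounded_linear (transpose :: (real, 'm::finite) smat \<Rightarrow> _)"
  by (auto intro!: linear_conv_bounded_linear[THEN iffD1] linearI simp: transpose_def vec_eq_iff)

text \<open>With E the exponential of t X, the derivative of E^T J E is E^T (X^T J + J X) E = 0, so
  this matrix keeps its value J at t = 0.\<close>

lemma mat_exp_Sp:
  fixes X :: "(real, 'n::finite) dmat"
  assumes X: "X \<in> sp_lie"
  shows "mat_exp (t *\<^sub>R X) \<in> Sp"
proof -
  let ?E = "\<lambda>t. mat_exp (t *\<^sub>R X)"
  let ?G = "\<lambda>t. transpose (?E t) ** J_mat ** ?E t"
  have X': "transpose X ** J_mat = - (J_mat ** X)" using X by (simp add: sp_lie_def eq_neg_iff_add_eq_0)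
  have d: "(?G has_derivative (\<lambda>h. 0)) (at t within UNIV)" for t
  proof -
    have "(?G has_derivative (\<lambda>h. (transpose (?E t) ** J_mat) ** (h *\<^sub>R (X ** ?E t)) + (transpose (h *\<^sub>R (X ** ?E t)) ** J_mat) ** ?E t)) (at t)"
      by (intro matmul.FDERIV bounded_linear.has_derivative[OF matmul.bounded_linear_left]
          bounded_linear.has_derivative[OF bounded_linear_transpose] has_derivative_mat_exp)
    moreover have "(transpose (?E t) ** J_mat) ** (h *\<^sub>R (X ** ?E t)) + (transpose (h *\<^sub>R (X ** ?E t)) ** J_mat) ** ?E t = 0" for h
    proof -
      have "transpose (?E t) ** (transpose X ** (J_mat ** ?E t)) = - (transpose (?E t) ** (J_mat ** (X ** ?E t)))"
        using arg_cong[OF X', of "\<lambda>M. transpose (?E t) ** (M ** ?E t)"] by (simp add: matrix_mul_ring_simps)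
      then show ?thesis
        by (simp add: transpose_scalar transpose_ring_simps matrix_mul_ring_simps matmul.scaleR_left matmul.scaleR_right flip: scaleR_add_right)
    qed
    ultimately show ?thesis by simp
  qed
  have "?G t = ?G 0"
    using has_derivative_zero_unique[of UNIV ?G t 0] d by simp
  then have "?G t = J_mat" by (simp add: mat_exp_0)
  then show ?thesis by (rule SpI)
qed

section \<open>Derivatives along the group and the action of \<open>p_minus\<close>\<close>

text \<open>Derivatives along \<open>Sp\<close> are taken through a local extension of
  \<open>\<phi>\<close> to an open set of matrices. Different extensions may give different L, but
  they agree along curves inside \<open>Sp\<close>, by \<open>sp_deriv_compose\<close>.\<close>

definition sp_deriv :: "((real, 'n::finite) dmat \<Rightarrow> complex) \<Rightarrow> (real, 'n) dmat \<Rightarrow> ((real, 'n) dmat \<Rightarrow> complex) \<Rightarrow> bool" where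
  "sp_deriv \<phi> g L \<longleftrightarrow> (\<exists>U \<psi>. open U \<and> g \<in> U \<and> (\<psi> has_derivative L) (at g) \<and> (\<forall>x\<in>U \<inter> Sp. \<psi> x = \<phi> x))"

lemma sp_deriv_exists:
  assumes "smooth_function_on Sp \<phi>" "g \<in> Sp"
  obtains L where "sp_deriv \<phi> g L"
proof -
  obtain U \<psi> where U: "open U" "g \<in> U" "\<forall>k. Ck_on k U \<psi>" "\<forall>x\<in>U \<inter> Sp. \<psi> x = \<phi> x"
    using assms unfolding smooth_function_on_def by blast
  have "Ck_on (Suc 0) U \<psi>" using U(3) by blast
  then have "\<psi> differentiable (at g)" using U(2) by simp
  then obtain L where "(\<psi> has_derivative L) (at g)" unfolding differentiable_def by blast
  then show thesis using that U unfolding sp_deriv_def by blast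
qed

lemma sp_deriv_bounded_linear: "sp_deriv \<phi> g L \<Longrightarrow> bounded_linear L"
  unfolding sp_deriv_def using has_derivative_bounded_linear by blast

lemma sp_deriv_compose:
  fixes \<gamma> :: "'x::real_normed_vector \<Rightarrow> (real, 'n::finite) dmat"
  assumes L: "sp_deriv \<phi> g L" and d: "(\<gamma> has_derivative D) (at a within S)" and "\<gamma> a = g" "a \<in> S" "\<And>x. x \<in> S \<Longrightarrow> \<gamma> x \<in> Sp"
  shows "((\<lambda>x. \<phi> (\<gamma> x)) has_derivative (\<lambda>h. L (D h))) (at a within S)"
proof -
  obtain U \<psi> where U: "open U" "g \<in> U" "(\<psi> has_derivative L) (at g)" "\<And>x. x \<in> U \<inter> Sp \<Longrightarrow> \<psi> x = \<phi> x"
    using L unfolding sp_deriv_def by blast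
  have c: "((\<lambda>x. \<psi> (\<gamma> x)) has_derivative (\<lambda>h. L (D h))) (at a within S)"
    using has_derivative_compose[OF d] U(3) assms(3) by blast
  have "(\<gamma> \<longlongrightarrow> g) (at a within S)"
    using has_derivative_continuous[OF d] assms(3) by (simp add: continuous_within)
  then have "eventually (\<lambda>x. \<gamma> x \<in> U) (at a within S)" using U(1,2) by (rule topological_tendstoD)
  moreover have "eventually (\<lambda>x. x \<in> S) (at a within S)" by (simp add: eventually_at_filter)
  ultimately have "eventually (\<lambda>x. \<psi> (\<gamma> x) = \<phi> (\<gamma> x)) (at a within S)"
    by eventually_elim (use U(4) assms(5) in blast)
  then show ?thesis
    by (rule has_derivative_transform_eventually[OF c]) (use U assms in auto)
qed

lemma lie_act_real_eq:
  assumes L: "sp_deriv \<phi> g L" and g: "g \<in> Sp" and X: "X \<in> sp_lie"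
  shows "lie_act_real X \<phi> g = L (g ** X)"
proof -
  have "((\<lambda>t. g ** mat_exp (t *\<^sub>R X)) has_derivative (\<lambda>h. g ** (h *\<^sub>R (X ** mat_exp (0 *\<^sub>R X))))) (at 0 within UNIV)"
    by (intro bounded_linear.has_derivative[OF matmul.bounded_linear_right] has_derivative_mat_exp)
  then have "((\<lambda>t. \<phi> (g ** mat_exp (t *\<^sub>R X))) has_derivative (\<lambda>h. L (g ** (h *\<^sub>R (X ** mat_exp (0 *\<^sub>R X)))))) (at 0 within UNIV)"
    by (rule sp_deriv_compose[OF L]) (auto intro: Sp_mult g mat_exp_Sp X simp: mat_exp_0)
  moreover have "L (g ** (h *\<^sub>R (X ** mat_exp (0 *\<^sub>R X)))) = h *\<^sub>R L (g ** X)" for h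
    using sp_deriv_bounded_linear[OF L] by (simp add: mat_exp_0 matmul.scaleR_right linear_simps(5))
  ultimately have "((\<lambda>t. \<phi> (g ** mat_exp (t *\<^sub>R X))) has_vector_derivative L (g ** X)) (at 0)"
    by (simp add: has_vector_derivative_def)
  then show ?thesis unfolding lie_act_real_def by (rule vector_derivative_at)
qed

lemma sp_lie_block:
  assumes "transpose S = S" "transpose T = T"
  shows "block S T T (- S) \<in> sp_lie"
  using assms by (simp add: sp_lie_def J_mat_def block_ops matrix_mul_ring_simps transpose_ring_simps)

text \<open>For n = 1 and M = 1 this is the matrix with rows (1, -i) and (-i, -1), which lowers the
  weight by 2; in general the same pattern with M in place of 1.\<close>

definition p_block :: "(complex, 'n::finite) smat \<Rightarrow> (complex, 'n) dmat" where
  "p_block M = block M (mat_scale (- \<i>) M) (mat_scale (- \<i>) M) (- M)"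

lemma mat_scale_nth [simp]: "mat_scale c X $ i $ j = c * X $ i $ j"
  by (simp add: mat_scale_def)

lemma p_block_complex_mat:
  "p_block (of_real_mat S) = complex_mat (block S 0 0 (- S)) (- block 0 S S 0)"
  by (simp add: dmat_eq_iff, simp add: p_block_def vec_eq_iff blockA_def blockB_def blockC_def blockD_def complex_mat_def complex_eq_iff)

lemma cartan_block:
  "(\<Sum>r\<in>UNIV. mat_scale (c r) (T_mat r)) =
    block 0 (\<chi> a b. if a = b then - \<i> * c a else 0) (\<chi> a b. if a = b then \<i> * c a else 0) 0"
proof -
  have "c r * - (\<i> * (if a = r \<and> b = r then 1 else 0)) = (if r = a then if a = b then - \<i> * c a else 0 else 0)" for r a b
    by auto
  moreover have "c r * - (\<i> * - (if a = r \<and> b = r then 1 else 0)) = (if r = a then if a = b then \<i> * c a else 0 else 0)" for r a b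
    by auto
  ultimately show ?thesis
    by (simp add: dmat_eq_iff, simp add: vec_eq_iff blockA_def blockB_def blockC_def blockD_def T_mat_def unit_mat_def)
qed

text \<open>The blocks of an element H of the Cartan subalgebra are diagonal, so the bracket with H
  multiplies the entry (a, b) of M by -(c a + c b). M is supported on the two positions where this
  factor is -(c r + c s).\<close>

lemma p_block_in_root_subspace:
  assumes "transpose S = S" and M: "M = (\<chi> a b. if (a = r \<and> b = s) \<or> (a = s \<and> b = r) then S $ r $ s else 0)"
  shows "p_block (of_real_mat M) \<in> root_subspace (\<lambda>H. - (e_weight r H + e_weight s H))"
  unfolding root_subspace_def
proof (intro CollectI conjI ballI)
  have symM: "transpose M = M" unfolding M by (auto simp: transpose_def vec_eq_iff)
  have "block M 0 0 (- M) \<in> sp_lie" "- block 0 M M 0 \<in> sp_lie"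
    using sp_lie_block[OF symM, of 0] sp_lie_block[of 0 "- M"] symM
    by (simp_all add: block_ops transpose_ring_simps)
  then show "p_block (of_real_mat M) \<in> sp_lie_complex"
    unfolding p_block_complex_mat sp_lie_complex_def by blast
  fix H :: "(complex, 'a) dmat" assume "H \<in> cartan_complex"
  then obtain c where H: "H = (\<Sum>r\<in>UNIV. mat_scale (c r) (T_mat r))" unfolding cartan_complex_def by blast
  have w: "e_weight r H = c r" "e_weight s H = c s" unfolding H by (rule e_weight_cartan)+
  let ?N = "of_real_mat M"
  have d: "((\<chi> a b. if a = b then e a else 0) ** X) $ i $ j = e i * X $ i $ j"
    "(X ** (\<chi> a b. if a = b then e a else 0)) $ i $ j = X $ i $ j * e j" for e and X :: "(complex, 'a) smat" and i j
    by (simp_all add: matrix_matrix_mult_def if_distrib[of "\<lambda>x. x * _"] if_distrib[of "\<lambda>x. _ * x"] cong: if_cong)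
  have N: "c a * ?N $ a $ b + ?N $ a $ b * c b = (c r + c s) * ?N $ a $ b" for a b
    unfolding M by (auto simp: algebra_simps)
  have "H = block 0 (\<chi> a b. if a = b then - \<i> * c a else 0) (\<chi> a b. if a = b then \<i> * c a else 0) 0"
    unfolding H by (rule cartan_block)
  then have "bracket H (p_block ?N) =
     block (\<chi> a b. - (c a * ?N $ a $ b + ?N $ a $ b * c b)) (\<chi> a b. \<i> * (c a * ?N $ a $ b + ?N $ a $ b * c b))
       (\<chi> a b. \<i> * (c a * ?N $ a $ b + ?N $ a $ b * c b)) (\<chi> a b. c a * ?N $ a $ b + ?N $ a $ b * c b)"
    unfolding bracket_def p_block_def
    by (simp add: block_ops matrix_mul_ring_simps) (simp add: vec_eq_iff d algebra_simps)
  also have "\<dots> = mat_scale (- (c r + c s)) (p_block ?N)"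
    unfolding N by (simp add: dmat_eq_iff, simp add: p_block_def vec_eq_iff blockA_def blockB_def blockC_def blockD_def algebra_simps)
  finally show "bracket H (p_block ?N) = mat_scale (- (e_weight r H + e_weight s H)) (p_block ?N)" unfolding w .
qed

lemma p_block_in_p_minus:
  fixes S :: "(real, 'n::{finite, linorder}) smat"
  assumes S: "transpose S = S"
  shows "p_block (of_real_mat S) \<in> p_minus"
proof -
  define M where "M = (\<lambda>r s. (\<chi> a b. if (a = r \<and> b = s) \<or> (a = s \<and> b = r) then S $ r $ s else 0) :: (real, 'n) smat)"
  have sym: "S $ a $ b = S $ b $ a" for a b
    using arg_cong[OF S, of "\<lambda>M. M $ b $ a"] by (simp add: transpose_def)
  have sM: "(\<Sum>(r, s)\<in>{(r, s). r \<le> s}. M r s $ a $ b) = S $ a $ b" for a b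
  proof -
    have "M r s $ a $ b = (if (r, s) = upair a b then S $ a $ b else 0)" if "r \<le> s" for r s
      using that sym by (auto simp: M_def upair_def)
    then have "(\<Sum>(r, s)\<in>{(r, s). r \<le> s}. M r s $ a $ b) = (\<Sum>p\<in>{(r, s). r \<le> s}. if p = upair a b then S $ a $ b else 0)"
      by (intro sum.cong refl) (metis (no_types, lifting) case_prod_conv mem_Collect_eq surj_pair)
    also have "\<dots> = S $ a $ b" by (subst sum.delta) (auto simp: upair_def intro: finite_subset[OF subset_UNIV])
    finally show ?thesis .
  qed
  have lin: "p_block (of_real_mat M) $ i $ j = (case i of Inl a \<Rightarrow> (case j of Inl b \<Rightarrow> 1 | Inr b \<Rightarrow> - \<i>) | Inr a \<Rightarrow> (case j of Inl b \<Rightarrow> - \<i> | Inr b \<Rightarrow> - 1))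
     * of_real (M $ (case i of Inl a \<Rightarrow> a | Inr a \<Rightarrow> a) $ (case j of Inl a \<Rightarrow> a | Inr a \<Rightarrow> a))" for M :: "(real, 'n) smat" and i j
    by (cases i; cases j) (simp_all add: p_block_def)
  have "p_block (of_real_mat S) $ i $ j = (\<Sum>(r, s)\<in>{(r, s). r \<le> s}. p_block (of_real_mat (M r s))) $ i $ j" for i j
    unfolding sum_component case_prod_beta unfolding lin sum_distrib_left[symmetric]
    using sM[unfolded case_prod_beta] by (simp flip: of_real_sum)
  then have "p_block (of_real_mat S) = (\<Sum>(r, s)\<in>{(r, s). r \<le> s}. p_block (of_real_mat (M r s)))"
    by (simp add: vec_eq_iff)
  moreover have "p_block (of_real_mat (M r s)) \<in> root_subspace (\<lambda>H. - (e_weight r H + e_weight s H))" for r s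
    by (rule p_block_in_root_subspace[OF S]) (simp add: M_def)
  ultimately show ?thesis unfolding p_minus_def by blast
qed

text \<open>The two directions compared are, up to sign, the real and the imaginary part of
  \<open>p_block\<close> of S, an element of \<open>p_minus\<close>; its action on
  \<open>\<phi>\<close> is the Cauchy-Riemann operator in these directions.\<close>

lemma sp_deriv_antiholomorphic:
  fixes \<phi> :: "(real, 'n::{finite, linorder}) dmat \<Rightarrow> complex"
  assumes L: "sp_deriv \<phi> g L" and g: "g \<in> Sp" and p: "\<And>X. X \<in> p_minus \<Longrightarrow> lie_act X \<phi> g = 0" and S: "transpose S = S"
  shows "L (g ** block S 0 0 (- S)) = \<i> * L (g ** block 0 S S 0)"
proof -
  have XY: "block S 0 0 (- S) \<in> sp_lie" "- block 0 S S 0 \<in> sp_lie"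
    using sp_lie_block[OF S, of 0] sp_lie_block[of 0 "- S"] S by (simp_all add: block_ops transpose_ring_simps)
  have ri: "map_matrix Re (complex_mat X Y) = X" "map_matrix Im (complex_mat X Y) = Y" for X Y :: "(real, 'n + 'n) smat"
    by (simp_all add: complex_mat_def vec_eq_iff)
  have "0 = lie_act (p_block (of_real_mat S)) \<phi> g" using p[OF p_block_in_p_minus[OF S]] by simp
  also have "\<dots> = L (g ** block S 0 0 (- S)) + \<i> * L (g ** - block 0 S S 0)"
    unfolding lie_act_def p_block_complex_mat ri lie_act_real_eq[OF L g XY(1)] lie_act_real_eq[OF L g XY(2)] ..
  also have "L (g ** - block 0 S S 0) = - L (g ** block 0 S S 0)"
    using sp_deriv_bounded_linear[OF L] by (simp add: matrix_mul_ring_simps linear_simps)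
  finally show ?thesis by simp
qed

section \<open>Holomorphy\<close>

lemma bounded_linear_map_matrix:
  "bounded_linear (map_matrix Re :: (complex, 'm::finite) smat \<Rightarrow> _)"
  "bounded_linear (map_matrix Im :: (complex, 'm::finite) smat \<Rightarrow> _)"
  "bounded_linear (of_real_mat :: (real, 'm::finite) smat \<Rightarrow> _)"
  by (auto intro!: linear_conv_bounded_linear[THEN iffD1] linearI simp: vec_eq_iff complex_eq_iff)

lemma Re_Im_mat_i:
  "map_matrix Re (mat \<i> :: (complex, 'm::finite) smat) = 0" "map_matrix Im (mat \<i> :: (complex, 'm) smat) = mat 1"
  by (simp_all add: vec_eq_iff mat_def)

lemma matrix_inv_1: "matrix_inv (mat 1 :: ('a::field, 'm::finite) smat) = mat 1"
  by (rule matrix_inv_unique) simp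

lemma invertible_1: "invertible (mat 1 :: ('a::field, 'm::finite) smat)"
  by (rule invertibleI(1)[of _ "mat 1"]) simp

lemma bz_mat_i: "bz (mat \<i>) = mat 1"
  by (simp add: bz_block Re_Im_mat_i pos_sqrt_1 matrix_inv_1 matrix_mul_ring_simps block_ops)

definition K_equivariant :: "nat \<Rightarrow> ((real, 'n::finite) dmat \<Rightarrow> complex) \<Rightarrow> bool" where
  "K_equivariant m \<phi> \<longleftrightarrow> (\<forall>g\<in>Sp. \<forall>k\<in>K_sp. \<phi> (g ** k) = chi m k * \<phi> g)"

lemma K_equivariant_translate:
  assumes "K_equivariant m \<phi>" "g \<in> Sp"
  shows "K_equivariant m (\<lambda>h. \<phi> (g ** h))"
  using assms unfolding K_equivariant_def by (metis Sp_mult matrix_mul_assoc)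

lemma hol_fun_act:
  assumes "K_equivariant m \<phi>" "g \<in> Sp"
  shows "hol_fun m \<phi> (siegel_act g (mat \<i>)) = \<phi> g * det (aut_factor g (mat \<i>)) ^ m"
  using assms by (intro hol_fun_eq) (auto simp: K_equivariant_def)

text \<open>Left translation of \<open>\<phi>\<close> by g corresponds to the slash operator of g.
  This is what reduces differentiation at an arbitrary point to the base point i.\<close>

lemma hol_fun_translate:
  assumes eq: "K_equivariant m \<phi>" and g: "g \<in> Sp" and Z: "Z \<in> siegel"
  shows "hol_fun m \<phi> (siegel_act g Z) = det (aut_factor g Z) ^ m * hol_fun m (\<lambda>h. \<phi> (g ** h)) Z"
proof -
  note b = bz_Sp[OF Z]
  have "hol_fun m \<phi> (siegel_act g Z) = hol_fun m \<phi> (siegel_act (g ** bz Z) (mat \<i>))"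
    using siegel_act_mult(2)[OF g b mat_i_in_siegel] siegel_act_bz[OF Z] by simp
  also have "\<dots> = \<phi> (g ** bz Z) * det (aut_factor (g ** bz Z) (mat \<i>)) ^ m"
    by (rule hol_fun_act[OF eq Sp_mult[OF g b]])
  also have "aut_factor (g ** bz Z) (mat \<i>) = aut_factor g Z ** aut_factor (bz Z) (mat \<i>)"
    using siegel_act_mult(1)[OF g b mat_i_in_siegel] siegel_act_bz[OF Z] by simp
  finally show ?thesis by (simp add: hol_fun_def det_mul power_mult_distrib)
qed

text \<open>At i the section \<open>bz\<close> takes the value 1. To first order the real part of H
  enters in the upper right block, and half of the imaginary part on the diagonal because of the
  square root; the trace term is the derivative of the automorphy factor.\<close>

lemma has_derivative_hol_fun_at_i:
  fixes \<phi> :: "(real, 'n::finite) dmat \<Rightarrow> complex"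
  assumes L: "sp_deriv \<phi> g L" and g: "g \<in> Sp"
  shows "(hol_fun m (\<lambda>h. \<phi> (g ** h)) has_derivative
     (\<lambda>H. L (g ** block ((1 / 2) *\<^sub>R map_matrix Im H) (map_matrix Re H) 0 (- ((1 / 2) *\<^sub>R map_matrix Im H)))
        - of_nat m * of_real (trace (map_matrix Im H)) / 2 * \<phi> g)) (at (mat \<i>) within siegel)"
proof -
  let ?s = "\<lambda>Z. pos_sqrt (map_matrix Im Z) :: (real, 'n) smat"
  let ?d = "\<lambda>H. (1 / 2) *\<^sub>R map_matrix Im H :: (real, 'n) smat"
  let ?F = "at (mat \<i> :: (complex, 'n) smat) within siegel"
  have Im: "(map_matrix Im has_derivative map_matrix Im) ?F" and Re: "(map_matrix Re has_derivative map_matrix Re) ?F"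
    by (intro bounded_linear_imp_has_derivative bounded_linear_map_matrix)+
  have s: "(?s has_derivative ?d) ?F"
  proof (rule has_derivative_in_compose[OF Im])
    show "(pos_sqrt has_derivative (\<lambda>H. (1 / 2) *\<^sub>R H)) (at (map_matrix Im (mat \<i> :: (complex, 'n) smat)) within map_matrix Im ` siegel)"
      unfolding Re_Im_mat_i by (rule has_derivative_subset[OF has_derivative_pos_sqrt_at_1]) (auto dest: siegelD)
  qed
  have s1: "?s (mat \<i>) = mat 1" by (simp add: Re_Im_mat_i pos_sqrt_1)
  have si: "((\<lambda>Z. matrix_inv (?s Z)) has_derivative (\<lambda>H. - ?d H)) ?F"
    using has_derivative_compose[OF s, of matrix_inv "\<lambda>H. - H"] has_derivative_matrix_inv[OF invertible_1, of UNIV]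
    by (simp add: s1 matrix_inv_1)
  have x: "((\<lambda>Z. map_matrix Re Z ** matrix_inv (?s Z)) has_derivative map_matrix Re) ?F"
    using matmul.FDERIV[OF Re si] by (simp add: pos_sqrt_1 matrix_inv_1 Re_Im_mat_i matrix_mul_ring_simps)
  have b: "(bz has_derivative (\<lambda>H. block (?d H) (map_matrix Re H) 0 (- ?d H))) ?F"
    unfolding bz_block[abs_def] by (intro has_derivative_block s x si has_derivative_const)
  have gb: "((\<lambda>Z. g ** bz Z) has_derivative (\<lambda>H. g ** block (?d H) (map_matrix Re H) 0 (- ?d H))) ?F"
    by (rule bounded_linear.has_derivative[OF matmul.bounded_linear_right b])
  have p: "((\<lambda>Z. \<phi> (g ** bz Z)) has_derivative (\<lambda>H. L (g ** block (?d H) (map_matrix Re H) 0 (- ?d H)))) ?F"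
    by (rule sp_deriv_compose[OF L gb]) (auto simp: bz_mat_i mat_i_in_siegel intro: Sp_mult g bz_Sp)
  have j: "((\<lambda>Z. of_real_mat (matrix_inv (?s Z))) has_derivative (\<lambda>H. of_real_mat (- ?d H))) ?F"
    by (rule bounded_linear.has_derivative[OF bounded_linear_map_matrix(3) si])
  have dj: "((\<lambda>Z. det (of_real_mat (matrix_inv (?s Z)))) has_derivative (\<lambda>H. trace (of_real_mat (- ?d H)))) ?F"
    using has_derivative_compose[OF j, of det trace] has_derivative_det_at_1[of UNIV]
    by (simp add: s1 matrix_inv_1 map_matrix_of_real_simps)
  have tr: "trace (of_real_mat (- ?d H)) = - (of_real (trace (map_matrix Im H)) / 2)" for H :: "(complex, 'n) smat"
    by (simp add: trace_def sum_negf sum_divide_distrib)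
  have "((\<lambda>Z. \<phi> (g ** bz Z) * det (of_real_mat (matrix_inv (?s Z))) ^ m) has_derivative
     (\<lambda>H. \<phi> (g ** bz (mat \<i>)) * (of_nat m * trace (of_real_mat (- ?d H)) * det (of_real_mat (matrix_inv (?s (mat \<i>)))) ^ (m - 1))
        + L (g ** block (?d H) (map_matrix Re H) 0 (- ?d H)) * det (of_real_mat (matrix_inv (?s (mat \<i>)))) ^ m)) ?F"
    by (intro has_derivative_mult p has_derivative_power dj)
  then show ?thesis
    unfolding hol_fun_def[abs_def] aut_factor_bz
    by (rule has_derivative_eq_rhs) (simp add: fun_eq_iff s1 matrix_inv_1 bz_mat_i map_matrix_of_real_simps(7) tr mult_ac)
qed

text \<open>Differentiating along the curve \<open>n\<^sub>t\<^sub>S n\<^sub>t\<^sub>S\<^sup>T\<close>, which is tangent to the noncompact part of the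
  Lie algebra, expresses the derivative along the translations.\<close>

lemma sp_deriv_translation:
  fixes \<phi> :: "(real, 'n::finite) dmat \<Rightarrow> complex"
  assumes eq: "K_equivariant m \<phi>" and L: "sp_deriv \<phi> g L" and g: "g \<in> Sp" and S: "transpose S = S"
  shows "L (g ** block 0 (2 *\<^sub>R S) 0 0) = L (g ** block 0 S S 0) + of_nat m * (\<i> * of_real (trace S)) * \<phi> g"
proof -
  let ?T = "\<lambda>t::real. t *\<^sub>R S"
  let ?c = "\<lambda>t. block (mat 1 + ?T t ** ?T t) (?T t) (?T t) (mat 1)"
  let ?Q = "\<lambda>t. mat 1 + mat \<i> ** of_real_mat (?T t)"
  let ?Z = "\<lambda>t. of_real_mat (?T t) + mat \<i> ** matrix_inv (?Q t)"
  have T: "transpose (?T t) = ?T t" for t by (simp add: transpose_scalar S)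
  have c: "?c t \<in> Sp" for t
    by (simp add: Sp_block_iff T transpose_ring_simps matrix_mul_ring_simps)
  have Q: "aut_factor (?c t) (mat \<i>) = ?Q t" for t
    by (simp add: aut_factor_def map_matrix_of_real_simps mat_commute add.commute)
  have Z: "siegel_act (?c t) (mat \<i>) = ?Z t" for t
  proof (rule siegel_act_unique[OF c mat_i_in_siegel])
    have "invertible (?Q t)" using siegel_act_props(1)[OF c mat_i_in_siegel] unfolding Q .
    then have "?Z t ** ?Q t = of_real_mat (?T t) ** ?Q t + mat \<i>"
      unfolding matrix_mul_ring_simps(2) matrix_mul_ring_simps(9) by (simp only: matrix_inv_mult(2) matrix_mul_ring_simps(11))
    also have "\<dots> = of_real_mat (blockA (?c t)) ** mat \<i> + of_real_mat (blockB (?c t))"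
      unfolding block_proj map_matrix_of_real_simps(1,5,7)
      by (simp add: matrix_mul_ring_simps mat_commute[of \<i> "of_real_mat (?T t)"] add_ac)
    finally show "?Z t ** aut_factor (?c t) (mat \<i>) = of_real_mat (blockA (?c t)) ** mat \<i> + of_real_mat (blockB (?c t))"
      unfolding Q .
  qed
  have Zs: "?Z t \<in> siegel" for t using siegel_act_props(2)[OF c mat_i_in_siegel, of t] unfolding Z .
  have T0: "(?T has_derivative ?T) (at 0)" by (intro bounded_linear_imp_has_derivative bounded_linear_scaleR_left)
  have Tc: "((\<lambda>t. of_real_mat (?T t)) has_derivative (\<lambda>t. of_real_mat (?T t))) (at 0)"
    by (rule bounded_linear.has_derivative[OF bounded_linear_map_matrix(3) T0])
  have Qd: "(?Q has_derivative (\<lambda>t. mat \<i> ** of_real_mat (?T t))) (at 0)"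
    using has_derivative_add[OF has_derivative_const bounded_linear.has_derivative[OF matmul.bounded_linear_right Tc]] by simp
  have Q0: "?Q 0 = mat 1" by (simp add: map_matrix_of_real_simps matrix_mul_ring_simps)
  have Qi: "((\<lambda>t. matrix_inv (?Q t)) has_derivative (\<lambda>t. - (mat \<i> ** of_real_mat (?T t)))) (at 0)"
    using has_derivative_compose[OF Qd, of matrix_inv "\<lambda>H. - H"] has_derivative_matrix_inv[OF invertible_1, of UNIV]
    by (simp add: Q0 matrix_inv_1 del: scaleR_zero_left)
  \<comment> \<open>To first order T + i (1 + i T)^-1 is i + 2 T: the translation and the inverse
    contribute T each.\<close>
  have Zd: "(?Z has_derivative (\<lambda>t. of_real_mat (?T (2 * t)))) (at 0)"
  proof -
    have "mat \<i> ** - (mat \<i> ** of_real_mat (?T t)) = of_real_mat (?T t)" for t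
      by (simp add: vec_eq_iff mat_mult_nth matrix_mul_ring_simps(5))
    moreover have "of_real_mat (?T t) + of_real_mat (?T t) = of_real_mat (?T (2 * t))" for t
      by (simp add: vec_eq_iff)
    ultimately show ?thesis
      using has_derivative_add[OF Tc bounded_linear.has_derivative[OF matmul.bounded_linear_right Qi], of "mat \<i>"] by simp
  qed
  have Z0: "?Z 0 = mat \<i>" unfolding Q0 by (simp add: map_matrix_of_real_simps matrix_inv_1)
  let ?D = "\<lambda>H. L (g ** block ((1 / 2) *\<^sub>R map_matrix Im H) (map_matrix Re H) 0 (- ((1 / 2) *\<^sub>R map_matrix Im H)))
        - of_nat m * of_real (trace (map_matrix Im H)) / 2 * \<phi> g"
  have 1: "((\<lambda>t. hol_fun m (\<lambda>h. \<phi> (g ** h)) (?Z t)) has_derivative (\<lambda>t. ?D (of_real_mat (?T (2 * t))))) (at 0)"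
  proof (rule has_derivative_in_compose[OF Zd])
    show "(hol_fun m (\<lambda>h. \<phi> (g ** h)) has_derivative ?D) (at (?Z 0) within range ?Z)"
      unfolding Z0 by (rule has_derivative_subset[OF has_derivative_hol_fun_at_i[OF L g]]) (use Zs in blast)
  qed
  have hf: "hol_fun m (\<lambda>h. \<phi> (g ** h)) (?Z t) = \<phi> (g ** ?c t) * det (?Q t) ^ m" for t
    using hol_fun_act[OF K_equivariant_translate[OF eq g] c, of t] unfolding Z Q .
  have cd: "(?c has_derivative (\<lambda>t. block 0 (?T t) (?T t) 0)) (at 0)"
  proof -
    have "((\<lambda>t. mat 1 + ?T t ** ?T t) has_derivative (\<lambda>t. 0)) (at 0)"
      using has_derivative_add[OF has_derivative_const matmul.FDERIV[OF T0 T0]] by (simp add: matrix_mul_ring_simps)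
    then show ?thesis by (intro has_derivative_block T0 has_derivative_const)
  qed
  have gc: "((\<lambda>t. g ** ?c t) has_derivative (\<lambda>t. g ** block 0 (?T t) (?T t) 0)) (at 0 within UNIV)"
    by (rule bounded_linear.has_derivative[OF matmul.bounded_linear_right cd])
  have c0: "?c 0 = mat 1" by (simp add: matrix_mul_ring_simps block_ops)
  have pc: "((\<lambda>t. \<phi> (g ** ?c t)) has_derivative (\<lambda>t. L (g ** block 0 (?T t) (?T t) 0))) (at 0)"
    by (rule sp_deriv_compose[OF L gc]) (auto simp: c0 simp del: scaleR_zero_left intro: Sp_mult g c)
  have dQ: "((\<lambda>t. det (?Q t)) has_derivative (\<lambda>t. trace (mat \<i> ** of_real_mat (?T t)))) (at 0)"
    by (rule has_derivative_compose[OF Qd]) (unfold Q0, rule has_derivative_det_at_1)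
  have 2: "((\<lambda>t. \<phi> (g ** ?c t) * det (?Q t) ^ m) has_derivative
     (\<lambda>t. \<phi> (g ** ?c 0) * (of_nat m * trace (mat \<i> ** of_real_mat (?T t)) * det (?Q 0) ^ (m - 1))
        + L (g ** block 0 (?T t) (?T t) 0) * det (?Q 0) ^ m)) (at 0)"
    by (intro has_derivative_mult pc has_derivative_power dQ)
  \<comment> \<open>Both sides are the derivative at 0 of the same function of t, once from the
    formula at the base point along \<open>?Z\<close>, once from equivariance along the curve
    \<open>?c\<close> in the group.\<close>
  have "(\<lambda>t. ?D (of_real_mat (?T (2 * t)))) = (\<lambda>t. \<phi> (g ** ?c 0) * (of_nat m * trace (mat \<i> ** of_real_mat (?T t)) * det (?Q 0) ^ (m - 1))
        + L (g ** block 0 (?T t) (?T t) 0) * det (?Q 0) ^ m)"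
    by (rule has_derivative_unique[OF 1[unfolded hf] 2])
  from fun_cong[OF this, of 1] have "?D (of_real_mat (2 *\<^sub>R S)) = \<phi> g * (of_nat m * trace (mat \<i> ** of_real_mat S)) + L (g ** block 0 S S 0)"
    unfolding c0 Q0 by simp
  moreover have "map_matrix Im (of_real_mat (2 *\<^sub>R S)) = 0" "map_matrix Re (of_real_mat (2 *\<^sub>R S)) = 2 *\<^sub>R S"
    by (simp_all add: vec_eq_iff)
  moreover have "trace (mat \<i> ** of_real_mat S) = \<i> * of_real (trace S)"
    by (simp add: trace_def mat_mult_nth sum_distrib_left)
  ultimately show ?thesis by (simp add: trace_def mult_ac add.commute)
qed

text \<open>The direction of Im H is exchanged by \<open>sp_deriv_antiholomorphic\<close>, that of
  Re H by \<open>sp_deriv_translation\<close>. With a real linear functional l, the derivative then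
  has the form l(Re H) + i l(Im H), which is complex linear on symmetric matrices.\<close>

lemma hol_fun_complex_derivative_at_i:
  fixes \<phi> :: "(real, 'n::{finite, linorder}) dmat \<Rightarrow> complex"
  assumes eq: "K_equivariant m \<phi>" and L: "sp_deriv \<phi> g L" and g: "g \<in> Sp"
    and p: "\<And>X. X \<in> p_minus \<Longrightarrow> lie_act X \<phi> g = 0"
  obtains D where "(hol_fun m (\<lambda>h. \<phi> (g ** h)) has_derivative D) (at (mat \<i>) within siegel)"
    "\<And>H. transpose H = H \<Longrightarrow> D (mat \<i> ** H) = \<i> * D H"
proof -
  let ?D = "\<lambda>H. L (g ** block ((1 / 2) *\<^sub>R map_matrix Im H) (map_matrix Re H) 0 (- ((1 / 2) *\<^sub>R map_matrix Im H)))
        - of_nat m * of_real (trace (map_matrix Im H)) / 2 * \<phi> g"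
  have bl: "bounded_linear (\<lambda>M. L (g ** M))"
    by (rule bounded_linear_compose[OF sp_deriv_bounded_linear[OF L] matmul.bounded_linear_right])
  have split: "block ((1 / 2) *\<^sub>R B) A 0 (- ((1 / 2) *\<^sub>R B)) = (1 / 2) *\<^sub>R block B 0 0 (- B) + (1 / 2) *\<^sub>R block 0 (2 *\<^sub>R A) 0 0" for A B :: "(real, 'n) smat"
    by (simp add: dmat_eq_iff, simp add: vec_eq_iff blockA_def blockB_def blockC_def blockD_def)
  have D: "?D H = (1 / 2) * (L (g ** block 0 (map_matrix Re H) (map_matrix Re H) 0) + \<i> * L (g ** block 0 (map_matrix Im H) (map_matrix Im H) 0))
      + of_nat m * \<i> / 2 * (of_real (trace (map_matrix Re H)) + \<i> * of_real (trace (map_matrix Im H))) * \<phi> g"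
    if H: "transpose H = H" for H
  proof -
    have RI: "transpose (map_matrix Re H) = map_matrix Re H" "transpose (map_matrix Im H) = map_matrix Im H"
      using arg_cong[OF H, of "map_matrix Re"] arg_cong[OF H, of "map_matrix Im"] by (auto simp: transpose_def vec_eq_iff)
    have "L (g ** block ((1 / 2) *\<^sub>R map_matrix Im H) (map_matrix Re H) 0 (- ((1 / 2) *\<^sub>R map_matrix Im H)))
      = (1 / 2) *\<^sub>R L (g ** block (map_matrix Im H) 0 0 (- map_matrix Im H)) + (1 / 2) *\<^sub>R L (g ** block 0 (2 *\<^sub>R map_matrix Re H) 0 0)"
      unfolding split using linear_add[OF bounded_linear.linear[OF bl]] linear_scale[OF bounded_linear.linear[OF bl]] by simp
    also have "\<dots> = (1 / 2) *\<^sub>R (\<i> * L (g ** block 0 (map_matrix Im H) (map_matrix Im H) 0))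
       + (1 / 2) *\<^sub>R (L (g ** block 0 (map_matrix Re H) (map_matrix Re H) 0) + of_nat m * (\<i> * of_real (trace (map_matrix Re H))) * \<phi> g)"
    proof -
      have "L (g ** block (map_matrix Im H) 0 0 (- map_matrix Im H)) = \<i> * L (g ** block 0 (map_matrix Im H) (map_matrix Im H) 0)"
        by (rule sp_deriv_antiholomorphic[OF L g _ RI(2)]) (rule p)
      then show ?thesis unfolding sp_deriv_translation[OF eq L g RI(1)] by simp
    qed
    finally show ?thesis by (simp add: scaleR_conv_of_real algebra_simps)
  qed
  have RIi: "map_matrix Re (mat \<i> ** H) = - map_matrix Im H" "map_matrix Im (mat \<i> ** H) = map_matrix Re H" for H :: "(complex, 'n) smat"
    by (simp_all add: vec_eq_iff mat_mult_nth)
  have neg: "L (g ** block 0 (- B) (- B) 0) = - L (g ** block 0 B B 0)" "trace (- B) = - trace B" for B :: "(real, 'n) smat"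
  proof -
    have "block 0 (- B) (- B) 0 = - block 0 B B 0" by (simp add: block_ops)
    then show "L (g ** block 0 (- B) (- B) 0) = - L (g ** block 0 B B 0)"
      using linear_neg[OF bounded_linear.linear[OF bl]] by simp
  qed (simp add: trace_def sum_negf)
  have "?D (mat \<i> ** H) = \<i> * ?D H" if H: "transpose H = H" for H
  proof -
    have iH: "transpose (mat \<i> ** H) = mat \<i> ** H" using H by (simp add: transpose_ring_simps mat_commute)
    show ?thesis unfolding D[OF H] D[OF iH] unfolding RIi neg by (simp add: algebra_simps)
  qed
  then show thesis using that has_derivative_hol_fun_at_i[OF L g] by blast
qed

lemma matrix_inv_bz:
  assumes z: "z \<in> siegel"
  shows "matrix_inv (bz z) = block (matrix_inv (pos_sqrt (map_matrix Im z))) (- (matrix_inv (pos_sqrt (map_matrix Im z)) ** map_matrix Re z)) 0 (pos_sqrt (map_matrix Im z))"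
proof -
  note s = pos_sqrt(1)[OF siegelD(2)[OF z]]
  have "transpose (pos_sqrt (map_matrix Im z)) = pos_sqrt (map_matrix Im z)" using s by (simp add: pos_def_def)
  then show ?thesis
    unfolding Sp_inverse(1)[OF bz_Sp[OF z]] unfolding bz_block
    by (simp add: transpose_ring_simps pos_def_inv_sym(1)[OF s] siegel_Re_sym[OF z])
qed

text \<open>The inverse of \<open>bz z0\<close> acts by z to s^-1 (z - Re z0) s^-1, with s the
  square root of Im z0. This map is complex affine, sends z0 to i and respects symmetric directions,
  so complex linearity carries over from the base point.\<close>

lemma hol_fun_complex_derivative:
  fixes \<phi> :: "(real, 'n::{finite, linorder}) dmat \<Rightarrow> complex"
  assumes eq: "K_equivariant m \<phi>" and smooth: "smooth_function_on Sp \<phi>"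
    and p: "\<And>X g. X \<in> p_minus \<Longrightarrow> g \<in> Sp \<Longrightarrow> lie_act X \<phi> g = 0" and z0: "z0 \<in> siegel"
  obtains D where "(hol_fun m \<phi> has_derivative D) (at z0 within siegel)"
    "\<And>H. transpose H = H \<Longrightarrow> D (mat \<i> ** H) = \<i> * D H"
proof -
  let ?g = "bz z0"
  let ?s = "pos_sqrt (map_matrix Im z0)"
  let ?si = "of_real_mat (matrix_inv ?s)"
  let ?Z = "\<lambda>z. ?si ** (z - of_real_mat (map_matrix Re z0)) ** ?si"
  note g = bz_Sp[OF z0]
  note s = pos_sqrt(1)[OF siegelD(2)[OF z0]]
  have ss: "?si ** of_real_mat ?s = mat 1" using pos_def_inv_sym(3)[OF s] by (simp flip: map_matrix_of_real_simps)
  have Z: "siegel_act (matrix_inv ?g) z = ?Z z" if "z \<in> siegel" for z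
  proof (rule siegel_act_unique[OF Sp_inverse(4)[OF g] that])
    show "?Z z ** aut_factor (matrix_inv ?g) z = of_real_mat (blockA (matrix_inv ?g)) ** z + of_real_mat (blockB (matrix_inv ?g))"
      unfolding matrix_inv_bz[OF z0] aut_factor_def block_proj
      by (simp add: map_matrix_of_real_simps matrix_mul_ring_simps ss)
  qed
  have Zs: "?Z z \<in> siegel" if "z \<in> siegel" for z
    using siegel_act_props(2)[OF Sp_inverse(4)[OF g] that] unfolding Z[OF that] .
  have act: "siegel_act ?g (?Z z) = z" if "z \<in> siegel" for z
  proof -
    have "siegel_act ?g (?Z z) = siegel_act (?g ** matrix_inv ?g) z"
      unfolding Z[OF that, symmetric] by (rule siegel_act_mult(2)[OF g Sp_inverse(4)[OF g] that, symmetric])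
    also have "\<dots> = z" unfolding Sp_inverse(2)[OF g]
      by (rule siegel_act_unique[OF mat_1_in_Sp that])
        (simp add: aut_factor_def block_ops(6) map_matrix_of_real_simps matrix_mul_ring_simps)
    finally show ?thesis .
  qed
  have Z0: "?Z z0 = mat \<i>"
    using siegel_act_bz[OF z0] siegel_act_mult(2)[OF Sp_inverse(4)[OF g] g mat_i_in_siegel] Z[OF z0]
    unfolding Sp_inverse(3)[OF g]
    by (metis Sp_inverse(3) bz_Sp bz_mat_i g mat_1_in_Sp mat_i_in_siegel siegel_act_bz)
  have h: "hol_fun m \<phi> z = det ?si ^ m * hol_fun m (\<lambda>h. \<phi> (?g ** h)) (?Z z)" if "z \<in> siegel" for z
    using hol_fun_translate[OF eq g Zs[OF that]] unfolding act[OF that] aut_factor_bz .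
  obtain L where L: "sp_deriv \<phi> ?g L" using sp_deriv_exists[OF smooth g] .
  obtain D where D: "(hol_fun m (\<lambda>h. \<phi> (?g ** h)) has_derivative D) (at (mat \<i>) within siegel)"
    "\<And>H. transpose H = H \<Longrightarrow> D (mat \<i> ** H) = \<i> * D H"
    using hol_fun_complex_derivative_at_i[OF eq L g p[OF _ g]] by blast
  have Zd: "(?Z has_derivative (\<lambda>H. ?si ** H ** ?si)) (at z0 within siegel)"
    by (intro bounded_linear.has_derivative[OF matmul.bounded_linear_left] bounded_linear.has_derivative[OF matmul.bounded_linear_right])
      (auto intro!: derivative_eq_intros)
  have "((\<lambda>z. hol_fun m (\<lambda>h. \<phi> (?g ** h)) (?Z z)) has_derivative (\<lambda>H. D (?si ** H ** ?si))) (at z0 within siegel)"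
    by (rule has_derivative_in_compose[OF Zd], unfold Z0, rule has_derivative_subset[OF D(1)]) (use Zs in blast)
  then have "((\<lambda>z. det ?si ^ m * hol_fun m (\<lambda>h. \<phi> (?g ** h)) (?Z z)) has_derivative (\<lambda>H. det ?si ^ m * D (?si ** H ** ?si))) (at z0 within siegel)"
    by (rule has_derivative_mult_right)
  then have 1: "(hol_fun m \<phi> has_derivative (\<lambda>H. det ?si ^ m * D (?si ** H ** ?si))) (at z0 within siegel)"
    by (rule has_derivative_transform[OF z0, rotated]) (use h in simp)
  have tsi: "transpose ?si = ?si" using pos_def_inv_sym(1)[OF s] by (simp flip: map_matrix_of_real_simps)
  have 2: "det ?si ^ m * D (?si ** (mat \<i> ** H) ** ?si) = \<i> * (det ?si ^ m * D (?si ** H ** ?si))" if H: "transpose H = H" for H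
  proof -
    have "transpose (?si ** H ** ?si) = ?si ** H ** ?si" by (simp add: transpose_ring_simps tsi H matrix_mul_ring_simps)
    from D(2)[OF this] have "D (mat \<i> ** (?si ** H ** ?si)) = \<i> * D (?si ** H ** ?si)" .
    moreover have "?si ** (mat \<i> ** H) ** ?si = mat \<i> ** (?si ** H ** ?si)"
      using mat_commute[of \<i> ?si] by (metis matrix_mul_assoc)
    ultimately show ?thesis by simp
  qed
  show thesis using that 1 2 by blast
qed

section \<open>Rotation invariance of the measure on the Siegel upper half space\<close>

lemma nn_integral_lborel_complex:
  assumes [measurable]: "f \<in> borel_measurable borel"
  shows "(\<integral>\<^sup>+z. f z \<partial>(lborel :: complex measure)) = (\<integral>\<^sup>+x. \<integral>\<^sup>+y. f (Complex x y) \<partial>lborel \<partial>lborel)"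
proof -
  have [measurable]: "(\<lambda>(x, y). Complex x y) \<in> borel_measurable (lborel \<Otimes>\<^sub>M lborel)"
    unfolding case_prod_beta by (rule measurable_Complex) auto
  have "lborel = distr (lborel \<Otimes>\<^sub>M lborel) borel (\<lambda>(x, y). Complex x y)"
  proof (rule lborel_eqI)
    fix l u :: complex assume *: "\<And>b. b \<in> Basis \<Longrightarrow> l \<bullet> b \<le> u \<bullet> b"
    have le: "Re l \<le> Re u" "Im l \<le> Im u" using *[of 1] *[of \<i>] by (auto simp: Basis_complex_def)
    have "(\<lambda>(x, y). Complex x y) -` box l u \<inter> space (lborel \<Otimes>\<^sub>M lborel) = {Re l<..<Re u} \<times> {Im l<..<Im u}"
      by (auto simp: box_def Basis_complex_def space_pair_measure)
    then have "emeasure (distr (lborel \<Otimes>\<^sub>M lborel) borel (\<lambda>(x, y). Complex x y)) (box l u) = emeasure (lborel \<Otimes>\<^sub>M lborel) ({Re l<..<Re u} \<times> {Im l<..<Im u})"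
      by (subst emeasure_distr) auto
    also have "\<dots> = ennreal ((Re u - Re l) * (Im u - Im l))"
      using le by (subst lborel.emeasure_pair_measure_Times) (auto simp: ennreal_mult')
    also have "(Re u - Re l) * (Im u - Im l) = (\<Prod>b\<in>Basis. (u - l) \<bullet> b)" by (simp add: Basis_complex_def)
    finally show "emeasure (distr (lborel \<Otimes>\<^sub>M lborel) borel (\<lambda>(x, y). Complex x y)) (box l u) = (\<Prod>b\<in>Basis. (u - l) \<bullet> b)" .
  qed simp
  then have "(\<integral>\<^sup>+z. f z \<partial>(lborel :: complex measure)) = (\<integral>\<^sup>+z. f z \<partial>distr (lborel \<Otimes>\<^sub>M lborel) borel (\<lambda>(x, y). Complex x y))"
    by simp
  also have "\<dots> = (\<integral>\<^sup>+p. f (case p of (x, y) \<Rightarrow> Complex x y) \<partial>(lborel \<Otimes>\<^sub>M lborel))"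
    by (rule nn_integral_distr) measurable
  also have "\<dots> = (\<integral>\<^sup>+x. \<integral>\<^sup>+y. f (Complex x y) \<partial>lborel \<partial>lborel)"
    by (subst lborel.nn_integral_fst[symmetric]) (auto simp: case_prod_beta)
  finally show ?thesis .
qed

text \<open>Multiplication by a is a positive scaling composed with a rotation. The rotation by p +
  iq with nonzero q is carried out one real variable at a time: first y is replaced by u = p x - q y
  with weight 1/|q|, then x, for fixed u, by the new imaginary part with weight |q|.\<close>

lemma nn_integral_complex_scale:
  fixes a :: complex
  assumes a: "a \<noteq> 0" and f[measurable]: "f \<in> borel_measurable borel"
  shows "(\<integral>\<^sup>+z. f (a * z) \<partial>lborel) = ennreal (1 / (norm a)\<^sup>2) * (\<integral>\<^sup>+z. f z \<partial>lborel)"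
proof -
  define r where "r = norm a"
  define w where "w = a / of_real r"
  have r: "r > 0" and w: "norm w = 1" and aw: "a = of_real r * w" using a by (auto simp: r_def w_def norm_divide)
  have rot: "(\<integral>\<^sup>+z. g (w * z) \<partial>lborel) = (\<integral>\<^sup>+z. g z \<partial>lborel)" if [measurable]: "g \<in> borel_measurable borel" for g :: "complex \<Rightarrow> ennreal"
  proof -
    define p q where "p = Re w" and "q = Im w"
    have pq: "p\<^sup>2 + q\<^sup>2 = 1" using w unfolding p_def q_def by (metis cmod_power2 one_power2)
    have wz: "w * Complex x y = Complex (p * x - q * y) (q * x + p * y)" for x y by (simp add: complex_eq_iff p_def q_def algebra_simps)
    have [measurable]: "(\<lambda>z. g (w * z)) \<in> borel_measurable borel" by measurable
    have gm[measurable]: "(\<lambda>(x, y). g (Complex x y)) \<in> borel_measurable (borel \<Otimes>\<^sub>M borel)"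
      unfolding case_prod_beta by (rule measurable_compose[OF measurable_Complex that]) auto
    have gC[measurable]: "(\<lambda>x. g (Complex (h x) (k x))) \<in> borel_measurable M" if "h \<in> borel_measurable M" "k \<in> borel_measurable M" for h k M
      using measurable_compose[OF measurable_Complex[OF that] \<open>g \<in> borel_measurable borel\<close>] .
    show ?thesis
    proof (cases "q = 0")
      case True
      then have p: "p = 1 \<or> p = -1" using pq by (simp add: power2_eq_1_iff)
      have "(\<integral>\<^sup>+z. g (w * z) \<partial>lborel) = (\<integral>\<^sup>+x. \<integral>\<^sup>+y. g (Complex (p * x) (p * y)) \<partial>lborel \<partial>lborel)"
        by (subst nn_integral_lborel_complex, measurable) (simp add: wz True)
      also have "\<dots> = (\<integral>\<^sup>+x. \<integral>\<^sup>+y. g (Complex (p * x) y) \<partial>lborel \<partial>lborel)"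
      proof (rule nn_integral_cong)
        fix x
        show "(\<integral>\<^sup>+y. g (Complex (p * x) (p * y)) \<partial>lborel) = (\<integral>\<^sup>+y. g (Complex (p * x) y) \<partial>lborel)"
          using nn_integral_real_affine[of "\<lambda>y. g (Complex (p * x) y)" p 0] p by auto
      qed
      also have "\<dots> = (\<integral>\<^sup>+x. \<integral>\<^sup>+y. g (Complex x y) \<partial>lborel \<partial>lborel)"
        using nn_integral_real_affine[of "\<lambda>x. \<integral>\<^sup>+y. g (Complex x y) \<partial>lborel" p 0] p by auto
      finally show ?thesis by (subst nn_integral_lborel_complex, measurable)
    next
      case False
      have "(\<integral>\<^sup>+z. g (w * z) \<partial>lborel) = (\<integral>\<^sup>+x. \<integral>\<^sup>+y. g (Complex (p * x - q * y) (q * x + p * y)) \<partial>lborel \<partial>lborel)"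
        by (subst nn_integral_lborel_complex, measurable) (simp add: wz)
      also have "\<dots> = (\<integral>\<^sup>+x. ennreal (1 / \<bar>q\<bar>) * (\<integral>\<^sup>+u. g (Complex u (x / q - p * u / q)) \<partial>lborel) \<partial>lborel)"
      proof (rule nn_integral_cong)
        fix x
        let ?h = "\<lambda>u. g (Complex u (x / q - p * u / q))"
        have "(\<integral>\<^sup>+u. ?h u \<partial>lborel) = ennreal \<bar>- q\<bar> * (\<integral>\<^sup>+y. ?h (p * x + (- q) * y) \<partial>lborel)"
          by (rule nn_integral_real_affine) (use False in auto)
        moreover have "x / q - p * (p * x + (- q) * y) / q = q * x + p * y" for y
        proof -
          have qq: "q * q = 1 - p * p" using pq by (simp add: power2_eq_square)
          have "x - p * p * x = q * q * x" unfolding qq by (simp add: algebra_simps)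
          then show ?thesis using False by (simp add: field_simps)
        qed
        ultimately have "(\<integral>\<^sup>+u. ?h u \<partial>lborel) = ennreal \<bar>q\<bar> * (\<integral>\<^sup>+y. g (Complex (p * x - q * y) (q * x + p * y)) \<partial>lborel)" by simp
        moreover have "ennreal (1 / \<bar>q\<bar>) * ennreal \<bar>q\<bar> = 1" using False by (simp flip: ennreal_mult')
        ultimately show "(\<integral>\<^sup>+y. g (Complex (p * x - q * y) (q * x + p * y)) \<partial>lborel) = ennreal (1 / \<bar>q\<bar>) * (\<integral>\<^sup>+u. ?h u \<partial>lborel)"
          by (simp add: mult.assoc[symmetric])
      qed
      also have "\<dots> = ennreal (1 / \<bar>q\<bar>) * (\<integral>\<^sup>+x. \<integral>\<^sup>+u. g (Complex u (x / q - p * u / q)) \<partial>lborel \<partial>lborel)"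
        by (rule nn_integral_cmult) measurable
      also have "(\<integral>\<^sup>+x. \<integral>\<^sup>+u. g (Complex u (x / q - p * u / q)) \<partial>lborel \<partial>lborel) = (\<integral>\<^sup>+u. \<integral>\<^sup>+x. g (Complex u (x / q - p * u / q)) \<partial>lborel \<partial>lborel)"
        by (rule lborel_pair.Fubini') measurable
      also have "\<dots> = (\<integral>\<^sup>+u. ennreal \<bar>q\<bar> * (\<integral>\<^sup>+v. g (Complex u v) \<partial>lborel) \<partial>lborel)"
      proof (rule nn_integral_cong)
        fix u
        let ?h = "\<lambda>v. g (Complex u v)"
        have "(\<integral>\<^sup>+v. ?h v \<partial>lborel) = ennreal \<bar>1 / q\<bar> * (\<integral>\<^sup>+x. ?h (- (p * u / q) + 1 / q * x) \<partial>lborel)"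
          by (rule nn_integral_real_affine) (use False in auto)
        moreover have "ennreal \<bar>q\<bar> * ennreal \<bar>1 / q\<bar> = 1" using False by (simp flip: ennreal_mult')
        ultimately show "(\<integral>\<^sup>+x. g (Complex u (x / q - p * u / q)) \<partial>lborel) = ennreal \<bar>q\<bar> * (\<integral>\<^sup>+v. ?h v \<partial>lborel)"
          by (simp add: mult.assoc[symmetric])
      qed
      also have "\<dots> = ennreal \<bar>q\<bar> * (\<integral>\<^sup>+u. \<integral>\<^sup>+v. g (Complex u v) \<partial>lborel \<partial>lborel)"
        by (rule nn_integral_cmult) measurable
      also have "ennreal (1 / \<bar>q\<bar>) * \<dots> = (\<integral>\<^sup>+u. \<integral>\<^sup>+v. g (Complex u v) \<partial>lborel \<partial>lborel)"
      proof -
        have "ennreal (1 / \<bar>q\<bar>) * ennreal \<bar>q\<bar> = 1" using False by (simp flip: ennreal_mult')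
        then show ?thesis by (simp add: mult.assoc[symmetric])
      qed
      finally show ?thesis by (subst (2) nn_integral_lborel_complex, measurable)
    qed
  qed
  have "(\<integral>\<^sup>+z. f (a * z) \<partial>lborel) = (\<integral>\<^sup>+z. f (of_real r * (w * z)) \<partial>lborel)" by (simp add: aw mult.assoc)
  also have "\<dots> = (\<integral>\<^sup>+z. f (of_real r * z) \<partial>lborel)"
    by (rule rot[of "\<lambda>z. f (of_real r * z)"]) measurable
  also have "\<dots> = ennreal (1 / r\<^sup>2) * (\<integral>\<^sup>+z. f z \<partial>lborel)"
  proof -
    have "(\<integral>\<^sup>+z. f z \<partial>lborel) = (\<integral>\<^sup>+z. f z \<partial>density (distr lborel borel (\<lambda>x. 0 + r *\<^sub>R x)) (\<lambda>_. ennreal (\<bar>r\<bar> ^ DIM(complex))))"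
      using lborel_affine[of r "0 :: complex"] r by simp
    also have "\<dots> = ennreal (r\<^sup>2) * (\<integral>\<^sup>+z. f (of_real r * z) \<partial>lborel)"
      using r by (subst nn_integral_density, measurable)
        (subst nn_integral_cmult, measurable, subst nn_integral_distr, auto simp: scaleR_conv_of_real)
    finally show ?thesis
    proof -
      assume "(\<integral>\<^sup>+z. f z \<partial>lborel) = ennreal (r\<^sup>2) * (\<integral>\<^sup>+z. f (of_real r * z) \<partial>lborel)"
      moreover have "ennreal (1 / r\<^sup>2) * ennreal (r\<^sup>2) = 1" using r by (simp flip: ennreal_mult')
      ultimately show ?thesis by (simp add: mult.assoc[symmetric])
    qed
  qed
  finally show ?thesis by (simp add: r_def)
qed

lemma nn_integral_complex_shift:
  fixes a :: complex
  assumes [measurable]: "f \<in> borel_measurable borel"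
  shows "(\<integral>\<^sup>+z. f (z + a) \<partial>lborel) = (\<integral>\<^sup>+z. f z \<partial>lborel)"
proof -
  have "(\<integral>\<^sup>+x. f x \<partial>lborel) = (\<integral>\<^sup>+x. f x \<partial>distr lborel borel ((+) a))" by (simp add: lborel_distr_plus)
  also have "\<dots> = (\<integral>\<^sup>+x. f (a + x) \<partial>lborel)" by (rule nn_integral_distr) auto
  finally show ?thesis by (simp add: add.commute)
qed

text \<open>The measure \<open>|z|\<^sup>-\<^sup>2 dz\<close> is invariant under multiplication, hence under inversion by
  Fubini's theorem.\<close>

lemma nn_integral_complex_inverse:
  fixes f :: "complex \<Rightarrow> ennreal"
  assumes [measurable]: "f \<in> borel_measurable borel"
  shows "(\<integral>\<^sup>+z. f (1 / z) * ennreal (1 / norm z ^ 4) \<partial>lborel) = (\<integral>\<^sup>+z. f z \<partial>lborel)"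
proof -
  define \<rho> where "\<rho> = (\<lambda>z :: complex. ennreal (1 / (norm z)\<^sup>2))"
  have [measurable]: "\<rho> \<in> borel_measurable borel" unfolding \<rho>_def by measurable
  have inv[measurable]: "(\<lambda>z :: complex. 1 / z) \<in> borel_measurable borel"
    by measurable
  have AE0: "AE z in lborel. z \<noteq> (0 :: complex)" by (rule AE_lborel_singleton)
  have mult: "(\<integral>\<^sup>+z. g (a * z) * \<rho> z \<partial>lborel) = (\<integral>\<^sup>+z. g z * \<rho> z \<partial>lborel)" if a: "a \<noteq> 0" and [measurable]: "g \<in> borel_measurable borel" for g a
  proof -
    have "\<rho> z = ennreal ((norm a)\<^sup>2) * \<rho> (a * z)" for z
      using a by (simp add: \<rho>_def norm_mult power_mult_distrib flip: ennreal_mult')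
    then have "(\<integral>\<^sup>+z. g (a * z) * \<rho> z \<partial>lborel) = (\<integral>\<^sup>+z. ennreal ((norm a)\<^sup>2) * (g (a * z) * \<rho> (a * z)) \<partial>lborel)"
      by (metis (no_types, lifting) mult.left_commute)
    also have "\<dots> = ennreal ((norm a)\<^sup>2) * (\<integral>\<^sup>+z. g (a * z) * \<rho> (a * z) \<partial>lborel)"
      by (rule nn_integral_cmult) measurable
    also have "(\<integral>\<^sup>+z. g (a * z) * \<rho> (a * z) \<partial>lborel) = ennreal (1 / (norm a)\<^sup>2) * (\<integral>\<^sup>+z. g z * \<rho> z \<partial>lborel)"
      by (rule nn_integral_complex_scale[OF a]) measurable
    also have "ennreal ((norm a)\<^sup>2) * (ennreal (1 / (norm a)\<^sup>2) * (\<integral>\<^sup>+z. g z * \<rho> z \<partial>lborel)) = (\<integral>\<^sup>+z. g z * \<rho> z \<partial>lborel)"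
      using a by (simp flip: mult.assoc ennreal_mult')
    finally show ?thesis .
  qed
  have inv_inv: "(\<integral>\<^sup>+z. g (1 / z) * \<rho> z \<partial>lborel) = (\<integral>\<^sup>+z. g z * \<rho> z \<partial>lborel)" if [measurable]: "g \<in> borel_measurable borel" for g
  proof -
    \<comment> \<open>A test function whose integral is finite and nonzero, so that it can be
      cancelled at the end; the annulus keeps away from the singularity of \<open>\<rho>\<close> at
      0.\<close>
    define A where "A = {z :: complex. 1 < norm z \<and> norm z < 2}"
    define h where "h = (\<lambda>z. indicator A z :: ennreal)"
    have Aopen: "open A" unfolding A_def by (intro open_Collect_conj open_Collect_less continuous_intros)
    then have [measurable]: "A \<in> sets borel" by simp
    have [measurable]: "h \<in> borel_measurable borel" unfolding h_def by measurable
    define H where "H = (\<integral>\<^sup>+z. h z * \<rho> z \<partial>lborel)"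
    have Hfin: "H < \<infinity>"
    proof -
      have "H \<le> (\<integral>\<^sup>+z. indicator A z \<partial>lborel)"
        unfolding H_def
      proof (rule nn_integral_mono)
        fix z :: complex
        have "1 / (norm z)\<^sup>2 \<le> 1" if "1 < norm z"
          using frac_le[of 1 1 1 "(norm z)\<^sup>2"] one_le_power[of "norm z" 2] that by simp
        then show "h z * \<rho> z \<le> indicator A z" by (auto simp: h_def \<rho>_def A_def indicator_def)
      qed
      also have "\<dots> \<le> emeasure lborel (cball (0 :: complex) 2)"
        by (subst nn_integral_indicator) (auto intro!: emeasure_mono simp: A_def)
      also have "\<dots> < \<infinity>" using emeasure_lborel_cball_finite by auto
      finally show ?thesis .
    qed
    have Hpos: "H \<noteq> 0"
    proof
      assume "H = 0"
      then have "AE z in lborel. h z * \<rho> z = 0" unfolding H_def by (subst (asm) nn_integral_0_iff_AE) auto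
      then have "AE z in lborel. z \<notin> A" by eventually_elim (auto simp: h_def \<rho>_def A_def)
      have "of_real (3/2) \<in> A" by (simp add: A_def)
      then have ne: "A \<noteq> {}" by blast
      have "emeasure lborel A = 0" using \<open>AE z in lborel. z \<notin> A\<close> by (subst (asm) AE_iff_measurable[where N = A]) auto
      then have "negligible A"
        unfolding negligible_iff_null_sets by (intro null_sets_completionI null_setsI) auto
      then show False using open_not_negligible[OF Aopen] ne by blast
    qed
    \<comment> \<open>Invariance under multiplication is used three times on the double integral:
      g(1/z) h(w) becomes g(1/z) h(zw), then g(w/z) h(z) by rescaling z, then g(w) h(z) by rescaling
      w.\<close>
    have "(\<integral>\<^sup>+z. g (1 / z) * \<rho> z \<partial>lborel) * H = (\<integral>\<^sup>+z. g (1 / z) * \<rho> z * H \<partial>lborel)"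
      by (rule nn_integral_multc[symmetric]) measurable
    also have "\<dots> = (\<integral>\<^sup>+z. \<integral>\<^sup>+w. g (1 / z) * \<rho> z * (h (z * w) * \<rho> w) \<partial>lborel \<partial>lborel)"
      using AE0
    proof (intro nn_integral_cong_AE, eventually_elim)
      case (elim z)
      show ?case unfolding H_def mult[OF elim(2), symmetric, of h, simplified]
        by (rule nn_integral_cmult[symmetric]) measurable
    qed
    also have "\<dots> = (\<integral>\<^sup>+w. \<integral>\<^sup>+z. g (1 / z) * \<rho> z * (h (z * w) * \<rho> w) \<partial>lborel \<partial>lborel)"
      by (rule lborel_pair.Fubini') measurable
    also have "\<dots> = (\<integral>\<^sup>+w. \<integral>\<^sup>+z. g (w / z) * \<rho> z * (h z * \<rho> w) \<partial>lborel \<partial>lborel)"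
      using AE0
    proof (intro nn_integral_cong_AE, eventually_elim)
      case (elim w)
      have "(\<integral>\<^sup>+z. (g (w / (w * z)) * (h (w * z) * \<rho> w)) * \<rho> z \<partial>lborel) = (\<integral>\<^sup>+z. (g (w / z) * (h z * \<rho> w)) * \<rho> z \<partial>lborel)"
        by (rule mult[OF elim(2), of "\<lambda>z. g (w / z) * (h z * \<rho> w)"]) measurable
      then show ?case using elim by (simp add: mult_ac)
    qed
    also have "\<dots> = (\<integral>\<^sup>+z. \<integral>\<^sup>+w. g (w / z) * \<rho> z * (h z * \<rho> w) \<partial>lborel \<partial>lborel)"
      by (rule lborel_pair.Fubini'[symmetric]) measurable
    also have "\<dots> = (\<integral>\<^sup>+z. (\<integral>\<^sup>+w. g w * \<rho> w \<partial>lborel) * (h z * \<rho> z) \<partial>lborel)"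
      using AE0
    proof (intro nn_integral_cong_AE, eventually_elim)
      case (elim z)
      have "(\<integral>\<^sup>+w. g (w / z) * \<rho> z * (h z * \<rho> w) \<partial>lborel) = (\<integral>\<^sup>+w. (g (1 / z * w) * \<rho> w) * (h z * \<rho> z) \<partial>lborel)"
        by (simp add: mult_ac)
      also have "\<dots> = (\<integral>\<^sup>+w. g (1 / z * w) * \<rho> w \<partial>lborel) * (h z * \<rho> z)"
        by (rule nn_integral_multc) measurable
      also have "(\<integral>\<^sup>+w. g (1 / z * w) * \<rho> w \<partial>lborel) = (\<integral>\<^sup>+w. g w * \<rho> w \<partial>lborel)"
        by (rule mult) (use elim in auto)
      finally show ?case .
    qed
    also have "\<dots> = (\<integral>\<^sup>+w. g w * \<rho> w \<partial>lborel) * H"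
      unfolding H_def by (rule nn_integral_cmult) measurable
    finally show ?thesis using Hfin Hpos by (auto simp: mult.commute[of _ H] ennreal_mult_cancel_left)
  qed
  have "(\<integral>\<^sup>+z. f (1 / z) * ennreal (1 / norm z ^ 4) \<partial>lborel) = (\<integral>\<^sup>+z. (f (1 / z) * ennreal ((norm (1 / z))\<^sup>2)) * \<rho> z \<partial>lborel)"
    by (intro nn_integral_cong) (simp add: \<rho>_def mult.assoc norm_divide power_divide power_add[symmetric] flip: ennreal_mult')
  also have "\<dots> = (\<integral>\<^sup>+z. (f z * ennreal ((norm z)\<^sup>2)) * \<rho> z \<partial>lborel)"
    by (rule inv_inv[of "\<lambda>z. f z * ennreal ((norm z)\<^sup>2)"]) measurable
  also have "\<dots> = (\<integral>\<^sup>+z. f z \<partial>lborel)"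
    using AE0 by (intro nn_integral_cong_AE, eventually_elim) (simp add: \<rho>_def mult.assoc flip: ennreal_mult')
  finally show ?thesis .
qed

text \<open>For nonzero s the transformation is -c/s + (1/s) / (c - s z), an inversion between two
  affine maps. The scaling weights s^-2 and s^2 of the affine maps cancel, and the inversion
  accounts for the fourth power.\<close>

lemma nn_integral_complex_rotation:
  fixes c s :: real and f :: "complex \<Rightarrow> ennreal"
  assumes cs: "c\<^sup>2 + s\<^sup>2 = 1" and [measurable]: "f \<in> borel_measurable borel"
  shows "(\<integral>\<^sup>+z. f ((c * z + s) / (c - s * z)) * ennreal (1 / norm (c - s * z) ^ 4) \<partial>(lborel :: complex measure)) = (\<integral>\<^sup>+z. f z \<partial>(lborel :: complex measure))"
proof (cases "s = 0")
  case True
  then have c: "c = 1 \<or> c = -1" using cs by (simp add: power2_eq_1_iff)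
  then have "(c * z + s) / (c - s * z) = z" "norm (c - s * z) = 1" for z :: complex using True by auto
  then show ?thesis by simp
next
  case False
  let ?g = "\<lambda>w :: complex. f (- (c / s) + 1 / s * (1 / w)) * ennreal (1 / norm w ^ 4)"
  have [measurable]: "(\<lambda>z :: complex. f ((c * z + s) / (c - s * z)) * ennreal (1 / norm (c - s * z) ^ 4)) \<in> borel_measurable borel" by measurable
  have eq: "f ((c * z + s) / (c - s * z)) * ennreal (1 / norm (c - s * z) ^ 4) = ?g (c + (- s) * z)" for z :: complex
  proof (cases "c - s * z = 0")
    case False
    have "c * z + s = - (c / s) * (c - s * z) + 1 / of_real s"
    proof -
      have "complex_of_real (c\<^sup>2 + s\<^sup>2) = 1" unfolding cs by simp
      then show ?thesis using \<open>s \<noteq> 0\<close> by (simp add: field_simps power2_eq_square)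
    qed
    then have "(c * z + s) / (c - s * z) = (- (c / s) * (c - s * z) + 1 / of_real s) / (c - s * z)" by simp
    also have "\<dots> = - (c / s) + (1 / of_real s) / (c - s * z)"
    proof -
      have "(a * d + b) / d = a + b / d" if "d \<noteq> 0" for a b d :: complex using that by (simp add: add_divide_distrib)
      from this[OF False] show ?thesis .
    qed
    also have "\<dots> = - (c / s) + 1 / s * (1 / (c - s * z))" by simp
    finally show ?thesis by simp
  qed simp
  have "(\<integral>\<^sup>+z. f ((c * z + s) / (c - s * z)) * ennreal (1 / norm (c - s * z) ^ 4) \<partial>(lborel :: complex measure)) = (\<integral>\<^sup>+z. ?g (of_real (- s) * z + c) \<partial>(lborel :: complex measure))"
    unfolding eq by (simp add: add.commute)
  also have "\<dots> = ennreal (1 / (norm (complex_of_real (- s)))\<^sup>2) * (\<integral>\<^sup>+z. ?g (z + c) \<partial>(lborel :: complex measure))"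
    by (rule nn_integral_complex_scale[of _ "\<lambda>z :: complex. ?g (z + c)"]) (use False in auto)
  also have "(\<integral>\<^sup>+z. ?g (z + c) \<partial>(lborel :: complex measure)) = (\<integral>\<^sup>+z. ?g z \<partial>(lborel :: complex measure))"
    by (rule nn_integral_complex_shift) measurable
  also have "\<dots> = (\<integral>\<^sup>+z. f (- (c / s) + 1 / s * z) \<partial>(lborel :: complex measure))"
    by (rule nn_integral_complex_inverse[of "\<lambda>z :: complex. f (- (c / s) + 1 / s * z)"]) measurable
  also have "\<dots> = (\<integral>\<^sup>+z. f (of_real (1 / s) * z + - (c / s)) \<partial>(lborel :: complex measure))" by (simp add: add.commute)
  also have "\<dots> = ennreal (1 / (norm (complex_of_real (1 / s)))\<^sup>2) * (\<integral>\<^sup>+z. f (z + - (c / s)) \<partial>(lborel :: complex measure))"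
    by (rule nn_integral_complex_scale[of _ "\<lambda>z :: complex. f (z + - (c / s))"]) (use False in auto)
  also have "(\<integral>\<^sup>+z. f (z + - (c / s)) \<partial>(lborel :: complex measure)) = (\<integral>\<^sup>+z. f z \<partial>(lborel :: complex measure))"
    by (rule nn_integral_complex_shift) measurable
  also have "ennreal (1 / (norm (complex_of_real (- s)))\<^sup>2) * (ennreal (1 / (norm (complex_of_real (1 / s)))\<^sup>2) * (\<integral>\<^sup>+z. f z \<partial>(lborel :: complex measure))) = (\<integral>\<^sup>+z. f z \<partial>(lborel :: complex measure))"
    using False by (simp add: norm_divide power_divide flip: mult.assoc ennreal_mult')
  finally show ?thesis .
qed

text \<open>Rotations act on complex entries, whereas \<open>siegel_measure\<close> is built from a
  measure on the real parts and one on the imaginary parts; this passes between the two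
  descriptions.\<close>

lemma nn_integral_lborel_prod_on_complex:
  fixes f :: "('i \<Rightarrow> complex) \<Rightarrow> ennreal"
  assumes "finite J" "f \<in> borel_measurable (lborel_prod_on J)"
  shows "(\<integral>\<^sup>+z. f z \<partial>lborel_prod_on J) = (\<integral>\<^sup>+x. \<integral>\<^sup>+y. f (\<lambda>j\<in>J. Complex (x j) (y j)) \<partial>lborel_prod_on J \<partial>lborel_prod_on J)"
  using assms
proof (induction J arbitrary: f rule: finite_induct)
  case empty
  then show ?case by (simp add: PiM_empty nn_integral_count_space_finite)
next
  case (insert i J)
  interpret C: product_sigma_finite "\<lambda>_. lborel :: complex measure" by (rule product_sigma_finite_lborel)
  interpret R: product_sigma_finite "\<lambda>_. lborel :: real measure" by (rule product_sigma_finite_lborel)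
  let ?R = "lborel_prod_on J :: ('i \<Rightarrow> real) measure" and ?R' = "lborel_prod_on (insert i J) :: ('i \<Rightarrow> real) measure"
  interpret RJ: sigma_finite_measure ?R by (rule sigma_finite_lborel_prod_on[OF insert.hyps(1)])
  interpret RJ': sigma_finite_measure ?R' by (rule sigma_finite_lborel_prod_on) (use insert.hyps in simp)
  interpret P: pair_sigma_finite "lborel :: real measure" ?R by unfold_locales
  interpret P2: pair_sigma_finite "?R" "lborel :: real measure" by unfold_locales
  note f[measurable] = insert.prems
  define F where "F = (\<lambda>x y. f (\<lambda>j\<in>insert i J. Complex (x j) (y j)))"
  have Fm: "(\<lambda>(x, y). F x y) \<in> borel_measurable (?R' \<Otimes>\<^sub>M ?R')"
    unfolding F_def case_prod_beta
  proof (rule measurable_compose[OF measurable_restrict f])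
    fix j assume "j \<in> insert i J"
    then have "(\<lambda>x. x j) \<in> ?R' \<rightarrow>\<^sub>M lborel" by (rule measurable_component_singleton)
    then show "(\<lambda>p. Complex (fst p j) (snd p j)) \<in> ?R' \<Otimes>\<^sub>M ?R' \<rightarrow>\<^sub>M lborel"
      using measurable_Complex[OF measurable_compose[OF measurable_fst] measurable_compose[OF measurable_snd], of "\<lambda>x. x j" ?R' "\<lambda>x. x j" ?R'] by simp
  qed
  have Fupd: "F (x(i := a)) (y(i := b)) = f ((\<lambda>j\<in>J. Complex (x j) (y j))(i := Complex a b))" for x y a b
    unfolding F_def using insert.hyps by (auto intro!: arg_cong[where f = f] simp: fun_eq_iff restrict_def)
  have FC: "(\<lambda>(a, x, b, y). F (x(i := a)) (y(i := b))) \<in> borel_measurable (lborel \<Otimes>\<^sub>M ?R \<Otimes>\<^sub>M lborel \<Otimes>\<^sub>M ?R)"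
  proof -
    have 1: "(\<lambda>q. (fst (snd q))(i := fst q)) \<in> lborel \<Otimes>\<^sub>M ?R \<Otimes>\<^sub>M lborel \<Otimes>\<^sub>M ?R \<rightarrow>\<^sub>M ?R'"
      and 2: "(\<lambda>q. (snd (snd (snd q)))(i := fst (snd (snd q)))) \<in> lborel \<Otimes>\<^sub>M ?R \<Otimes>\<^sub>M lborel \<Otimes>\<^sub>M ?R \<rightarrow>\<^sub>M ?R'"
      by (rule measurable_fun_upd[where J = J]; measurable)+
    then show ?thesis
      using measurable_compose[OF measurable_Pair[OF 1 2] Fm] by (simp add: case_prod_beta)
  qed
  have FC': "(\<lambda>q. F ((X q)(i := A q)) ((Y q)(i := B q))) \<in> borel_measurable M"
    if "A \<in> M \<rightarrow>\<^sub>M lborel" "X \<in> M \<rightarrow>\<^sub>M ?R" "B \<in> M \<rightarrow>\<^sub>M lborel" "Y \<in> M \<rightarrow>\<^sub>M ?R" for A X B Y and M :: "'z measure"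
    using measurable_compose[OF measurable_Pair[OF that(1) measurable_Pair[OF that(2) measurable_Pair[OF that(3,4)]]] FC] by simp
  have cm: "(\<lambda>y. f (y(i := z))) \<in> borel_measurable (lborel_prod_on J)" for z
    by (rule measurable_compose[OF measurable_fun_upd[where J = J] f]) auto
  have "(\<integral>\<^sup>+z. f z \<partial>lborel_prod_on (insert i J)) = (\<integral>\<^sup>+z. \<integral>\<^sup>+w. f (w(i := z)) \<partial>lborel_prod_on J \<partial>lborel)"
    by (rule C.product_nn_integral_insert_rev[OF insert.hyps f])
  also have "\<dots> = (\<integral>\<^sup>+z. \<integral>\<^sup>+x. \<integral>\<^sup>+y. f ((\<lambda>j\<in>J. Complex (x j) (y j))(i := z)) \<partial>?R \<partial>?R \<partial>lborel)"
    by (intro nn_integral_cong) (rule insert.IH[OF cm])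
  also have "\<dots> = (\<integral>\<^sup>+a. \<integral>\<^sup>+b. \<integral>\<^sup>+x. \<integral>\<^sup>+y. F (x(i := a)) (y(i := b)) \<partial>?R \<partial>?R \<partial>lborel \<partial>lborel)"
  proof (subst nn_integral_lborel_complex)
    have "(\<lambda>(z, x, y). f ((\<lambda>j\<in>J. Complex (x j) (y j))(i := z))) \<in> borel_measurable (borel \<Otimes>\<^sub>M ?R \<Otimes>\<^sub>M ?R)"
    proof -
      have "(\<lambda>q. (\<lambda>j\<in>J. Complex (fst (snd q) j) (snd (snd q) j))) \<in> borel \<Otimes>\<^sub>M ?R \<Otimes>\<^sub>M ?R \<rightarrow>\<^sub>M lborel_prod_on J"
      proof (rule measurable_restrict)
        fix j assume j: "j \<in> J"
        have comp: "(\<lambda>x. x j) \<in> borel_measurable ?R"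
          using measurable_component_singleton[OF j, of "\<lambda>_. lborel :: real measure"] by simp
        have "(\<lambda>q. fst (snd q) j) \<in> borel_measurable (borel \<Otimes>\<^sub>M ?R \<Otimes>\<^sub>M ?R)"
          by (rule measurable_compose[OF measurable_compose[OF measurable_snd measurable_fst] comp])
        moreover have "(\<lambda>q. snd (snd q) j) \<in> borel_measurable (borel \<Otimes>\<^sub>M ?R \<Otimes>\<^sub>M ?R)"
          by (rule measurable_compose[OF measurable_compose[OF measurable_snd measurable_snd] comp])
        ultimately have "(\<lambda>q. Complex (fst (snd q) j) (snd (snd q) j)) \<in> borel_measurable (borel \<Otimes>\<^sub>M ?R \<Otimes>\<^sub>M ?R)"
          by (rule measurable_Complex)
        then show "(\<lambda>q. Complex (fst (snd q) j) (snd (snd q) j)) \<in> borel \<Otimes>\<^sub>M ?R \<Otimes>\<^sub>M ?R \<rightarrow>\<^sub>M lborel"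
          by simp
      qed
      then have "(\<lambda>q. (\<lambda>j\<in>J. Complex (fst (snd q) j) (snd (snd q) j))(i := fst q)) \<in> borel \<Otimes>\<^sub>M ?R \<Otimes>\<^sub>M ?R \<rightarrow>\<^sub>M lborel_prod_on (insert i J)"
        by (rule measurable_fun_upd[where J = J, rotated]) auto
      from measurable_compose[OF this f] show ?thesis by (simp add: case_prod_beta)
    qed
    then show "(\<lambda>z. \<integral>\<^sup>+x. \<integral>\<^sup>+y. f ((\<lambda>j\<in>J. Complex (x j) (y j))(i := z)) \<partial>?R \<partial>?R) \<in> borel_measurable borel"
      by measurable
  qed (simp only: Fupd)
  also have "\<dots> = (\<integral>\<^sup>+a. \<integral>\<^sup>+x. \<integral>\<^sup>+b. \<integral>\<^sup>+y. F (x(i := a)) (y(i := b)) \<partial>?R \<partial>lborel \<partial>?R \<partial>lborel)"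
  proof (rule nn_integral_cong)
    fix a :: real
    have "(\<lambda>q. F ((snd (fst q))(i := a)) ((snd q)(i := fst (fst q)))) \<in> borel_measurable ((lborel \<Otimes>\<^sub>M ?R) \<Otimes>\<^sub>M ?R)"
      by (rule FC') measurable
    then have "(\<lambda>(b, x). \<integral>\<^sup>+y. F (x(i := a)) (y(i := b)) \<partial>?R) \<in> borel_measurable (lborel \<Otimes>\<^sub>M ?R)"
      unfolding case_prod_beta by measurable
    then show "(\<integral>\<^sup>+b. \<integral>\<^sup>+x. \<integral>\<^sup>+y. F (x(i := a)) (y(i := b)) \<partial>?R \<partial>?R \<partial>lborel) = (\<integral>\<^sup>+x. \<integral>\<^sup>+b. \<integral>\<^sup>+y. F (x(i := a)) (y(i := b)) \<partial>?R \<partial>lborel \<partial>?R)"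
      by (rule P.Fubini'[symmetric])
  qed
  also have "\<dots> = (\<integral>\<^sup>+a. \<integral>\<^sup>+x. \<integral>\<^sup>+y. F (x(i := a)) y \<partial>?R' \<partial>?R \<partial>lborel)"
  proof (rule nn_integral_cong, rule nn_integral_cong)
    fix a :: real and x :: "'i \<Rightarrow> real" assume "x \<in> space ?R"
    then have "x(i := a) \<in> space ?R'" by (auto simp: space_PiM PiE_def extensional_def)
    then have "(\<lambda>y. F (x(i := a)) y) \<in> borel_measurable ?R'" using measurable_compose[OF measurable_Pair1' Fm] by simp
    then show "(\<integral>\<^sup>+b. \<integral>\<^sup>+y. F (x(i := a)) (y(i := b)) \<partial>?R \<partial>lborel) = (\<integral>\<^sup>+y. F (x(i := a)) y \<partial>?R')"
      by (rule R.product_nn_integral_insert_rev[OF insert.hyps, symmetric])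
  qed
  also have "\<dots> = (\<integral>\<^sup>+x. \<integral>\<^sup>+y. F x y \<partial>?R' \<partial>?R')"
  proof (rule R.product_nn_integral_insert_rev[OF insert.hyps, symmetric])
    show "(\<lambda>x. \<integral>\<^sup>+y. F x y \<partial>?R') \<in> borel_measurable ?R'" using Fm by measurable
  qed
  finally show ?case unfolding F_def .
qed

section \<open>Coordinates on the Siegel upper half space\<close>

definition upmat :: "('n::{finite, linorder} \<times> 'n \<Rightarrow> 'a) \<Rightarrow> ('a, 'n) smat" where
  "upmat x = (\<chi> r s. x (upair r s))"

lemma upmat_nth [simp]: "upmat x $ r $ s = x (upair r s)" by (simp add: upmat_def)

lemma transpose_upmat [simp]: "transpose (upmat x) = upmat x"
  by (simp add: upmat_def transpose_def upair_commute vec_eq_iff)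

lemma upairs_UNIV: "{(r, s). r \<le> s} = upairs UNIV" by (simp add: upairs_def)

lemma pos_def_iff_sub_pos: "pos_def y \<longleftrightarrow> transpose y = y \<and> sub_pos UNIV (\<lambda>r s. y $ r $ s)"
proof -
  have q: "(\<chi> r. v r) \<bullet> (y *v (\<chi> r. v r)) = (\<Sum>r\<in>UNIV. \<Sum>s\<in>UNIV. v r * y $ r $ s * v s)" for v
    by (simp add: inner_vec_def matrix_vector_mult_def sum_distrib_left mult_ac)
  have "(\<forall>v. v \<noteq> 0 \<longrightarrow> v \<bullet> (y *v v) > 0) \<longleftrightarrow> sub_pos UNIV (\<lambda>r s. y $ r $ s)"
    unfolding sub_pos_def q[symmetric]
  proof (intro iffI allI impI)
    fix v :: "'a \<Rightarrow> real" assume "\<forall>v. v \<noteq> 0 \<longrightarrow> v \<bullet> (y *v v) > 0" "\<exists>r\<in>UNIV. v r \<noteq> 0"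
    moreover from this have "(\<chi> r. v r) \<noteq> 0" by (auto simp: vec_eq_iff)
    ultimately show "0 < (\<chi> r. v r) \<bullet> (y *v (\<chi> r. v r))" by blast
  next
    fix v :: "(real, 'a) vec" assume *: "\<forall>v. (\<exists>r\<in>UNIV. v r \<noteq> 0) \<longrightarrow> 0 < (\<chi> r. v r) \<bullet> (y *v (\<chi> r. v r))" "v \<noteq> 0"
    then have "\<exists>r\<in>UNIV. v $ r \<noteq> 0" by (auto simp: vec_eq_iff)
    then have "0 < (\<chi> r. v $ r) \<bullet> (y *v (\<chi> r. v $ r))" using *(1)[rule_format, of "\<lambda>r. v $ r"] by blast
    then show "0 < v \<bullet> (y *v v)" by simp
  qed
  then show ?thesis unfolding pos_def_def by blast
qed

lemma borel_measurable_nth2 [measurable]: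
  "(\<lambda>z :: ('a::{real_normed_field, second_countable_topology}, 'n::finite) smat. z $ r $ s) \<in> borel_measurable borel"
  by (intro borel_measurable_continuous_onI continuous_intros)

lemma siegel_borel [measurable]: "siegel \<in> sets (borel :: (complex, 'n::finite) smat measure)"
proof -
  \<comment> \<open>Symmetrized so that the symmetry required by \<open>measurable_sub_pos\<close>
    holds at every matrix; on symmetric z it is twice the imaginary part, with the same
    positivity.\<close>
  let ?M = "\<lambda>z :: (complex, 'n) smat. \<lambda>r s. Im (z $ r $ s) + Im (z $ s $ r)"
  have eq: "siegel = {z :: (complex, 'n) smat. transpose z = z} \<inter> {z \<in> space borel. sub_pos UNIV (?M z)}"
  proof -
    have "pos_def (map_matrix Im z) \<longleftrightarrow> sub_pos UNIV (?M z)" if z: "transpose z = z" for z :: "(complex, 'n) smat"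
    proof -
      have s: "z $ s $ r = z $ r $ s" for r s using arg_cong[OF z, of "\<lambda>z. z $ r $ s"] by (simp add: transpose_def)
      have "transpose (map_matrix Im z) = map_matrix Im z" by (simp add: transpose_def vec_eq_iff s)
      moreover have "sub_pos UNIV (?M z) \<longleftrightarrow> sub_pos UNIV (\<lambda>r s. map_matrix Im z $ r $ s)"
      proof -
        have "(\<Sum>r\<in>UNIV. \<Sum>t\<in>UNIV. v r * (Im (z $ r $ t) + Im (z $ t $ r)) * v t) = 2 * (\<Sum>r\<in>UNIV. \<Sum>t\<in>UNIV. v r * Im (z $ r $ t) * v t)" for v
          unfolding sum_distrib_left by (intro sum.cong refl) (simp add: s)
        then show ?thesis unfolding sub_pos_def by simp
      qed
      ultimately show ?thesis unfolding pos_def_iff_sub_pos by blast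
    qed
    then show ?thesis unfolding siegel_def by auto
  qed
  have "closed {z :: (complex, 'n) smat. transpose z = z}"
    unfolding vec_eq_iff transpose_def by (intro closed_Collect_all) (simp, intro closed_Collect_eq continuous_intros)
  moreover have "{z \<in> space borel. sub_pos UNIV (?M z)} \<in> sets borel"
    by (rule predE, rule measurable_sub_pos) (auto simp: sub_sym_def add.commute)
  ultimately show ?thesis unfolding eq by auto
qed

lemma sets_siegel_measure: "sets siegel_measure = sets (restrict_space borel siegel)"
  "space siegel_measure = siegel"
proof -
  show "sets siegel_measure = sets (restrict_space borel siegel)"
    unfolding siegel_measure_def by (simp add: sets_restrict_space)
  then have "space siegel_measure = space (restrict_space borel siegel)" by (rule sets_eq_imp_space_eq)
  then show "space siegel_measure = siegel" by (simp add: space_restrict_space)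
qed

lemma measurable_upmat:
  "upmat \<in> (lborel_prod_on (upairs UNIV) :: ('n::{finite, linorder} \<times> 'n \<Rightarrow> 'a::{euclidean_space}) measure) \<rightarrow>\<^sub>M borel"
proof (rule borel_measurable_euclidean_space[THEN iffD2], rule ballI)
  fix b :: "('a, 'n) smat" assume "b \<in> Basis"
  then obtain r s u where b: "b = axis r (axis s u)" "u \<in> Basis" unfolding Basis_vec_def by auto
  have [measurable]: "(\<lambda>x. x (upair r s)) \<in> borel_measurable (lborel_prod_on (upairs UNIV) :: ('n \<times> 'n \<Rightarrow> 'a) measure)"
    by (rule measurable_upair_component) auto
  show "(\<lambda>x. upmat x \<bullet> b) \<in> borel_measurable (lborel_prod_on (upairs UNIV))"
    unfolding b inner_axis upmat_nth by measurable
qed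

lemma sym_lborel_eq: "sym_lborel = distr (lborel_prod_on (upairs UNIV)) borel upmat"
  unfolding sym_lborel_def upairs_UNIV
  by (rule arg_cong[where f = "distr _ _"]) (simp add: fun_eq_iff upmat_def upair_def)

text \<open>An image of a sigma-finite measure need not be sigma-finite. Here the matrices with
  bounded entries pull back into boxes, which have finite volume.\<close>

lemma sigma_finite_sym_lborel: "sigma_finite_measure (sym_lborel :: (real, 'n::{finite, linorder}) smat measure)"
proof
  interpret product_sigma_finite "\<lambda>_. lborel :: real measure" by (rule product_sigma_finite_lborel)
  let ?A = "\<lambda>k::nat. {X :: (real, 'n) smat. \<forall>r s. \<bar>X $ r $ s\<bar> \<le> real k}"
  have Am: "?A k \<in> sets borel" for k
    by (intro borel_closed closed_Collect_all closed_Collect_le continuous_intros)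
  have fin: "emeasure (sym_lborel :: (real, 'n) smat measure) (?A k) \<noteq> \<infinity>" for k
  proof -
    have "emeasure (sym_lborel :: (real, 'n) smat measure) (?A k) = emeasure (lborel_prod_on (upairs UNIV)) (upmat -` ?A k \<inter> space (lborel_prod_on (upairs UNIV)))"
      unfolding sym_lborel_eq by (rule emeasure_distr[OF measurable_upmat Am])
    also have "\<dots> \<le> emeasure (lborel_prod_on (upairs UNIV)) (PiE (upairs (UNIV :: 'n set)) (\<lambda>_. {- real k..real k}))"
    proof (rule emeasure_mono)
      show "upmat -` ?A k \<inter> space (lborel_prod_on (upairs UNIV)) \<subseteq> PiE (upairs UNIV) (\<lambda>_. {- real k..real k})"
      proof
        fix x :: "'n \<times> 'n \<Rightarrow> real" assume x: "x \<in> upmat -` ?A k \<inter> space (lborel_prod_on (upairs UNIV))"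
        have "x (r, s) \<in> {- real k..real k}" if "r \<le> s" for r s
        proof -
          have "\<bar>upmat x $ r $ s\<bar> \<le> real k" using x by blast
          then show ?thesis using that by (auto simp: upair_def)
        qed
        then show "x \<in> PiE (upairs UNIV) (\<lambda>_. {- real k..real k})"
          using x by (auto simp: space_PiM PiE_def upairs_def)
      qed
    qed (auto intro!: sets_PiM_I_finite finite_upairs)
    also have "\<dots> = (\<Prod>i\<in>upairs (UNIV :: 'n set). emeasure lborel {- real k..real k})"
      by (rule emeasure_PiM) (auto intro: finite_upairs)
    also have "\<dots> < \<infinity>" by (simp add: ennreal_prod_eq_top less_top[symmetric] power_eq_top_ennreal)
    finally show ?thesis by simp
  qed
  have un: "(\<Union>k. ?A k) = UNIV"
  proof -
    have "\<exists>k. X \<in> ?A k" for X :: "(real, 'n) smat"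
    proof -
      obtain k where k: "norm X \<le> real k" using real_arch_simple by blast
      have "\<bar>X $ r $ s\<bar> \<le> norm X" for r s
        using component_le_norm_cart[of "X $ r" s] Finite_Cartesian_Product.norm_nth_le[of X r] by linarith
      then have "X \<in> ?A k" using k by (auto intro: order_trans)
      then show ?thesis by blast
    qed
    then show ?thesis by blast
  qed
  show "\<exists>A. countable A \<and> A \<subseteq> sets sym_lborel \<and> \<Union> A = space (sym_lborel :: (real, 'n) smat measure) \<and> (\<forall>a\<in>A. emeasure sym_lborel a \<noteq> \<infinity>)"
    by (rule exI[of _ "range ?A"]) (use Am fin un in \<open>auto simp: sym_lborel_def\<close>)
qed

lemma continuous_on_map_matrix [continuous_intros]:
  assumes "continuous_on S f" "continuous_on UNIV h"
  shows "continuous_on S (\<lambda>x. map_matrix h (f x))"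
  unfolding map_matrix_def
  by (intro continuous_on_matrix continuous_on_compose2[OF assms(2)] continuous_intros assms(1)) auto

lemma measurable_det_Im [measurable]: "(\<lambda>z :: (complex, 'n::finite) smat. det (map_matrix Im z)) \<in> borel_measurable borel"
  by (intro borel_measurable_continuous_onI continuous_on_det continuous_intros)

abbreviation siegel_density :: "(complex, 'n::finite) smat \<Rightarrow> ennreal" where
  "siegel_density z \<equiv> indicator siegel z * ennreal (inverse (det (map_matrix Im z) ^ (CARD('n) + 1)))"

lemma nn_integral_siegel_real:
  fixes G :: "(complex, 'n::{finite, linorder}) smat \<Rightarrow> ennreal"
  assumes G: "G \<in> borel_measurable borel"
  shows "(\<integral>\<^sup>+z. G z \<partial>siegel_measure) = (\<integral>\<^sup>+x. \<integral>\<^sup>+y. G (complex_mat (upmat x) (upmat y)) * siegel_density (complex_mat (upmat x) (upmat y))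
     \<partial>lborel_prod_on (upairs UNIV) \<partial>lborel_prod_on (upairs UNIV))"
proof -
  interpret S: sigma_finite_measure "sym_lborel :: (real, 'n) smat measure" by (rule sigma_finite_sym_lborel)
  note G[measurable]
  have "continuous_on UNIV (\<lambda>p :: (real, 'n) smat \<times> (real, 'n) smat. complex_mat (fst p) (snd p))"
    unfolding complex_mat_def Complex_eq by (intro continuous_on_matrix continuous_intros)
  then have "(\<lambda>p :: (real, 'n) smat \<times> (real, 'n) smat. complex_mat (fst p) (snd p)) \<in> borel_measurable borel"
    by (rule borel_measurable_continuous_onI)
  then have cm[measurable]: "(\<lambda>(x, y). complex_mat x y) \<in> (sym_lborel \<Otimes>\<^sub>M sym_lborel :: ((real, 'n) smat \<times> (real, 'n) smat) measure) \<rightarrow>\<^sub>M borel"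
    by (simp add: case_prod_beta borel_prod[symmetric] sym_lborel_def cong: measurable_cong_sets sets_pair_measure_cong)
  let ?D = "distr (sym_lborel \<Otimes>\<^sub>M sym_lborel) borel (\<lambda>(x, y). complex_mat x y) :: (complex, 'n) smat measure"
  let ?w = "\<lambda>z :: (complex, 'n) smat. ennreal (inverse (det (map_matrix Im z) ^ (CARD('n) + 1)))"
  let ?F = "\<lambda>z. G z * siegel_density z"
  have F[measurable]: "?F \<in> borel_measurable borel" by measurable
  have "(\<integral>\<^sup>+z. G z \<partial>siegel_measure) = (\<integral>\<^sup>+z. ?w z * G z \<partial>restrict_space ?D siegel)"
    unfolding siegel_measure_def
    by (rule nn_integral_density) (auto intro!: measurable_restrict_space1)
  also have "\<dots> = (\<integral>\<^sup>+z. (?w z * G z) * indicator siegel z \<partial>?D)"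
    by (rule nn_integral_restrict_space) simp
  also have "\<dots> = (\<integral>\<^sup>+z. ?F z \<partial>?D)" by (simp add: mult_ac)
  also have "\<dots> = (\<integral>\<^sup>+p. ?F (case p of (x, y) \<Rightarrow> complex_mat x y) \<partial>(sym_lborel \<Otimes>\<^sub>M sym_lborel))"
    by (rule nn_integral_distr) measurable
  also have "\<dots> = (\<integral>\<^sup>+x. \<integral>\<^sup>+y. ?F (complex_mat x y) \<partial>sym_lborel \<partial>sym_lborel)"
  proof -
    have "(\<lambda>p. ?F (case p of (x, y) \<Rightarrow> complex_mat x y)) \<in> borel_measurable (sym_lborel \<Otimes>\<^sub>M sym_lborel)"
      by (rule measurable_compose[OF cm F])
    from S.nn_integral_fst[OF this] show ?thesis by simp
  qed
  also have "\<dots> = (\<integral>\<^sup>+x. \<integral>\<^sup>+y. ?F (complex_mat (upmat x) (upmat y)) \<partial>lborel_prod_on (upairs UNIV) \<partial>lborel_prod_on (upairs UNIV))"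
  proof -
    have cm1: "(\<lambda>p. ?F (complex_mat (fst p) (snd p))) \<in> borel_measurable (sym_lborel \<Otimes>\<^sub>M sym_lborel)"
      using measurable_compose[OF cm F] by (simp add: case_prod_beta)
    have cm2: "(\<lambda>y. ?F (complex_mat x y)) \<in> borel_measurable sym_lborel" for x
      using measurable_compose[OF measurable_Pair1' cm1, of x] by (simp add: sym_lborel_def)
    have 1: "(\<integral>\<^sup>+y. ?F (complex_mat x y) \<partial>sym_lborel) = (\<integral>\<^sup>+y. ?F (complex_mat x (upmat y)) \<partial>lborel_prod_on (upairs UNIV))" for x
      using cm2 unfolding sym_lborel_eq by (intro nn_integral_distr[OF measurable_upmat]) (simp cong: measurable_cong_sets)
    have 2: "(\<lambda>x. \<integral>\<^sup>+y. ?F (complex_mat x y) \<partial>sym_lborel) \<in> borel_measurable sym_lborel"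
      using S.borel_measurable_nn_integral_fst[OF cm1] by simp
    have "(\<integral>\<^sup>+x. \<integral>\<^sup>+y. ?F (complex_mat x y) \<partial>sym_lborel \<partial>sym_lborel) = (\<integral>\<^sup>+x. \<integral>\<^sup>+y. ?F (complex_mat (upmat x) y) \<partial>sym_lborel \<partial>lborel_prod_on (upairs UNIV))"
    proof -
      have "integral\<^sup>N sym_lborel f = (\<integral>\<^sup>+x. f (upmat x) \<partial>lborel_prod_on (upairs UNIV))" if "f \<in> borel_measurable sym_lborel" for f :: "(real, 'n) smat \<Rightarrow> ennreal"
        using that unfolding sym_lborel_eq by (rule nn_integral_distr[OF measurable_upmat])
      from this[OF 2] show ?thesis .
    qed
    then show ?thesis unfolding 1 .
  qed
  finally show ?thesis .
qed

lemma nn_integral_siegel: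
  fixes G :: "(complex, 'n::{finite, linorder}) smat \<Rightarrow> ennreal"
  assumes G: "G \<in> borel_measurable borel"
  shows "(\<integral>\<^sup>+z. G z \<partial>siegel_measure) = (\<integral>\<^sup>+z. G (upmat z) * siegel_density (upmat z) \<partial>lborel_prod_on (upairs UNIV))"
proof -
  note G[measurable]
  have F: "(\<lambda>z. G z * siegel_density z) \<in> borel_measurable borel" by measurable
  have "complex_mat (upmat x) (upmat y) = upmat (\<lambda>j\<in>upairs UNIV. Complex (x j) (y j))" for x y :: "'n \<times> 'n \<Rightarrow> real"
    by (simp add: complex_mat_def vec_eq_iff)
  then have eq: "complex_mat (upmat x) (upmat y) = upmat (\<lambda>j\<in>upairs UNIV. Complex (x j) (y j))" for x y :: "'n \<times> 'n \<Rightarrow> real" .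
  show ?thesis
    unfolding nn_integral_siegel_real[OF G] eq
    by (rule nn_integral_lborel_prod_on_complex[OF finite_upairs[OF finite] measurable_compose[OF measurable_upmat F], symmetric])
qed

section \<open>Coordinate rotations\<close>

text \<open>The element of \<open>K_sp\<close> attached to the diagonal unitary matrix with entries
  c + is at the positions in \<open>I\<close> and 1 elsewhere.\<close>

definition rot :: "'n::finite set \<Rightarrow> real \<Rightarrow> real \<Rightarrow> (real, 'n) dmat" where
  "rot I c s = block (\<chi> i j. if i = j then if i \<in> I then c else 1 else 0) (\<chi> i j. if i = j \<and> i \<in> I then s else 0)
     (\<chi> i j. if i = j \<and> i \<in> I then - s else 0) (\<chi> i j. if i = j then if i \<in> I then c else 1 else 0)"

lemma diag_mult:
  fixes a b :: "'n::finite \<Rightarrow> 'a::comm_ring_1"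
  shows "(\<chi> i j. if i = j then a i else 0) ** (\<chi> i j. if i = j then b i else 0) = (\<chi> i j. if i = j then a i * b i else 0)"
    "transpose (\<chi> i j. if i = j then a i else 0) = (\<chi> i j. if i = j then a i else 0)"
  by (auto simp: vec_eq_iff matrix_matrix_mult_def transpose_def if_distrib[of "\<lambda>x. x * _"] cong: if_cong)

lemma rot_diag: "rot I c s = block (\<chi> i j. if i = j then (if i \<in> I then c else 1) else 0) (\<chi> i j. if i = j then (if i \<in> I then s else 0) else 0)
     (\<chi> i j. if i = j then (if i \<in> I then - s else 0) else 0) (\<chi> i j. if i = j then (if i \<in> I then c else 1) else 0)"
  unfolding rot_def block_eq_iff by (auto simp: vec_eq_iff)

lemma rot_Sp: "c\<^sup>2 + s\<^sup>2 = 1 \<Longrightarrow> rot I c s \<in> Sp"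
  unfolding rot_diag Sp_block_iff diag_mult
  by (auto simp: vec_eq_iff mat_def power2_eq_square)

lemma rot_insert: "k \<notin> I \<Longrightarrow> rot (insert k I) c s = rot {k} c s ** rot I c s"
  unfolding rot_diag block_ops diag_mult block_eq_iff by (auto simp: vec_eq_iff)

lemma rot_empty: "rot {} c s = mat 1"
  unfolding rot_def block_ops(6) block_eq_iff by (simp add: vec_eq_iff mat_def)

text \<open>Explicit form of the action of \<open>rot {k} c s\<close>: a fractional linear map on
  the entry (k, k), a scaling of the rest of row k, a translation of the other entries. It is
  defined for all matrices, so that it can be substituted under integrals over all symmetric
  matrices.\<close>

definition rotk :: "'n::finite \<Rightarrow> complex \<Rightarrow> complex \<Rightarrow> (complex, 'n) smat \<Rightarrow> (complex, 'n) smat" where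
  "rotk k c s z = (\<chi> r t. if r = k then if t = k then (c * z $ k $ k + s) / (c - s * z $ k $ k) else z $ k $ t / (c - s * z $ k $ k)
     else if t = k then z $ r $ k / (c - s * z $ k $ k) else z $ r $ t + s * z $ r $ k * z $ k $ t / (c - s * z $ k $ k))"

lemma aut_factor_rot1:
  "aut_factor (rot {k} c s) z = (\<chi> i j. if i = k then (if j = k then of_real c else 0) - of_real s * z $ k $ j else if i = j then 1 else 0)"
  by (auto simp: aut_factor_def rot_def vec_eq_iff matrix_matrix_mult_def if_distrib[of "\<lambda>x. x * _"] if_distrib[of of_real] cong: if_cong)

lemma det_aut_factor_rot1:
  assumes "of_real c - of_real s * z $ k $ k \<noteq> 0"
  shows "det (aut_factor (rot {k} c s) z) = of_real c - of_real s * z $ k $ k"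
proof -
  let ?d = "of_real c - of_real s * z $ k $ k"
  let ?U = "\<chi> r t. if t = k \<and> r \<noteq> k then - of_real s * z $ k $ r / ?d else if r = t then 1 else 0"
  have m: "?d * (- of_real s * x / ?d) = - of_real s * x" for x using assms by simp
  have "aut_factor (rot {k} c s) z = (\<chi> i. if i = k then ?d *s (transpose ?U $ i) else transpose ?U $ i)"
    unfolding aut_factor_rot1 vec_eq_iff transpose_def vec_lambda_beta if_distrib[of "\<lambda>x. x $ _"] vector_smult_component
    using m by auto
  then have "det (aut_factor (rot {k} c s) z) = ?d * det (\<chi> i. if i = k then transpose ?U $ i else transpose ?U $ i)"
    by (simp only: det_row_mul)
  also have "(\<chi> i. if i = k then transpose ?U $ i else transpose ?U $ i) = transpose ?U" by (simp add: vec_eq_iff)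
  finally show ?thesis by (simp only: det_transpose det_column_unipotent mult_1_right)
qed

lemma siegel_act_rot1:
  assumes cs: "c\<^sup>2 + s\<^sup>2 = 1" and z: "z \<in> siegel"
  shows "siegel_act (rot {k} c s) z = rotk k (of_real c) (of_real s) z" and "of_real c - of_real s * z $ k $ k \<noteq> 0"
proof -
  let ?d = "of_real c - of_real s * z $ k $ k"
  have "Im (z $ k $ k) > 0"
  proof -
    have "axis k 1 \<bullet> (map_matrix Im z *v axis k 1) > 0" using siegelD(2)[OF z] unfolding pos_def_def by (simp add: axis_eq_0_iff)
    then show ?thesis by (simp add: inner_axis' matrix_vector_mult_basis column_def)
  qed
  then show d: "?d \<noteq> 0"
  proof -
    assume im: "Im (z $ k $ k) > 0"
    show ?thesis
    proof
      assume 0: "?d = 0"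
      then have "Im ?d = 0" by simp
      then have "s = 0" using im by simp
      then have "c = 0" using 0 by simp
      then show False using cs \<open>s = 0\<close> by simp
    qed
  qed
  have cs': "complex_of_real c * of_real c + of_real s * of_real s = 1"
    using arg_cong[OF cs, of complex_of_real] by (simp add: power2_eq_square)
  show "siegel_act (rot {k} c s) z = rotk k (of_real c) (of_real s) z"
  proof (rule siegel_act_unique[OF rot_Sp[OF cs] z])
    have "(\<Sum>j\<in>UNIV. rotk k (of_real c) (of_real s) z $ r $ j * aut_factor (rot {k} c s) z $ j $ t)
      = (\<Sum>j\<in>UNIV. (if j = k then rotk k (of_real c) (of_real s) z $ r $ k * ((if t = k then of_real c else 0) - of_real s * z $ k $ t) else 0)
          + (if j = t then if t \<noteq> k then rotk k (of_real c) (of_real s) z $ r $ t else 0 else 0))" for r t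
      unfolding aut_factor_rot1 by (rule sum.cong) auto
    then have L: "(rotk k (of_real c) (of_real s) z ** aut_factor (rot {k} c s) z) $ r $ t =
      rotk k (of_real c) (of_real s) z $ r $ k * ((if t = k then of_real c else 0) - of_real s * z $ k $ t)
       + (if t \<noteq> k then rotk k (of_real c) (of_real s) z $ r $ t else 0)" for r t
      by (simp add: matrix_matrix_mult_def sum.distrib)
    have R: "(of_real_mat (blockA (rot {k} c s)) ** z + of_real_mat (blockB (rot {k} c s))) $ r $ t =
      (if r = k then of_real c * z $ k $ t + (if t = k then of_real s else 0) else z $ r $ t)" for r t
      by (auto simp: rot_def matrix_matrix_mult_def if_distrib[of "\<lambda>x. x * _"] if_distrib[of of_real] cong: if_cong)
    have key: "(of_real c * x + of_real s) / ?d * (- (of_real s * y)) + y / ?d = of_real c * y" if "x = z $ k $ k" for x y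
    proof -
      have "(of_real c * x + of_real s) * (- (of_real s * y)) + y = (of_real c * y) * ?d
         + y * (1 - (complex_of_real c * of_real c + of_real s * of_real s))"
        unfolding that by (simp add: algebra_simps)
      then have "(of_real c * x + of_real s) * (- (of_real s * y)) + y = (of_real c * y) * ?d" unfolding cs' by simp
      then have "((of_real c * x + of_real s) * (- (of_real s * y)) + y) / ?d = of_real c * y" using d by simp
      then show ?thesis by (simp only: times_divide_eq_left add_divide_distrib[of _ y])
    qed
    have "rotk k (of_real c) (of_real s) z $ r $ k * ((if t = k then of_real c else 0) - of_real s * z $ k $ t)
       + (if t \<noteq> k then rotk k (of_real c) (of_real s) z $ r $ t else 0) = (if r = k then of_real c * z $ k $ t + (if t = k then of_real s else 0) else z $ r $ t)" for r t
    proof -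
      define D where "D = ?d"
      have D: "D \<noteq> 0" using d by (simp add: D_def)
      have key': "y / D - (of_real c * z $ k $ k + of_real s) * (of_real s * y) / D = of_real c * y" for y
        using key[OF refl, of y] unfolding D_def[symmetric] by simp
      show ?thesis
        by (cases "r = k"; cases "t = k") (simp_all add: rotk_def D_def[symmetric] D key')
    qed
    then show "rotk k (of_real c) (of_real s) z ** aut_factor (rot {k} c s) z
      = of_real_mat (blockA (rot {k} c s)) ** z + of_real_mat (blockB (rot {k} c s))"
      unfolding vec_eq_iff L R by blast
  qed
qed

text \<open>The denominator of the reverse rotation, evaluated at the image, is the reciprocal of
  the original denominator (\<open>n\<close>). Being free of any reference to the half space, this
  can be applied to points outside it.\<close>

lemma rotk_inverse:
  assumes cs: "c\<^sup>2 + s\<^sup>2 = (1 :: complex)" and d: "c - s * z $ k $ k \<noteq> 0"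
  shows "rotk k c (- s) (rotk k c s z) = z"
proof -
  let ?d = "c - s * z $ k $ k"
  have n: "c - - s * rotk k c s z $ k $ k = 1 / ?d"
  proof -
    have "c * ?d + s * (c * z $ k $ k + s) = 1" using cs by (simp add: power2_eq_square algebra_simps)
    moreover have "c + s * (y / ?d) = (c * ?d + s * y) / ?d" for y using d by (simp add: add_divide_distrib del: right_diff_distrib)
    ultimately have "c + s * ((c * z $ k $ k + s) / ?d) = 1 / ?d" by metis
    then show ?thesis by (simp add: rotk_def)
  qed
  have kk: "(c * rotk k c s z $ k $ k + - s) * ?d = z $ k $ k"
  proof -
    have "(c * rotk k c s z $ k $ k + - s) * ?d = c * (c * z $ k $ k + s) - s * ?d" using d by (simp add: rotk_def field_simps)
    also have "\<dots> = (c\<^sup>2 + s\<^sup>2) * z $ k $ k" by (simp add: power2_eq_square algebra_simps)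
    finally show ?thesis using cs by simp
  qed
  have "rotk k c (- s) (rotk k c s z) $ r $ t = z $ r $ t" for r t
  proof (cases "r = k \<and> t = k")
    case True
    then show ?thesis using kk unfolding rotk_def[of k c "- s"] n by simp
  next
    case False
    then show ?thesis unfolding rotk_def[of k c "- s"] n using d by (auto simp: rotk_def)
  qed
  then show ?thesis by (simp add: vec_eq_iff)
qed

lemma measurable_rotk: "rotk k c s \<in> borel_measurable (borel :: (complex, 'n::finite) smat measure)"
proof (rule borel_measurable_euclidean_space[THEN iffD2], rule ballI)
  fix b :: "(complex, 'n) smat" assume "b \<in> Basis"
  then obtain r t u where b: "b = axis r (axis t u)" "u \<in> Basis" unfolding Basis_vec_def by auto
  have "(\<lambda>z. rotk k c s z $ r $ t) \<in> borel_measurable borel"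
    unfolding rotk_def vec_lambda_beta by (cases "r = k"; cases "t = k") (simp_all, measurable)
  then show "(\<lambda>x. rotk k c s x \<bullet> b) \<in> borel_measurable borel"
    unfolding b inner_axis by measurable
qed

text \<open>In bordered coordinates, with d the denominator at the entry (k, k), the smaller matrix
  is translated, and scaling the n - 1 remaining entries of row k by 1/d gives the factor |d|^(2(n -
  1)). Together with the weight this leaves |d|^-4, the Jacobian of the fractional linear map of the
  diagonal entry.\<close>

lemma nn_integral_upmat_rotk:
  fixes F :: "(complex, 'n::{finite, linorder}) smat \<Rightarrow> ennreal"
  assumes cs: "c\<^sup>2 + s\<^sup>2 = (1 :: real)" and F: "F \<in> borel_measurable borel"
  shows "(\<integral>\<^sup>+z. F (rotk k (of_real c) (of_real s) (upmat z)) * ennreal (1 / norm (of_real c - of_real s * z (k, k)) ^ (2 * (CARD('n) + 1))) \<partial>lborel_prod_on (upairs UNIV))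
    = (\<integral>\<^sup>+z. F (upmat z) \<partial>lborel_prod_on (upairs UNIV))"
proof -
  define I where "I = UNIV - {k}"
  have k: "k \<notin> I" and U: "insert k I = UNIV" and fin: "finite I" by (auto simp: I_def)
  have cardI: "card I = CARD('n) - 1" "CARD('n) \<ge> 1" by (simp_all add: I_def Suc_le_eq)
  interpret product_sigma_finite "\<lambda>_. lborel :: complex measure" by (rule product_sigma_finite_lborel)
  let ?d = "\<lambda>\<xi> :: complex. of_real c - of_real s * \<xi>"
  let ?\<rho> = "\<lambda>\<xi>. (of_real c * \<xi> + of_real s) / ?d \<xi>"
  let ?b = "bordered k I"
  interpret XI: sigma_finite_measure "lborel_prod_on (upairs I) :: ('n \<times> 'n \<Rightarrow> complex) measure"
    by (rule sigma_finite_lborel_prod_on[OF finite_upairs[OF fin]])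
  interpret UI: sigma_finite_measure "lborel_prod_on (upair k ` I) :: ('n \<times> 'n \<Rightarrow> complex) measure"
    by (rule sigma_finite_lborel_prod_on[OF finite_imageI[OF fin]])
  have Fu: "(\<lambda>z. F (upmat z)) \<in> borel_measurable (lborel_prod_on (upairs (insert k I)))"
    unfolding U by (rule measurable_compose[OF measurable_upmat F])
  have Fb: "(\<lambda>(\<xi>, u, x). F (upmat (?b \<xi> u x))) \<in> borel_measurable (lborel \<Otimes>\<^sub>M lborel_prod_on (upair k ` I) \<Otimes>\<^sub>M lborel_prod_on (upairs I))"
    using measurable_compose[OF measurable_bordered Fu] by (simp add: case_prod_beta)
  define H where "H = (\<lambda>\<xi> u. \<integral>\<^sup>+x. F (upmat (?b \<xi> u x)) \<partial>lborel_prod_on (upairs I))"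
  define K where "K = (\<lambda>\<xi>. \<integral>\<^sup>+u. H \<xi> u \<partial>lborel_prod_on (upair k ` I))"
  have Hm: "(\<lambda>(\<xi>, u). H \<xi> u) \<in> borel_measurable (lborel \<Otimes>\<^sub>M lborel_prod_on (upair k ` I))"
  proof -
    have "(\<lambda>q. F (upmat (?b (fst (fst q)) (snd (fst q)) (snd q)))) \<in> borel_measurable ((lborel \<Otimes>\<^sub>M lborel_prod_on (upair k ` I)) \<Otimes>\<^sub>M lborel_prod_on (upairs I))"
      using measurable_compose[OF measurable_Pair[OF measurable_compose[OF measurable_fst measurable_fst] measurable_Pair[OF measurable_compose[OF measurable_fst measurable_snd] measurable_snd]] Fb]
      by simp
    from XI.borel_measurable_nn_integral_fst[OF this] show ?thesis unfolding H_def case_prod_beta by simp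
  qed
  have Km: "K \<in> borel_measurable borel"
    using UI.borel_measurable_nn_integral_fst[OF Hm] unfolding K_def by simp
  define \<beta> where "\<beta> = (\<lambda>\<xi> (u :: 'n \<times> 'n \<Rightarrow> complex) (r, t). of_real s * u (upair k r) * u (upair k t) / ?d \<xi>)"
  have \<beta>: "\<beta> \<xi> u (upair r t) = of_real s * u (upair k r) * u (upair k t) / ?d \<xi>" for \<xi> u r t
    by (simp add: \<beta>_def upair_def mult.left_commute mult.assoc)
  have bk: "?b \<xi> u x (k, k) = \<xi>" for \<xi> u x by (rule bordered_simps(1)[OF k])
  have act: "rotk k (of_real c) (of_real s) (upmat (?b \<xi> u x)) =
      upmat (?b (?\<rho> \<xi>) (\<lambda>j\<in>upair k ` I. 1 / ?d \<xi> * u j) (\<lambda>j\<in>upairs I. x j + \<beta> \<xi> u j))" for \<xi> u x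
  proof -
    have "rotk k (of_real c) (of_real s) (upmat (?b \<xi> u x)) $ r $ t =
      upmat (?b (?\<rho> \<xi>) (\<lambda>j\<in>upair k ` I. 1 / ?d \<xi> * u j) (\<lambda>j\<in>upairs I. x j + \<beta> \<xi> u j)) $ r $ t" for r t
    proof -
      have in_I: "q \<in> I" if "q \<noteq> k" for q using that by (simp add: I_def)
      show ?thesis
        by (cases "r = k"; cases "t = k") (simp_all add: rotk_def bk bordered_simps[OF k] in_I \<beta>)
    qed
    then show ?thesis by (simp add: vec_eq_iff)
  qed
  let ?w = "\<lambda>\<xi>. ennreal (1 / norm (?d \<xi>) ^ (2 * (CARD('n) + 1)))"
  have kc: "(\<lambda>z. z (k, k)) \<in> borel_measurable (lborel_prod_on (upairs UNIV) :: ('n \<times> 'n \<Rightarrow> complex) measure)"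
    using measurable_upair_component[of k UNIV k] by simp
  have lm: "(\<lambda>z. F (rotk k (of_real c) (of_real s) (upmat z)) * ?w (z (k, k))) \<in> borel_measurable (lborel_prod_on (upairs (insert k I)))"
  proof -
    have "?w \<in> borel_measurable borel" by measurable
    then show ?thesis unfolding U
      by (intro borel_measurable_times_ennreal measurable_compose[OF measurable_compose[OF measurable_upmat measurable_rotk] F] measurable_compose[OF kc])
  qed
  have AEd: "AE \<xi> in lborel. ?d \<xi> \<noteq> 0"
  proof (cases "s = 0")
    case True
    then have "c \<noteq> 0" using cs by auto
    then show ?thesis using True by simp
  next
    case False
    have "AE \<xi> in lborel. \<xi> \<noteq> complex_of_real (c / s)" by (rule AE_lborel_singleton)
    then show ?thesis by eventually_elim (use False in \<open>auto simp: field_simps\<close>)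
  qed
  have "(\<integral>\<^sup>+z. F (rotk k (of_real c) (of_real s) (upmat z)) * ?w (z (k, k)) \<partial>lborel_prod_on (upairs UNIV))
    = (\<integral>\<^sup>+\<xi>. \<integral>\<^sup>+u. \<integral>\<^sup>+x. F (rotk k (of_real c) (of_real s) (upmat (?b \<xi> u x))) * ?w \<xi> \<partial>lborel_prod_on (upairs I) \<partial>lborel_prod_on (upair k ` I) \<partial>lborel)"
    using nn_integral_bordered[OF fin k lm] unfolding U bk .
  also have "\<dots> = (\<integral>\<^sup>+\<xi>. K (?\<rho> \<xi>) * ennreal (1 / norm (?d \<xi>) ^ 4) \<partial>lborel)"
    using AEd
  proof (intro nn_integral_cong_AE, eventually_elim)
    case (elim \<xi>)
    let ?u = "\<lambda>u. \<lambda>j\<in>upair k ` I. 1 / ?d \<xi> * u j"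
    have um: "?u \<in> lborel_prod_on (upair k ` I) \<rightarrow>\<^sub>M lborel_prod_on (upair k ` I)"
    proof (rule measurable_restrict)
      fix j :: "'n \<times> 'n" assume "j \<in> upair k ` I"
      then have "(\<lambda>u. u j) \<in> borel_measurable (lborel_prod_on (upair k ` I) :: ('n \<times> 'n \<Rightarrow> complex) measure)"
        using measurable_component_singleton[of j "upair k ` I" "\<lambda>_. lborel :: complex measure"] by simp
      then have "(\<lambda>u. 1 / ?d \<xi> * u j) \<in> borel_measurable (lborel_prod_on (upair k ` I))" by (intro borel_measurable_times borel_measurable_const)
      then show "(\<lambda>u. 1 / ?d \<xi> * u j) \<in> lborel_prod_on (upair k ` I) \<rightarrow>\<^sub>M lborel" by simp
    qed
    have Hm1: "H (?\<rho> \<xi>) \<in> borel_measurable (lborel_prod_on (upair k ` I))"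
      using measurable_compose[OF measurable_Pair1' Hm, of "?\<rho> \<xi>"] by simp
    have inner: "(\<integral>\<^sup>+x. F (rotk k (of_real c) (of_real s) (upmat (?b \<xi> u x))) * ?w \<xi> \<partial>lborel_prod_on (upairs I)) = ?w \<xi> * H (?\<rho> \<xi>) (?u u)"
      if "u \<in> space (lborel_prod_on (upair k ` I))" for u
    proof -
      have us: "?u u \<in> space (lborel_prod_on (upair k ` I))" by (simp add: space_PiM)
      have Fx: "(\<lambda>x. F (upmat (?b (?\<rho> \<xi>) (?u u) x))) \<in> borel_measurable (lborel_prod_on (upairs I))"
      proof -
        have "(\<lambda>p. F (upmat (?b (?\<rho> \<xi>) (fst p) (snd p)))) \<in> borel_measurable (lborel_prod_on (upair k ` I) \<Otimes>\<^sub>M lborel_prod_on (upairs I))"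
          using measurable_compose[OF measurable_Pair1' Fb, of "?\<rho> \<xi>"] by (simp add: case_prod_beta)
        from measurable_compose[OF measurable_Pair1'[OF us] this] show ?thesis by simp
      qed
      have "(\<integral>\<^sup>+x. F (rotk k (of_real c) (of_real s) (upmat (?b \<xi> u x))) * ?w \<xi> \<partial>lborel_prod_on (upairs I))
        = (\<integral>\<^sup>+x. F (upmat (?b (?\<rho> \<xi>) (?u u) (\<lambda>j\<in>upairs I. x j + \<beta> \<xi> u j))) * ?w \<xi> \<partial>lborel_prod_on (upairs I))"
        unfolding act ..
      also have "\<dots> = (\<integral>\<^sup>+x. F (upmat (?b (?\<rho> \<xi>) (?u u) x)) * ?w \<xi> \<partial>lborel_prod_on (upairs I))"
        by (rule nn_integral_PiM_shift[OF finite_upairs[OF fin], of "\<lambda>x. F (upmat (?b (?\<rho> \<xi>) (?u u) x)) * ?w \<xi>"])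
          (intro borel_measurable_times_ennreal Fx borel_measurable_const)
      also have "\<dots> = H (?\<rho> \<xi>) (?u u) * ?w \<xi>" unfolding H_def by (rule nn_integral_multc[OF Fx])
      finally show ?thesis by (simp add: mult.commute)
    qed
    have "(\<integral>\<^sup>+u. \<integral>\<^sup>+x. F (rotk k (of_real c) (of_real s) (upmat (?b \<xi> u x))) * ?w \<xi> \<partial>lborel_prod_on (upairs I) \<partial>lborel_prod_on (upair k ` I))
      = (\<integral>\<^sup>+u. ?w \<xi> * H (?\<rho> \<xi>) (?u u) \<partial>lborel_prod_on (upair k ` I))"
      by (rule nn_integral_cong) (rule inner)
    also have "\<dots> = ?w \<xi> * (\<integral>\<^sup>+u. H (?\<rho> \<xi>) (?u u) \<partial>lborel_prod_on (upair k ` I))"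
      by (rule nn_integral_cmult) (rule measurable_compose[OF um Hm1])
    also have "(\<integral>\<^sup>+u. H (?\<rho> \<xi>) (?u u) \<partial>lborel_prod_on (upair k ` I)) = (\<Prod>j\<in>upair k ` I. ennreal ((norm (?d \<xi>))\<^sup>2)) * K (?\<rho> \<xi>)"
      unfolding K_def
    proof (rule nn_integral_PiM_coordinatewise[OF finite_imageI[OF fin] _ _ Hm1])
      show "(\<integral>\<^sup>+x. g (1 / ?d \<xi> * x) \<partial>lborel) = ennreal ((norm (?d \<xi>))\<^sup>2) * (\<integral>\<^sup>+x. g x \<partial>lborel)" if "g \<in> borel_measurable borel" for g :: "complex \<Rightarrow> ennreal"
        using nn_integral_complex_scale[of "1 / ?d \<xi>" g] that elim by (simp add: norm_divide power_divide)
    qed auto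
    also have "?w \<xi> * ((\<Prod>j\<in>upair k ` I. ennreal ((norm (?d \<xi>))\<^sup>2)) * K (?\<rho> \<xi>)) = K (?\<rho> \<xi>) * ennreal (1 / norm (?d \<xi>) ^ 4)"
    proof -
      have "(\<Prod>j\<in>upair k ` I. ennreal ((norm (?d \<xi>))\<^sup>2)) = ennreal ((norm (?d \<xi>)) ^ (2 * (CARD('n) - 1)))"
        by (simp add: card_image[OF inj_on_upair[OF k]] cardI ennreal_power power_mult)
      moreover have "1 / norm (?d \<xi>) ^ (2 * (CARD('n) + 1)) * norm (?d \<xi>) ^ (2 * (CARD('n) - 1)) = 1 / norm (?d \<xi>) ^ 4"
      proof -
        have "2 * (CARD('n) + 1) = 4 + 2 * (CARD('n) - 1)" using cardI(2) by (cases "CARD('n)") simp_all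
        then have "norm (?d \<xi>) ^ (2 * (CARD('n) + 1)) = norm (?d \<xi>) ^ 4 * norm (?d \<xi>) ^ (2 * (CARD('n) - 1))"
          by (simp only: power_add)
        then show ?thesis using elim by simp
      qed
      ultimately have e: "?w \<xi> * (\<Prod>j\<in>upair k ` I. ennreal ((norm (?d \<xi>))\<^sup>2)) = ennreal (1 / norm (?d \<xi>) ^ 4)"
        by (simp only: ennreal_mult'[symmetric] zero_le_divide_1_iff zero_le_power norm_ge_zero)
      show ?thesis unfolding mult.assoc[symmetric] e by (rule mult.commute)
    qed
    finally show ?case .
  qed
  also have "\<dots> = (\<integral>\<^sup>+\<xi>. K \<xi> \<partial>lborel)" by (rule nn_integral_complex_rotation[OF cs Km])
  also have "\<dots> = (\<integral>\<^sup>+z. F (upmat z) \<partial>lborel_prod_on (upairs UNIV))"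
    using nn_integral_bordered[OF fin k Fu] unfolding U K_def H_def ..
  finally show ?thesis .
qed

section \<open>Invariant integrals on the Siegel upper half space\<close>

lemma det_Im_pos: "z \<in> siegel \<Longrightarrow> det (map_matrix Im z) > 0"
proof -
  assume "z \<in> siegel"
  then have z: "pos_def (map_matrix Im z)" by (rule siegelD(2))
  then have "sub_sym UNIV (\<lambda>r s. map_matrix Im z $ r $ s)"
    unfolding sub_sym_def pos_def_def transpose_def vec_eq_iff by simp
  moreover have "sub_pos UNIV (\<lambda>r s. map_matrix Im z $ r $ s)" using z pos_def_iff_sub_pos by blast
  ultimately have "subdet UNIV (\<lambda>r s. map_matrix Im z $ r $ s) > 0" by (rule subdet_pos)
  then show ?thesis by (simp add: subdet_UNIV map_matrix_def)
qed

lemma continuous_on_siegel_act: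
  assumes g: "g \<in> Sp"
  shows "continuous_on siegel (siegel_act g)" "continuous_on siegel (aut_factor g)"
proof -
  show a: "continuous_on siegel (aut_factor g)"
    unfolding aut_factor_def by (intro continuous_intros continuous_on_matrix_mult)
  show "continuous_on siegel (siegel_act g)"
    unfolding siegel_act_def
    by (intro continuous_on_matrix_mult continuous_on_matrix_inv a continuous_intros siegel_act_props(1)[OF g])
qed

lemma measurable_siegel_act:
  assumes g: "g \<in> Sp"
  shows "siegel_act g \<in> siegel_measure \<rightarrow>\<^sub>M siegel_measure"
proof -
  have "siegel_act g \<in> restrict_space borel siegel \<rightarrow>\<^sub>M restrict_space borel siegel"
    by (rule measurable_restrict_space2)
      (auto simp: space_restrict_space siegel_act_props(2)[OF g] intro: borel_measurable_continuous_on_restrict continuous_on_siegel_act[OF g])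
  then show ?thesis by (simp add: sets_siegel_measure cong: measurable_cong_sets)
qed

text \<open>Inside the half space, det (Im z) is divided by |d|^2 under the rotation, and the
  density is its power -(n + 1). A point outside with nonzero d stays outside, as the reverse
  rotation shows; where d = 0 the point is outside, and the right side vanishes because 1 / 0 is
  0.\<close>

lemma siegel_density_rotk:
  fixes z :: "(complex, 'n::{finite, linorder}) smat"
  assumes cs: "c\<^sup>2 + s\<^sup>2 = (1 :: real)"
  shows "siegel_density z = siegel_density (rotk k (of_real c) (of_real s) z) *
    ennreal (1 / norm (of_real c - of_real s * z $ k $ k) ^ (2 * (CARD('n) + 1)))"
proof -
  let ?d = "of_real c - of_real s * z $ k $ k"
  let ?r = "rotk k (of_real c) (of_real s) z"
  show ?thesis
  proof (cases "z \<in> siegel")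
    case True
    have d: "?d \<noteq> 0" and act: "siegel_act (rot {k} c s) z = ?r" using siegel_act_rot1[OF cs True] by auto
    have r: "?r \<in> siegel" using siegel_act_props(2)[OF rot_Sp[OF cs] True] act by metis
    have "det (map_matrix Im ?r) * (norm ?d)\<^sup>2 = det (map_matrix Im z)"
      using det_Im_siegel_act(1)[OF rot_Sp[OF cs] True, of "{k}"] unfolding act det_aut_factor_rot1[OF d] .
    then have "inverse (det (map_matrix Im z) ^ (CARD('n) + 1)) = inverse (det (map_matrix Im ?r) ^ (CARD('n) + 1)) * (1 / norm ?d ^ (2 * (CARD('n) + 1)))"
      by (metis (no_types, lifting) power_mult power_mult_distrib inverse_mult_distrib inverse_eq_divide)
    then show ?thesis using True r det_Im_pos[OF r] by (simp only: ennreal_mult'[symmetric] indicator_simps mult_1_left) (simp add: ennreal_mult'[symmetric])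
  next
    case False
    have "?r \<notin> siegel" if d: "?d \<noteq> 0"
    proof
      assume r: "?r \<in> siegel"
      have cs': "c\<^sup>2 + (- s)\<^sup>2 = 1" using cs by simp
      have "siegel_act (rot {k} c (- s)) ?r = rotk k (of_real c) (- of_real s) ?r"
        using siegel_act_rot1(1)[OF cs' r] by simp
      also have "\<dots> = z"
        by (rule rotk_inverse[OF _ d]) (use arg_cong[OF cs, of complex_of_real] in simp)
      finally show False using siegel_act_props(2)[OF rot_Sp[OF cs'] r] False by metis
    qed
    then show ?thesis using False by (cases "?d = 0") auto
  qed
qed

lemma nn_integral_siegel_rot1:
  fixes G :: "(complex, 'n::{finite, linorder}) smat \<Rightarrow> ennreal"
  assumes cs: "c\<^sup>2 + s\<^sup>2 = (1 :: real)" and G: "G \<in> borel_measurable siegel_measure"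
  shows "(\<integral>\<^sup>+z. G (siegel_act (rot {k} c s) z) \<partial>siegel_measure) = (\<integral>\<^sup>+z. G z \<partial>siegel_measure)"
proof -
  \<comment> \<open>Extension by zero, since the change of variables takes place on the space of all
    symmetric matrices.\<close>
  define G' where "G' = (\<lambda>z. G z * indicator siegel z)"
  have G': "G' \<in> borel_measurable borel"
    using G unfolding G'_def
    by (subst borel_measurable_restrict_space_iff_ennreal[symmetric]) (auto simp: sets_siegel_measure cong: measurable_cong_sets)
  let ?r = "rotk k (of_real c) (of_real s) :: (complex, 'n) smat \<Rightarrow> _"
  have F: "(\<lambda>z. G' z * siegel_density z) \<in> borel_measurable borel"
    by (intro borel_measurable_times_ennreal G' borel_measurable_indicator siegel_borel) measurable
  have "(\<integral>\<^sup>+z. G (siegel_act (rot {k} c s) z) \<partial>siegel_measure) = (\<integral>\<^sup>+z. G' (?r z) \<partial>siegel_measure)"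
    by (rule nn_integral_cong)
      (auto simp: sets_siegel_measure(2) G'_def siegel_act_rot1(1)[OF cs, symmetric] siegel_act_props(2)[OF rot_Sp[OF cs]])
  also have "\<dots> = (\<integral>\<^sup>+z. G' (?r (upmat z)) * siegel_density (upmat z) \<partial>lborel_prod_on (upairs UNIV))"
    by (rule nn_integral_siegel) (rule measurable_compose[OF measurable_rotk G'])
  also have "\<dots> = (\<integral>\<^sup>+z. (G' (?r (upmat z)) * siegel_density (?r (upmat z))) * ennreal (1 / norm (of_real c - of_real s * z (k, k)) ^ (2 * (CARD('n) + 1))) \<partial>lborel_prod_on (upairs UNIV))"
    by (subst siegel_density_rotk[OF cs, of _ k]) (simp add: mult.assoc)
  also have "\<dots> = (\<integral>\<^sup>+z. G' (upmat z) * siegel_density (upmat z) \<partial>lborel_prod_on (upairs UNIV))"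
    by (rule nn_integral_upmat_rotk[OF cs F])
  also have "\<dots> = (\<integral>\<^sup>+z. G' z \<partial>siegel_measure)" by (rule nn_integral_siegel[OF G', symmetric])
  also have "\<dots> = (\<integral>\<^sup>+z. G z \<partial>siegel_measure)"
    by (rule nn_integral_cong) (simp add: sets_siegel_measure(2) G'_def)
  finally show ?thesis .
qed

lemma nn_integral_siegel_rot:
  fixes G :: "(complex, 'n::{finite, linorder}) smat \<Rightarrow> ennreal"
  assumes cs: "c\<^sup>2 + s\<^sup>2 = (1 :: real)" and G: "G \<in> borel_measurable siegel_measure"
  shows "(\<integral>\<^sup>+z. G (siegel_act (rot I c s) z) \<partial>siegel_measure) = (\<integral>\<^sup>+z. G z \<partial>siegel_measure)"
  using finite[of I] G
proof (induction I arbitrary: G rule: finite_induct)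
  case empty
  have "siegel_act (mat 1) z = z" if "z \<in> siegel" for z :: "(complex, 'n) smat"
    by (rule siegel_act_unique[OF mat_1_in_Sp that]) (simp add: aut_factor_def block_ops(6) map_matrix_of_real_simps matrix_mul_ring_simps)
  then show ?case by (intro nn_integral_cong) (simp add: rot_empty sets_siegel_measure(2))
next
  case (insert k I)
  have "(\<integral>\<^sup>+z. G (siegel_act (rot (insert k I) c s) z) \<partial>siegel_measure)
    = (\<integral>\<^sup>+z. G (siegel_act (rot {k} c s) (siegel_act (rot I c s) z)) \<partial>siegel_measure)"
    by (rule nn_integral_cong)
      (simp add: sets_siegel_measure(2) rot_insert[OF insert.hyps(2)] siegel_act_mult(2)[OF rot_Sp[OF cs] rot_Sp[OF cs]])
  also have "\<dots> = (\<integral>\<^sup>+z. G (siegel_act (rot {k} c s) z) \<partial>siegel_measure)"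
    by (rule insert.IH) (rule measurable_compose[OF measurable_siegel_act[OF rot_Sp[OF cs]] insert.prems])
  also have "\<dots> = (\<integral>\<^sup>+z. G z \<partial>siegel_measure)" by (rule nn_integral_siegel_rot1[OF cs insert.prems])
  finally show ?case .
qed

section \<open>Evaluation of the integral of powers of det (z + i) and det y\<close>

lemma siegel_x_const_nonneg:
  assumes "a > real d" shows "siegel_x_const d a \<ge> 0"
  unfolding siegel_x_const_def
proof (rule prod_nonneg)
  fix i assume "i \<in> {..<d}"
  then have "real i + 1 \<le> real d" by simp
  then have "Gamma (2 * a - real i - 1 / 2) > 0" "Gamma (2 * a - (real i + 1) / 2) > 0" "Gamma (a - (real i + 1) / 2) > 0" "Gamma (a - real i / 2) > 0"
    using assms by (auto intro!: Gamma_real_pos)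
  then show "0 \<le> pi powr (real i / 2) * Gamma (2 * a - real i - 1 / 2) / Gamma (2 * a - (real i + 1) / 2) * (sqrt pi * Gamma (a - (real i + 1) / 2) / Gamma (a - real i / 2))"
    by (intro mult_nonneg_nonneg divide_nonneg_pos) auto
qed

text \<open>Adding i replaces the imaginary part y by y + 1, so the integral over the real parts
  yields det (y + 1) to the power (n + 1)/2 - 2a. The factor (det y)^a and the density of dv combine
  to the power a - n - 1, and the cone integral has these two exponents.\<close>

lemma nn_integral_siegel_f1:
  assumes a: "a > real CARD('n)"
  shows "(\<integral>\<^sup>+z. ennreal (norm (det (z + mat \<i>)) powr (- (2 * a)) * det (map_matrix Im z) powr a)
      \<partial>(siegel_measure :: (complex, 'n::{finite, linorder}) smat measure))
    = ennreal (siegel_x_const CARD('n) a * siegel_y_const CARD('n) (2 * a - (real CARD('n) + 1) / 2) (a - real CARD('n) - 1))"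
proof -
  let ?n = "CARD('n)"
  let ?P = "lborel_prod_on (upairs (UNIV :: 'n set)) :: ('n \<times> 'n \<Rightarrow> real) measure"
  let ?G = "\<lambda>z :: (complex, 'n) smat. ennreal (norm (det (z + mat \<i>)) powr (- (2 * a)) * det (map_matrix Im z) powr a)"
  let ?b = "a - real ?n - 1" and ?s = "2 * a - (real ?n + 1) / 2"
  interpret pair_sigma_finite ?P ?P
    unfolding pair_sigma_finite_def using sigma_finite_lborel_prod_on[OF finite_upairs[OF finite]] by blast
  have "(\<lambda>z :: (complex, 'n) smat. det (z + mat \<i>)) \<in> borel_measurable borel"
    by (intro borel_measurable_continuous_onI continuous_on_det continuous_intros)
  then have G: "?G \<in> borel_measurable borel" by measurable
  have F: "(\<lambda>z. ?G z * siegel_density z) \<in> borel_measurable borel"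
    by (intro borel_measurable_times_ennreal G borel_measurable_indicator siegel_borel) measurable
  have "continuous_on UNIV (\<lambda>p :: (real, 'n) smat \<times> (real, 'n) smat. complex_mat (fst p) (snd p))"
    unfolding complex_mat_def Complex_eq by (intro continuous_on_matrix continuous_intros)
  then have "(\<lambda>p :: (real, 'n) smat \<times> (real, 'n) smat. complex_mat (fst p) (snd p)) \<in> borel_measurable (borel \<Otimes>\<^sub>M borel)"
    unfolding borel_prod by (rule borel_measurable_continuous_onI)
  from measurable_compose[OF measurable_Pair[OF measurable_compose[OF measurable_fst measurable_upmat] measurable_compose[OF measurable_snd measurable_upmat]] this]
  have cm: "(\<lambda>p. complex_mat (upmat (fst p)) (upmat (snd p))) \<in> ?P \<Otimes>\<^sub>M ?P \<rightarrow>\<^sub>M borel" by simp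
  have jm: "(\<lambda>(x, y). ?G (complex_mat (upmat x) (upmat y)) * siegel_density (complex_mat (upmat x) (upmat y))) \<in> borel_measurable (?P \<Otimes>\<^sub>M ?P)"
    using measurable_compose[OF cm F] by (simp add: case_prod_beta)
  have "(\<integral>\<^sup>+z. ?G z \<partial>siegel_measure) = (\<integral>\<^sup>+y. \<integral>\<^sup>+x. ?G (complex_mat (upmat x) (upmat y)) * siegel_density (complex_mat (upmat x) (upmat y)) \<partial>?P \<partial>?P)"
    unfolding nn_integral_siegel_real[OF G] using Fubini'[OF jm] by simp
  also have "\<dots> = (\<integral>\<^sup>+y. ennreal (siegel_x_const ?n a) * (if sub_pos UNIV (\<lambda>r s. y (upair r s))
       then ennreal (subdet UNIV (plus_one (\<lambda>r s. y (upair r s))) powr (- ?s) * subdet UNIV (\<lambda>r s. y (upair r s)) powr ?b) else 0) \<partial>?P)"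
  proof (rule nn_integral_cong)
    fix y :: "'n \<times> 'n \<Rightarrow> real"
    let ?Y = "\<lambda>r s. y (upair r s)"
    have im: "map_matrix Im (complex_mat (upmat x) (upmat y)) = upmat y" for x by (simp add: complex_mat_def vec_eq_iff)
    have sg: "complex_mat (upmat x) (upmat y) \<in> siegel \<longleftrightarrow> sub_pos UNIV ?Y" for x
    proof -
      have "transpose (complex_mat (upmat x) (upmat y)) = complex_mat (upmat x) (upmat y)"
        by (simp add: complex_mat_def vec_eq_iff transpose_def upair_commute)
      moreover have "(\<lambda>r. ($) (upmat y $ r)) = ?Y" by (simp add: fun_eq_iff)
      ultimately show ?thesis unfolding siegel_def mem_Collect_eq im pos_def_iff_sub_pos by simp
    qed
    show "(\<integral>\<^sup>+x. ?G (complex_mat (upmat x) (upmat y)) * siegel_density (complex_mat (upmat x) (upmat y)) \<partial>?P)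
      = ennreal (siegel_x_const ?n a) * (if sub_pos UNIV ?Y then ennreal (subdet UNIV (plus_one ?Y) powr (- ?s) * subdet UNIV ?Y powr ?b) else 0)"
    proof (cases "sub_pos UNIV ?Y")
      case False
      then show ?thesis by (simp add: sg)
    next
      case True
      have sY: "sub_sym UNIV ?Y" by (rule sub_sym_upair)
      have sY1: "sub_sym UNIV (plus_one ?Y)" using sY by (auto simp: sub_sym_def)
      have pY1: "sub_pos UNIV (plus_one ?Y)" by (rule sub_pos_add_one[OF True finite])
      have dY: "subdet UNIV ?Y > 0" by (rule subdet_pos[OF sY True])
      have dU: "det (upmat y) = subdet UNIV ?Y" by (simp add: subdet_UNIV upmat_def)
      have d1: "det (complex_mat (upmat x) (upmat y) + mat \<i>) = subdet UNIV (\<lambda>r s. Complex (x (upair r s)) (plus_one ?Y r s))" for x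
        unfolding subdet_UNIV by (rule arg_cong[where f = det]) (simp add: vec_eq_iff complex_mat_def mat_def complex_eq_iff)
      let ?e = "\<lambda>x. ennreal (norm (subdet UNIV (\<lambda>r s. Complex (x (upair r s)) (plus_one ?Y r s))) powr (- (2 * a)))"
      have em: "?e \<in> borel_measurable ?P"
      proof -
        have [measurable]: "(\<lambda>x. subdet UNIV (\<lambda>r s. Complex (x (upair r s)) (plus_one ?Y r s))) \<in> borel_measurable ?P"
          by (intro measurable_subdet measurable_Complex measurable_upair_component borel_measurable_const UNIV_I)
        show ?thesis by measurable
      qed
      have pw: "subdet UNIV ?Y powr a * inverse (subdet UNIV ?Y ^ (?n + 1)) = subdet UNIV ?Y powr ?b"
        using dY by (simp add: powr_diff powr_realpow[symmetric] divide_inverse powr_add powr_minus[symmetric] mult_ac flip: powr_realpow)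
      have "(\<integral>\<^sup>+x. ?G (complex_mat (upmat x) (upmat y)) * siegel_density (complex_mat (upmat x) (upmat y)) \<partial>?P)
        = (\<integral>\<^sup>+x. ?e x * ennreal (subdet UNIV ?Y powr ?b) \<partial>?P)"
      proof (rule nn_integral_cong)
        fix x
        show "?G (complex_mat (upmat x) (upmat y)) * siegel_density (complex_mat (upmat x) (upmat y)) = ?e x * ennreal (subdet UNIV ?Y powr ?b)"
          using True dY by (simp only: im dU d1 sg indicator_simps mult_1_left pw[symmetric]) (simp add: ennreal_mult' ennreal_mult'' mult.assoc)
      qed
      also have "\<dots> = (\<integral>\<^sup>+x. ?e x \<partial>?P) * ennreal (subdet UNIV ?Y powr ?b)" by (rule nn_integral_multc[OF em])
      also have "(\<integral>\<^sup>+x. ?e x \<partial>?P) = ennreal (siegel_x_const ?n a * subdet UNIV (plus_one ?Y) powr ((real ?n + 1) / 2 - 2 * a))"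
        using nn_integral_subdet_shift_Re[OF sY1 pY1, of a] a by simp
      finally show ?thesis using True by (simp add: ennreal_mult'' mult.assoc)
    qed
  qed
  also have "\<dots> = ennreal (siegel_x_const ?n a) * ennreal (siegel_y_const ?n ?s ?b)"
  proof -
    have "(\<lambda>y. if sub_pos UNIV (\<lambda>r s. y (upair r s)) then ennreal (subdet UNIV (plus_one (\<lambda>r s. y (upair r s))) powr (- ?s) * subdet UNIV (\<lambda>r s. y (upair r s)) powr ?b) else 0) \<in> borel_measurable ?P"
    proof -
      have [measurable]: "Measurable.pred ?P (\<lambda>y. sub_pos UNIV (\<lambda>r s. y (upair r s)))" by (rule sub_pos_upair_measurable)
      have [measurable]: "(\<lambda>y. subdet UNIV (plus_one (\<lambda>r s. y (upair r s)))) \<in> borel_measurable ?P"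
        "(\<lambda>y. subdet UNIV (\<lambda>r s. y (upair r s))) \<in> borel_measurable ?P"
        by (intro measurable_subdet borel_measurable_add measurable_upair_component borel_measurable_const UNIV_I)+
      show ?thesis by measurable
    qed
    moreover have "?b > - 1" using a by simp
    moreover have "?s > ?b + real (card (UNIV :: 'n set))" 
    proof -
      have "2 * a - (N + 1) / 2 > a - N - 1 + N" if "a > N" "N \<ge> 0" for N :: real using that by (simp add: field_simps)
      from this[OF a] show ?thesis by simp
    qed
    ultimately show ?thesis by (subst nn_integral_cmult) (auto simp: nn_integral_subdet_positive_cone)
  qed
  also have "\<dots> = ennreal (siegel_x_const ?n a * siegel_y_const ?n ?s ?b)"
    by (rule ennreal_mult'[symmetric, OF siegel_x_const_nonneg[OF a]])
  finally show ?thesis .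
qed

section \<open>The disc through a point and its center\<close>

lemma hform_add: "hform (A + B) v = hform A v + hform B v"
  unfolding hform_def by (simp add: matrix_vector_mult_add_rdistrib algebra_simps sum.distrib)

lemma mat_mult_vector: "(mat c ** A) *v v = c *s (A *v v)" for A :: "(complex, 'm::finite) smat"
  by (simp add: vec_eq_iff matrix_vector_mult_def mat_mult_nth sum_distrib_left mult.assoc)

lemma mat_vector: "mat c *v v = c *s v" for v :: "(complex, 'm::finite) vec"
  using mat_mult_vector[of c "mat 1" v] by (simp add: matrix_mul_ring_simps)

lemma hform_scale: "hform (mat c ** A) v = c * hform A v"
  unfolding hform_def mat_mult_vector by (simp add: sum_distrib_left mult_ac)

lemma Im_hform:
  assumes "transpose z = z"
  shows "Im (hform z v) = Re (hform (of_real_mat (map_matrix Im z)) v)"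
proof -
  have z: "z = of_real_mat (map_matrix Re z) + mat \<i> ** of_real_mat (map_matrix Im z)"
    by (simp add: vec_eq_iff mat_mult_nth complex_eq_iff)
  have "transpose (map_matrix Re z) = map_matrix Re z"
    using assms by (simp add: vec_eq_iff transpose_def)
  then show ?thesis by (subst z, unfold hform_add hform_scale hform_real) simp
qed

lemma siegel_iff_hform:
  assumes "transpose z = z"
  shows "z \<in> siegel \<longleftrightarrow> (\<forall>v. v \<noteq> 0 \<longrightarrow> Im (hform z v) > 0)"
proof -
  have "transpose (map_matrix Im z) = map_matrix Im z"
    using assms by (simp add: vec_eq_iff transpose_def)
  then show ?thesis unfolding Im_hform[OF assms] siegel_def by (simp add: assms pos_def_iff_hform)
qed

lemma siegel_invertible:
  assumes "z \<in> siegel" shows "invertible z"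
proof -
  have "v = 0" if "z *v v = 0" for v
  proof (rule ccontr)
    assume "v \<noteq> 0"
    then have "Im (hform z v) > 0" using assms siegel_iff_hform[OF siegelD(1)[OF assms]] by blast
    then show False using that by (simp add: hform_def)
  qed
  then show ?thesis using matrix_left_invertible_ker invertibleI by blast
qed

lemma hform_mat: "hform (mat c) v = c * of_real (\<Sum>i\<in>UNIV. (norm (v $ i))\<^sup>2)"
  unfolding hform_def mat_vector by (simp add: sum_distrib_left complex_norm_square mult_ac del: of_real_power)

lemma siegel_add_i:
  assumes "z \<in> siegel" shows "z + mat \<i> \<in> siegel"
proof -
  note t = siegelD(1)[OF assms]
  have "Im (hform (z + mat \<i>) v) > 0" if "v \<noteq> 0" for v
  proof -
    have "Im (hform z v) > 0" using assms that siegel_iff_hform[OF t] by blast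
    moreover have "(\<Sum>i\<in>UNIV. (norm (v $ i))\<^sup>2) \<ge> 0" by (intro sum_nonneg) simp
    ultimately show ?thesis unfolding hform_add hform_mat by simp
  qed
  moreover have "transpose (z + mat \<i>) = z + mat \<i>" by (simp add: transpose_ring_simps t)
  ultimately show ?thesis using siegel_iff_hform by blast
qed

lemma det_mat: "det (mat c :: ('a::comm_ring_1, 'm::finite) smat) = c ^ CARD('m)"
proof -
  have "det (mat c :: ('a, 'm) smat) = (\<Prod>i\<in>UNIV. (mat c :: ('a, 'm) smat) $ i $ i)"
    by (rule det_diagonal) (simp add: mat_def)
  then show ?thesis by (simp add: mat_def)
qed

lemma rot_UNIV_blocks:
  "of_real_mat (blockA (rot UNIV c s)) = mat (of_real c)" "of_real_mat (blockB (rot UNIV c s)) = mat (of_real s)"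
  "of_real_mat (blockC (rot UNIV c s)) = mat (- of_real s)" "of_real_mat (blockD (rot UNIV c s)) = mat (of_real c)"
  by (simp_all add: rot_def vec_eq_iff mat_def)

lemma continuous_on_mat [continuous_intros]:
  "continuous_on S f \<Longrightarrow> continuous_on S (\<lambda>x. mat (f x) :: ('a::{real_normed_field}, 'n::finite) smat)"
  unfolding mat_def
proof (intro continuous_on_matrix)
  assume "continuous_on S f"
  then show "continuous_on S (\<lambda>x. if i = j then f x else 0)" for i j :: 'n by (cases "i = j") simp_all
qed

definition cay :: "(complex, 'n::finite) smat \<Rightarrow> (complex, 'n) smat" where
  "cay z = mat \<i> + mat 2 ** matrix_inv (z + mat \<i>)"

text \<open>Solving \<open>cay w = mat t ** cay z\<close> for w gives w + i = 2 (t c - i)^-1 with c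
  = \<open>cay z\<close>; this is the matrix to be inverted.\<close>

definition disc_den :: "(complex, 'n::finite) smat \<Rightarrow> complex \<Rightarrow> (complex, 'n) smat" where
  "disc_den z t = mat (- \<i>) + mat t ** cay z"

text \<open>With \<open>c = cay z\<close>, which is up to the factor \<open>\<i>\<close> the Cayley transform of \<open>z\<close>, the matrix
  \<open>disc z t\<close> is the point whose Cayley transform is \<open>t\<close> times that of \<open>z\<close>.\<close>

definition disc :: "(complex, 'n::finite) smat \<Rightarrow> complex \<Rightarrow> (complex, 'n) smat" where
  "disc z t = mat (- \<i>) + mat 2 ** matrix_inv (disc_den z t)"

lemma mat_mat: "mat a ** mat b = (mat (a * b) :: ('a::comm_ring_1, 'm::finite) smat)"
  by (simp add: vec_eq_iff mat_mult_nth) (simp add: mat_def)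

lemma mat_add: "mat a + mat b = (mat (a + b) :: ('a::comm_ring_1, 'm::finite) smat)"
  by (simp add: vec_eq_iff mat_def)

lemma disc_0: "disc z 0 = mat \<i>"
proof -
  have "matrix_inv (disc_den z 0) = mat \<i>"
    by (rule matrix_inv_unique) (simp add: disc_den_def mat_mat matrix_mul_ring_simps)
  then show ?thesis by (simp add: disc_def mat_mat mat_add)
qed

lemma matrix_inv_transpose:
  fixes A :: "('a::field, 'm::finite) smat"
  assumes "invertible A" shows "matrix_inv (transpose A) = transpose (matrix_inv A)"
proof (rule matrix_inv_unique)
  have "transpose (matrix_inv A ** A) = transpose (mat 1)" using matrix_inv_mult(2)[OF assms] by simp
  then show "transpose A ** transpose (matrix_inv A) = mat 1" by (simp add: transpose_ring_simps)
qed

context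
  fixes z :: "(complex, 'n::finite) smat"
  assumes z: "z \<in> siegel"
begin

lemma zi_inv: "invertible (z + mat \<i>)" "(z + mat \<i>) ** matrix_inv (z + mat \<i>) = mat 1" "matrix_inv (z + mat \<i>) ** (z + mat \<i>) = mat 1"
  using matrix_inv_mult[OF siegel_invertible[OF siegel_add_i[OF z]]] siegel_invertible[OF siegel_add_i[OF z]] by auto

lemma transpose_cay: "transpose (cay z) = cay z"
proof -
  have "transpose (matrix_inv (z + mat \<i>)) = matrix_inv (z + mat \<i>)"
    using matrix_inv_transpose[OF zi_inv(1)] by (simp add: transpose_ring_simps siegelD(1)[OF z])
  then show ?thesis by (simp add: cay_def transpose_ring_simps mat_commute[of 2, symmetric])
qed

lemma transpose_disc_den: "transpose (disc_den z t) = disc_den z t"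
  by (simp add: disc_den_def transpose_ring_simps transpose_cay mat_commute[of t, symmetric])

lemma disc_den_mult: "disc_den z t ** (z + mat \<i>) = mat (- \<i> * (1 - t)) ** (z + mat \<i>) + mat (2 * t)"
proof -
  have "disc_den z t = mat (- \<i>) + (mat (t * \<i>) + mat (2 * t) ** matrix_inv (z + mat \<i>))"
    by (simp add: disc_den_def cay_def matrix_mul_ring_simps mat_mat mult.commute matrix_mul_assoc)
  also have "\<dots> = mat (- \<i> * (1 - t)) + mat (2 * t) ** matrix_inv (z + mat \<i>)"
    by (simp add: add.assoc[symmetric] mat_add algebra_simps)
  finally show ?thesis
    by (simp only: matmul.add_left matrix_mul_assoc[symmetric] zi_inv(3) matrix_mul_rid)
qed

text \<open>Stated for any w with this relation because it is used in both directions: at w = z and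
  t = 1 membership in the half space makes \<open>cay z\<close> a strict contraction, and at w =
  \<open>disc z t\<close> the contraction gives membership back.\<close>

lemma hform_disc:
  assumes w: "w ** disc_den z t = mat (- \<i>) ** disc_den z t + mat 2"
  shows "Im (hform w (disc_den z t *v u)) = (\<Sum>i\<in>UNIV. (norm (u $ i))\<^sup>2) - (norm t)\<^sup>2 * (\<Sum>i\<in>UNIV. (norm ((cay z *v u) $ i))\<^sup>2)"
proof -
  let ?p = "cay z *v u"
  have v: "disc_den z t *v u = (- \<i>) *s u + t *s ?p"
    by (simp only: disc_den_def matrix_vector_mult_add_rdistrib mat_mult_vector mat_vector)
  have wv: "w *v (disc_den z t *v u) = (- \<i>) *s (disc_den z t *v u) + 2 *s u"
    by (simp only: matrix_vector_mul_assoc w) (simp only: matrix_vector_mult_add_rdistrib mat_mult_vector mat_vector matrix_vector_mul_assoc[symmetric])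
  \<comment> \<open>The two cross terms are conjugate to each other, so they do not contribute to
    the imaginary part.\<close>
  have pw: "Im (cnj (- \<i> * a + x) * (- \<i> * (- \<i> * a + x) + 2 * a)) = (norm a)\<^sup>2 - (norm x)\<^sup>2" for a x
    unfolding cmod_power2 by (simp add: algebra_simps power2_eq_square)
  have "Im (hform w (disc_den z t *v u)) = (\<Sum>i\<in>UNIV. Im (cnj (- \<i> * u $ i + t * ?p $ i) * (- \<i> * (- \<i> * u $ i + t * ?p $ i) + 2 * u $ i)))"
    unfolding hform_def wv unfolding v by (simp only: Im_sum vector_add_component vector_smult_component)
  then show ?thesis
    unfolding pw norm_mult power_mult_distrib by (simp only: sum_subtractf sum_distrib_left)
qed

lemma disc_den_1: "disc_den z 1 = mat 2 ** matrix_inv (z + mat \<i>)" "invertible (disc_den z 1)"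
proof -
  show e: "disc_den z 1 = mat 2 ** matrix_inv (z + mat \<i>)"
    by (simp add: disc_den_def cay_def matrix_mul_ring_simps add.assoc[symmetric] mat_add)
  have "mat 2 ** matrix_inv (z + mat \<i>) ** ((z + mat \<i>) ** mat (1 / 2)) = mat 2 ** (matrix_inv (z + mat \<i>) ** (z + mat \<i>)) ** mat (1 / 2)"
    by (simp only: matrix_mul_assoc)
  also have "\<dots> = mat 1" by (simp add: zi_inv mat_mat)
  finally show "invertible (disc_den z 1)" unfolding e by (meson invertibleI matrix_left_right_inverse)
qed

lemma cay_contraction:
  assumes "u \<noteq> 0"
  shows "(\<Sum>i\<in>UNIV. (norm ((cay z *v u) $ i))\<^sup>2) < (\<Sum>i\<in>UNIV. (norm (u $ i))\<^sup>2)"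
proof -
  have "z ** disc_den z 1 = mat (- \<i>) ** disc_den z 1 + mat 2"
  proof -
    have "(z + mat \<i>) ** disc_den z 1 = mat 2"
      unfolding disc_den_1 mat_commute[of 2] by (simp add: matrix_mul_assoc zi_inv)
    then show ?thesis
      by (simp add: matrix_mul_ring_simps algebra_simps) (simp add: vec_eq_iff mat_mult_nth algebra_simps)
  qed
  note * = hform_disc[OF this, of u]
  have "disc_den z 1 *v u \<noteq> 0"
  proof
    assume "disc_den z 1 *v u = 0"
    then have "matrix_inv (disc_den z 1) *v (disc_den z 1 *v u) = 0" by simp
    then show False using assms by (simp add: matrix_vector_mul_assoc matrix_inv_mult[OF disc_den_1(2)])
  qed
  then have "Im (hform z (disc_den z 1 *v u)) > 0" using z siegel_iff_hform[OF siegelD(1)[OF z]] by blast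
  then show ?thesis unfolding * by simp
qed

lemma disc_contraction:
  assumes "u \<noteq> 0" "norm t \<le> 1"
  shows "(norm t)\<^sup>2 * (\<Sum>i\<in>UNIV. (norm ((cay z *v u) $ i))\<^sup>2) < (\<Sum>i\<in>UNIV. (norm (u $ i))\<^sup>2)"
proof -
  have "(norm t)\<^sup>2 * (\<Sum>i\<in>UNIV. (norm ((cay z *v u) $ i))\<^sup>2) \<le> 1 * (\<Sum>i\<in>UNIV. (norm ((cay z *v u) $ i))\<^sup>2)"
    using assms(2) by (intro mult_right_mono sum_nonneg) (auto simp: power_le_one)
  then show ?thesis using cay_contraction[OF assms(1)] by linarith
qed

lemma invertible_disc_den:
  assumes "norm t \<le> 1" shows "invertible (disc_den z t)"
proof -
  have "u = 0" if "disc_den z t *v u = 0" for u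
  proof (rule ccontr)
    assume u: "u \<noteq> 0"
    have "(- \<i>) *s u + t *s (cay z *v u) = 0"
      using that by (simp only: disc_den_def matrix_vector_mult_add_rdistrib mat_mult_vector mat_vector)
    then have "t * (cay z *v u) $ i = \<i> * u $ i" for i by (simp add: vec_eq_iff eq_neg_iff_add_eq_0)
    then have "norm t * norm ((cay z *v u) $ i) = norm (u $ i)" for i by (metis norm_mult norm_ii mult_1_left)
    then have "(\<Sum>i\<in>UNIV. (norm (u $ i))\<^sup>2) = (norm t)\<^sup>2 * (\<Sum>i\<in>UNIV. (norm ((cay z *v u) $ i))\<^sup>2)"
      by (simp add: sum_distrib_left power_mult_distrib[symmetric])
    then show False using disc_contraction[OF u assms] by simp
  qed
  then show ?thesis using matrix_left_invertible_ker invertibleI by blast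
qed

lemma disc_den_inv:
  assumes "norm t \<le> 1"
  shows "disc_den z t ** matrix_inv (disc_den z t) = mat 1" "matrix_inv (disc_den z t) ** disc_den z t = mat 1"
  using matrix_inv_mult[OF invertible_disc_den[OF assms]] by auto

lemma disc_mult:
  assumes "norm t \<le> 1"
  shows "disc z t ** disc_den z t = mat (- \<i>) ** disc_den z t + mat 2"
  unfolding disc_def matmul.add_left matrix_mul_assoc[symmetric] disc_den_inv[OF assms] matrix_mul_rid ..

lemma disc_in_siegel:
  assumes t: "norm t \<le> 1" shows "disc z t \<in> siegel"
proof -
  have tr: "transpose (disc z t) = disc z t"
    using matrix_inv_transpose[OF invertible_disc_den[OF t]]
    by (simp add: disc_def transpose_ring_simps transpose_disc_den mat_commute[of 2, symmetric])
  have "Im (hform (disc z t) v) > 0" if v: "v \<noteq> 0" for v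
  proof -
    let ?u = "matrix_inv (disc_den z t) *v v"
    have e: "disc_den z t *v ?u = v" by (simp only: matrix_vector_mul_assoc disc_den_inv[OF t] matrix_vector_mul_lid)
    then have "?u \<noteq> 0" using v by auto
    from disc_contraction[OF this t] show ?thesis
      using hform_disc[OF disc_mult[OF t], of ?u] unfolding e by simp
  qed
  then show ?thesis using siegel_iff_hform[OF tr] by blast
qed

lemma det_disc_add_i:
  assumes "norm t \<le> 1"
  shows "det (disc z t + mat \<i>) = 2 ^ CARD('n) / det (disc_den z t)" "det (disc_den z t) \<noteq> 0"
proof -
  have "disc z t + mat \<i> = mat 2 ** matrix_inv (disc_den z t)"
    by (simp add: disc_def vec_eq_iff mat_def)
  then have "det (disc z t + mat \<i>) = 2 ^ CARD('n) * det (matrix_inv (disc_den z t))" by (simp add: det_mul det_mat)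
  moreover show d: "det (disc_den z t) \<noteq> 0" using invertible_disc_den[OF assms] by (simp add: invertible_det_nz)
  moreover have "det (disc_den z t) * det (matrix_inv (disc_den z t)) = 1"
    using arg_cong[OF disc_den_inv(1)[OF assms], of det] by (simp add: det_mul)
  ultimately show "det (disc z t + mat \<i>) = 2 ^ CARD('n) / det (disc_den z t)" by (simp add: field_simps)
qed

lemma continuous_on_disc_den: "continuous_on S (disc_den z)"
  unfolding disc_den_def by (intro continuous_intros continuous_on_matrix_mult)

lemma continuous_on_disc: "continuous_on (cball 0 1) (disc z)"
  unfolding disc_def
  by (intro continuous_intros continuous_on_matrix_mult continuous_on_matrix_inv continuous_on_disc_den invertible_disc_den) simp

text \<open>Symmetry of \<open>B\<close> is recorded because
  \<open>hol_fun_complex_derivative\<close> provides complex linearity in symmetric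
  directions.\<close>

lemma has_derivative_disc:
  assumes "norm t \<le> 1"
  obtains B where "transpose B = B" "(disc z has_derivative (\<lambda>\<tau>. mat \<tau> ** B)) (at t within S)"
proof -
  let ?I = "matrix_inv (disc_den z t)"
  define B where "B = - (mat 2 ** (?I ** cay z ** ?I))"
  have bl: "bounded_linear (mat :: complex \<Rightarrow> (complex, 'n) smat)"
  proof (rule linear_conv_bounded_linear[THEN iffD1], rule linearI)
    show "mat (a + b) = (mat a + mat b :: (complex, 'n) smat)" for a b by (rule mat_add[symmetric])
    show "mat (c *\<^sub>R b) = (c *\<^sub>R mat b :: (complex, 'n) smat)" for c b by (simp add: vec_eq_iff mat_def)
  qed
  have d: "(disc_den z has_derivative (\<lambda>\<tau>. mat \<tau> ** cay z)) (at t within S)"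
    unfolding disc_den_def
    using has_derivative_add[OF has_derivative_const
        bounded_linear.has_derivative[OF matmul.bounded_linear_left bounded_linear_imp_has_derivative[OF bl]]]
    by simp
  have "((\<lambda>x. matrix_inv (disc_den z x)) has_derivative (\<lambda>\<tau>. - (?I ** (mat \<tau> ** cay z) ** ?I))) (at t within S)"
    by (rule has_derivative_compose[OF d has_derivative_matrix_inv[OF invertible_disc_den[OF assms]]])
  then have "(disc z has_derivative (\<lambda>\<tau>. mat 2 ** (- (?I ** (mat \<tau> ** cay z) ** ?I)))) (at t within S)"
    unfolding disc_def
    using has_derivative_add[OF has_derivative_const bounded_linear.has_derivative[OF matmul.bounded_linear_right]]
    by fastforce
  moreover have "mat 2 ** (- (?I ** (mat \<tau> ** cay z) ** ?I)) = mat \<tau> ** B" for \<tau>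
  proof -
    have "?I ** (mat \<tau> ** cay z) ** ?I = mat \<tau> ** (?I ** cay z ** ?I)"
      by (simp only: matrix_mul_assoc mat_commute[of \<tau> ?I])
    then show ?thesis unfolding B_def by (simp add: vec_eq_iff mat_mult_nth)
  qed
  moreover have "transpose B = B"
  proof -
    have "transpose ?I = ?I" using matrix_inv_transpose[OF invertible_disc_den[OF assms]] by (simp add: transpose_disc_den)
    then show ?thesis unfolding B_def
      by (simp add: transpose_ring_simps transpose_cay mat_commute[of 2, symmetric] matrix_mul_assoc)
  qed
  ultimately show thesis using that[of B] by simp
qed

text \<open>The scalar unitary matrix with entry e^(i theta) acts on Cayley transforms as on
  quadratic forms, from both sides, hence by e^(2 i theta). In the computation,
  \<open>disc_den\<close> times z + i turns out to be 2 e^(i theta) times the automorphy factor of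
  the rotation.\<close>

lemma disc_rotation:
  "disc z (cis (2 * \<theta>)) = siegel_act (rot UNIV (cos \<theta>) (sin \<theta>)) z"
proof -
  let ?c = "complex_of_real (cos \<theta>)" and ?s = "complex_of_real (sin \<theta>)" and ?t = "cis (2 * \<theta>)"
  let ?k = "rot UNIV (cos \<theta>) (sin \<theta>) :: (real, 'n) dmat"
  have Sp: "?k \<in> Sp" by (rule rot_Sp) simp
  note bl = rot_UNIV_blocks[of "cos \<theta>" "sin \<theta>"]
  have cs: "?c\<^sup>2 + ?s\<^sup>2 = 1"
    using arg_cong[OF sin_cos_squared_add2[of \<theta>], of complex_of_real] by (simp only: of_real_add of_real_power of_real_1)
  have t: "?t = (cis \<theta>)\<^sup>2" by (simp add: cis_mult power2_eq_square)
  have e: "cis \<theta> = ?c + \<i> * ?s" by (simp add: complex_eq_iff)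
  have e1: "cis \<theta> * (?c - \<i> * ?s) = 1" using cs by (simp add: e algebra_simps power2_eq_square)
  have t1: "1 + ?t = 2 * cis \<theta> * ?c"
  proof -
    have "1 + ?t = (?c\<^sup>2 + ?s\<^sup>2) + (?c + \<i> * ?s)\<^sup>2" unfolding t e cs ..
    also have "\<dots> = 2 * (?c + \<i> * ?s) * ?c" by (simp add: power2_eq_square algebra_simps)
    finally show ?thesis unfolding e .
  qed
  have t2: "\<i> * (1 - ?t) = 2 * cis \<theta> * ?s"
  proof -
    have "\<i> * (1 - ?t) = \<i> * ((?c\<^sup>2 + ?s\<^sup>2) - (?c + \<i> * ?s)\<^sup>2)" unfolding t e cs ..
    also have "\<dots> = 2 * (?c + \<i> * ?s) * ?s" by (simp add: power2_eq_square algebra_simps)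
    finally show ?thesis unfolding e .
  qed
  have aut: "aut_factor ?k z = mat (- ?s) ** z + mat ?c" unfolding aut_factor_def bl ..
  have den: "disc_den z ?t ** (z + mat \<i>) = mat (2 * cis \<theta>) ** aut_factor ?k z"
  proof -
    have "mat (- \<i> * (1 - ?t)) ** (z + mat \<i>) + mat (2 * ?t) = mat (- (\<i> * (1 - ?t))) ** z + mat (1 + ?t)"
      by (simp add: vec_eq_iff mat_mult_nth) (simp add: mat_def algebra_simps)
    also have "\<dots> = mat (2 * cis \<theta>) ** aut_factor ?k z"
      unfolding aut t1 t2 by (simp add: vec_eq_iff mat_mult_nth) (simp add: mat_def algebra_simps)
    finally show ?thesis unfolding disc_den_mult .
  qed
  have "disc z ?t ** (mat (2 * cis \<theta>) ** aut_factor ?k z) = (mat (- \<i>) ** disc_den z ?t + mat 2) ** (z + mat \<i>)"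
    unfolding den[symmetric] matrix_mul_assoc by (subst disc_mult) simp_all
  also have "\<dots> = mat (- \<i>) ** (mat (2 * cis \<theta>) ** aut_factor ?k z) + mat 2 ** (z + mat \<i>)"
    unfolding den[symmetric] by (simp only: matmul.add_left matrix_mul_assoc)
  finally have "mat ((?c - \<i> * ?s) / 2) ** (disc z ?t ** (mat (2 * cis \<theta>) ** aut_factor ?k z))
     = mat ((?c - \<i> * ?s) / 2) ** (mat (- \<i>) ** (mat (2 * cis \<theta>) ** aut_factor ?k z) + mat 2 ** (z + mat \<i>))" by simp
  moreover have "mat ((?c - \<i> * ?s) / 2) ** (disc z ?t ** (mat (2 * cis \<theta>) ** aut_factor ?k z)) = disc z ?t ** aut_factor ?k z"
  proof -
    have "disc z ?t ** (mat (2 * cis \<theta>) ** aut_factor ?k z) = mat (2 * cis \<theta>) ** (disc z ?t ** aut_factor ?k z)"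
      by (simp only: matrix_mul_assoc mat_commute[of _ "disc z ?t"])
    moreover have "(?c - \<i> * ?s) / 2 * (2 * cis \<theta>) = 1"
    proof -
      have "x / 2 * (2 * y) = y * x" for x y :: complex by simp
      then show ?thesis using e1 by metis
    qed
    ultimately show ?thesis by (simp only: matrix_mul_assoc mat_mat matrix_mul_lid)
  qed
  moreover have "mat ((?c - \<i> * ?s) / 2) ** (mat (- \<i>) ** (mat (2 * cis \<theta>) ** aut_factor ?k z) + mat 2 ** (z + mat \<i>))
    = mat ?c ** z + mat ?s"
  proof -
    have "(?c - \<i> * ?s) / 2 * (- (\<i> * (2 * cis \<theta> * (- (?s * x) + y * ?c))) + 2 * (x + \<i> * y)) = ?c * x + y * ?s" for x y
    proof -
      have "(?c - \<i> * ?s) / 2 * (- (\<i> * (2 * cis \<theta> * (- (?s * x) + y * ?c))) + 2 * (x + \<i> * y))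
        = - \<i> * (cis \<theta> * (?c - \<i> * ?s)) * (- (?s * x) + y * ?c) + (?c - \<i> * ?s) * (x + \<i> * y)"
        by (simp add: field_simps)
      then show ?thesis unfolding e1 by (simp add: algebra_simps)
    qed
    note * = this
    have "(mat ((?c - \<i> * ?s) / 2) ** (mat (- \<i>) ** (mat (2 * cis \<theta>) ** aut_factor ?k z) + mat 2 ** (z + mat \<i>))) $ i $ j
      = (mat ?c ** z + mat ?s) $ i $ j" for i j
      using *[of "z $ i $ j" "if i = j then 1 else 0"]
      by (simp only: aut mat_mult_nth vector_add_component) (auto simp: mat_def)
    then show ?thesis by (simp add: vec_eq_iff)
  qed
  ultimately have "disc z ?t ** aut_factor ?k z = of_real_mat (blockA ?k) ** z + of_real_mat (blockB ?k)" unfolding bl by simp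
  from siegel_act_unique[OF Sp z this] show ?thesis by simp
qed

end

lemma complex_linear_eq:
  assumes "linear L" "L \<i> = \<i> * L 1"
  shows "L = (*) (L 1)"
proof
  fix x :: complex
  have "L x = L (Re x *\<^sub>R 1 + Im x *\<^sub>R \<i>)" by (rule arg_cong[where f = L]) (simp add: complex_eq_iff)
  also have "\<dots> = Re x *\<^sub>R L 1 + Im x *\<^sub>R (\<i> * L 1)" by (simp only: linear_add[OF assms(1)] linear_scale[OF assms(1)] assms(2))
  also have "\<dots> = L 1 * (Re x *\<^sub>R 1 + Im x *\<^sub>R \<i>)" by (simp add: algebra_simps)
  also have "Re x *\<^sub>R 1 + Im x *\<^sub>R \<i> = x" by (simp add: complex_eq_iff)
  finally show "L x = L 1 * x" .
qed

section \<open>The mean value property\<close>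

text \<open>The quotient of \<open>hol_fun m \<phi>\<close> by \<open>f1 m\<close>, with the
  division by the power of det (z + i) written as a multiplication.\<close>

definition hol_quot :: "nat \<Rightarrow> ((real, 'n::finite) dmat \<Rightarrow> complex) \<Rightarrow> (complex, 'n) smat \<Rightarrow> complex" where
  "hol_quot m \<phi> z = hol_fun m \<phi> z * det (z + mat \<i>) ^ m / (2 * \<i>) ^ (m * CARD('n))"

lemma hol_quot_mat_i: "hol_quot m \<phi> (mat \<i>) = \<phi> (mat 1)" for \<phi> :: "(real, 'n::finite) dmat \<Rightarrow> complex"
proof -
  have "aut_factor (mat 1) (mat \<i>) = (mat 1 :: (complex, 'n) smat)"
    by (simp add: aut_factor_def block_ops(6) map_matrix_of_real_simps matrix_mul_ring_simps)
  moreover have "det (mat \<i> + mat \<i> :: (complex, 'n) smat) ^ m = (2 * \<i>) ^ (m * CARD('n))"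
  proof -
    have "det (mat \<i> + mat \<i> :: (complex, 'n) smat) = (2 * \<i>) ^ CARD('n)"
      unfolding mat_add det_mat by (simp only: mult_2)
    then show ?thesis by (simp only: power_mult[symmetric] mult.commute)
  qed
  ultimately show ?thesis unfolding hol_quot_def hol_fun_def bz_mat_i by simp
qed

lemma continuous_on_hol_fun:
  fixes \<phi> :: "(real, 'n::{finite, linorder}) dmat \<Rightarrow> complex"
  assumes "K_equivariant m \<phi>" "smooth_function_on Sp \<phi>"
    and "\<And>X g. X \<in> p_minus \<Longrightarrow> g \<in> Sp \<Longrightarrow> lie_act X \<phi> g = 0"
  shows "continuous_on siegel (hol_fun m \<phi>)"
  unfolding continuous_on_eq_continuous_within
proof
  fix z :: "(complex, 'n) smat" assume "z \<in> siegel"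
  then obtain D where "(hol_fun m \<phi> has_derivative D) (at z within siegel)"
    using hol_fun_complex_derivative[OF assms] by metis
  then show "continuous (at z within siegel) (hol_fun m \<phi>)" by (rule has_derivative_continuous)
qed

lemma continuous_on_hol_quot:
  fixes \<phi> :: "(real, 'n::{finite, linorder}) dmat \<Rightarrow> complex"
  assumes "K_equivariant m \<phi>" "smooth_function_on Sp \<phi>"
    and "\<And>X g. X \<in> p_minus \<Longrightarrow> g \<in> Sp \<Longrightarrow> lie_act X \<phi> g = 0"
  shows "continuous_on siegel (hol_quot m \<phi>)"
  unfolding hol_quot_def
  by (intro continuous_intros continuous_on_hol_fun[OF assms] continuous_on_det) auto

text \<open>Cauchy's formula at the centre of the unit disc, with \<open>disc z\<close> as
  parametrization. The rotation angle is pi x because rotation by theta corresponds to the boundary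
  point e^(2 i theta), so that x in [0, 1] runs once around the circle.\<close>

lemma hol_quot_mean_value:
  fixes \<phi> :: "(real, 'n::{finite, linorder}) dmat \<Rightarrow> complex"
  assumes eq: "K_equivariant m \<phi>" and smooth: "smooth_function_on Sp \<phi>"
    and p: "\<And>X g. X \<in> p_minus \<Longrightarrow> g \<in> Sp \<Longrightarrow> lie_act X \<phi> g = 0" and z: "z \<in> siegel"
  shows "((\<lambda>x. hol_quot m \<phi> (siegel_act (rot UNIV (cos (pi * x)) (sin (pi * x))) z)) has_integral \<phi> (mat 1)) {0..1}"
proof -
  \<comment> \<open>On the closed disc this is \<open>hol_quot m \<phi> (disc z t)\<close>.
    Expressing det (disc z t + i) by \<open>disc_den\<close> exhibits the second factor as a power
    of the reciprocal of a polynomial in t.\<close>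
  define u where "u = (\<lambda>t. hol_fun m \<phi> (disc z t) * (2 ^ CARD('n) / det (disc_den z t)) ^ m / (2 * \<i>) ^ (m * CARD('n)))"
  have u: "u t = hol_quot m \<phi> (disc z t)" if "norm t \<le> 1" for t
    unfolding u_def hol_quot_def det_disc_add_i(1)[OF z that] ..
  have cont: "continuous_on (cball 0 1) u"
  proof -
    have "continuous_on (cball 0 1) (\<lambda>t. hol_fun m \<phi> (disc z t))"
      by (rule continuous_on_compose2[OF continuous_on_hol_fun[OF eq smooth p] continuous_on_disc[OF z]])
        (auto intro: disc_in_siegel[OF z])
    moreover have "continuous_on (cball 0 1) (\<lambda>t. det (disc_den z t))"
      by (intro continuous_on_det continuous_on_disc_den[OF z])
    ultimately show ?thesis unfolding u_def using det_disc_add_i(2)[OF z] by (intro continuous_intros) auto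
  qed
  have hol: "u holomorphic_on ball 0 1"
  proof -
    have "(\<lambda>t. hol_fun m \<phi> (disc z t)) holomorphic_on ball 0 1"
      unfolding holomorphic_on_def
    proof
      fix t :: complex assume t: "t \<in> ball 0 1"
      then have t': "norm t \<le> 1" by simp
      obtain B where B: "transpose B = B" "(disc z has_derivative (\<lambda>\<tau>. mat \<tau> ** B)) (at t within ball 0 1)"
        using has_derivative_disc[OF z t'] by blast
      obtain D where D: "(hol_fun m \<phi> has_derivative D) (at (disc z t) within siegel)"
        "\<And>H. transpose H = H \<Longrightarrow> D (mat \<i> ** H) = \<i> * D H"
        using hol_fun_complex_derivative[OF eq smooth p disc_in_siegel[OF z t']] by blast
      have "disc z ` ball 0 1 \<subseteq> siegel" using disc_in_siegel[OF z] by auto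
      from has_derivative_in_compose[OF B(2) has_derivative_subset[OF D(1) this]]
      have d: "((\<lambda>x. hol_fun m \<phi> (disc z x)) has_derivative (\<lambda>\<tau>. D (mat \<tau> ** B))) (at t within ball 0 1)" .
      have "(\<lambda>\<tau>. D (mat \<tau> ** B)) = (*) (D (mat 1 ** B))"
        by (rule complex_linear_eq[OF has_derivative_linear[OF d]]) (simp add: D(2)[OF B(1)])
      then show "(\<lambda>t. hol_fun m \<phi> (disc z t)) field_differentiable at t within ball 0 1"
        using d unfolding field_differentiable_def has_field_derivative_def by metis
    qed
    moreover have "(\<lambda>t. det (disc_den z t)) holomorphic_on ball 0 1"
      unfolding det_def disc_den_def vector_add_component mat_mult_nth by (intro holomorphic_intros)
    ultimately show ?thesis unfolding u_def using det_disc_add_i(2)[OF z] by (intro holomorphic_intros) auto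
  qed
  have "((\<lambda>w. u w / (w - 0)) has_contour_integral 2 * of_real pi * \<i> * u 0) (circlepath 0 1)"
    by (rule Cauchy_integral_circlepath[OF cont hol]) simp
  then have C: "((\<lambda>x. u (circlepath 0 1 x) / circlepath 0 1 x * vector_derivative (circlepath 0 1) (at x within {0..1})) has_integral 2 * of_real pi * \<i> * u 0) {0..1}"
    unfolding has_contour_integral_def by simp
  have cg: "u (circlepath 0 1 x) / circlepath 0 1 x * vector_derivative (circlepath 0 1) (at x within {0..1})
      = 2 * of_real pi * \<i> * hol_quot m \<phi> (siegel_act (rot UNIV (cos (pi * x)) (sin (pi * x))) z)" if x: "x \<in> {0..1}" for x
  proof -
    have c: "circlepath 0 1 x = cis (2 * (pi * x))" by (simp add: circlepath cis_conv_exp mult_ac)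
    have "vector_derivative (circlepath 0 1) (at x within {0..1}) = 2 * of_real pi * \<i> * cis (2 * (pi * x))"
      using vector_derivative_circlepath01[of x 0 1] x by (simp add: cis_conv_exp mult_ac)
    then show ?thesis unfolding c by (simp add: u disc_rotation[OF z])
  qed
  have "u 0 = \<phi> (mat 1)" by (simp add: u disc_0 hol_quot_mat_i)
  with has_integral_cong[THEN iffD1, OF cg C]
  have "((\<lambda>x. 2 * of_real pi * \<i> * hol_quot m \<phi> (siegel_act (rot UNIV (cos (pi * x)) (sin (pi * x))) z)) has_integral 2 * of_real pi * \<i> * \<phi> (mat 1)) {0..1}"
    by simp
  from has_integral_mult_right[OF this, of "1 / (2 * of_real pi * \<i>)"] show ?thesis by simp
qed

section \<open>The reproducing property on the Siegel upper half space\<close>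

lemma measurable_siegel_measureI: "f \<in> borel_measurable borel \<Longrightarrow> f \<in> borel_measurable siegel_measure"
  unfolding measurable_cong_sets[OF sets_siegel_measure(1) refl] by (rule measurable_restrict_space1)

lemma continuous_on_siegel_measurable:
  "continuous_on siegel f \<Longrightarrow> f \<in> borel_measurable siegel_measure" for f :: "_ \<Rightarrow> 'a::topological_space"
  unfolding measurable_cong_sets[OF sets_siegel_measure(1) refl] by (rule borel_measurable_continuous_on_restrict)

definition siegel_weight :: "nat \<Rightarrow> (complex, 'n::finite) smat \<Rightarrow> real" where
  "siegel_weight m z = (norm (f1 m z))\<^sup>2 * det (map_matrix Im z) ^ m"

lemma norm_f1: "norm (f1 m z) = 2 ^ (m * CARD('n)) / norm (det (z + mat \<i>)) ^ m" for z :: "(complex, 'n::finite) smat"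
  by (simp add: f1_def norm_mult norm_power norm_inverse divide_inverse)

lemma det_add_i_nonzero: "z \<in> siegel \<Longrightarrow> det (z + mat \<i>) \<noteq> 0"
  using siegel_invertible[OF siegel_add_i] by (simp add: invertible_det_nz)

text \<open>For the image w of z under the rotation, w + i times the automorphy factor is (c - is)(z
  + i), and c - is has modulus one. The powers of the automorphy factor arising from |f_1|^2 and
  from det y therefore cancel.\<close>

lemma siegel_weight_rot:
  fixes z :: "(complex, 'n::finite) smat"
  assumes cs: "c\<^sup>2 + s\<^sup>2 = (1 :: real)" and z: "z \<in> siegel"
  shows "siegel_weight m (siegel_act (rot UNIV c s) z) = siegel_weight m z"
proof -
  let ?k = "rot UNIV c s :: (real, 'n) dmat" and ?w = "siegel_act (rot UNIV c s) z"
  let ?A = "aut_factor ?k z"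
  note k = rot_Sp[OF cs, of "UNIV :: 'n set"]
  have "(?w + mat \<i>) ** ?A = (mat (of_real c) ** z + mat (of_real s)) + mat \<i> ** (mat (- of_real s) ** z + mat (of_real c))"
    unfolding matmul.add_left siegel_act_props(4)[OF k z] unfolding aut_factor_def rot_UNIV_blocks ..
  also have "\<dots> = mat (of_real c - \<i> * of_real s) ** (z + mat \<i>)"
    by (simp add: vec_eq_iff mat_mult_nth) (simp add: mat_def algebra_simps)
  finally have "det (?w + mat \<i>) * det ?A = (of_real c - \<i> * of_real s) ^ CARD('n) * det (z + mat \<i>)"
    by (metis det_mul det_mat)
  then have "norm (det (?w + mat \<i>)) * norm (det ?A) = norm (complex_of_real c - \<i> * of_real s) ^ CARD('n) * norm (det (z + mat \<i>))"
    by (metis norm_mult norm_power)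
  moreover have "norm (complex_of_real c - \<i> * of_real s) = 1"
    using cs by (simp add: cmod_def)
  ultimately have q: "norm (det (z + mat \<i>)) = norm (det (?w + mat \<i>)) * norm (det ?A)" by simp
  have A: "norm (det ?A) \<noteq> 0" using det_Im_siegel_act(2)[OF k z] by simp
  have alg: "(a / (b * d))\<^sup>2 * (y * d\<^sup>2) = (a / b)\<^sup>2 * y" if "d \<noteq> 0" for a b d y :: real
    using that by (simp add: power_divide power_mult_distrib)
  have pw: "(y * (norm (det ?A))\<^sup>2) ^ m = y ^ m * (norm (det ?A) ^ m)\<^sup>2" for y
    by (simp add: power_mult_distrib power_mult[symmetric] mult.commute)
  have "norm (det ?A) ^ m \<noteq> 0" using A by simp
  then show ?thesis
    unfolding siegel_weight_def norm_f1 q det_Im_siegel_act(1)[OF k z, symmetric] pw power_mult_distrib[of _ "norm (det ?A)"]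
    by (rule alg[symmetric])
qed

lemma siegel_act_bz_aut:
  fixes z :: "(complex, 'n::finite) smat"
  assumes z: "z \<in> siegel"
  defines "J \<equiv> det (aut_factor (bz z) (mat \<i>))"
  shows "J \<noteq> 0" "det (map_matrix Im z) * (norm J)\<^sup>2 = 1" "F1 m (bz z) = f1 m z / J ^ m"
proof -
  note b = bz_Sp[OF z]
  show "J \<noteq> 0" unfolding J_def by (rule det_Im_siegel_act(2)[OF b mat_i_in_siegel])
  show "det (map_matrix Im z) * (norm J)\<^sup>2 = 1"
    using det_Im_siegel_act(1)[OF b mat_i_in_siegel] unfolding siegel_act_bz[OF z] J_def by (simp add: Re_Im_mat_i)
  show "F1 m (bz z) = f1 m z / J ^ m"
    unfolding F1_def slash_def siegel_act_bz[OF z] J_def by (simp add: divide_inverse mult.commute)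
qed

lemma f1_nonzero: "z \<in> siegel \<Longrightarrow> f1 m z \<noteq> 0"
  using det_add_i_nonzero[of z] by (simp add: f1_def)

text \<open>With f = \<open>hol_fun m \<phi>\<close> and J the determinant of the automorphy factor
  of \<open>bz z\<close>, the left side is f times the conjugate of f_1 divided by |J|^(2m), and
  |J|^-2 = det y.\<close>

lemma inner_eq_weight_hol_quot:
  assumes z: "z \<in> siegel"
  shows "\<phi> (bz z) * cnj (F1 m (bz z)) = siegel_weight m z *\<^sub>R hol_quot m \<phi> z"
proof -
  let ?J = "det (aut_factor (bz z) (mat \<i>))"
  note J = siegel_act_bz_aut[OF z]
  have h: "hol_quot m \<phi> z = \<phi> (bz z) * ?J ^ m / f1 m z"
    unfolding hol_quot_def hol_fun_def f1_def by (simp add: divide_inverse)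
  have "complex_of_real (det (map_matrix Im z)) * (?J * cnj ?J) = 1"
    using arg_cong[OF J(2), of complex_of_real] by (simp only: of_real_mult complex_norm_square of_real_1)
  then have 1: "complex_of_real (det (map_matrix Im z)) ^ m * (?J ^ m * cnj ?J ^ m) = 1"
    by (simp add: power_mult_distrib[symmetric])
  have "siegel_weight m z *\<^sub>R hol_quot m \<phi> z = of_real ((norm (f1 m z))\<^sup>2) * of_real (det (map_matrix Im z)) ^ m * (\<phi> (bz z) * ?J ^ m / f1 m z)"
    unfolding h siegel_weight_def scaleR_conv_of_real of_real_mult of_real_power ..
  also have "\<dots> = cnj (f1 m z) * of_real (det (map_matrix Im z)) ^ m * (\<phi> (bz z) * ?J ^ m)"
    unfolding complex_norm_square using f1_nonzero[OF z, of m] by simp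
  also have "\<dots> = \<phi> (bz z) * cnj (f1 m z) / cnj ?J ^ m"
  proof -
    have "u * d * (v * a) * c = v * u * (d * (a * c))" for u d v a c :: complex by simp
    from this[of "cnj (f1 m z)" "complex_of_real (det (map_matrix Im z)) ^ m" "\<phi> (bz z)" "?J ^ m" "cnj ?J ^ m"]
    show ?thesis unfolding 1 using J(1) by (simp add: eq_divide_eq)
  qed
  finally show ?thesis unfolding J(3) by simp
qed

text \<open>The first formula is brought into the shape of \<open>nn_integral_siegel_f1\<close> with
  a = m/2. The second one serves to show that the integral of the norm does not vanish.\<close>

lemma norm_F1_bz:
  fixes z :: "(complex, 'n::finite) smat"
  assumes z: "z \<in> siegel"
  shows "norm (F1 m (bz z)) = 2 ^ (m * CARD('n)) * (norm (det (z + mat \<i>)) powr (- (2 * (real m / 2))) * det (map_matrix Im z) powr (real m / 2))"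
    and "(norm (F1 m (bz z)))\<^sup>2 = siegel_weight m z"
proof -
  let ?J = "det (aut_factor (bz z) (mat \<i>))" and ?y = "det (map_matrix Im z)" and ?D = "norm (det (z + mat \<i>))"
  note J = siegel_act_bz_aut[OF z]
  have y: "?y > 0" by (rule det_Im_pos[OF z])
  have D: "?D > 0" using det_add_i_nonzero[OF z] by simp
  have nJ: "norm ?J > 0" using J(1) by simp
  have y': "?y = 1 / (norm ?J)\<^sup>2" using J(2) nJ by (simp add: field_simps)
  have "norm ?J powr (- real m) = ((norm ?J) powr (-2)) powr (real m / 2)" by (simp add: powr_powr)
  also have "(norm ?J) powr (-2) = ?y" using nJ y' by (simp add: powr_minus divide_inverse)
  finally have "norm ?J powr (- real m) = ?y powr (real m / 2)" .
  moreover have pm: "1 / x ^ m = x powr (- real m)" if "x > 0" for x :: real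
    using that by (simp add: powr_minus_divide powr_realpow)
  ultimately have "1 / norm ?J ^ m = ?y powr (real m / 2)" using pm[OF nJ] by simp
  moreover have "1 / ?D ^ m = ?D powr (- (2 * (real m / 2)))" using pm[OF D] by simp
  moreover have "norm (F1 m (bz z)) = 2 ^ (m * CARD('n)) * ((1 / ?D ^ m) * (1 / norm ?J ^ m))"
    unfolding J(3) norm_divide norm_f1 norm_power by simp
  ultimately show "norm (F1 m (bz z)) = 2 ^ (m * CARD('n)) * (?D powr (- (2 * (real m / 2))) * ?y powr (real m / 2))" by simp
  have "?y ^ m = 1 / (norm ?J ^ m)\<^sup>2" unfolding y' by (simp add: power_divide power_mult[symmetric] mult.commute)
  then show "(norm (F1 m (bz z)))\<^sup>2 = siegel_weight m z"
    unfolding J(3) siegel_weight_def by (simp add: norm_divide norm_power power_divide)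
qed

lemma measurable_det_add_i: "(\<lambda>z :: (complex, 'n::finite) smat. det (z + mat \<i>)) \<in> borel_measurable borel"
  by (intro borel_measurable_continuous_onI continuous_on_det continuous_intros)

lemma nn_integral_norm_F1_finite:
  assumes m: "m > 2 * CARD('n)"
  shows "(\<integral>\<^sup>+z. ennreal (norm (F1 m (bz z))) \<partial>(siegel_measure :: (complex, 'n::{finite, linorder}) smat measure)) < \<infinity>"
proof -
  note [measurable] = measurable_det_add_i
  let ?g = "\<lambda>z :: (complex, 'n) smat. norm (det (z + mat \<i>)) powr (- (2 * (real m / 2))) * det (map_matrix Im z) powr (real m / 2)"
  have g: "(\<lambda>z. ennreal (?g z)) \<in> borel_measurable siegel_measure"
    by (rule measurable_siegel_measureI) measurable
  have "(\<integral>\<^sup>+z. ennreal (norm (F1 m (bz z))) \<partial>(siegel_measure :: (complex, 'n) smat measure)) = (\<integral>\<^sup>+z. ennreal (2 ^ (m * CARD('n))) * ennreal (?g z) \<partial>siegel_measure)"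
    by (rule nn_integral_cong) (simp only: sets_siegel_measure(2) norm_F1_bz(1) ennreal_mult' zero_le_power zero_le_numeral)
  also have "\<dots> = ennreal (2 ^ (m * CARD('n))) * (\<integral>\<^sup>+z. ennreal (?g z) \<partial>siegel_measure)" by (rule nn_integral_cmult[OF g])
  also have "\<dots> < \<infinity>"
  proof -
    have "real m / 2 > real CARD('n)" using m by simp
    from nn_integral_siegel_f1[OF this] show ?thesis by (simp add: ennreal_mult_less_top)
  qed
  finally show ?thesis .
qed

lemma C_const_pos:
  assumes "m > n" shows "C_const m n > 0"
proof -
  have "Gamma (real m - (real n + real r) / 2) > 0" "Gamma (real m - (real r - 1) / 2) > 0" if "r \<in> {1..n}" for r
    using that assms by (auto intro!: Gamma_real_pos)
  then show ?thesis unfolding C_const_def by (intro mult_pos_pos prod_pos divide_pos_pos) auto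
qed

lemma siegel_weight_measurable [measurable]: "siegel_weight m \<in> borel_measurable borel"
  unfolding siegel_weight_def norm_f1 using measurable_det_add_i by measurable

lemma siegel_weight_nonneg: "z \<in> siegel \<Longrightarrow> siegel_weight m z \<ge> 0"
  using det_Im_pos[of z] by (simp add: siegel_weight_def)

lemma nn_integral_siegel_weight:
  assumes m: "m > CARD('n)"
  shows "(\<integral>\<^sup>+z. ennreal (siegel_weight m z) \<partial>(siegel_measure :: (complex, 'n::{finite, linorder}) smat measure)) = ennreal (C_const m CARD('n))"
proof -
  note [measurable] = measurable_det_add_i
  let ?n = "CARD('n)"
  let ?g = "\<lambda>z :: (complex, 'n) smat. norm (det (z + mat \<i>)) powr (- (2 * real m)) * det (map_matrix Im z) powr real m"
  let ?c = "siegel_x_const ?n (real m) * siegel_y_const ?n (2 * real m - (real ?n + 1) / 2) (real m - real ?n - 1)"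
  have g: "(\<lambda>z. ennreal (?g z)) \<in> borel_measurable siegel_measure"
    by (rule measurable_siegel_measureI) measurable
  have w: "siegel_weight m z = 2 powr (2 * real m * real ?n) * ?g z" if z: "z \<in> siegel" for z :: "(complex, 'n) smat"
  proof -
    let ?D = "norm (det (z + mat \<i>))"
    have D: "?D > 0" using det_add_i_nonzero[OF z] by simp
    have sq: "x powr real (2 * k) = (x ^ k)\<^sup>2" if "x > 0" for x :: real and k
      using powr_realpow[OF that, of "2 * k"] by (simp only: power_even_eq)
    have "2 powr (2 * real m * real ?n) = (2 ^ (m * ?n))\<^sup>2"
      using sq[of 2 "m * ?n"] by (simp add: mult.assoc)
    moreover have "?D powr (- (2 * real m)) = 1 / (?D ^ m)\<^sup>2"
      using sq[OF D, of m] by (simp add: powr_minus_divide)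
    moreover have "det (map_matrix Im z) powr real m = det (map_matrix Im z) ^ m" using det_Im_pos[OF z] by (simp add: powr_realpow)
    ultimately show ?thesis unfolding siegel_weight_def norm_f1 power_divide by simp
  qed
  have "(\<integral>\<^sup>+z. ennreal (siegel_weight m z) \<partial>(siegel_measure :: (complex, 'n) smat measure)) = (\<integral>\<^sup>+z. ennreal (2 powr (2 * real m * real ?n)) * ennreal (?g z) \<partial>siegel_measure)"
    by (rule nn_integral_cong) (simp only: sets_siegel_measure(2) w ennreal_mult' powr_ge_zero)
  also have "\<dots> = ennreal (2 powr (2 * real m * real ?n)) * (\<integral>\<^sup>+z. ennreal (?g z) \<partial>siegel_measure)" by (rule nn_integral_cmult[OF g])
  also have "\<dots> = ennreal (2 powr (2 * real m * real ?n)) * ennreal ?c"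
  proof -
    have "real m > real ?n" using m by simp
    from nn_integral_siegel_f1[OF this] show ?thesis by simp
  qed
  also have "\<dots> = ennreal (2 powr (2 * real m * real ?n) * ?c)" by (simp only: ennreal_mult' powr_ge_zero)
  also have "2 powr (2 * real m * real ?n) * ?c = C_const m ?n"
    unfolding C_const_def by (rule siegel_const_product) (use m in simp)
  finally show ?thesis .
qed

definition weighted_siegel :: "nat \<Rightarrow> (complex, 'n::{finite, linorder}) smat measure" where
  "weighted_siegel m = density siegel_measure (\<lambda>z. ennreal (siegel_weight m z))"

lemma sets_weighted_siegel: "sets (weighted_siegel m) = sets siegel_measure" "space (weighted_siegel m) = siegel"
  by (simp_all add: weighted_siegel_def sets_siegel_measure(2))

lemma emeasure_weighted_siegel:
  assumes "m > CARD('n)"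
  shows "emeasure (weighted_siegel m :: (complex, 'n::{finite, linorder}) smat measure) siegel = ennreal (C_const m CARD('n))"
proof -
  have "siegel \<in> sets (siegel_measure :: (complex, 'n) smat measure)" using sets.top sets_siegel_measure(2) by metis
  then show ?thesis unfolding weighted_siegel_def
    by (subst emeasure_density) (auto simp: measurable_siegel_measureI nn_integral_siegel_weight[OF assms, symmetric] sets_siegel_measure(2) intro!: nn_integral_cong)
qed

lemma nn_integral_weighted_siegel:
  "G \<in> borel_measurable siegel_measure \<Longrightarrow> (\<integral>\<^sup>+z. G z \<partial>weighted_siegel m) = (\<integral>\<^sup>+z. ennreal (siegel_weight m z) * G z \<partial>siegel_measure)"
  unfolding weighted_siegel_def by (rule nn_integral_density) (auto intro!: measurable_siegel_measureI)

lemma distr_weighted_siegel_rot: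
  assumes cs: "c\<^sup>2 + s\<^sup>2 = (1 :: real)"
  shows "distr (weighted_siegel m) (weighted_siegel m) (siegel_act (rot UNIV c s)) = (weighted_siegel m :: (complex, 'n::{finite, linorder}) smat measure)"
proof -
  let ?k = "rot UNIV c s :: (real, 'n) dmat"
  note km = measurable_siegel_act[OF rot_Sp[OF cs], of "UNIV :: 'n set"]
  have km': "siegel_act ?k \<in> weighted_siegel m \<rightarrow>\<^sub>M weighted_siegel m"
    using km unfolding measurable_cong_sets[OF sets_weighted_siegel(1) sets_weighted_siegel(1)] .
  have inv: "(\<integral>\<^sup>+z. G (siegel_act ?k z) \<partial>weighted_siegel m) = (\<integral>\<^sup>+z. G z \<partial>weighted_siegel m)"
    if G: "G \<in> borel_measurable siegel_measure" for G
  proof -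
    have "(\<integral>\<^sup>+z. G (siegel_act ?k z) \<partial>weighted_siegel m) = (\<integral>\<^sup>+z. ennreal (siegel_weight m (siegel_act ?k z)) * G (siegel_act ?k z) \<partial>siegel_measure)"
      unfolding nn_integral_weighted_siegel[OF measurable_compose[OF km G]]
      by (rule nn_integral_cong) (simp add: sets_siegel_measure(2) siegel_weight_rot[OF cs])
    also have "\<dots> = (\<integral>\<^sup>+z. ennreal (siegel_weight m z) * G z \<partial>siegel_measure)"
      by (rule nn_integral_siegel_rot[OF cs])
        (rule borel_measurable_times_ennreal[OF _ G], rule measurable_siegel_measureI, measurable)
    finally show ?thesis by (simp add: nn_integral_weighted_siegel[OF G])
  qed
  show ?thesis
  proof (rule measure_eqI)
    fix A assume "A \<in> sets (distr (weighted_siegel m) (weighted_siegel m) (siegel_act ?k))"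
    then have A: "A \<in> sets (weighted_siegel m)" "A \<in> sets siegel_measure" by (simp_all add: sets_weighted_siegel)
    have "emeasure (distr (weighted_siegel m) (weighted_siegel m) (siegel_act ?k)) A = (\<integral>\<^sup>+z. indicator A (siegel_act ?k z) \<partial>weighted_siegel m)"
      by (subst nn_integral_distr[OF km', of "indicator A", symmetric]) (use A in auto)
    also have "\<dots> = (\<integral>\<^sup>+z. indicator A z \<partial>weighted_siegel m)" by (rule inv) (use A in auto)
    finally show "emeasure (distr (weighted_siegel m) (weighted_siegel m) (siegel_act ?k)) A = emeasure (weighted_siegel m) A"
      using A by simp
  qed simp
qed

lemma continuous_on_rotation:
  "continuous_on (UNIV \<times> siegel) (\<lambda>p. siegel_act (rot UNIV (cos (pi * fst p)) (sin (pi * fst p))) (snd p) :: (complex, 'n::finite) smat)"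
proof -
  have inv: "invertible (mat (- complex_of_real (sin (pi * fst p))) ** snd p + mat (complex_of_real (cos (pi * fst p))))"
    if "p \<in> UNIV \<times> siegel" for p :: "real \<times> (complex, 'n) smat"
    using siegel_act_props(1)[OF rot_Sp, of "cos (pi * fst p)" "sin (pi * fst p)" "snd p" UNIV] that
    unfolding aut_factor_def rot_UNIV_blocks by auto
  show ?thesis
    unfolding siegel_act_def aut_factor_def rot_UNIV_blocks
    by (intro continuous_on_matrix_mult continuous_on_matrix_inv inv continuous_intros)
qed

lemma measurable_rotation:
  "(\<lambda>p. siegel_act (rot UNIV (cos (pi * fst p)) (sin (pi * fst p))) (snd p)) \<in>
     lborel \<Otimes>\<^sub>M (siegel_measure :: (complex, 'n::{finite, linorder}) smat measure) \<rightarrow>\<^sub>M siegel_measure"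
proof -
  let ?f = "\<lambda>p :: real \<times> (complex, 'n) smat. siegel_act (rot UNIV (cos (pi * fst p)) (sin (pi * fst p))) (snd p)"
  have "?f \<in> restrict_space borel (UNIV \<times> siegel) \<rightarrow>\<^sub>M restrict_space borel siegel"
    by (rule measurable_restrict_space2)
      (auto simp: space_restrict_space intro!: borel_measurable_continuous_on_restrict continuous_on_rotation siegel_act_props(2) rot_Sp)
  moreover have "(\<lambda>p. (fst p, snd p)) \<in> lborel \<Otimes>\<^sub>M (siegel_measure :: (complex, 'n) smat measure) \<rightarrow>\<^sub>M restrict_space borel (UNIV \<times> siegel)"
  proof (rule measurable_restrict_space2)
    have "(\<lambda>z. z) \<in> (siegel_measure :: (complex, 'n) smat measure) \<rightarrow>\<^sub>M borel" by (rule measurable_siegel_measureI) simp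
    then show "(\<lambda>p. (fst p, snd p)) \<in> lborel \<Otimes>\<^sub>M (siegel_measure :: (complex, 'n) smat measure) \<rightarrow>\<^sub>M borel"
      unfolding borel_prod[symmetric] by (intro measurable_Pair measurable_compose[OF measurable_snd]) auto
  qed (auto simp: space_pair_measure sets_siegel_measure(2))
  ultimately have "(\<lambda>p. ?f (fst p, snd p)) \<in> lborel \<Otimes>\<^sub>M (siegel_measure :: (complex, 'n) smat measure) \<rightarrow>\<^sub>M restrict_space borel siegel"
    by (rule measurable_compose[rotated])
  then show ?thesis by (simp add: sets_siegel_measure cong: measurable_cong_sets)
qed

text \<open>The invariance of the measure allows averaging over the angle first, after which the
  mean value property makes the integrand constant. The exchange of integrals is justified by the
  same invariance, applied to the norm of the integrand.\<close>

lemma integral_hol_quot: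
  fixes \<phi> :: "(real, 'n::{finite, linorder}) dmat \<Rightarrow> complex"
  assumes eq: "K_equivariant m \<phi>" and smooth: "smooth_function_on Sp \<phi>"
    and p: "\<And>X g. X \<in> p_minus \<Longrightarrow> g \<in> Sp \<Longrightarrow> lie_act X \<phi> g = 0"
    and m: "m > CARD('n)" and int: "integrable (weighted_siegel m) (hol_quot m \<phi>)"
  shows "(LINT z|weighted_siegel m. hol_quot m \<phi> z) = of_real (C_const m CARD('n)) * \<phi> (mat 1)"
proof -
  let ?M = "weighted_siegel m :: (complex, 'n) smat measure"
  let ?h = "hol_quot m \<phi>"
  let ?r = "\<lambda>x. siegel_act (rot UNIV (cos (pi * x)) (sin (pi * x))) :: (complex, 'n) smat \<Rightarrow> _"
  define P where "P = restrict_space lborel {0..1::real}"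
  have P1: "emeasure P (space P) = 1" by (simp add: P_def emeasure_restrict_space space_restrict_space)
  interpret P: prob_space P by standard (rule P1)
  have hc: "continuous_on siegel ?h" by (rule continuous_on_hol_quot[OF eq smooth p])
  have hm: "?h \<in> borel_measurable siegel_measure" by (rule continuous_on_siegel_measurable[OF hc])
  interpret M: finite_measure ?M
    by standard (simp add: sets_weighted_siegel emeasure_weighted_siegel[OF m])
  interpret pair_sigma_finite P ?M ..
  have rm: "(\<lambda>p. ?r (fst p) (snd p)) \<in> P \<Otimes>\<^sub>M ?M \<rightarrow>\<^sub>M siegel_measure"
  proof -
    have "(\<lambda>p. (fst p, snd p)) \<in> P \<Otimes>\<^sub>M ?M \<rightarrow>\<^sub>M lborel \<Otimes>\<^sub>M siegel_measure"
    proof (rule measurable_Pair)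
      show "fst \<in> P \<Otimes>\<^sub>M ?M \<rightarrow>\<^sub>M lborel"
        using measurable_compose[OF measurable_fst measurable_restrict_space1[OF measurable_ident]] unfolding P_def id_def by blast
      show "snd \<in> P \<Otimes>\<^sub>M ?M \<rightarrow>\<^sub>M siegel_measure"
        using measurable_snd[of P ?M] unfolding measurable_cong_sets[OF refl sets_weighted_siegel(1)] .
    qed
    from measurable_compose[OF this measurable_rotation] show ?thesis by simp
  qed
  have r1: "distr ?M ?M (?r x) = ?M" for x by (rule distr_weighted_siegel_rot) simp
  have rx: "?r x \<in> ?M \<rightarrow>\<^sub>M ?M" for x
    unfolding measurable_cong_sets[OF sets_weighted_siegel(1) sets_weighted_siegel(1)]
    by (rule measurable_siegel_act[OF rot_Sp]) simp
  have hM: "?h \<in> borel_measurable ?M" using hm unfolding measurable_cong_sets[OF sets_weighted_siegel(1) refl] .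
  have Gm: "(\<lambda>p. ?h (?r (fst p) (snd p))) \<in> borel_measurable (P \<Otimes>\<^sub>M ?M)" by (rule measurable_compose[OF rm hm])
  have nn: "(\<integral>\<^sup>+z. ennreal (norm (?h (?r x z))) \<partial>?M) = (\<integral>\<^sup>+z. ennreal (norm (?h z)) \<partial>?M)" for x
    using nn_integral_distr[OF rx[of x], of "\<lambda>z. ennreal (norm (?h z))"] hM unfolding r1 by simp
  have "(\<integral>\<^sup>+q. ennreal (norm (?h (?r (fst q) (snd q)))) \<partial>(P \<Otimes>\<^sub>M ?M)) = (\<integral>\<^sup>+x. \<integral>\<^sup>+z. ennreal (norm (?h (?r x z))) \<partial>?M \<partial>P)"
  proof -
    have "(\<lambda>q. ennreal (norm (?h (?r (fst q) (snd q))))) \<in> borel_measurable (P \<Otimes>\<^sub>M ?M)" using Gm by measurable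
    from M.nn_integral_fst[OF this] show ?thesis by simp
  qed
  also have "\<dots> = (\<integral>\<^sup>+z. ennreal (norm (?h z)) \<partial>?M)" unfolding nn by (simp add: P.emeasure_space_1)
  also have "\<dots> < \<infinity>" using int by (simp add: integrable_iff_bounded)
  finally have Gi: "integrable (P \<Otimes>\<^sub>M ?M) (\<lambda>(x, z). ?h (?r x z))"
    using Gm by (simp add: integrable_iff_bounded case_prod_beta)
  have inner: "(LINT x|P. ?h (?r x z)) = \<phi> (mat 1)" if z: "z \<in> siegel" for z
  proof -
    have "continuous_on {0..1} (\<lambda>x. ?r x z)"
      using continuous_on_compose2[OF continuous_on_rotation, of "{0..1}" "\<lambda>x. (x, z)"] z
      by (simp add: continuous_on_Pair continuous_on_const continuous_on_id image_subset_iff)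
    then have "continuous_on {0..1} (\<lambda>x. ?h (?r x z))"
      by (rule continuous_on_compose2[OF hc]) (auto intro!: siegel_act_props(2) rot_Sp z)
    then have si: "set_integrable lborel {0..1} (\<lambda>x. ?h (?r x z))" by (rule borel_integrable_atLeastAtMost')
    have "(LINT x|P. ?h (?r x z)) = (LINT x:{0..1}|lborel. ?h (?r x z))"
      unfolding P_def set_lebesgue_integral_def by (rule integral_restrict_space) simp
    also have "\<dots> = integral {0..1} (\<lambda>x. ?h (?r x z))" by (rule set_borel_integral_eq_integral(2)[OF si])
    also have "\<dots> = \<phi> (mat 1)" by (rule integral_unique[OF hol_quot_mean_value[OF eq smooth p z]])
    finally show ?thesis .
  qed
  have "(LINT z|?M. ?h z) = (LINT x|P. LINT z|?M. ?h (?r x z))"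
  proof -
    have "(LINT z|?M. ?h (?r x z)) = (LINT z|?M. ?h z)" for x using integral_distr[OF rx[of x] hM] unfolding r1 by simp
    then show ?thesis by (simp add: P.prob_space)
  qed
  also have "\<dots> = (LINT z|?M. LINT x|P. ?h (?r x z))" by (rule Fubini_integral[OF Gi, symmetric])
  also have "\<dots> = (LINT z|?M. \<phi> (mat 1))"
    by (rule Bochner_Integration.integral_cong) (auto simp: inner sets_weighted_siegel)
  also have "\<dots> = of_real (C_const m CARD('n)) * \<phi> (mat 1)"
    using C_const_pos[OF m] by (simp add: sets_weighted_siegel measure_def emeasure_weighted_siegel[OF m] scaleR_conv_of_real)
  finally show ?thesis .
qed

lemma siegel_reproducing:
  fixes \<phi> :: "(real, 'n::{finite, linorder}) dmat \<Rightarrow> complex"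
  assumes eq: "K_equivariant m \<phi>" and smooth: "smooth_function_on Sp \<phi>"
    and p: "\<And>X g. X \<in> p_minus \<Longrightarrow> g \<in> Sp \<Longrightarrow> lie_act X \<phi> g = 0"
    and m: "m > 2 * CARD('n)" and b: "\<And>g. g \<in> Sp \<Longrightarrow> norm (\<phi> g) \<le> b"
  shows "integrable siegel_measure (\<lambda>z. \<phi> (bz z) * cnj (F1 m (bz z)))"
    and "(LINT z|siegel_measure. \<phi> (bz z) * cnj (F1 m (bz z))) = of_real (C_const m CARD('n)) * \<phi> (mat 1)"
proof -
  have m1: "m > CARD('n)" using m by linarith
  have hm: "hol_quot m \<phi> \<in> borel_measurable siegel_measure"
    by (rule continuous_on_siegel_measurable[OF continuous_on_hol_quot[OF eq smooth p]])
  have wm: "siegel_weight m \<in> borel_measurable siegel_measure" by (rule measurable_siegel_measureI) measurable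
  have ws: "AE z in siegel_measure. siegel_weight m z \<ge> 0"
    by (rule AE_I2) (simp add: sets_siegel_measure(2) siegel_weight_nonneg)
  have b0: "b \<ge> 0" using b[OF mat_1_in_Sp] norm_ge_zero[of "\<phi> (mat 1)"] by linarith
  have Fm: "(\<lambda>z. ennreal (norm (F1 m (bz z)))) \<in> borel_measurable (siegel_measure :: (complex, 'n) smat measure)"
  proof -
    note [measurable] = measurable_det_add_i
    have "(\<lambda>z :: (complex, 'n) smat. ennreal (2 ^ (m * CARD('n)) * (norm (det (z + mat \<i>)) powr (- (2 * (real m / 2))) * det (map_matrix Im z) powr (real m / 2)))) \<in> borel_measurable siegel_measure"
      by (rule measurable_siegel_measureI) measurable
    then show ?thesis by (rule measurable_cong[THEN iffD2, rotated]) (simp only: sets_siegel_measure(2) norm_F1_bz(1))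
  qed
  have whi: "integrable siegel_measure (\<lambda>z. siegel_weight m z *\<^sub>R hol_quot m \<phi> z)"
  proof (rule integrableI_bounded)
    have "(\<integral>\<^sup>+z. ennreal (norm (siegel_weight m z *\<^sub>R hol_quot m \<phi> z)) \<partial>siegel_measure) \<le> (\<integral>\<^sup>+z. ennreal b * ennreal (norm (F1 m (bz z))) \<partial>(siegel_measure :: (complex, 'n) smat measure))"
    proof (rule nn_integral_mono)
      fix z :: "(complex, 'n) smat" assume "z \<in> space siegel_measure"
      then have z: "z \<in> siegel" by (simp add: sets_siegel_measure(2))
      show "ennreal (norm (siegel_weight m z *\<^sub>R hol_quot m \<phi> z)) \<le> ennreal b * ennreal (norm (F1 m (bz z)))"
        unfolding inner_eq_weight_hol_quot[OF z, symmetric] norm_mult complex_mod_cnj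
        using b[OF bz_Sp[OF z]] b0 by (simp add: ennreal_mult'[symmetric] mult_right_mono)
    qed
    also have "\<dots> = ennreal b * (\<integral>\<^sup>+z. ennreal (norm (F1 m (bz z))) \<partial>(siegel_measure :: (complex, 'n) smat measure))" by (rule nn_integral_cmult[OF Fm])
    also have "\<dots> < \<infinity>" using nn_integral_norm_F1_finite[OF m] by (simp add: ennreal_mult_less_top)
    finally show "(\<integral>\<^sup>+z. ennreal (norm (siegel_weight m z *\<^sub>R hol_quot m \<phi> z)) \<partial>siegel_measure) < \<infinity>" .
  qed (use wm hm in measurable)
  then have hi: "integrable (weighted_siegel m) (hol_quot m \<phi>)"
    unfolding weighted_siegel_def by (subst integrable_density[OF hm wm ws]) 
  show "integrable siegel_measure (\<lambda>z. \<phi> (bz z) * cnj (F1 m (bz z)))"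
    by (rule Bochner_Integration.integrable_cong[THEN iffD2, OF refl _ whi]) (simp add: sets_siegel_measure(2) inner_eq_weight_hol_quot)
  have "(LINT z|siegel_measure. \<phi> (bz z) * cnj (F1 m (bz z))) = (LINT z|siegel_measure. siegel_weight m z *\<^sub>R hol_quot m \<phi> z)"
    by (rule Bochner_Integration.integral_cong) (simp_all add: sets_siegel_measure(2) inner_eq_weight_hol_quot)
  also have "\<dots> = (LINT z|weighted_siegel m. hol_quot m \<phi> z)"
    unfolding weighted_siegel_def by (rule integral_density[OF hm wm ws, symmetric])
  also have "\<dots> = of_real (C_const m CARD('n)) * \<phi> (mat 1)" by (rule integral_hol_quot[OF eq smooth p m1 hi])
  finally show "(LINT z|siegel_measure. \<phi> (bz z) * cnj (F1 m (bz z))) = of_real (C_const m CARD('n)) * \<phi> (mat 1)" .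
qed

section \<open>Unfolding\<close>

text \<open>Makes dominated convergence available for sums over the discrete group.\<close>

lemma infsum_eq_integral_count_space:
  fixes g :: "'a \<Rightarrow> 'b::{banach, second_countable_topology}"
  assumes "integrable (count_space A) g"
  shows "infsum g A = integral\<^sup>L (count_space A) g"
  using infsetsum_infsum[of g A] assms unfolding Infinite_Set_Sum.abs_summable_on_def infsetsum_def by simp

lemma integrable_count_space_real:
  fixes w :: "'a \<Rightarrow> real"
  assumes "w summable_on A" shows "integrable (count_space A) w"
proof -
  have "Infinite_Set_Sum.abs_summable_on w A"
    using assms summable_on_iff_abs_summable_on_real abs_summable_equivalent by blast
  then show ?thesis unfolding Infinite_Set_Sum.abs_summable_on_def .
qed

text \<open>The truncations are continuous, as the characterization of the quotient measure demands,
  and increasing in j, as monotone convergence demands.\<close>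

definition cutoff :: "nat \<Rightarrow> 'a::real_normed_vector \<Rightarrow> real" where
  "cutoff j h = max 0 (min 1 (real j + 1 - norm h))"

lemma cutoff_props:
  "0 \<le> cutoff j h" "cutoff j h \<le> 1" "norm h \<le> real j \<Longrightarrow> cutoff j h = 1"
  "norm h > real j + 1 \<Longrightarrow> cutoff j h = 0" "j \<le> k \<Longrightarrow> cutoff j h \<le> cutoff k h"
  by (auto simp: cutoff_def)

lemma continuous_on_cutoff: "continuous_on S (cutoff j)"
  unfolding cutoff_def by (intro continuous_intros)

lemma cutoff_tendsto: "(\<lambda>j. cutoff j h) \<longlonglongrightarrow> 1"
proof -
  obtain k where k: "norm h \<le> real k" using real_arch_simple by blast
  have "eventually (\<lambda>j. cutoff j h = 1) sequentially"
    using eventually_ge_at_top[of k] by eventually_elim (use k in \<open>auto intro: cutoff_props(3)\<close>)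
  then show ?thesis by (rule tendsto_eventually)
qed

lemma compactly_supported_add:
  assumes "compactly_supported H f" "compactly_supported H g"
  shows "compactly_supported H (\<lambda>h. f h + g h)"
proof -
  obtain C D where "compact C" "C \<subseteq> H" "\<forall>h\<in>H - C. f h = 0" "compact D" "D \<subseteq> H" "\<forall>h\<in>H - D. g h = 0"
    using assms unfolding compactly_supported_def by metis
  then have "compact (C \<union> D) \<and> C \<union> D \<subseteq> H \<and> (\<forall>h\<in>H - (C \<union> D). f h + g h = 0)" by auto
  then show ?thesis unfolding compactly_supported_def by blast
qed

lemma space_quotient_measure: "quotient_measure \<Delta> H \<nu> \<mu> \<Longrightarrow> space \<mu> = coset_space \<Delta> H"
proof -
  assume "quotient_measure \<Delta> H \<nu> \<mu>"
  then have "sets \<mu> = sets (coset_borel \<Delta> H)" unfolding quotient_measure_def by blast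
  then have "space \<mu> = space (coset_borel \<Delta> H)" by (rule sets_eq_imp_space_eq)
  then show ?thesis unfolding coset_borel_def by (subst (asm) space_measure_of) auto
qed

lemma representative_in:
  assumes "\<Delta> \<noteq> {}" "\<And>\<gamma> h. \<gamma> \<in> \<Delta> \<Longrightarrow> h \<in> H \<Longrightarrow> \<gamma> ** h \<in> H" "C \<in> coset_space \<Delta> H"
  shows "(SOME h. h \<in> C) \<in> H"
proof -
  obtain h where h: "h \<in> H" "C = (\<lambda>\<gamma>. \<gamma> ** h) ` \<Delta>" using assms(3) unfolding coset_space_def by blast
  then have "C \<noteq> {}" using assms(1) by simp
  then have "(SOME h. h \<in> C) \<in> C" by (simp add: some_in_eq)
  then show ?thesis using h assms(2) by auto
qed

text \<open>The function E dominates G and is used first: its truncated sums increase and have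
  bounded integrals over the quotient, so their supremum S is finite almost everywhere and provides
  a dominating function for G. Nonvanishing of the integral of E is what secures integrability on
  the quotient. The last hypothesis fixes the value of the sum over \<open>\<Delta>\<close> where
  the series of E diverges, so that limits hold at every coset.\<close>

lemma quotient_unfolding:
  fixes \<Delta> H :: "(real, 'm::finite) smat set" and E :: "(real, 'm) smat \<Rightarrow> real" and G :: "(real, 'm) smat \<Rightarrow> complex"
  assumes q: "quotient_measure \<Delta> H \<nu> \<mu>" and ne: "\<Delta> \<noteq> {}"
    and act: "\<And>\<gamma> h. \<gamma> \<in> \<Delta> \<Longrightarrow> h \<in> H \<Longrightarrow> \<gamma> ** h \<in> H"
    and fin: "\<And>C h. compact C \<Longrightarrow> C \<subseteq> H \<Longrightarrow> h \<in> H \<Longrightarrow> finite {\<gamma> \<in> \<Delta>. \<gamma> ** h \<in> C}"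
    and exh: "\<And>r. compact {h \<in> H. norm h \<le> r}"
    and s\<nu>: "sets \<nu> = sets (restrict_space borel H)"
    and Ec: "continuous_on H E" and E0: "\<And>h. h \<in> H \<Longrightarrow> 0 \<le> E h" and Ei: "integrable \<nu> E" and En: "(LINT h|\<nu>. E h) \<noteq> 0"
    and Gc: "continuous_on H G" and c0: "0 \<le> c" and GE: "\<And>h. h \<in> H \<Longrightarrow> norm (G h) \<le> c * E h"
    and G0: "\<And>h. h \<in> H \<Longrightarrow> \<not> (\<lambda>\<gamma>. E (\<gamma> ** h)) summable_on \<Delta> \<Longrightarrow> (\<Sum>\<^sub>\<infinity>\<gamma>\<in>\<Delta>. G (\<gamma> ** h)) = 0"
  shows "(LINT C|\<mu>. on_cosets (\<lambda>h. \<Sum>\<^sub>\<infinity>\<gamma>\<in>\<Delta>. G (\<gamma> ** h)) C) = (LINT h|\<nu>. G h)"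
proof -
  define PP where "PP = (\<lambda>f :: (real, 'm) smat \<Rightarrow> complex. \<lambda>h. \<Sum>\<^sub>\<infinity>\<gamma>\<in>\<Delta>. f (\<gamma> ** h))"
  define rep where "rep = (\<lambda>C :: (real, 'm) smat set. SOME h. h \<in> C)"
  have on: "on_cosets \<psi> C = \<psi> (rep C)" for \<psi> C by (simp add: on_cosets_def rep_def)
  have rep: "rep C \<in> H" if "C \<in> space \<mu>" for C
    using that unfolding rep_def space_quotient_measure[OF q] by (intro representative_in[OF ne] act)
  have sp\<nu>: "space \<nu> = H" using sets_eq_imp_space_eq[OF s\<nu>] by (simp add: space_restrict_space)
  have meas: "f \<in> borel_measurable \<nu>" if "continuous_on H f" for f :: "(real, 'm) smat \<Rightarrow> 'z::topological_space"
    unfolding measurable_cong_sets[OF s\<nu> refl] using that by (rule borel_measurable_continuous_on_restrict)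
  have supp: "finite {\<gamma> \<in> \<Delta>. f (\<gamma> ** h) \<noteq> 0}" if f: "compactly_supported H f" and h: "h \<in> H" for f h
  proof -
    obtain C where C: "compact C" "C \<subseteq> H" "\<forall>h\<in>H - C. f h = 0" using f unfolding compactly_supported_def by blast
    show ?thesis by (rule finite_subset[OF _ fin[OF C(1,2) h]]) (use C act h in auto)
  qed
  have sm: "(\<lambda>\<gamma>. f (\<gamma> ** h)) summable_on \<Delta>" if "compactly_supported H f" "h \<in> H" for f h
    using supp[OF that] by (rule finite_nonzero_values_imp_summable_on)
  have unf: "(LINT C|\<mu>. PP f (rep C)) = (LINT h|\<nu>. f h)" if "continuous_on H f" "compactly_supported H f" for f
    using q that unfolding quotient_measure_def on PP_def by blast
  have cut: "compactly_supported H (\<lambda>h. of_real (cutoff j h) * f h)" for j and f :: "(real, 'm) smat \<Rightarrow> complex"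
    unfolding compactly_supported_def
    by (rule exI[of _ "{h \<in> H. norm h \<le> real j + 1}"]) (auto simp: exh intro: cutoff_props(4))
  have cutc: "continuous_on H (\<lambda>h. of_real (cutoff j h) * f h)" if "continuous_on H f" for j and f :: "(real, 'm) smat \<Rightarrow> complex"
    by (intro continuous_intros continuous_on_cutoff that)
  have Eic: "continuous_on H (\<lambda>h. complex_of_real (E h))" by (intro continuous_intros Ec)
  define Ej where "Ej = (\<lambda>j h. of_real (cutoff j h) * complex_of_real (E h))"
  define Gj where "Gj = (\<lambda>j h. complex_of_real (cutoff j h) * G h)"
  have dom: "norm (of_real (cutoff j h) * f h) \<le> norm (f h)" for j and f :: "(real, 'm) smat \<Rightarrow> complex" and h
    using cutoff_props(1,2)[of j h] by (simp add: norm_mult mult_left_le_one_le)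
  have Gi: "integrable \<nu> G"
    by (rule Bochner_Integration.integrable_bound[OF integrable_mult_right[OF Ei, of c] meas[OF Gc]])
      (auto simp: sp\<nu> GE c0 E0 intro!: AE_I2)
  have cuti: "integrable \<nu> (\<lambda>h. of_real (cutoff j h) * f h)" "(\<lambda>j. LINT h|\<nu>. of_real (cutoff j h) * f h) \<longlonglongrightarrow> (LINT h|\<nu>. f h)"
    if f: "continuous_on H f" "integrable \<nu> f" for j and f :: "(real, 'm) smat \<Rightarrow> complex"
  proof -
    show "integrable \<nu> (\<lambda>h. of_real (cutoff j h) * f h)"
      by (rule Bochner_Integration.integrable_bound[OF f(2) meas[OF cutc[OF f(1)]]]) (simp only: dom AE_I2)
    show "(\<lambda>j. LINT h|\<nu>. of_real (cutoff j h) * f h) \<longlonglongrightarrow> (LINT h|\<nu>. f h)"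
    proof (rule integral_dominated_convergence[where w = "\<lambda>h. norm (f h)"])
      show "AE h in \<nu>. (\<lambda>j. of_real (cutoff j h) * f h) \<longlonglongrightarrow> f h"
      proof (rule AE_I2)
        fix h
        have "(\<lambda>j. of_real (cutoff j h) * f h) \<longlonglongrightarrow> of_real 1 * f h" by (intro tendsto_intros cutoff_tendsto)
        then show "(\<lambda>j. of_real (cutoff j h) * f h) \<longlonglongrightarrow> f h" by simp
      qed
    qed (use f in \<open>auto intro: meas cutc integrable_norm dom\<close>)
  qed
  have Eii: "integrable \<nu> (\<lambda>h. complex_of_real (E h))" using Ei by simp
  \<comment> \<open>Exists because the integrals of the truncations tend to that of E, which is
    nonzero.\<close>
  obtain J where J: "(LINT h|\<nu>. Ej J h) \<noteq> 0"
  proof (rule ccontr)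
    assume "\<not> thesis"
    then have "(LINT h|\<nu>. Ej j h) = 0" for j using that by blast
    then have "(LINT h|\<nu>. complex_of_real (E h)) = 0"
      using cuti(2)[OF Eic Eii] unfolding Ej_def by (simp add: LIMSEQ_const_iff)
    then show False using En by simp
  qed
  have Jc: "continuous_on H (Ej J)" "compactly_supported H (Ej J)" "integrable \<nu> (Ej J)"
    unfolding Ej_def by (intro cutc Eic cut cuti(1) Eii)+
  \<comment> \<open>The quotient measure prescribes only values of integrals. Since a function that
    is not integrable has integral 0 by convention, a nonzero value proves integrability.\<close>
  have nz: "integrable \<mu> (\<lambda>C. PP f (rep C))" if "continuous_on H f" "compactly_supported H f" "(LINT h|\<nu>. f h) \<noteq> 0" for f
    using unf[OF that(1,2)] that(3) not_integrable_integral_eq by metis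
  \<comment> \<open>If the integral of f is 0, the truncation \<open>Ej J\<close> with nonzero
    integral is added and its sum over the group is subtracted afterwards.\<close>
  have int: "integrable \<mu> (\<lambda>C. PP f (rep C))" if f: "continuous_on H f" "compactly_supported H f" "integrable \<nu> f" for f
  proof (cases "(LINT h|\<nu>. f h) = 0")
    case True
    have c: "continuous_on H (\<lambda>h. f h + Ej J h)" "compactly_supported H (\<lambda>h. f h + Ej J h)"
      by (intro continuous_on_add f Jc compactly_supported_add)+
    have "integrable \<mu> (\<lambda>C. PP (\<lambda>h. f h + Ej J h) (rep C))"
      by (rule nz[OF c]) (use True J f(3) Jc(3) in simp)
    then have "integrable \<mu> (\<lambda>C. PP (\<lambda>h. f h + Ej J h) (rep C) - PP (Ej J) (rep C))"
      by (rule Bochner_Integration.integrable_diff) (rule nz[OF Jc(1,2) J])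
    moreover have "PP (\<lambda>h. f h + Ej J h) (rep C) - PP (Ej J) (rep C) = PP f (rep C)" if C: "C \<in> space \<mu>" for C
      unfolding PP_def infsum_add[OF sm[OF f(2) rep[OF C]] sm[OF Jc(2) rep[OF C]]] by simp
    ultimately show ?thesis by (rule Bochner_Integration.integrable_cong[THEN iffD1, OF refl, rotated])
  qed (use nz f in blast)
  define e where "e = (\<lambda>j h. \<Sum>\<^sub>\<infinity>\<gamma>\<in>\<Delta>. cutoff j (\<gamma> ** h) * E (\<gamma> ** h))"
  have esm: "(\<lambda>\<gamma>. cutoff j (\<gamma> ** h) * E (\<gamma> ** h)) summable_on \<Delta>" if h: "h \<in> H" for j h
    by (rule finite_nonzero_values_imp_summable_on) (use supp[OF cut[of j "\<lambda>h. complex_of_real (E h)"] h] in simp)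
  have PE: "PP (Ej j) h = of_real (e j h)" if h: "h \<in> H" for j h
  proof -
    let ?F = "{\<gamma> \<in> \<Delta>. cutoff j (\<gamma> ** h) * E (\<gamma> ** h) \<noteq> 0}"
    have F: "finite ?F" using supp[OF cut[of j "\<lambda>h. complex_of_real (E h)"] h] by simp
    have "e j h = (\<Sum>\<^sub>\<infinity>\<gamma>\<in>?F. cutoff j (\<gamma> ** h) * E (\<gamma> ** h))" unfolding e_def by (rule infsum_cong_neutral) auto
    moreover have "PP (Ej j) h = (\<Sum>\<^sub>\<infinity>\<gamma>\<in>?F. complex_of_real (cutoff j (\<gamma> ** h) * E (\<gamma> ** h)))"
      unfolding PP_def Ej_def of_real_mult by (rule infsum_cong_neutral) auto
    ultimately show ?thesis unfolding infsum_finite[OF F] by (simp only: of_real_sum)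
  qed
  have nn: "0 \<le> cutoff j (\<gamma> ** h) * E (\<gamma> ** h)" if "\<gamma> \<in> \<Delta>" "h \<in> H" for j \<gamma> h
    using that by (intro mult_nonneg_nonneg cutoff_props(1) E0 act)
  have e0: "0 \<le> e j h" if h: "h \<in> H" for j h unfolding e_def by (rule infsum_nonneg) (rule nn[OF _ h])
  have emono: "e j h \<le> e k h" if h: "h \<in> H" and "j \<le> k" for j k h
    unfolding e_def
    by (rule infsum_mono[OF esm[OF h] esm[OF h]]) (intro mult_right_mono cutoff_props(5) that E0 act)
  \<comment> \<open>Takes values in the extended reals: S is infinite exactly at the cosets where
    the series of E over the group diverges (\<open>summ\<close> and \<open>nsumm\<close>).\<close>
  define S where "S = (\<lambda>C. SUP j. ennreal (e j (rep C)))"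
  have ei: "integrable \<mu> (\<lambda>C. e j (rep C))" "(LINT C|\<mu>. e j (rep C)) \<le> (LINT h|\<nu>. E h)" for j
  proof -
    have Ejc: "continuous_on H (Ej j)" "compactly_supported H (Ej j)" "integrable \<nu> (Ej j)"
      unfolding Ej_def by (intro cutc Eic cut cuti(1) Eii)+
    have 1: "integrable \<mu> (\<lambda>C. complex_of_real (e j (rep C)))"
      using int[OF Ejc] by (rule Bochner_Integration.integrable_cong[THEN iffD1, OF refl, rotated]) (simp add: PE rep)
    then show "integrable \<mu> (\<lambda>C. e j (rep C))" by (simp only: complex_of_real_integrable_eq)
    have "complex_of_real (LINT C|\<mu>. e j (rep C)) = (LINT C|\<mu>. PP (Ej j) (rep C))"
      unfolding integral_complex_of_real[symmetric] by (rule Bochner_Integration.integral_cong) (simp_all add: PE rep)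
    also have "\<dots> = complex_of_real (LINT h|\<nu>. cutoff j h * E h)"
      unfolding unf[OF Ejc(1,2)] unfolding Ej_def of_real_mult[symmetric] by (rule integral_complex_of_real)
    finally have 2: "(LINT C|\<mu>. e j (rep C)) = (LINT h|\<nu>. cutoff j h * E h)" by (simp only: of_real_eq_iff)
    have 3: "integrable \<nu> (\<lambda>h. cutoff j h * E h)"
      using Ejc(3) unfolding Ej_def of_real_mult[symmetric] by (simp only: complex_of_real_integrable_eq)
    show "(LINT C|\<mu>. e j (rep C)) \<le> (LINT h|\<nu>. E h)"
      unfolding 2 by (rule integral_mono[OF 3 Ei]) (simp add: sp\<nu> E0 cutoff_props mult_left_le_one_le)
  qed
  have Sm[measurable]: "S \<in> borel_measurable \<mu>"
  proof -
    have "(\<lambda>C. ennreal (e j (rep C))) \<in> borel_measurable \<mu>" for j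
      using borel_measurable_integrable[OF ei(1)] by measurable
    then show ?thesis unfolding S_def by (intro borel_measurable_SUP) auto
  qed
  have "(\<integral>\<^sup>+C. S C \<partial>\<mu>) = (SUP j. \<integral>\<^sup>+C. ennreal (e j (rep C)) \<partial>\<mu>)"
    unfolding S_def
  proof (rule nn_integral_monotone_convergence_SUP_AE)
    show "AE C in \<mu>. ennreal (e j (rep C)) \<le> ennreal (e (Suc j) (rep C))" for j
      by (rule AE_I2) (intro ennreal_leI emono rep, auto)
    show "(\<lambda>C. ennreal (e j (rep C))) \<in> borel_measurable \<mu>" for j
      using borel_measurable_integrable[OF ei(1)] by measurable
  qed
  also have "\<dots> \<le> ennreal (LINT h|\<nu>. E h)"
  proof (rule SUP_least)
    fix j
    have "(\<integral>\<^sup>+C. ennreal (e j (rep C)) \<partial>\<mu>) = ennreal (LINT C|\<mu>. e j (rep C))"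
      by (rule nn_integral_eq_integral[OF ei(1)]) (simp add: rep e0 AE_I2)
    then show "(\<integral>\<^sup>+C. ennreal (e j (rep C)) \<partial>\<mu>) \<le> ennreal (LINT h|\<nu>. E h)" using ei(2) by (simp add: ennreal_leI)
  qed
  finally have Sfin: "(\<integral>\<^sup>+C. S C \<partial>\<mu>) < \<infinity>" by (rule order_le_less_trans) simp
  have AES: "AE C in \<mu>. S C \<noteq> \<infinity>" using Sfin by (intro nn_integral_PInf_AE Sm) simp
  have eS: "e j (rep C) \<le> enn2real (S C)" if "C \<in> space \<mu>" "S C \<noteq> \<infinity>" for j C
  proof -
    have "ennreal (e j (rep C)) \<le> S C" unfolding S_def by (rule SUP_upper) simp
    then show ?thesis using that(2) by (metis enn2real_leI enn2real_mono enn2real_ennreal e0 rep that(1) top.not_eq_extremum infinity_ennreal_def)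
  qed
  have summ: "(\<lambda>\<gamma>. E (\<gamma> ** rep C)) summable_on \<Delta>" if C: "C \<in> space \<mu>" "S C \<noteq> \<infinity>" for C
  proof (rule nonneg_bdd_above_summable_on)
    let ?h = "rep C"
    show "0 \<le> E (\<gamma> ** ?h)" if "\<gamma> \<in> \<Delta>" for \<gamma> using that by (intro E0 act rep C)
    have "sum (\<lambda>\<gamma>. E (\<gamma> ** ?h)) T \<le> enn2real (S C)" if T: "T \<subseteq> \<Delta>" "finite T" for T
    proof -
      \<comment> \<open>From this j on the cutoff is 1 at the finitely many points of T translated
        to \<open>?h\<close>; the inserted 0 keeps \<open>Max\<close> meaningful for empty
        T.\<close>
      obtain j where j: "Max (insert 0 ((\<lambda>\<gamma>. norm (\<gamma> ** ?h)) ` T)) \<le> real j" using real_arch_simple by blast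
      have "norm (\<gamma> ** ?h) \<le> real j" if "\<gamma> \<in> T" for \<gamma>
        using j T(2) that by (auto simp: Max_le_iff)
      then have "sum (\<lambda>\<gamma>. E (\<gamma> ** ?h)) T = sum (\<lambda>\<gamma>. cutoff j (\<gamma> ** ?h) * E (\<gamma> ** ?h)) T"
        by (intro sum.cong refl) (simp add: cutoff_props(3))
      also have "\<dots> \<le> e j ?h"
        unfolding e_def by (rule finite_sum_le_infsum[OF esm[OF rep[OF C(1)]] T(2,1)]) (rule nn[OF _ rep[OF C(1)]], blast)
      finally show ?thesis using eS[OF C, of j] by linarith
    qed
    then show "bdd_above (sum (\<lambda>\<gamma>. E (\<gamma> ** ?h)) ` {F. F \<subseteq> \<Delta> \<and> finite F})" by (intro bdd_aboveI) auto
  qed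
  have nsumm: "\<not> (\<lambda>\<gamma>. E (\<gamma> ** rep C)) summable_on \<Delta>" if C: "C \<in> space \<mu>" "S C = \<infinity>" for C
  proof
    let ?h = "rep C"
    note h = rep[OF C(1)]
    assume s: "(\<lambda>\<gamma>. E (\<gamma> ** ?h)) summable_on \<Delta>"
    have "e j ?h \<le> (\<Sum>\<^sub>\<infinity>\<gamma>\<in>\<Delta>. E (\<gamma> ** ?h))" for j
      unfolding e_def by (rule infsum_mono[OF esm[OF h] s]) (simp add: E0 act h cutoff_props mult_left_le_one_le)
    then have "S C \<le> ennreal (\<Sum>\<^sub>\<infinity>\<gamma>\<in>\<Delta>. E (\<gamma> ** ?h))" unfolding S_def by (intro SUP_least ennreal_leI)
    then show False using C(2) by (simp add: top_unique)
  qed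
  have Gjc: "continuous_on H (Gj j)" "compactly_supported H (Gj j)" "integrable \<nu> (Gj j)" for j
    unfolding Gj_def by (intro cutc Gc cut cuti(1) Gi)+
  have bound: "norm (PP (Gj j) (rep C)) \<le> c * enn2real (S C)" if C: "C \<in> space \<mu>" "S C \<noteq> \<infinity>" for j C
  proof -
    let ?h = "rep C"
    note h = rep[OF C(1)]
    have n1: "(\<lambda>\<gamma>. norm (Gj j (\<gamma> ** ?h))) summable_on \<Delta>"
      by (rule finite_nonzero_values_imp_summable_on) (use supp[OF Gjc(2)[of j] h] in simp)
    have "norm (PP (Gj j) ?h) \<le> (\<Sum>\<^sub>\<infinity>\<gamma>\<in>\<Delta>. norm (Gj j (\<gamma> ** ?h)))" unfolding PP_def by (rule norm_infsum_bound[OF n1])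
    also have "\<dots> \<le> (\<Sum>\<^sub>\<infinity>\<gamma>\<in>\<Delta>. c * (cutoff j (\<gamma> ** ?h) * E (\<gamma> ** ?h)))"
    proof (rule infsum_mono[OF n1 summable_on_cmult_right[OF esm[OF h]]])
      fix \<gamma> assume "\<gamma> \<in> \<Delta>"
      then have "cutoff j (\<gamma> ** ?h) * norm (G (\<gamma> ** ?h)) \<le> cutoff j (\<gamma> ** ?h) * (c * E (\<gamma> ** ?h))"
        by (intro mult_left_mono GE act h cutoff_props(1))
      then show "norm (Gj j (\<gamma> ** ?h)) \<le> c * (cutoff j (\<gamma> ** ?h) * E (\<gamma> ** ?h))"
        by (simp add: Gj_def norm_mult cutoff_props(1) mult.left_commute)
    qed
    also have "\<dots> = c * e j ?h" unfolding e_def by (rule infsum_cmult_right')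
    also have "\<dots> \<le> c * enn2real (S C)" by (rule mult_left_mono[OF eS[OF C] c0])
    finally show ?thesis .
  qed
  have lim: "(\<lambda>j. PP (Gj j) (rep C)) \<longlonglongrightarrow> PP G (rep C)" if C: "C \<in> space \<mu>" "S C \<noteq> \<infinity>" for C
  proof -
    let ?h = "rep C"
    note h = rep[OF C(1)]
    have w: "(\<lambda>\<gamma>. c * E (\<gamma> ** ?h)) summable_on \<Delta>" by (rule summable_on_cmult_right[OF summ[OF C]])
    have Gjb: "norm (Gj j g) \<le> c * E g" if "g \<in> H" for j g
      unfolding Gj_def using dom[of j g G] GE[OF that] by linarith
    note wi = integrable_count_space_real[OF w]
    have ns: "integrable (count_space \<Delta>) (\<lambda>\<gamma>. f (\<gamma> ** ?h))" if f: "\<And>h. h \<in> H \<Longrightarrow> norm (f h) \<le> c * E h" for f :: "(real, 'm) smat \<Rightarrow> complex"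
      by (rule Bochner_Integration.integrable_bound[OF wi]) (auto intro!: AE_I2 f act h order_trans[OF f abs_ge_self])
    have "(\<lambda>j. LINT \<gamma>|count_space \<Delta>. Gj j (\<gamma> ** ?h)) \<longlonglongrightarrow> (LINT \<gamma>|count_space \<Delta>. G (\<gamma> ** ?h))"
    proof (rule integral_dominated_convergence[OF _ _ wi])
      show "AE \<gamma> in count_space \<Delta>. (\<lambda>j. Gj j (\<gamma> ** ?h)) \<longlonglongrightarrow> G (\<gamma> ** ?h)"
      proof (rule AE_I2)
        fix \<gamma>
        have "(\<lambda>j. Gj j (\<gamma> ** ?h)) \<longlonglongrightarrow> of_real 1 * G (\<gamma> ** ?h)" unfolding Gj_def by (intro tendsto_intros cutoff_tendsto)
        then show "(\<lambda>j. Gj j (\<gamma> ** ?h)) \<longlonglongrightarrow> G (\<gamma> ** ?h)" by simp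
      qed
      show "AE \<gamma> in count_space \<Delta>. norm (Gj j (\<gamma> ** ?h)) \<le> c * E (\<gamma> ** ?h)" for j
        by (rule AE_I2) (simp add: Gjb act h)
    qed auto
    moreover have "PP f ?h = (LINT \<gamma>|count_space \<Delta>. f (\<gamma> ** ?h))" if "\<And>h. h \<in> H \<Longrightarrow> norm (f h) \<le> c * E h" for f
      unfolding PP_def by (rule infsum_eq_integral_count_space[OF ns]) (rule that)
    ultimately show ?thesis by (simp add: GE Gjb)
  qed
  \<comment> \<open>Set to 0 where S is infinite. There the sum of G is 0 as well, so
    \<open>s j\<close> converges at every coset, and measurability of the limit follows without a
    completion of the measure.\<close>
  define s where "s = (\<lambda>j C. if S C \<noteq> \<infinity> then PP (Gj j) (rep C) else 0)"
  have sm': "s j \<in> borel_measurable \<mu>" for j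
  proof -
    have [measurable]: "(\<lambda>C. PP (Gj j) (rep C)) \<in> borel_measurable \<mu>" by (rule borel_measurable_integrable[OF int[OF Gjc]])
    show ?thesis unfolding s_def by measurable
  qed
  have slim: "(\<lambda>j. s j C) \<longlonglongrightarrow> PP G (rep C)" if C: "C \<in> space \<mu>" for C
  proof (cases "S C = \<infinity>")
    case True
    have "PP G (rep C) = 0" unfolding PP_def by (rule G0[OF rep[OF C] nsumm[OF C True]])
    then show ?thesis using True by (simp add: s_def)
  next
    case False
    then show ?thesis using lim[OF C False] by (simp add: s_def)
  qed
  have PGm: "(\<lambda>C. PP G (rep C)) \<in> borel_measurable \<mu>" by (rule borel_measurable_LIMSEQ_metric[OF sm' slim])
  have "(\<lambda>j. LINT C|\<mu>. s j C) \<longlonglongrightarrow> (LINT C|\<mu>. PP G (rep C))"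
  proof (rule integral_dominated_convergence[where w = "\<lambda>C. c * enn2real (S C)"])
    have "integrable \<mu> (\<lambda>C. enn2real (S C))"
    proof (rule integrableI_bounded)
      have "(\<integral>\<^sup>+C. ennreal (norm (enn2real (S C))) \<partial>\<mu>) \<le> (\<integral>\<^sup>+C. S C \<partial>\<mu>)"
        by (rule nn_integral_mono) (simp add: ennreal_enn2real_if)
      then show "(\<integral>\<^sup>+C. ennreal (norm (enn2real (S C))) \<partial>\<mu>) < \<infinity>" using Sfin by (rule order_le_less_trans)
    qed measurable
    then show "integrable \<mu> (\<lambda>C. c * enn2real (S C))" by simp
    show "AE C in \<mu>. norm (s j C) \<le> c * enn2real (S C)" for j
      by (rule AE_I2) (auto simp: s_def bound)
  qed (use sm' PGm slim in auto)
  moreover have "(LINT C|\<mu>. s j C) = (LINT h|\<nu>. Gj j h)" for j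
  proof -
    have "(LINT C|\<mu>. s j C) = (LINT C|\<mu>. PP (Gj j) (rep C))"
      by (rule integral_cong_AE[OF sm' borel_measurable_integrable[OF int[OF Gjc]]])
        (use AES in \<open>auto simp: s_def\<close>)
    then show ?thesis using unf[OF Gjc(1,2)] by simp
  qed
  ultimately have "(\<lambda>j. LINT h|\<nu>. Gj j h) \<longlonglongrightarrow> (LINT C|\<mu>. PP G (rep C))" by simp
  with cuti(2)[OF Gc Gi] have "(LINT C|\<mu>. PP G (rep C)) = (LINT h|\<nu>. G h)"
    unfolding Gj_def using LIMSEQ_unique by blast
  then show ?thesis unfolding on PP_def .
qed

section \<open>The symplectic group as a locally compact group\<close>

lemma Sp_eq: "Sp = {g :: (real, 'n::finite) dmat. transpose g ** J_mat ** g = J_mat}"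
proof -
  have "invertible g" if g: "transpose g ** J_mat ** g = J_mat" for g :: "(real, 'n) dmat"
  proof -
    have "J_mat ** J_mat = - (mat 1 :: (real, 'n) dmat)"
      by (simp add: J_mat_def block_ops matrix_mul_ring_simps)
    then have "- (J_mat ** (transpose g ** J_mat ** g)) = mat 1" unfolding g by simp
    then have "(- (J_mat ** (transpose g ** J_mat))) ** g = mat 1"
      by (simp add: matmul.minus_left matrix_mul_assoc)
    then show ?thesis unfolding invertible_left_inverse by blast
  qed
  then show ?thesis by (auto simp: Sp_def)
qed

lemma continuous_on_transpose [continuous_intros]:
  "continuous_on S f \<Longrightarrow> continuous_on S (\<lambda>x. transpose (f x) :: ('a::topological_space, 'n::finite) smat)"
  unfolding transpose_def by (intro continuous_on_matrix continuous_intros)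

lemma compact_Sp_norm_le: "compact {h \<in> Sp. norm (h :: (real, 'n::finite) dmat) \<le> r}"
proof -
  have "closed (Sp :: (real, 'n) dmat set)"
    unfolding Sp_eq by (intro closed_Collect_eq continuous_on_matrix_mult continuous_intros)
  then have "compact (cball 0 r \<inter> (Sp :: (real, 'n) dmat set))" by (intro compact_Int_closed compact_cball)
  then show ?thesis by (rule back_subst[of compact]) auto
qed

lemma finite_Sp_int_norm_le: "finite {\<gamma> \<in> Sp_int. norm (\<gamma> :: (real, 'n::finite) dmat) \<le> r}"
proof -
  let ?A = "{x :: real. x \<in> \<int> \<and> \<bar>x\<bar> \<le> r}"
  have "finite ?A" by (rule finite_abs_int_segment)
  then have "finite (PiE (UNIV :: (('n + 'n) \<times> ('n + 'n)) set) (\<lambda>_. ?A))" by (intro finite_PiE) auto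
  then have "finite ((\<lambda>f. \<chi> i j. f (i, j)) ` PiE (UNIV :: (('n + 'n) \<times> ('n + 'n)) set) (\<lambda>_. ?A))" by (rule finite_imageI)
  moreover have "{\<gamma> \<in> Sp_int. norm (\<gamma> :: (real, 'n) dmat) \<le> r} \<subseteq> (\<lambda>f. \<chi> i j. f (i, j)) ` PiE (UNIV :: (('n + 'n) \<times> ('n + 'n)) set) (\<lambda>_. ?A)"
  proof
    fix \<gamma> :: "(real, 'n) dmat" assume g: "\<gamma> \<in> {\<gamma> \<in> Sp_int. norm \<gamma> \<le> r}"
    have "\<bar>\<gamma> $ i $ j\<bar> \<le> r" for i j
      using g component_le_norm_cart[of "\<gamma> $ i" j] Finite_Cartesian_Product.norm_nth_le[of \<gamma> i] by simp
    then have "(\<lambda>p. \<gamma> $ fst p $ snd p) \<in> PiE UNIV (\<lambda>_. ?A)" using g by (auto simp: Sp_int_def)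
    then show "\<gamma> \<in> (\<lambda>f. \<chi> i j. f (i, j)) ` PiE UNIV (\<lambda>_. ?A)"
      by (rule rev_image_eqI) (simp add: vec_eq_iff)
  qed
  ultimately show ?thesis by (rule finite_subset[rotated])
qed

lemma congruence_subgroup_subset:
  assumes "congruence_subgroup \<Gamma>"
  shows "\<Gamma> \<subseteq> Sp_int" "\<Gamma> \<noteq> {}"
proof -
  have s: "subgroup \<Gamma> (mat_group Sp_int)" using assms by (simp add: congruence_subgroup_def)
  show "\<Gamma> \<subseteq> Sp_int" using subgroup.subset[OF s] by (simp add: mat_group_def)
  show "\<Gamma> \<noteq> {}" using subgroup.one_closed[OF s] by auto
qed

text \<open>Multiplying by the fixed inverse of h bounds the norm of any such group element, and
  only finitely many integral matrices have bounded norm.\<close>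

lemma finite_meeting_compact:
  fixes \<Gamma> :: "(real, 'n::finite) dmat set"
  assumes "\<Gamma> \<subseteq> Sp_int" "compact C" "h \<in> Sp"
  shows "finite {\<gamma> \<in> \<Gamma>. \<gamma> ** h \<in> C}"
proof -
  obtain R where R: "\<And>x. x \<in> C \<Longrightarrow> norm x \<le> R" using compact_imp_bounded[OF assms(2)] unfolding bounded_iff by blast
  obtain K where K: "K > 0" "norm (X ** Y) \<le> norm X * norm Y * K" for X Y :: "(real, 'n) dmat"
    using matmul.pos_bounded by blast
  have "norm \<gamma> \<le> R * norm (matrix_inv h) * K" if "\<gamma> ** h \<in> C" for \<gamma>
  proof -
    have e: "(\<gamma> ** h) ** matrix_inv h = \<gamma>" using Sp_inverse(2)[OF assms(3)] by (simp flip: matrix_mul_assoc)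
    have "norm \<gamma> \<le> norm (\<gamma> ** h) * norm (matrix_inv h) * K" using K(2)[of "\<gamma> ** h" "matrix_inv h"] unfolding e .
    also have "\<dots> \<le> R * norm (matrix_inv h) * K" using R[OF that] K(1) by (intro mult_right_mono) auto
    finally show ?thesis .
  qed
  then have "{\<gamma> \<in> \<Gamma>. \<gamma> ** h \<in> C} \<subseteq> {\<gamma> \<in> Sp_int. norm \<gamma> \<le> R * norm (matrix_inv h) * K}" using assms(1) by auto
  then show ?thesis using finite_Sp_int_norm_le finite_subset by blast
qed

section \<open>Integrals over the symplectic group\<close>

lemma continuous_on_bz: "continuous_on siegel (bz :: (complex, 'n::finite) smat \<Rightarrow> _)"
proof -
  have s: "continuous_on siegel (\<lambda>z :: (complex, 'n) smat. pos_sqrt (map_matrix Im z))"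
    by (rule continuous_on_compose2[OF continuous_on_pos_sqrt]) (auto intro!: continuous_intros dest: siegelD)
  have i: "continuous_on siegel (\<lambda>z :: (complex, 'n) smat. matrix_inv (pos_sqrt (map_matrix Im z)))"
    by (rule continuous_on_matrix_inv[OF s]) (rule det_pos_def_nonzero(2)[OF pos_sqrt(1)[OF siegelD(2)]])
  have r: "continuous_on siegel (\<lambda>z :: (complex, 'n) smat. map_matrix Re z ** matrix_inv (pos_sqrt (map_matrix Im z)))"
    by (intro continuous_on_matrix_mult i continuous_intros)
  have "continuous_on siegel (\<lambda>z :: (complex, 'n) smat. (block (pos_sqrt (map_matrix Im z)) (map_matrix Re z ** matrix_inv (pos_sqrt (map_matrix Im z))) 0 (matrix_inv (pos_sqrt (map_matrix Im z)))))"
    unfolding block_def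
  proof (intro continuous_on_matrix)
    fix i j :: "'n + 'n"
    show "continuous_on siegel (\<lambda>z :: (complex, 'n) smat. case i of Inl r \<Rightarrow> (case j of Inl s \<Rightarrow> pos_sqrt (map_matrix Im z) $ r $ s
        | Inr s \<Rightarrow> (map_matrix Re z ** matrix_inv (pos_sqrt (map_matrix Im z))) $ r $ s)
      | Inr r \<Rightarrow> (case j of Inl s \<Rightarrow> 0 $ r $ s | Inr s \<Rightarrow> matrix_inv (pos_sqrt (map_matrix Im z)) $ r $ s))"
      by (cases i; cases j) (auto intro!: continuous_intros s i r)
  qed
  then show ?thesis unfolding bz_block[symmetric] .
qed

context
  fixes \<kappa> :: "(real, 'n::{finite, linorder}) dmat measure"
  assumes haar: "haar_measure K_sp \<kappa>" and one: "emeasure \<kappa> K_sp = 1"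
begin

lemma sets_\<kappa>: "sets \<kappa> = sets (restrict_space borel K_sp)" "space \<kappa> = K_sp"
proof -
  show s: "sets \<kappa> = sets (restrict_space borel K_sp)" using haar by (simp add: haar_measure_def)
  show "space \<kappa> = K_sp" using sets_eq_imp_space_eq[OF s] by (simp add: space_restrict_space)
qed

lemma prob_space_\<kappa>: "prob_space \<kappa>"
  by standard (simp add: sets_\<kappa> one)

lemma sp_measure_eq:
  "sp_measure \<kappa> = distr (siegel_measure \<Otimes>\<^sub>M \<kappa>) (restrict_space borel Sp) (\<lambda>p. bz (fst p) ** snd p)"
  unfolding sp_measure_def bz_def by (simp only: case_prod_beta')

lemma measurable_bz_mult:
  "(\<lambda>p. bz (fst p) ** snd p) \<in> (siegel_measure :: (complex, 'n) smat measure) \<Otimes>\<^sub>M \<kappa> \<rightarrow>\<^sub>M restrict_space borel Sp"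
proof -
  let ?f = "\<lambda>p :: (complex, 'n) smat \<times> (real, 'n) dmat. bz (fst p) ** snd p"
  have c: "continuous_on (siegel \<times> K_sp) ?f"
    by (intro continuous_on_matrix_mult continuous_on_compose2[OF continuous_on_bz] continuous_intros) auto
  have "?f \<in> restrict_space borel (siegel \<times> K_sp) \<rightarrow>\<^sub>M restrict_space borel Sp"
    by (rule measurable_restrict_space2)
      (auto simp: space_restrict_space K_sp_def intro!: borel_measurable_continuous_on_restrict c[unfolded K_sp_def] Sp_mult bz_Sp)
  moreover have "(\<lambda>p. (fst p, snd p)) \<in> (siegel_measure :: (complex, 'n) smat measure) \<Otimes>\<^sub>M \<kappa> \<rightarrow>\<^sub>M restrict_space borel (siegel \<times> K_sp)"
  proof (rule measurable_restrict_space2)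
    have "(\<lambda>z. z) \<in> (siegel_measure :: (complex, 'n) smat measure) \<rightarrow>\<^sub>M borel" by (rule measurable_siegel_measureI) simp
    moreover have "(\<lambda>k. k) \<in> \<kappa> \<rightarrow>\<^sub>M borel"
      unfolding measurable_cong_sets[OF sets_\<kappa>(1) refl] by (rule measurable_restrict_space1) simp
    ultimately show "(\<lambda>p. (fst p, snd p)) \<in> (siegel_measure :: (complex, 'n) smat measure) \<Otimes>\<^sub>M \<kappa> \<rightarrow>\<^sub>M borel"
      unfolding borel_prod[symmetric] by (intro measurable_Pair measurable_compose[OF measurable_fst] measurable_compose[OF measurable_snd])
  qed (auto simp: space_pair_measure sets_siegel_measure(2) sets_\<kappa>(2))
  ultimately have "(\<lambda>p. ?f (fst p, snd p)) \<in> (siegel_measure :: (complex, 'n) smat measure) \<Otimes>\<^sub>M \<kappa> \<rightarrow>\<^sub>M restrict_space borel Sp"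
    by (rule measurable_compose[rotated])
  then show ?thesis by simp
qed

text \<open>For a right invariant function the integrand depends only on the half space component,
  and projecting the product with a probability measure to its first factor returns
  \<open>siegel_measure\<close>.\<close>

lemma integral_sp_measure:
  fixes f :: "(real, 'n) dmat \<Rightarrow> 'a::{banach, second_countable_topology}"
  assumes f: "continuous_on Sp f" and inv: "\<And>g k. g \<in> Sp \<Longrightarrow> k \<in> K_sp \<Longrightarrow> f (g ** k) = f g"
  shows "(LINT g|sp_measure \<kappa>. f g) = (LINT z|siegel_measure. f (bz z))"
    and "integrable siegel_measure (\<lambda>z. f (bz z)) \<Longrightarrow> integrable (sp_measure \<kappa>) f"
proof -
  interpret \<kappa>: prob_space \<kappa> by (rule prob_space_\<kappa>)
  have fm: "f \<in> borel_measurable (restrict_space borel Sp)" by (rule borel_measurable_continuous_on_restrict[OF f])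
  have fb: "(\<lambda>z. f (bz z)) \<in> borel_measurable siegel_measure"
    by (intro continuous_on_siegel_measurable continuous_on_compose2[OF f continuous_on_bz]) (auto intro: bz_Sp)
  have eq: "f (bz (fst p) ** snd p) = f (bz (fst p))" if "p \<in> space (siegel_measure \<Otimes>\<^sub>M \<kappa>)" for p
    using that by (auto simp: space_pair_measure sets_siegel_measure(2) sets_\<kappa>(2) intro!: inv bz_Sp)
  have "(LINT g|sp_measure \<kappa>. f g) = (LINT p|(siegel_measure \<Otimes>\<^sub>M \<kappa>). f (bz (fst p) ** snd p))"
    unfolding sp_measure_eq by (rule integral_distr[OF measurable_bz_mult fm])
  also have "\<dots> = (LINT p|(siegel_measure \<Otimes>\<^sub>M \<kappa>). f (bz (fst p)))" by (rule Bochner_Integration.integral_cong[OF refl eq])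
  also have "\<dots> = integral\<^sup>L (distr (siegel_measure \<Otimes>\<^sub>M \<kappa>) siegel_measure fst) (\<lambda>z. f (bz z))"
    by (rule integral_distr[OF measurable_fst fb, symmetric])
  finally show "(LINT g|sp_measure \<kappa>. f g) = (LINT z|siegel_measure. f (bz z))" unfolding \<kappa>.distr_pair_fst .
  assume "integrable siegel_measure (\<lambda>z. f (bz z))"
  then have "integrable (distr (siegel_measure \<Otimes>\<^sub>M \<kappa>) siegel_measure fst) (\<lambda>z. f (bz z))" unfolding \<kappa>.distr_pair_fst .
  then have "integrable (siegel_measure \<Otimes>\<^sub>M \<kappa>) (\<lambda>p. f (bz (fst p)))" by (rule integrable_distr[OF measurable_fst])
  then have "integrable (siegel_measure \<Otimes>\<^sub>M \<kappa>) (\<lambda>p. f (bz (fst p) ** snd p))"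
    by (rule Bochner_Integration.integrable_cong[THEN iffD2, OF refl, rotated]) (rule eq)
  then show "integrable (sp_measure \<kappa>) f" unfolding sp_measure_eq by (rule integrable_distr_eq[THEN iffD2, OF measurable_bz_mult fm])
qed

end

text \<open>Since k fixes i, passing from g to g k changes only the automorphy factor, by that of k
  at i, whose m-th power has inverse \<open>chi m k\<close>.\<close>

lemma F1_K_equivariant: "K_equivariant m (F1 m :: (real, 'n::finite) dmat \<Rightarrow> complex)"
  unfolding K_equivariant_def
proof (intro ballI)
  fix g k :: "(real, 'n) dmat" assume g: "g \<in> Sp" and k: "k \<in> K_sp"
  have kS: "k \<in> Sp" using k by (simp add: K_sp_def)
  let ?a = "det (aut_factor k (mat \<i>)) ^ m" and ?b = "det (aut_factor g (mat \<i>)) ^ m"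
  have e: "aut_factor (g ** k) (mat \<i>) = aut_factor g (mat \<i>) ** aut_factor k (mat \<i>)" "siegel_act (g ** k) (mat \<i>) = siegel_act g (mat \<i>)"
    using siegel_act_mult[OF g kS mat_i_in_siegel] unfolding K_sp_block(6)[OF k] by auto
  have "inverse ?a = chi m k" using K_sp_block(4)[OF k, of m] by (simp add: inverse_unique mult.commute)
  then show "F1 m (g ** k) = chi m k * F1 m g"
    unfolding F1_def slash_def e by (simp add: det_mul power_mult_distrib mult_ac)
qed

lemma continuous_on_F1: "continuous_on Sp (F1 m :: (real, 'n::finite) dmat \<Rightarrow> complex)"
proof -
  have blk: "continuous_on S (\<lambda>g :: (real, 'n) dmat. of_real_mat (blockA g))" "continuous_on S (\<lambda>g :: (real, 'n) dmat. of_real_mat (blockB g))"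
    "continuous_on S (\<lambda>g :: (real, 'n) dmat. of_real_mat (blockC g))" "continuous_on S (\<lambda>g :: (real, 'n) dmat. of_real_mat (blockD g))" for S
    unfolding map_matrix_def blockA_def blockB_def blockC_def blockD_def vec_lambda_beta
    by (intro continuous_on_matrix continuous_intros)+
  have a: "continuous_on Sp (\<lambda>g :: (real, 'n) dmat. aut_factor g (mat \<i>))"
    unfolding aut_factor_def by (intro continuous_on_add continuous_on_matrix_mult blk continuous_on_const)
  have s: "continuous_on Sp (\<lambda>g :: (real, 'n) dmat. siegel_act g (mat \<i>))"
    unfolding siegel_act_def
    by (intro continuous_on_matrix_mult continuous_on_matrix_inv a continuous_on_add blk continuous_on_const) (rule siegel_act_props(1)[OF _ mat_i_in_siegel])
  have f: "continuous_on Sp (\<lambda>g :: (real, 'n) dmat. f1 m (siegel_act g (mat \<i>)))"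
    unfolding f1_def using det_add_i_nonzero[OF siegel_act_props(2)[OF _ mat_i_in_siegel]]
    by (intro continuous_intros continuous_on_det s) auto
  show ?thesis
    unfolding F1_def slash_def using det_Im_siegel_act(2)[OF _ mat_i_in_siegel]
    by (intro continuous_intros continuous_on_det a f) auto
qed

lemma smooth_function_on_continuous:
  assumes "smooth_function_on M \<phi>" shows "continuous_on M \<phi>"
  unfolding continuous_on_eq_continuous_within
proof
  fix g assume g: "g \<in> M"
  then obtain U \<psi> where U: "open U" "g \<in> U" "\<forall>k. Ck_on k U \<psi>" "\<forall>x\<in>U \<inter> M. \<psi> x = \<phi> x"
    using assms unfolding smooth_function_on_def by meson
  have "continuous_on U \<psi>" using U(3)[rule_format, of 0] by simp
  then have "(\<psi> \<longlongrightarrow> \<psi> g) (at g)" using U(1,2) continuous_on_eq_continuous_at continuous_at by blast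
  then have t: "(\<psi> \<longlongrightarrow> \<phi> g) (at g within M)" using U(2,4) g by (auto intro: tendsto_within_subset)
  have "eventually (\<lambda>x. \<psi> x = \<phi> x) (at g within M)"
    unfolding eventually_at_topological using U by blast
  then have "(\<phi> \<longlongrightarrow> \<phi> g) (at g within M)" using t tendsto_cong by blast
  then show "continuous (at g within M) \<phi>" by (simp add: continuous_within)
qed

theorem proposition7p1:
  fixes m :: nat
    and \<Gamma> :: "(real, 'n::{finite, linorder}) dmat set"
    and \<phi> :: "(real, 'n) dmat \<Rightarrow> complex"
    and \<kappa> :: "(real, 'n) dmat measure"
    and \<mu> :: "(real, 'n) dmat set measure"
  assumes "m > 2 * CARD('n)"
    and "congruence_subgroup \<Gamma>"
    and "haar_measure K_sp \<kappa>" and "emeasure \<kappa> K_sp = 1"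
    and "quotient_measure \<Gamma> Sp (sp_measure \<kappa>) \<mu>"
    and "\<phi> \<in> A_cusp_chi_p_minus \<Gamma> m"
  shows "L2_inner \<mu> \<phi> (poincare \<Gamma> (F1 m)) = of_real (C_const m CARD('n)) * \<phi> (mat 1)"
proof -
  note m = assms(1) and q = assms(5) and \<phi> = assms(6)
  note \<Gamma> = congruence_subgroup_subset[OF assms(2)]
  have smooth: "smooth_function_on Sp \<phi>" and \<phi>\<Gamma>: "\<And>\<gamma> g. \<gamma> \<in> \<Gamma> \<Longrightarrow> g \<in> Sp \<Longrightarrow> \<phi> (\<gamma> ** g) = \<phi> g"
    and bdd: "\<exists>b. \<forall>g\<in>Sp. norm (\<phi> g) \<le> b" and eq: "K_equivariant m \<phi>"
    and p: "\<And>X g. X \<in> p_minus \<Longrightarrow> g \<in> Sp \<Longrightarrow> lie_act X \<phi> g = 0"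
    using \<phi> by (auto simp: A_cusp_chi_p_minus_def A_cusp_def K_equivariant_def)
  obtain b where b: "\<And>g. g \<in> Sp \<Longrightarrow> norm (\<phi> g) \<le> b" using bdd by blast
  have b0: "0 \<le> b" using b[OF mat_1_in_Sp] norm_ge_zero order_trans by blast
  define G where "G = (\<lambda>g. \<phi> g * cnj (F1 m g))"
  \<comment> \<open>The dominating function for \<open>quotient_unfolding\<close>, with a bound b
    for \<open>\<phi>\<close> as the constant.\<close>
  define E where "E = (\<lambda>g :: (real, 'n) dmat. norm (F1 m g))"
  have F1k: "F1 m (g ** k) = chi m k * F1 m g" "norm (chi m k) = 1" "\<phi> (g ** k) = chi m k * \<phi> g" if "g \<in> Sp" "k \<in> K_sp" for g k
    using F1_K_equivariant eq that K_sp_block(5) unfolding K_equivariant_def by blast+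
  have Gc: "continuous_on Sp G" and Ec: "continuous_on Sp E"
    unfolding G_def E_def by (intro continuous_intros continuous_on_F1 smooth_function_on_continuous[OF smooth])+
  \<comment> \<open>The character of modulus one cancels against its conjugate in G and disappears
    in the norm.\<close>
  have GK: "G (g ** k) = G g" and EK: "E (g ** k) = E g" if "g \<in> Sp" "k \<in> K_sp" for g k
  proof -
    have "chi m k * cnj (chi m k) = 1" using F1k(2)[OF that] by (simp add: complex_norm_square[symmetric])
    then show "G (g ** k) = G g" unfolding G_def F1k(1,3)[OF that] by (simp add: mult_ac)
    show "E (g ** k) = E g" unfolding E_def F1k(1)[OF that] by (simp add: norm_mult F1k(2)[OF that])
  qed
  have spG: "(LINT g|sp_measure \<kappa>. G g) = (LINT z|siegel_measure. G (bz z))"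
    by (rule integral_sp_measure(1)[OF assms(3,4) Gc]) (rule GK)
  have spE: "(LINT g|sp_measure \<kappa>. E g) = (LINT z|siegel_measure. E (bz z))"
    by (rule integral_sp_measure(1)[OF assms(3,4) Ec]) (rule EK)
  have Em: "(\<lambda>z. E (bz z)) \<in> borel_measurable siegel_measure"
    by (intro continuous_on_siegel_measurable continuous_on_compose2[OF Ec continuous_on_bz]) (auto intro: bz_Sp)
  have Ei: "integrable siegel_measure (\<lambda>z. E (bz z))"
    by (rule integrableI_bounded[OF Em]) (use nn_integral_norm_F1_finite[OF m] in \<open>simp add: E_def\<close>)
  \<comment> \<open>If this integral were 0, then E would vanish almost everywhere on the half
    space, and so would its square, the weight, whose total mass is the positive constant
    \<open>C_const m CARD('n)\<close>.\<close>
  have En: "(LINT z|siegel_measure. E (bz z)) \<noteq> 0"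
  proof
    assume "(LINT z|siegel_measure. E (bz z)) = 0"
    then have "AE z in siegel_measure. E (bz z) = 0"
      using integral_nonneg_eq_0_iff_AE[OF Ei] by (simp add: E_def)
    then have "(\<integral>\<^sup>+z. ennreal (siegel_weight m z) \<partial>(siegel_measure :: (complex, 'n) smat measure)) = (\<integral>\<^sup>+z. 0 \<partial>(siegel_measure :: (complex, 'n) smat measure))"
    proof (intro nn_integral_cong_AE, elim AE_mp, intro AE_I2 impI)
      fix z :: "(complex, 'n) smat" assume "z \<in> space siegel_measure" "E (bz z) = 0"
      then show "ennreal (siegel_weight m z) = 0"
        using norm_F1_bz(2)[of z m] by (simp add: E_def sets_siegel_measure(2))
    qed
    then show False using nn_integral_siegel_weight[of m, where 'n = 'n] C_const_pos[of "CARD('n)" m] m by simp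
  qed
  have act: "\<gamma> ** h \<in> Sp" if "\<gamma> \<in> \<Gamma>" "h \<in> Sp" for \<gamma> h
    using that \<Gamma>(1) by (auto simp: Sp_int_def intro: Sp_mult)
  \<comment> \<open>The invariance of \<open>\<phi>\<close> under the group moves it out of the
    sum.\<close>
  have PG: "(\<Sum>\<^sub>\<infinity>\<gamma>\<in>\<Gamma>. G (\<gamma> ** h)) = \<phi> h * cnj (poincare \<Gamma> (F1 m) h)" if h: "h \<in> Sp" for h
  proof -
    have "(\<Sum>\<^sub>\<infinity>\<gamma>\<in>\<Gamma>. G (\<gamma> ** h)) = (\<Sum>\<^sub>\<infinity>\<gamma>\<in>\<Gamma>. \<phi> h * cnj (F1 m (\<gamma> ** h)))"
      by (rule infsum_cong) (simp add: G_def \<phi>\<Gamma> h)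
    then show ?thesis by (simp add: infsum_cmult_right' poincare_def)
  qed
  have "L2_inner \<mu> \<phi> (poincare \<Gamma> (F1 m)) = (LINT C|\<mu>. on_cosets (\<lambda>h. \<Sum>\<^sub>\<infinity>\<gamma>\<in>\<Gamma>. G (\<gamma> ** h)) C)"
    unfolding L2_inner_def
  proof (rule Bochner_Integration.integral_cong[OF refl])
    fix C assume "C \<in> space \<mu>"
    then have "(SOME h. h \<in> C) \<in> Sp"
      unfolding space_quotient_measure[OF q] using representative_in[OF \<Gamma>(2) act] by blast
    then show "on_cosets (\<lambda>g. \<phi> g * cnj (poincare \<Gamma> (F1 m) g)) C = on_cosets (\<lambda>h. \<Sum>\<^sub>\<infinity>\<gamma>\<in>\<Gamma>. G (\<gamma> ** h)) C"
      unfolding on_cosets_def by (simp only: PG)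
  qed
  also have "\<dots> = (LINT h|sp_measure \<kappa>. G h)"
  proof (rule quotient_unfolding[OF q \<Gamma>(2) act _ compact_Sp_norm_le _ Ec _ _ _ Gc b0])
    show "finite {\<gamma> \<in> \<Gamma>. \<gamma> ** h \<in> C}" if "compact C" "C \<subseteq> Sp" "h \<in> Sp" for C h
      by (rule finite_meeting_compact[OF \<Gamma>(1) that(1,3)])
    show "sets (sp_measure \<kappa>) = sets (restrict_space borel Sp)" by (simp add: sp_measure_def)
    show "0 \<le> E h" for h by (simp add: E_def)
    show "integrable (sp_measure \<kappa>) E" by (rule integral_sp_measure(2)[OF assms(3,4) Ec _ Ei]) (rule EK)
    show "(LINT h|sp_measure \<kappa>. E h) \<noteq> 0" unfolding spE by (rule En)
    show "norm (G h) \<le> b * E h" if "h \<in> Sp" for h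
      using b[OF that] by (simp add: G_def E_def norm_mult mult_right_mono)
    show "(\<Sum>\<^sub>\<infinity>\<gamma>\<in>\<Gamma>. G (\<gamma> ** h)) = 0" if h: "h \<in> Sp" and "\<not> (\<lambda>\<gamma>. E (\<gamma> ** h)) summable_on \<Gamma>" for h
    proof -
      \<comment> \<open>A summable complex family is absolutely summable, so divergence of the sum
        of norms excludes summability of the Poincare series, whose value is then 0.\<close>
      have "\<not> (\<lambda>\<gamma>. F1 m (\<gamma> ** h)) summable_on \<Gamma>"
        using that(2) summable_on_iff_abs_summable_on_complex[of "\<lambda>\<gamma>. F1 m (\<gamma> ** h)" \<Gamma>] unfolding E_def by blast
      then show ?thesis unfolding PG[OF h] poincare_def by (simp add: infsum_not_exists)
    qed
  qed
  also have "\<dots> = (LINT z|siegel_measure. G (bz z))" by (rule spG)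
  also have "\<dots> = of_real (C_const m CARD('n)) * \<phi> (mat 1)"
    unfolding G_def by (rule siegel_reproducing(2)[OF eq smooth p m b])
  finally show ?thesis .
qed

end
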